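(* Let $\Omega\subset\mathbb R^2$ be a bounded Lipschitz domain and let $m\in BV(\Omega;\mathbb R^2)$ satisfy $|m|=1$ a.e. in $\Omega$ and $\nabla\cdot m=0$ in $\mathcal D'(\Omega)$. Let $\|\sigma\|$ be the measure on $\Omega$ $$\|\sigma\|=\bigvee_{f\in C^0(\mathbb R/2\pi\mathbb Z,\mathbb R),\ |f|\le1}\|\nabla\cdot\Phi_f(m)\|,$$ for which the inequality of measures on $\Omega$ $$2\|\sigma\|\ \ge\ \frac13|m^+-m^-|^3\,\mathcal H^1\llcorner J_m$$ holds. If $Dm$ has a nontrivial jump part, then this inequality is strict, i.e. the two measures are not equal.
   Context: $J_m$ is the jump set of $m$, $m^\pm$ its traces on $J_m$, and the jump part of $Dm$ is its restriction to $J_m$. $\|\mu\|$ denotes the total variation measure of $\mu$, and the least upper bound of nonnegative measures is $\bigvee_\alpha\mu_\alpha(E)=\sup\{\sum_{\alpha'}\mu_{\alpha'}(E_{\alpha'})\}$ over finite or countable subfamilies and pairwise disjoint Borel sets $E_{\alpha'}$ with $\bigcup E_{\alpha'}=E$. The maps $\Phi_f\colon S^1\to\mathbb R^2$ ($\mathbb R^2\simeq\mathbb C$), for $f\in C^0(\mathbb R/2\pi\mathbb Z,\mathbb R)$, are defined by $$\tilde f(t)=f(t)-\frac1{2\pi}\int_0^{2\pi}f(s)\,ds-\Big(\frac1\pi\int_0^{2\pi}f(s)\cos s\,ds\Big)\cos t-\Big(\frac1\pi\int_0^{2\pi}f(s)\sin s\,ds\Big)\sin t,$$ $$\psi_f(t)=\int_0^t\tilde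 f(s)\,ds,\qquad \varphi_f(t)=\int_0^t\psi_f(s)\,ie^{is}\,ds,\qquad \Phi_f(e^{it})=-i\varphi_f(t-\pi/2)+i\varphi_f(t+\pi/2).$$ The notation $\|\sigma\|$ refers to the measure $\sigma\in\mathcal M_{\mathrm{loc}}(\Omega\times\mathbb R/2\pi\mathbb Z)$ characterized by $\langle\nabla\cdot\Phi_f(m),\zeta\rangle=\iint f(t)\zeta(x)\,d\sigma(x,t)$ for all $\zeta\in C_c^\infty(\Omega)$, $f\in C^0(\mathbb R/2\pi\mathbb Z,\mathbb R)$: $\|\sigma\|$ is the marginal on $\Omega$ of its total variation. *)

theory Defs
  imports "HOL-Analysis.Analysis"
begin

section \<open>Test functions and distributions\<close>

primrec C_k :: "nat \<Rightarrow> ('a::euclidean_space \<Rightarrow> real) \<Rightarrow> bool" where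
  "C_k 0 f \<longleftrightarrow> continuous_on UNIV f"
| "C_k (Suc k) f \<longleftrightarrow> (\<forall>x. f differentiable (at x)) \<and>
      (\<forall>v. C_k k (\<lambda>x. frechet_derivative f (at x) v))"

definition test_functions :: "'a::euclidean_space set \<Rightarrow> ('a \<Rightarrow> real) set" where
  "test_functions \<Omega> = {\<zeta>. (\<forall>k. C_k k \<zeta>) \<and>
     compact (closure {x. \<zeta> x \<noteq> 0}) \<and> closure {x. \<zeta> x \<noteq> 0} \<subseteq> \<Omega>}"

text \<open>A distribution on \<open>\<Omega>\<close> is represented by its values on \<open>test_functions \<Omega>\<close>; its values on other
  functions are never used.\<close>

definition dist_deriv ::
    "'a::euclidean_space set \<Rightarrow> ('a \<Rightarrow> real) \<Rightarrow> 'a \<Rightarrow> ('a \<Rightarrow> real) \<Rightarrow> real" where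
  "dist_deriv \<Omega> u v \<zeta> = - (LINT x:\<Omega>|lebesgue. u x * frechet_derivative \<zeta> (at x) v)"

text \<open>In the following definition the integrand is \<open>F(x) \<cdot> \<nabla>\<zeta>(x)\<close>.\<close>

definition dist_div ::
    "'a::euclidean_space set \<Rightarrow> ('a \<Rightarrow> 'a) \<Rightarrow> ('a \<Rightarrow> real) \<Rightarrow> real" where
  "dist_div \<Omega> F \<zeta> = - (LINT x:\<Omega>|lebesgue. frechet_derivative \<zeta> (at x) (F x))"


section \<open>Signed measures\<close>

text \<open>A finite signed Borel measure on \<open>\<Omega>\<close> is a real-valued set function that is the difference of
  two finite measures \<open>P\<close>, \<open>N\<close> on the Borel subsets of \<open>\<Omega>\<close>; integration against it is
  the difference of the two integrals. It takes the value 0 on sets that are not Borel subsets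
  of \<open>\<Omega>\<close>.\<close>

definition dist_is_measure ::
    "'a::euclidean_space set \<Rightarrow> (('a \<Rightarrow> real) \<Rightarrow> real) \<Rightarrow> ('a set \<Rightarrow> real) \<Rightarrow> bool" where
  "dist_is_measure \<Omega> T \<mu> \<longleftrightarrow> (\<exists>P N.
     finite_measure P \<and> sets P = sets (restrict_space borel \<Omega>) \<and>
     finite_measure N \<and> sets N = sets (restrict_space borel \<Omega>) \<and>
     (\<forall>E. \<mu> E = measure P E - measure N E) \<and>
     (\<forall>\<zeta>\<in>test_functions \<Omega>. T \<zeta> = (\<integral>x. \<zeta> x \<partial>P) - (\<integral>x. \<zeta> x \<partial>N)))"

text \<open>For open \<open>\<Omega>\<close> there is at most one such \<open>\<mu>\<close>.\<close>

definition dist_measure ::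
    "'a::euclidean_space set \<Rightarrow> (('a \<Rightarrow> real) \<Rightarrow> real) \<Rightarrow> 'a set \<Rightarrow> real" where
  "dist_measure \<Omega> T = (THE \<mu>. dist_is_measure \<Omega> T \<mu>)"

definition total_variation :: "('a::euclidean_space set \<Rightarrow> real) \<Rightarrow> 'a set \<Rightarrow> ennreal" where
  "total_variation \<mu> E =
     (SUP A \<in> {A :: nat \<Rightarrow> 'a set. range A \<subseteq> sets borel \<and> disjoint_family A \<and> (\<Union>n. A n) = E}.
        \<Sum>n. ennreal \<bar>\<mu> (A n)\<bar>)"

text \<open>Least upper bound of the nonnegative measures \<open>\<mu> \<alpha>\<close>, \<open>\<alpha> \<in> I\<close>: \<open>S\<close> is the finite or countable
  subfamily and \<open>A\<close> the partition of \<open>E\<close> indexed by it.\<close>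

definition measure_lub :: "'i set \<Rightarrow> ('i \<Rightarrow> 'a::euclidean_space set \<Rightarrow> ennreal) \<Rightarrow> 'a set \<Rightarrow> ennreal" where
  "measure_lub I \<mu> E =
     (SUP (S, A) \<in> {(S, A). S \<subseteq> I \<and> countable S \<and> (\<forall>\<alpha>\<in>S. A \<alpha> \<in> sets borel) \<and>
                            disjoint_family_on A S \<and> (\<Union>\<alpha>\<in>S. A \<alpha>) = E}.
        \<Sum>\<^sub>\<infinity>\<alpha>\<in>S. \<mu> \<alpha> (A \<alpha>))"


section \<open>One-dimensional Hausdorff measure\<close>

definition hausdorff1_outer :: "'a::euclidean_space set \<Rightarrow> ennreal" where
  "hausdorff1_outer E = (SUP \<delta>\<in>{0<..}.
     INF C \<in> {C :: nat \<Rightarrow> 'a set. E \<subseteq> (\<Union>n. C n) \<and> (\<forall>n. bounded (C n) \<and> diameter (C n) \<le> \<delta>)}.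
       \<Sum>n. ennreal (diameter (C n)))"

text \<open>\<open>hausdorff1_outer\<close> is a metric outer measure, so it is countably additive on the Borel
  sets and \<open>hausdorff1\<close> agrees with it there. A factor \<open>\<omega>\<^sub>1 / 2\<close> is not needed since \<open>\<omega>\<^sub>1 = 2\<close>.\<close>

definition hausdorff1 :: "'a::euclidean_space measure" where
  "hausdorff1 = measure_of UNIV (sets borel) hausdorff1_outer"


section \<open>Functions of bounded variation\<close>

definition BV :: "'a::euclidean_space set \<Rightarrow> ('a \<Rightarrow> 'b::euclidean_space) \<Rightarrow> bool" where
  "BV \<Omega> u \<longleftrightarrow> set_integrable lebesgue \<Omega> u \<and>
     (\<forall>v b. \<exists>\<mu>. dist_is_measure \<Omega> (dist_deriv \<Omega> (\<lambda>x. u x \<bullet> b) v) \<mu>)"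

text \<open>\<open>Du\<close>, with values in the linear maps from \<open>'a\<close> to \<open>'b\<close>.\<close>

definition BV_deriv ::
    "'a::euclidean_space set \<Rightarrow> ('a \<Rightarrow> 'b::euclidean_space) \<Rightarrow> 'a set \<Rightarrow> 'a \<Rightarrow> 'b" where
  "BV_deriv \<Omega> u E v = (\<Sum>b\<in>Basis. dist_measure \<Omega> (dist_deriv \<Omega> (\<lambda>x. u x \<bullet> b) v) E *\<^sub>R b)"

definition half_ball :: "'a::euclidean_space \<Rightarrow> real \<Rightarrow> 'a \<Rightarrow> 'a set" where
  "half_ball x r \<nu> = {y \<in> ball x r. (y - x) \<bullet> \<nu> > 0}"

text \<open>\<open>a\<close> and \<open>b\<close> are the one-sided approximate limits of \<open>u\<close> at \<open>x\<close> on the sides \<open>\<nu>\<close> and \<open>-\<nu>\<close>.\<close>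

definition is_jump_triple ::
    "('a::euclidean_space \<Rightarrow> 'b::euclidean_space) \<Rightarrow> 'a \<Rightarrow> 'b \<Rightarrow> 'b \<Rightarrow> 'a \<Rightarrow> bool" where
  "is_jump_triple u x a b \<nu> \<longleftrightarrow> a \<noteq> b \<and> norm \<nu> = 1 \<and>
     ((\<lambda>r. (LINT y:half_ball x r \<nu>|lebesgue. norm (u y - a)) / measure lebesgue (half_ball x r \<nu>))
        \<longlongrightarrow> 0) (at_right 0) \<and>
     ((\<lambda>r. (LINT y:half_ball x r (- \<nu>)|lebesgue. norm (u y - b)) / measure lebesgue (half_ball x r (- \<nu>)))
        \<longlongrightarrow> 0) (at_right 0)"

definition jump_set :: "'a::euclidean_space set \<Rightarrow> ('a \<Rightarrow> 'b::euclidean_space) \<Rightarrow> 'a set" where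
  "jump_set \<Omega> u = {x \<in> \<Omega>. \<exists>a b \<nu>. is_jump_triple u x a b \<nu>}"

text \<open>On the jump set the triple \<open>(a, b, \<nu>)\<close> is unique up to exchanging it with \<open>(b, a, -\<nu>)\<close>.
  The choice made here may depend on \<open>x\<close> in an arbitrary way, but quantities symmetric in
  the two traces, such as \<open>|u\<^sup>+ - u\<^sup>-|\<close>, do not depend on it.\<close>

definition jump_triple ::
    "('a::euclidean_space \<Rightarrow> 'b::euclidean_space) \<Rightarrow> 'a \<Rightarrow> 'b \<times> 'b \<times> 'a" where
  "jump_triple u x = (SOME (a, b, \<nu>). is_jump_triple u x a b \<nu>)"

definition trace_plus :: "('a::euclidean_space \<Rightarrow> 'b::euclidean_space) \<Rightarrow> 'a \<Rightarrow> 'b" where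
  "trace_plus u x = fst (jump_triple u x)"

definition trace_minus :: "('a::euclidean_space \<Rightarrow> 'b::euclidean_space) \<Rightarrow> 'a \<Rightarrow> 'b" where
  "trace_minus u x = fst (snd (jump_triple u x))"

definition BV_jump_part ::
    "'a::euclidean_space set \<Rightarrow> ('a \<Rightarrow> 'b::euclidean_space) \<Rightarrow> 'a set \<Rightarrow> 'a \<Rightarrow> 'b" where
  "BV_jump_part \<Omega> u E = BV_deriv \<Omega> u (E \<inter> jump_set \<Omega> u)"


section \<open>Lipschitz domains in the plane\<close>

text \<open>Near each boundary point \<open>p\<close>, in the orthonormal coordinates with origin \<open>p\<close> and axes
  \<open>w\<close>, \<open>\<i> w\<close>, the domain is the set of points above a Lipschitz graph.\<close>

definition lipschitz_domain :: "complex set \<Rightarrow> bool" where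
  "lipschitz_domain \<Omega> \<longleftrightarrow> open \<Omega> \<and> connected \<Omega> \<and> \<Omega> \<noteq> {} \<and>
     (\<forall>p\<in>frontier \<Omega>. \<exists>r>0. \<exists>w g L. norm w = 1 \<and> L-lipschitz_on UNIV g \<and>
        (\<forall>z\<in>ball p r. z \<in> \<Omega> \<longleftrightarrow> g (Re (cnj w * (z - p))) < Im (cnj w * (z - p))))"


section \<open>The maps \<open>\<Phi>\<^sub>f\<close> and the measure \<open>\<parallel>\<sigma>\<parallel>\<close>\<close>

text \<open>Functions on \<open>\<real>/2\<pi>\<int>\<close> are \<open>2\<pi>\<close>-periodic functions on \<open>\<real>\<close>, and \<open>\<real>\<^sup>2\<close> is \<open>complex\<close>.\<close>

definition C0_per :: "(real \<Rightarrow> real) set" where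
  "C0_per = {f. continuous_on UNIV f \<and> (\<forall>t. f (t + 2 * pi) = f t)}"

definition f_tilde :: "(real \<Rightarrow> real) \<Rightarrow> real \<Rightarrow> real" where
  "f_tilde f t = f t - 1 / (2 * pi) * (LBINT s=0..2*pi. f s)
     - (1 / pi * (LBINT s=0..2*pi. f s * cos s)) * cos t
     - (1 / pi * (LBINT s=0..2*pi. f s * sin s)) * sin t"

text \<open>Interval integrals are oriented: \<open>LBINT s=0..t\<close> is \<open>- LBINT s=t..0\<close> for \<open>t < 0\<close>.\<close>

definition psi :: "(real \<Rightarrow> real) \<Rightarrow> real \<Rightarrow> real" where
  "psi f t = (LBINT s=0..t. f_tilde f s)"

definition phi :: "(real \<Rightarrow> real) \<Rightarrow> real \<Rightarrow> complex" where
  "phi f t = (LBINT s=0..t. of_real (psi f s) * (\<i> * exp (\<i> * of_real s)))"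

text \<open>\<open>f_tilde f\<close> is orthogonal to \<open>1\<close>, \<open>cos\<close>, \<open>sin\<close>, so \<open>psi f\<close> and \<open>phi f\<close> are
  \<open>2\<pi>\<close>-periodic and the value at \<open>exp (\<i> t)\<close> is given by the right-hand side for every argument \<open>t\<close>
  (lemma \<open>Phi_exp\<close>). Only the values on the unit circle matter.\<close>

definition Phi :: "(real \<Rightarrow> real) \<Rightarrow> complex \<Rightarrow> complex" where
  "Phi f z = - \<i> * phi f (Arg z - pi / 2) + \<i> * phi f (Arg z + pi / 2)"

lemma
  assumes "f \<in> C0_per"
  shows phi_periodic: "phi f (t + 2 * pi) = phi f t"
proof -
  have cf: "continuous_on A f" for A
    using assms continuous_on_subset by (auto simp: C0_per_def)
  have per: "f (x + 2 * pi) = f x" for x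
    using assms by (auto simp: C0_per_def)
  have FTC2: "((\<lambda>t. LBINT s=ereal 0..ereal t. g s) has_vector_derivative g x) (at x)"
    if "continuous_on UNIV g" for g :: "real \<Rightarrow> 'c::euclidean_space" and x
  proof -
    have "((\<lambda>t. LBINT s=ereal 0..ereal t. g s) has_vector_derivative g x)
            (at x within {min 0 x - 1..max 0 x + 1})"
      by (rule interval_integral_FTC2) (auto intro: continuous_on_subset[OF that])
    then show ?thesis
      by (simp add: at_within_Icc_at)
  qed
  define a0 where "a0 = 1 / (2 * pi) * (LBINT s=0..2*pi. f s)"
  define a where "a = 1 / pi * (LBINT s=0..2*pi. f s * cos s)"
  define b where "b = 1 / pi * (LBINT s=0..2*pi. f s * sin s)"
  have ft: "f_tilde f s = f s - a0 - a * cos s - b * sin s" for s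
    by (simp add: f_tilde_def a0_def a_def b_def)
  have cft: "continuous_on A (f_tilde f)" for A
    unfolding ft[abs_def] by (intro continuous_intros cf)
  define F C S where "F t = (LBINT s=ereal 0..ereal t. f s)"
    and "C t = (LBINT s=ereal 0..ereal t. f s * cos s)"
    and "S t = (LBINT s=ereal 0..ereal t. f s * sin s)" for t
  have D: "(F has_real_derivative f t) (at t)" "(C has_real_derivative f t * cos t) (at t)"
    "(S has_real_derivative f t * sin t) (at t)" for t
    unfolding F_def C_def S_def has_real_derivative_iff_has_vector_derivative
    by (rule FTC2, intro continuous_intros cf)+
  have z: "F 0 = 0" "C 0 = 0" "S 0 = 0"
    unfolding F_def C_def S_def by simp_all
  have p: "F (2 * pi) = 2 * pi * a0" "C (2 * pi) = pi * a" "S (2 * pi) = pi * b"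
    unfolding F_def C_def S_def a0_def a_def b_def by (simp_all add: zero_ereal_def)
  have psi: "psi f t = F t - a0 * t - a * sin t + b * cos t - b" for t
  proof -
    have "(LBINT s=ereal 0..ereal t. f_tilde f s)
        = (F t - a0 * t - a * sin t + b * cos t) - (F 0 - a0 * 0 - a * sin 0 + b * cos 0)"
      by (rule interval_integral_FTC_finite[OF cft])
        (auto simp: ft has_real_derivative_iff_has_vector_derivative[symmetric]
          intro!: derivative_eq_intros DERIV_subset[OF D(1)])
    then show ?thesis by (simp add: psi_def z zero_ereal_def)
  qed
  have Dpsi: "(psi f has_real_derivative f_tilde f t) (at t)" for t
    unfolding psi[abs_def] ft by (auto intro!: derivative_eq_intros D)
  then have cpsi: "continuous_on A (psi f)" for A
    by (meson DERIV_isCont continuous_at_imp_continuous_on)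
  have psi0: "psi f 0 = 0" "psi f (2 * pi) = 0"
    by (simp_all add: psi z p)
  define Gc Gs where "Gc t = C t - a0 * sin t - a * (t / 2 + sin t * cos t / 2) - b * (sin t)\<^sup>2 / 2"
    and "Gs t = S t - a0 * (1 - cos t) - a * (sin t)\<^sup>2 / 2 - b * (t / 2 - sin t * cos t / 2)" for t
  have e2: "cos t * cos t = 1 - sin t * sin t" for t :: real
    using sin_cos_squared_add[of t] by (simp add: power2_eq_square)
  have e3: "cos t * (cos t * x) = x - sin t * (sin t * x)" for t x :: real
    by (simp only: mult.assoc[symmetric] e2 left_diff_distrib mult_1)
  have DGc: "(Gc has_real_derivative f_tilde f t * cos t) (at t)" for t
    unfolding Gc_def[abs_def] ft
    by (auto intro!: derivative_eq_intros D simp: field_simps power2_eq_square e2 e3)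
  have DGs: "(Gs has_real_derivative f_tilde f t * sin t) (at t)" for t
    unfolding Gs_def[abs_def] ft
    by (auto intro!: derivative_eq_intros D simp: field_simps power2_eq_square e2 e3)
  define H where "H t = complex_of_real (psi f t) * exp (\<i> * of_real t) - (of_real (Gc t) + \<i> * of_real (Gs t))" for t
  have DH: "(H has_vector_derivative of_real (psi f t) * (\<i> * exp (\<i> * of_real t))) (at t within A)" for t A
  proof -
    have E: "((\<lambda>t. exp (\<i> * complex_of_real t)) has_vector_derivative (\<i> * exp (\<i> * of_real t))) (at t within A)"
      by (rule has_vector_derivative_real_field[where f = "\<lambda>z. exp (\<i> * z)"])
        (auto intro!: derivative_eq_intros)
    have R: "((\<lambda>t. complex_of_real (g t)) has_vector_derivative of_real g') (at t within A)"
      if "(g has_real_derivative g') (at t)" for g g'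
      using has_vector_derivative_of_real that has_vector_derivative_at_within by blast
    show ?thesis
      unfolding H_def[abs_def]
      by (rule has_vector_derivative_eq_rhs,
          (rule has_vector_derivative_diff has_vector_derivative_add has_vector_derivative_mult
            has_vector_derivative_mult_right E R[OF Dpsi] R[OF DGc] R[OF DGs])+)
        (simp add: exp_Euler cos_of_real sin_of_real algebra_simps)
  qed
  have phi: "phi f t = H t" for t
  proof -
    have "(LBINT s=ereal 0..ereal t. of_real (psi f s) * (\<i> * exp (\<i> * of_real s))) = H t - H 0"
      by (rule interval_integral_FTC_finite[OF _ DH]) (intro continuous_intros cpsi)
    then show ?thesis by (simp add: phi_def H_def psi0 Gc_def Gs_def z zero_ereal_def)
  qed
  have shift: "g (t + 2 * pi) = g t" if "\<And>t. (g has_vector_derivative g' t) (at t)"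
    "\<And>t. g' (t + 2 * pi) = g' t" "g (2 * pi) = g 0"
    for g g' :: "real \<Rightarrow> 'c::euclidean_space" and t
  proof -
    have "((\<lambda>t. g (t + 2 * pi) - g t) has_vector_derivative 0) (at t within UNIV)" for t
    proof -
      have "((\<lambda>t::real. t + 2 * pi) has_vector_derivative 1) (at t)"
        by (auto intro!: derivative_eq_intros simp flip: has_real_derivative_iff_has_vector_derivative)
      from vector_diff_chain_at[OF this that(1)]
      have "((\<lambda>t. g (t + 2 * pi)) has_vector_derivative g' t) (at t)"
        by (simp add: o_def that(2))
      from has_vector_derivative_diff[OF this that(1)[of t]] show ?thesis by simp
    qed
    then obtain c where "\<And>t. g (t + 2 * pi) - g t = c"
      by (rule has_vector_derivative_zero_constant[OF convex_UNIV]) auto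
    from this[of 0] this[of t] that(3) show ?thesis by simp
  qed
  have ps: "psi f (t + 2 * pi) = psi f t" for t
    by (rule shift[of "psi f" "f_tilde f"])
      (use Dpsi psi0 in \<open>auto simp: has_real_derivative_iff_has_vector_derivative ft per\<close>)
  show ?thesis
    unfolding phi
  proof (rule shift[OF DH])
    show "H (2 * pi) = H 0"
      by (simp add: H_def psi0 Gc_def Gs_def z p)
  qed (simp add: ps exp_Euler cos_of_real sin_of_real flip: of_real_add)
qed

lemma Phi_exp:
  assumes "f \<in> C0_per"
  shows "Phi f (exp (\<i> * of_real t)) = - \<i> * phi f (t - pi / 2) + \<i> * phi f (t + pi / 2)"
proof -
  have per: "phi f (x + of_int n * (2 * pi)) = phi f x" for x n
  proof (induction n rule: int_induct[where k = 0])
    case (step1 i)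
    then show ?case using phi_periodic[OF assms, of "x + of_int i * (2 * pi)"] by (simp add: algebra_simps)
  next
    case (step2 i)
    then show ?case using phi_periodic[OF assms, of "x + of_int (i - 1) * (2 * pi)"] by (simp add: algebra_simps)
  qed simp
  have "exp (\<i> * of_real (Arg (exp (\<i> * of_real t)))) = exp (\<i> * complex_of_real t)"
    using Arg_eq[of "exp (\<i> * complex_of_real t)"] by simp
  then obtain n where n: "Arg (exp (\<i> * of_real t)) = t + of_int n * (2 * pi)"
    unfolding exp_eq by (force simp: complex_eq_iff)
  show ?thesis
    unfolding Phi_def n using per[of "t - pi / 2" n] per[of "t + pi / 2" n] by (simp add: algebra_simps)
qed

definition sigma_norm :: "complex set \<Rightarrow> (complex \<Rightarrow> complex) \<Rightarrow> complex set \<Rightarrow> ennreal" where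
  "sigma_norm \<Omega> m = measure_lub {f \<in> C0_per. \<forall>t. \<bar>f t\<bar> \<le> 1}
     (\<lambda>f. total_variation (dist_measure \<Omega> (dist_div \<Omega> (\<lambda>x. Phi f (m x)))))"

definition jump_cost :: "complex set \<Rightarrow> (complex \<Rightarrow> complex) \<Rightarrow> complex set \<Rightarrow> ennreal" where
  "jump_cost \<Omega> m E =
     (\<integral>\<^sup>+x \<in> E \<inter> jump_set \<Omega> m. ennreal (1 / 3 * norm (trace_plus m x - trace_minus m x) ^ 3) \<partial>hausdorff1)"

end

theory Submission
  imports Defs "HOL-Computational_Algebra.Polynomial"
begin

text \<open>At a jump point \<open>x\<close> of \<open>m\<close> with traces \<open>a\<close>, \<open>b\<close> and normal \<open>\<nu>\<close>, the measure \<open>\<nabla>\<cdot>\<Phi>\<^sub>f(m)\<close> has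
lower density at least \<open>\<bar>(\<Phi>\<^sub>f(a) - \<Phi>\<^sub>f(b)) \<cdot> \<nu>\<bar>\<close> with respect to length, so \<open>\<parallel>\<sigma>\<parallel>\<close> dominates the
supremum of these densities over \<open>\<bar>f\<bar> \<le> 1\<close>. Since \<open>\<nabla>\<cdot>m = 0\<close>, the jump \<open>a - b\<close> is tangential, and
the choice \<open>f(t) = - cos 2(t - arg \<nu>)\<close> yields the density \<open>\<bar>a - b\<bar>\<^sup>3/6\<close>, which is
the asserted inequality. This \<open>f\<close> is not optimal. Composing \<open>- cos 2(t - arg \<nu>)\<close> with the cubic
\<open>x - (1 - x)\<^sup>2(1 + x)/4\<close>, which maps \<open>[-1, 1]\<close> into itself, gives \<open>steep_entropy\<close>, and
for it the density is at least \<open>289/280\<close> times \<open>\<bar>a - b\<bar>\<^sup>3/6\<close> whatever \<open>a\<close> and \<open>b\<close> are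
(\<open>steep_entropy_jump\<close>). After small losses in the test functions,
\<open>101/100 \<cdot> (jump cost) \<le> 2 \<parallel>\<sigma>\<parallel>\<close> on all Borel sets. If the jump cost were equal to \<open>2 \<parallel>\<sigma>\<parallel>\<close>, both would
vanish on every ball where they are finite, whereas \<open>\<parallel>\<sigma>\<parallel>\<close> is positive on every ball
around a jump point; and a nontrivial jump part requires a jump point.

The density at a jump point comes from a blow-up (\<open>frame_bump_blow_up\<close>, \<open>divergence_density_at_jump\<close>):
testing \<open>\<nabla>\<cdot>F\<close> with a smooth bump that is concentrated, at scale \<open>r\<close>, near the tangential diameter of
\<open>ball x r\<close> gives the normal jump of \<open>F\<close> times almost \<open>2r\<close>. To pass from balls to sets, a Vitali covering
(\<open>hausdorff1_outer_le_measure_lub\<close>) turns a lower density bound \<open>c\<close> at every point of a Borel set \<open>A\<close> into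
\<open>c \<H>\<^sup>1(A) \<le> \<Lambda>(A)\<close>, where \<open>\<Lambda>\<close> is the least upper bound of the measures concerned.

That covering argument and the finiteness on balls rest on a finite measure that dominates all \<open>\<nabla>\<cdot>\<Phi>\<^sub>f(m)\<close> in
question. The map \<open>\<Phi>\<^sub>f\<close> is Lipschitz on the unit circle, so the increments of \<open>\<Phi>\<^sub>f(m)\<close> are
bounded by those of \<open>m\<close>, and passing to the limit in difference quotients shows that the derivatives of
\<open>\<Phi>\<^sub>f(m)\<close> are dominated by a multiple of a measure \<open>M\<close> that dominates \<open>Dm\<close>
(\<open>lipschitz_chain_rule_bound\<close>). A functional on test functions that is dominated by \<open>M\<close> has a
bounded density with respect to \<open>M\<close> (\<open>functional_density\<close>), and with this density
\<open>dist_measure\<close> and \<open>total_variation\<close> become integrals.\<close>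

section \<open>Smooth bump functions\<close>

lemma C_k_continuous: "C_k k f \<Longrightarrow> continuous_on UNIV f"
  by (cases k) (auto intro!: continuous_at_imp_continuous_on differentiable_imp_continuous_within)

lemma C_k_mono_Suc: "C_k (Suc k) f \<Longrightarrow> C_k k f"
proof (induction k arbitrary: f)
  case 0
  then show ?case
    using C_k_continuous by fastforce
next
  case (Suc k)
  then show ?case by (auto simp del: C_k.simps(1) simp: C_k.simps(2))
qed

lemma C_k_const: "C_k k (\<lambda>x. c)"
proof (induction k arbitrary: c)
  case (Suc k)
  have "frechet_derivative (\<lambda>x::'a. c) (at x) = (\<lambda>v. 0)" for x
    by (metis frechet_derivative_at has_derivative_const)
  then show ?case using Suc by simp
qed simp

lemma frechet_derivative_eqI:
  "(f has_derivative f') (at x) \<Longrightarrow> frechet_derivative f (at x) = f'"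
  using frechet_derivative_at by metis

lemma C_k_add: "C_k k f \<Longrightarrow> C_k k g \<Longrightarrow> C_k k (\<lambda>x. f x + g x)"
proof (induction k arbitrary: f g)
  case (Suc k)
  have "frechet_derivative (\<lambda>x. f x + g x) (at x) =
      (\<lambda>v. frechet_derivative f (at x) v + frechet_derivative g (at x) v)" for x
    using Suc.prems
    by (intro frechet_derivative_eqI has_derivative_add) (auto simp: frechet_derivative_works[symmetric])
  then show ?case using Suc by auto
qed (auto intro: continuous_intros)

lemma C_k_mult: "C_k k f \<Longrightarrow> C_k k g \<Longrightarrow> C_k k (\<lambda>x. f x * g x)"
proof (induction k arbitrary: f g)
  case (Suc k)
  have "frechet_derivative (\<lambda>x. f x * g x) (at x) =
      (\<lambda>v. f x * frechet_derivative g (at x) v + frechet_derivative f (at x) v * g x)" for x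
    using Suc.prems
    by (intro frechet_derivative_eqI has_derivative_mult) (auto simp: frechet_derivative_works[symmetric])
  moreover have "C_k k f" "C_k k g" using Suc.prems C_k_mono_Suc by blast+
  ultimately show ?case using Suc by (auto intro!: C_k_add)
qed (auto intro: continuous_intros)

lemma C_k_cmult: "C_k k f \<Longrightarrow> C_k k (\<lambda>x. c * f x)"
  by (intro C_k_mult C_k_const)

lemma C_k_diff: "C_k k f \<Longrightarrow> C_k k g \<Longrightarrow> C_k k (\<lambda>x. f x - g x)"
  using C_k_add[of k f "\<lambda>x. (-1) * g x"] C_k_cmult[of k g "-1"] by simp

lemma C_k_prod: "(\<And>i. i \<in> I \<Longrightarrow> C_k k (f i)) \<Longrightarrow> C_k k (\<lambda>x. \<Prod>i\<in>I. f i x)"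
  by (induction I rule: infinite_finite_induct) (auto intro: C_k_const C_k_mult)

lemma frechet_derivative_translate:
  fixes f :: "'a::real_normed_vector \<Rightarrow> 'b::real_normed_vector"
  assumes "f differentiable (at (x - c))"
  shows "frechet_derivative (\<lambda>x. f (x - c)) (at x) = frechet_derivative f (at (x - c))"
    and "(\<lambda>x. f (x - c)) differentiable (at x)"
proof -
  have "((\<lambda>x. f (x - c)) has_derivative frechet_derivative f (at (x - c))) (at x)"
  proof -
    have "((\<lambda>x. x - c) has_derivative (\<lambda>h. h)) (at x)"
      by (auto intro!: derivative_eq_intros)
    from diff_chain_at[OF this] show ?thesis
      using assms by (auto simp: o_def frechet_derivative_works)
  qed
  then show "frechet_derivative (\<lambda>x. f (x - c)) (at x) = frechet_derivative f (at (x - c))"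
    and "(\<lambda>x. f (x - c)) differentiable (at x)"
    by (auto intro: frechet_derivative_eqI differentiableI)
qed

lemma C_k_translate: "C_k k f \<Longrightarrow> C_k k (\<lambda>x. f (x - c))"
proof (induction k arbitrary: f)
  case 0
  then show ?case by (auto intro!: continuous_on_compose2[of UNIV f] continuous_intros)
next
  case (Suc k)
  then show ?case
    by (auto simp: frechet_derivative_translate)
qed

text \<open>Differentiating \<open>exp (-1/x)\<close> repeatedly only produces polynomials in \<open>1/x\<close> in front of it; \<open>flat_step\<close>
records how the polynomial changes. Smoothness of \<open>flat\<close> then follows by induction over this class of functions.\<close>

definition flat_poly :: "real poly \<Rightarrow> real \<Rightarrow> real" where
  "flat_poly p x = (if x > 0 then poly p (1 / x) * exp (- (1 / x)) else 0)"

abbreviation flat :: "real \<Rightarrow> real" where "flat \<equiv> flat_poly 1"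

definition flat_step :: "real poly \<Rightarrow> real poly" where
  "flat_step p = [:0, 0, 1:] * (p - pderiv p)"

lemma poly_times_exp_minus_tendsto_0:
  "((\<lambda>y. poly p y * exp (- y)) \<longlongrightarrow> 0) (at_top :: real filter)"
proof -
  have "((\<lambda>y. y ^ k * poly p y * exp (- y)) \<longlongrightarrow> 0) (at_top :: real filter)" for k
  proof (induction p arbitrary: k)
    case 0
    then show ?case by simp
  next
    case (pCons a p)
    have "((\<lambda>y. y ^ k * exp (- y)) \<longlongrightarrow> 0) (at_top :: real filter)"
      using tendsto_power_div_exp_0[of k] by (simp add: exp_minus field_simps)
    from tendsto_add[OF tendsto_mult_left[OF this, of a] pCons.IH[of "Suc k"]]
    show ?case by (simp add: algebra_simps)
  qed
  from this[of 0] show ?thesis by simp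
qed

lemma DERIV_flat_poly: "(flat_poly p has_real_derivative flat_poly (flat_step p) x) (at x)"
proof -
  consider "x > 0" | "x < 0" | "x = 0" by linarith
  then show ?thesis
  proof cases
    case 1
    have "((\<lambda>x. poly p (1 / x) * exp (- (1 / x))) has_real_derivative flat_poly (flat_step p) x) (at x)"
      using 1 by (auto intro!: derivative_eq_intros simp: flat_poly_def flat_step_def field_simps power2_eq_square)
    then show ?thesis
      by (rule has_field_derivative_transform_within_open[where S = "{0<..}"])
         (use 1 in \<open>auto simp: flat_poly_def\<close>)
  next
    case 2
    have "((\<lambda>x. 0) has_real_derivative flat_poly (flat_step p) x) (at x)"
      using 2 by (auto simp: flat_poly_def)
    then show ?thesis
      by (rule has_field_derivative_transform_within_open[where S = "{..<0}"])
         (use 2 in \<open>auto simp: flat_poly_def\<close>)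
  next
    case 3
    have "((\<lambda>h. flat_poly p h / h) \<longlongrightarrow> 0) (at_right 0)"
    proof -
      have "((\<lambda>h. poly (pCons 0 p) (inverse h) * exp (- inverse h)) \<longlongrightarrow> 0) (at_right (0::real))"
        by (rule filterlim_compose[OF poly_times_exp_minus_tendsto_0 filterlim_inverse_at_top_right])
      then show ?thesis
        by (rule Lim_transform_eventually)
           (auto simp: eventually_at_right_field flat_poly_def field_simps intro!: exI[of _ 1])
    qed
    moreover have "((\<lambda>h. flat_poly p h / h) \<longlongrightarrow> 0) (at_left 0)"
    proof (rule Lim_transform_eventually[OF tendsto_const])
      show "\<forall>\<^sub>F h in at_left 0. 0 = flat_poly p h / h"
        by (auto simp: eventually_at_left_field flat_poly_def intro!: exI[of _ "-1"])
    qed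
    ultimately have "((\<lambda>h. flat_poly p h / h) \<longlongrightarrow> 0) (at 0)"
      by (simp add: filterlim_split_at)
    then show ?thesis
      using 3 by (simp add: DERIV_def flat_poly_def)
  qed
qed

text \<open>The induction on \<open>k\<close> is over all polynomials at once, because a derivative replaces \<open>p\<close> by \<open>flat_step p\<close>.\<close>

lemma C_k_flat_affine: "C_k k (\<lambda>z. flat_poly p (w \<bullet> z + d))"
proof -
  have D: "((\<lambda>z. flat_poly p (w \<bullet> z + d)) has_derivative
         (\<lambda>v. (w \<bullet> v) * flat_poly (flat_step p) (w \<bullet> z + d))) (at z)" for z p
  proof -
    have "((\<lambda>z. w \<bullet> z + d) has_derivative (\<lambda>v. w \<bullet> v)) (at z)"
      by (auto intro!: derivative_eq_intros)
    from diff_chain_at[OF this DERIV_flat_poly[THEN has_field_derivative_imp_has_derivative]]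
    show ?thesis by (simp add: o_def mult.commute)
  qed
  show ?thesis
  proof (induction k arbitrary: p)
    case 0
    have "continuous_on UNIV (flat_poly p)"
      by (meson DERIV_flat_poly DERIV_isCont continuous_at_imp_continuous_on)
    then show ?case by (auto intro!: continuous_on_compose2[of UNIV "flat_poly p"] continuous_intros)
  next
    case (Suc k)
    have "frechet_derivative (\<lambda>z. flat_poly p (w \<bullet> z + d)) (at z) =
         (\<lambda>v. (w \<bullet> v) * flat_poly (flat_step p) (w \<bullet> z + d))" for z
      by (rule frechet_derivative_eqI[OF D])
    then show ?case
      using Suc by (auto intro!: differentiableI[OF D] C_k_cmult)
  qed
qed

lemma flat_bounds: "0 \<le> flat x" "flat x \<le> 1"
  by (auto simp: flat_poly_def)

lemma flat_eq_0_iff: "flat x = 0 \<longleftrightarrow> x \<le> 0"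
  by (auto simp: flat_poly_def)

lemma flat_scaled_tendsto_1:
  assumes "x > 0" shows "(\<lambda>n. flat (real n * x)) \<longlonglongrightarrow> 1"
proof -
  have "(\<lambda>n. exp (- ((1 / x) * (1 / real n)))) \<longlonglongrightarrow> exp (- ((1 / x) * 0))"
    by (intro tendsto_intros lim_1_over_n)
  then have "(\<lambda>n. exp (- ((1 / x) * (1 / real n)))) \<longlonglongrightarrow> 1" by simp
  then show ?thesis
    by (rule Lim_transform_eventually)
       (use assms in \<open>auto simp: flat_poly_def eventually_sequentially field_simps intro!: exI[of _ 1]\<close>)
qed

text \<open>The factor \<open>n\<close> makes these bumps converge to the indicator function of the open box as \<open>n\<close> grows.\<close>

definition box_bump :: "nat \<Rightarrow> 'a \<Rightarrow> 'a \<Rightarrow> 'a::euclidean_space \<Rightarrow> real" where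
  "box_bump n a b z = (\<Prod>i\<in>Basis. flat (n * ((z - a) \<bullet> i)) * flat (n * ((b - z) \<bullet> i)))"

lemma C_k_box_bump: "C_k k (box_bump n a b)"
proof -
  have eq: "flat (n * ((z - a) \<bullet> i)) = flat_poly 1 ((n *\<^sub>R i) \<bullet> z + (- n * (a \<bullet> i)))"
           "flat (n * ((b - z) \<bullet> i)) = flat_poly 1 ((- n *\<^sub>R i) \<bullet> z + (n * (b \<bullet> i)))" for z i
    by (simp_all add: inner_diff_left algebra_simps inner_commute)
  show ?thesis
    unfolding box_bump_def[abs_def] eq by (intro C_k_prod C_k_mult C_k_flat_affine)
qed

lemma box_bump_bounds: "0 \<le> box_bump n a b z" "box_bump n a b z \<le> 1"
  unfolding box_bump_def
  by (auto intro!: prod_nonneg prod_le_1 mult_nonneg_nonneg mult_le_one simp: flat_bounds)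

lemma box_bump_eq_0: "z \<notin> box a b \<Longrightarrow> box_bump n a b z = 0"
  unfolding box_bump_def mem_box
  by (auto simp: flat_eq_0_iff inner_diff_left not_less intro!: prod_zero)
     (metis diff_le_0_iff_le mult_nonneg_nonpos of_nat_0_le_iff)+

lemma box_bump_tendsto:
  assumes "z \<in> box a b" shows "(\<lambda>n. box_bump n a b z) \<longlonglongrightarrow> 1"
proof -
  have "(\<lambda>n. box_bump n a b z) \<longlonglongrightarrow> (\<Prod>i\<in>(Basis::'a set). 1 * 1)"
    unfolding box_bump_def using assms
    by (intro tendsto_prod tendsto_mult flat_scaled_tendsto_1) (auto simp: mem_box inner_diff_left)
  then show ?thesis by simp
qed

lemma test_functionsD:
  assumes "\<zeta> \<in> test_functions \<Omega>"
  shows "C_k k \<zeta>" "compact (closure {x. \<zeta> x \<noteq> 0})" "closure {x. \<zeta> x \<noteq> 0} \<subseteq> \<Omega>"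
  using assms by (auto simp: test_functions_def)

lemma test_functionsI:
  assumes "\<And>k. C_k k \<zeta>" "compact K" "K \<subseteq> \<Omega>" "\<And>x. x \<notin> K \<Longrightarrow> \<zeta> x = 0"
  shows "\<zeta> \<in> test_functions \<Omega>"
proof -
  have sub: "closure {x. \<zeta> x \<noteq> 0} \<subseteq> K"
    using assms(2,4) by (intro closure_minimal compact_imp_closed) auto
  moreover have "compact (closure {x. \<zeta> x \<noteq> 0})"
    by (metis assms(2) closed_closure compact_Int_closed inf.absorb_iff2 sub)
  ultimately show ?thesis
    using assms by (auto simp: test_functions_def)
qed

text \<open>An open set is a countable union of open boxes whose closures it contains. With box bumps \<open>\<beta>\<^sub>j\<close> of these boxes,
\<open>1 - (\<Prod>j<n. 1 - \<beta>\<^sub>j)\<close> is a smooth version of the indicator of a finite union.\<close>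

lemma open_bump_sequence:
  fixes V :: "'a::euclidean_space set"
  assumes "open V"
  obtains f :: "nat \<Rightarrow> 'a \<Rightarrow> real" where "\<And>n. f n \<in> test_functions V"
    "\<And>n x. 0 \<le> f n x" "\<And>n x. f n x \<le> 1" "\<And>x. (\<lambda>n. f n x) \<longlonglongrightarrow> indicator V x"
proof -
  obtain a b :: "nat \<Rightarrow> 'a" where ab: "\<And>n. cbox (a n) (b n) \<subseteq> V" "V = (\<Union>n. box (a n) (b n))"
  proof -
    define \<D> where "\<D> = {p. cbox (fst p) (snd p) \<subseteq> V}"
    obtain \<D>' where D': "\<D>' \<subseteq> (\<lambda>p. box (fst p) (snd p)) ` \<D>" "countable \<D>'"
        "\<Union>\<D>' = \<Union>((\<lambda>p. box (fst p) (snd p)) ` \<D>)"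
      by (rule Lindelof[of "(\<lambda>p. box (fst p) (snd p)) ` \<D>"]) (auto simp: open_box)
    obtain C where C: "countable C" "C \<subseteq> \<D>" "\<D>' = (\<lambda>p. box (fst p) (snd p)) ` C"
      using countable_subset_image[of \<D>' "\<lambda>p. box (fst p) (snd p)" \<D>] D'(1,2) by auto
    have "cbox One (0::'a) = {}"
      using SOME_Basis by (force simp: box_eq_empty)
    then have "(One, 0::'a) \<in> \<D>"
      by (simp add: \<D>_def)
    define C' where "C' = insert (One, 0::'a) C"
    have C': "C' \<noteq> {}" "countable C'" "C' \<subseteq> \<D>" "(\<Union>p\<in>C'. box (fst p) (snd p)) = (\<Union>p\<in>\<D>. box (fst p) (snd p))"
      using C D'(3) \<open>(One, 0) \<in> \<D>\<close> by (auto simp: C'_def mem_box)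
    have "V \<subseteq> (\<Union>p\<in>\<D>. box (fst p) (snd p))"
    proof
      fix x assume "x \<in> V"
      then obtain p q where "x \<in> box p q" "cbox p q \<subseteq> V"
        using assms open_contains_cbox by meson
      then show "x \<in> (\<Union>p\<in>\<D>. box (fst p) (snd p))" by (force simp: \<D>_def)
    qed
    then have V: "V = (\<Union>p\<in>C'. box (fst p) (snd p))"
      unfolding C'(4) using box_subset_cbox by (fastforce simp: \<D>_def)
    show ?thesis
    proof (rule that[of "\<lambda>n. fst (from_nat_into C' n)" "\<lambda>n. snd (from_nat_into C' n)"])
      show "cbox (fst (from_nat_into C' n)) (snd (from_nat_into C' n)) \<subseteq> V" for n
        using from_nat_into[OF C'(1), of n] C'(3) by (auto simp: \<D>_def)
      have "(\<Union>p\<in>C'. box (fst p) (snd p)) = (\<Union>p\<in>range (from_nat_into C'). box (fst p) (snd p))"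
        using C'(1,2) by (simp add: range_from_nat_into)
      then show "V = (\<Union>n. box (fst (from_nat_into C' n)) (snd (from_nat_into C' n)))"
        using V by simp
    qed
  qed
  define f where "f n x = 1 - (\<Prod>j<n. 1 - box_bump n (a j) (b j) x)" for n x
  have b01: "0 \<le> (\<Prod>j\<in>J. 1 - box_bump n (a j) (b j) x)" "(\<Prod>j\<in>J. 1 - box_bump n (a j) (b j) x) \<le> 1" for J n x
    using box_bump_bounds by (auto intro!: prod_nonneg prod_le_1)
  show ?thesis
  proof
    show "0 \<le> f n x" "f n x \<le> 1" for n x
      using b01[of n x "{..<n}"] by (auto simp: f_def)
    show "f n \<in> test_functions V" for n
    proof (rule test_functionsI)
      show "C_k k (f n)" for k
        unfolding f_def[abs_def] by (intro C_k_diff C_k_prod C_k_const C_k_box_bump)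
      show "compact (\<Union>j<n. cbox (a j) (b j))" by auto
      show "(\<Union>j<n. cbox (a j) (b j)) \<subseteq> V" using ab(1) by auto
      show "f n x = 0" if "x \<notin> (\<Union>j<n. cbox (a j) (b j))" for x
      proof -
        have "box_bump n (a j) (b j) x = 0" if "j < n" for j
          using \<open>x \<notin> _\<close> that box_subset_cbox by (intro box_bump_eq_0) blast
        then show ?thesis by (simp add: f_def)
      qed
    qed
    show "(\<lambda>n. f n x) \<longlonglongrightarrow> indicator V x" for x
    proof (cases "x \<in> V")
      case True
      then obtain k where k: "x \<in> box (a k) (b k)" using ab(2) by auto
      have "(\<lambda>n. \<Prod>j<n. 1 - box_bump n (a j) (b j) x) \<longlonglongrightarrow> 0"
      proof (rule tendsto_sandwich)
        show "\<forall>\<^sub>F n in sequentially. 0 \<le> (\<Prod>j<n. 1 - box_bump n (a j) (b j) x)"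
          using b01 by simp
        show "\<forall>\<^sub>F n in sequentially. (\<Prod>j<n. 1 - box_bump n (a j) (b j) x) \<le> 1 - box_bump n (a k) (b k) x"
        proof (rule eventually_sequentiallyI[of "Suc k"])
          fix n assume "Suc k \<le> n"
          then have "(\<Prod>j<n. 1 - box_bump n (a j) (b j) x) =
            (1 - box_bump n (a k) (b k) x) * (\<Prod>j\<in>{..<n}-{k}. 1 - box_bump n (a j) (b j) x)"
            by (intro prod.remove) auto
          also have "\<dots> \<le> (1 - box_bump n (a k) (b k) x) * 1"
            using box_bump_bounds b01 by (intro mult_left_mono) auto
          finally show "(\<Prod>j<n. 1 - box_bump n (a j) (b j) x) \<le> 1 - box_bump n (a k) (b k) x" by simp
        qed
        show "(\<lambda>n. 1 - box_bump n (a k) (b k) x) \<longlonglongrightarrow> 0"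
          using tendsto_diff[OF tendsto_const box_bump_tendsto[OF k], of 1] by simp
      qed simp
      from tendsto_diff[OF tendsto_const this, of 1] show ?thesis
        using True by (simp add: f_def)
    next
      case False
      then have "box_bump n (a j) (b j) x = 0" for n j
        using ab(2) by (intro box_bump_eq_0) auto
      then show ?thesis using False by (simp add: f_def)
    qed
  qed
qed

section \<open>Calculus of test functions\<close>

lemma continuous_compact_support_bounded:
  fixes f :: "'a::euclidean_space \<Rightarrow> real"
  assumes "continuous_on UNIV f" "compact K" "\<And>x. x \<notin> K \<Longrightarrow> f x = 0"
  obtains B where "B \<ge> 0" "\<And>x. \<bar>f x\<bar> \<le> B"
proof -
  have "compact (f ` K)"
    using assms(1,2) compact_continuous_image continuous_on_subset by blast
  then obtain B where B: "\<And>y. y \<in> f ` K \<Longrightarrow> norm y \<le> B"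
    using compact_imp_bounded bounded_iff by meson
  show ?thesis
    by (rule that[of "max 0 B"]) (use assms(3) B in \<open>force simp: max_def\<close>)+
qed

context
  fixes \<zeta> :: "'a::euclidean_space \<Rightarrow> real" and \<Omega>
  assumes test: "\<zeta> \<in> test_functions \<Omega>"
begin

lemma test_support:
  obtains K where "compact K" "K \<subseteq> \<Omega>" "\<And>x. x \<notin> K \<Longrightarrow> \<zeta> x = 0"
    "\<And>x v. x \<notin> K \<Longrightarrow> frechet_derivative \<zeta> (at x) v = 0"
proof (rule that)
  let ?K = "closure {x. \<zeta> x \<noteq> 0}"
  show "compact ?K" "?K \<subseteq> \<Omega>" using test by (auto simp: test_functions_def)
  show z: "\<zeta> x = 0" if "x \<notin> ?K" for x
    using that closure_subset[of "{x. \<zeta> x \<noteq> 0}"] by blast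
  show "frechet_derivative \<zeta> (at x) v = 0" if "x \<notin> ?K" for x v
  proof -
    have "(\<zeta> has_derivative (\<lambda>v. 0)) (at x)"
    proof (rule has_derivative_transform_within_open[OF has_derivative_const])
      show "open (- ?K)" by (rule open_Compl[OF closed_closure])
      show "x \<in> - ?K" using that by simp
      show "0 = \<zeta> y" if "y \<in> - ?K" for y
        using z[of y] that by simp
    qed
    then show ?thesis by (simp add: frechet_derivative_eqI)
  qed
qed

lemma test_continuous: "continuous_on UNIV \<zeta>"
  by (rule C_k_continuous[OF test_functionsD(1)[OF test, of 0]])

lemma test_measurable [measurable]: "\<zeta> \<in> borel_measurable borel"
  using borel_measurable_continuous_onI[OF test_continuous] .

lemma test_zero_outside: "x \<notin> \<Omega> \<Longrightarrow> \<zeta> x = 0"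
proof (rule test_support)
  fix K assume "K \<subseteq> \<Omega>" "\<And>x. x \<notin> K \<Longrightarrow> \<zeta> x = 0" "x \<notin> \<Omega>"
  then show "\<zeta> x = 0" by (metis subsetD)
qed

lemma test_bounded: obtains B where "B \<ge> 0" "\<And>x. \<bar>\<zeta> x\<bar> \<le> B"
proof (rule test_support)
  fix K assume "compact K" "\<And>x. x \<notin> K \<Longrightarrow> \<zeta> x = 0"
  from continuous_compact_support_bounded[OF test_continuous this] that show thesis by metis
qed

lemma test_has_derivative: "(\<zeta> has_derivative frechet_derivative \<zeta> (at x)) (at x)"
  using test_functionsD(1)[OF test, of 1] by (simp add: frechet_derivative_works[symmetric])

lemma test_derivative_linear: "linear (frechet_derivative \<zeta> (at x))"
  by (rule has_derivative_linear[OF test_has_derivative])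

lemma test_derivative_continuous: "continuous_on UNIV (\<lambda>x. frechet_derivative \<zeta> (at x) v)"
  using test_functionsD(1)[OF test, of 1] by simp

lemma test_derivative_measurable: "(\<lambda>x. frechet_derivative \<zeta> (at x) v) \<in> borel_measurable borel"
  using borel_measurable_continuous_onI[OF test_derivative_continuous] .

lemma test_derivative_bounded:
  obtains B where "B \<ge> 0" "\<And>x. \<bar>frechet_derivative \<zeta> (at x) v\<bar> \<le> B"
proof (rule test_support)
  fix K assume "compact K" "\<And>x v. x \<notin> K \<Longrightarrow> frechet_derivative \<zeta> (at x) v = 0"
  from continuous_compact_support_bounded[OF test_derivative_continuous[of v] this] that show thesis by metis
qed

lemma test_line_derivative:
  "((\<lambda>t. \<zeta> (x + t *\<^sub>R v)) has_real_derivative frechet_derivative \<zeta> (at (x + t *\<^sub>R v)) v) (at t within S)"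
proof -
  have "((\<lambda>t. x + t *\<^sub>R v) has_derivative (\<lambda>h. h *\<^sub>R v)) (at t)"
    by (auto intro!: derivative_eq_intros)
  from diff_chain_at[OF this test_has_derivative]
  have "((\<lambda>t. \<zeta> (x + t *\<^sub>R v)) has_derivative (\<lambda>h. h * frechet_derivative \<zeta> (at (x + t *\<^sub>R v)) v)) (at t)"
    using linear_scale[OF test_derivative_linear] by (simp add: o_def)
  then have "((\<lambda>t. \<zeta> (x + t *\<^sub>R v)) has_real_derivative frechet_derivative \<zeta> (at (x + t *\<^sub>R v)) v) (at t)"
    unfolding has_field_derivative_def by (rule has_derivative_eq_rhs) (auto simp: fun_eq_iff)
  then show ?thesis by (rule has_field_derivative_at_within)
qed

lemma test_lipschitz_line:
  assumes B: "\<And>x. \<bar>frechet_derivative \<zeta> (at x) v\<bar> \<le> B"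
  shows "\<bar>\<zeta> (x + t *\<^sub>R v) - \<zeta> x\<bar> \<le> B * \<bar>t\<bar>"
proof -
  have "norm (\<zeta> (x + t *\<^sub>R v) - \<zeta> (x + 0 *\<^sub>R v)) \<le> B * norm (t - 0)"
    by (rule field_differentiable_bound[OF convex_UNIV test_line_derivative]) (use B in auto)
  then show ?thesis by simp
qed

lemma test_integrable:
  assumes "finite_measure M" "sets M = sets borel"
  shows "integrable M \<zeta>"
proof -
  obtain B where "\<And>x. \<bar>\<zeta> x\<bar> \<le> B" using test_bounded by metis
  moreover have "\<zeta> \<in> borel_measurable M"
    using test_measurable measurable_cong_sets[OF assms(2) refl] by blast
  ultimately show ?thesis
    by (intro finite_measure.integrable_const_bound[OF assms(1), where B = B]) (auto intro!: AE_I2)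
qed

end

lemma test_zero: "(\<lambda>x. 0) \<in> test_functions \<Omega>"
  by (rule test_functionsI[of _ "{}"]) (auto intro: C_k_const)

lemma test_add:
  assumes "\<zeta> \<in> test_functions \<Omega>" "\<xi> \<in> test_functions \<Omega>"
  shows "(\<lambda>x. \<zeta> x + \<xi> x) \<in> test_functions \<Omega>"
proof -
  obtain K where K: "compact K" "K \<subseteq> \<Omega>" "\<And>x. x \<notin> K \<Longrightarrow> \<zeta> x = 0" using test_support[OF assms(1)] by metis
  obtain K' where K': "compact K'" "K' \<subseteq> \<Omega>" "\<And>x. x \<notin> K' \<Longrightarrow> \<xi> x = 0" using test_support[OF assms(2)] by metis
  show ?thesis
    by (rule test_functionsI[of _ "K \<union> K'"])
       (use assms K K' in \<open>auto intro: C_k_add test_functionsD(1)\<close>)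
qed

lemma test_cmult:
  assumes "\<zeta> \<in> test_functions \<Omega>" shows "(\<lambda>x. c * \<zeta> x) \<in> test_functions \<Omega>"
proof -
  obtain K where K: "compact K" "K \<subseteq> \<Omega>" "\<And>x. x \<notin> K \<Longrightarrow> \<zeta> x = 0" using test_support[OF assms(1)] by metis
  show ?thesis
    by (rule test_functionsI[of _ K]) (use assms K in \<open>auto intro: C_k_cmult test_functionsD(1)\<close>)
qed

lemma test_diff:
  assumes "\<zeta> \<in> test_functions \<Omega>" "\<xi> \<in> test_functions \<Omega>"
  shows "(\<lambda>x. \<zeta> x - \<xi> x) \<in> test_functions \<Omega>"
  using test_add[OF assms(1) test_cmult[OF assms(2), of "-1"]] by simp

lemma test_sum:
  "(\<And>i. i \<in> I \<Longrightarrow> \<zeta> i \<in> test_functions \<Omega>) \<Longrightarrow> (\<lambda>x. \<Sum>i\<in>I. \<zeta> i x) \<in> test_functions \<Omega>"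
  by (induction I rule: infinite_finite_induct) (auto intro: test_zero test_add)

lemma test_mono: "\<zeta> \<in> test_functions U \<Longrightarrow> U \<subseteq> \<Omega> \<Longrightarrow> \<zeta> \<in> test_functions \<Omega>"
  by (auto simp: test_functions_def)

lemma test_translate:
  assumes "\<zeta> \<in> test_functions U" "\<And>x. x \<in> U \<Longrightarrow> x + c \<in> \<Omega>"
  shows "(\<lambda>x. \<zeta> (x - c)) \<in> test_functions \<Omega>"
proof -
  obtain K where K: "compact K" "K \<subseteq> U" "\<And>x. x \<notin> K \<Longrightarrow> \<zeta> x = 0" using test_support[OF assms(1)] by metis
  show ?thesis
  proof (rule test_functionsI)
    show "compact ((\<lambda>x. x + c) ` K)"
      using K(1) by (intro compact_continuous_image continuous_intros)
    show "\<zeta> (x - c) = 0" if "x \<notin> (\<lambda>x. x + c) ` K" for x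
      using that K(3) by (metis diff_add_cancel imageI)
  qed (use assms K C_k_translate test_functionsD(1) in \<open>blast+\<close>)
qed

section \<open>Density of test functions and uniqueness of representing measures\<close>

lemma integral_mono_le_measure:
  fixes f :: "'a \<Rightarrow> real"
  assumes "sets Q = sets M" "Q \<le> M" "integrable M f" "\<And>x. 0 \<le> f x"
  shows "integrable Q f" "(\<integral>x. f x \<partial>Q) \<le> (\<integral>x. f x \<partial>M)"
proof -
  have f: "f \<in> borel_measurable M" "f \<in> borel_measurable Q"
    using assms(3) measurable_cong_sets[OF assms(1) refl] by auto
  have le: "(\<integral>\<^sup>+x. ennreal (f x) \<partial>Q) \<le> (\<integral>\<^sup>+x. ennreal (f x) \<partial>M)"
    by (rule nn_integral_mono_measure[OF assms(1,2)])
  have fin: "(\<integral>\<^sup>+x. ennreal (f x) \<partial>M) < \<infinity>"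
    using assms(3,4) by (simp add: integrable_iff_bounded)
  show i: "integrable Q f"
    using f le fin assms(4) by (auto simp: integrable_iff_bounded)
  show "(\<integral>x. f x \<partial>Q) \<le> (\<integral>x. f x \<partial>M)"
    using le nn_integral_eq_integral[OF i] nn_integral_eq_integral[OF assms(3)] assms(4)
    by (simp add: ennreal_le_iff integral_nonneg_AE)
qed

text \<open>Several finite measures are handled through one measure that is larger than each of them: an approximation in
\<open>L\<^sup>1\<close> of that measure is an approximation for all of them simultaneously.\<close>

lemma finite_sum_of_measures:
  fixes Q :: "'i \<Rightarrow> 'a::topological_space measure"
  assumes "finite I" "\<And>i. i \<in> I \<Longrightarrow> finite_measure (Q i)" "\<And>i. i \<in> I \<Longrightarrow> sets (Q i) = sets borel"
  obtains M :: "'a measure" where "finite_measure M" "sets M = sets borel"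
    "\<And>A. A \<in> sets borel \<Longrightarrow> emeasure M A = (\<Sum>i\<in>I. emeasure (Q i) A)"
    "\<And>i. i \<in> I \<Longrightarrow> Q i \<le> M"
proof -
  define \<mu> where "\<mu> A = (\<Sum>i\<in>I. emeasure (Q i) A)" for A
  define M where "M = measure_of UNIV (sets borel) \<mu>"
  have s: "sets M = sets borel" 
    unfolding M_def using sets.sigma_sets_eq[of "borel :: 'a measure"] by (simp add: sets_measure_of)
  have e: "emeasure M A = \<mu> A" if "A \<in> sets borel" for A
    unfolding M_def
  proof (rule emeasure_measure_of_sigma)
    show "sigma_algebra UNIV (sets borel)" by (metis sets.sigma_algebra_axioms space_borel)
    show "positive (sets borel) \<mu>" by (auto simp: positive_def \<mu>_def)
    show "countably_additive (sets borel) \<mu>"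
    proof (rule countably_additiveI)
      fix A :: "nat \<Rightarrow> 'a set"
      assume A: "range A \<subseteq> sets borel" "disjoint_family A"
      have "(\<Sum>n. \<mu> (A n)) = (\<Sum>i\<in>I. \<Sum>n. emeasure (Q i) (A n))"
        unfolding \<mu>_def by (intro suminf_sum) auto
      also have "\<dots> = \<mu> (\<Union>n. A n)"
        unfolding \<mu>_def using A assms(3) by (intro sum.cong refl suminf_emeasure) auto
      finally show "(\<Sum>n. \<mu> (A n)) = \<mu> (\<Union>n. A n)" .
    qed
  qed (use that in auto)
  show ?thesis
  proof (rule that)
    have "emeasure M UNIV < \<infinity>"
      using finite_measure.emeasure_finite[OF assms(2)] assms(1)
      by (subst e) (auto simp: \<mu>_def less_top[symmetric])
    then show "finite_measure M"
      using s by (intro finite_measureI) (auto dest: sets_eq_imp_space_eq)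
    show "sets M = sets borel" by fact
    show "emeasure M A = (\<Sum>i\<in>I. emeasure (Q i) A)" if "A \<in> sets borel" for A
      using e[OF that] by (simp add: \<mu>_def)
    show "Q i \<le> M" if "i \<in> I" for i
      using that assms e s member_le_sum[OF that, of "\<lambda>i. emeasure (Q i) _"]
      by (subst le_measure) (auto simp: \<mu>_def)
  qed
qed

context
  fixes M :: "'a::euclidean_space measure" and \<Omega> :: "'a set"
  assumes M: "finite_measure M" "sets M = sets borel" and \<Omega>: "open \<Omega>" "emeasure M (- \<Omega>) = 0"
begin

lemma AE_in_carrier: "AE x in M. x \<in> \<Omega>"
  using \<Omega> M(2) by (intro AE_I'[of "- \<Omega>"]) (auto simp: null_sets_def)

text \<open>The Borel sets whose indicators can be approximated form a Dynkin system, which contains the open sets by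
\<open>open_bump_sequence\<close> and dominated convergence.\<close>

lemma test_functions_dense_indicator:
  assumes "A \<in> sets borel" "e > 0"
  shows "\<exists>\<zeta>\<in>test_functions \<Omega>. (\<integral>x. \<bar>\<zeta> x - indicator A x\<bar> \<partial>M) < e"
proof -
  interpret finite_measure M by (rule M(1))
  have sp: "space M = UNIV" using sets_eq_imp_space_eq[OF M(2)] by simp
  note [measurable_cong] = M(2)
  have ind: "integrable M (indicator B :: 'a \<Rightarrow> real)" if "B \<in> sets borel" for B
    using that M(2) by (intro integrable_real_indicator) (auto simp: emeasure_finite less_top[symmetric])
  have "Int_stable {S::'a set. open S}" by (auto simp: Int_stable_def)
  moreover have "{S::'a set. open S} \<subseteq> Pow UNIV" by simp
  moreover have "A \<in> sigma_sets UNIV {S::'a set. open S}"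
    using assms(1) by (simp add: borel_def)
  ultimately have "\<forall>e>0. \<exists>\<zeta>\<in>test_functions \<Omega>. (\<integral>x. \<bar>\<zeta> x - indicator A x\<bar> \<partial>M) < e"
  proof (induction A rule: sigma_sets_induct_disjoint)
    case (basic A)
    obtain f :: "nat \<Rightarrow> 'a \<Rightarrow> real" where f: "\<And>n. f n \<in> test_functions (A \<inter> \<Omega>)"
      "\<And>n x. 0 \<le> f n x" "\<And>n x. f n x \<le> 1" "\<And>x. (\<lambda>n. f n x) \<longlonglongrightarrow> indicator (A \<inter> \<Omega>) x"
      using open_bump_sequence[of "A \<inter> \<Omega>"] basic \<Omega>(1) by (metis mem_Collect_eq open_Int)
    note [measurable] = test_measurable[OF f(1)]
    have [measurable]: "A \<in> sets borel" using basic by auto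
    have "(\<lambda>n. \<integral>x. \<bar>f n x - indicator A x\<bar> \<partial>M) \<longlonglongrightarrow> (\<integral>x. 0 \<partial>M)"
    proof (rule integral_dominated_convergence[where w = "\<lambda>_. 1"])
      show "AE x in M. (\<lambda>n. \<bar>f n x - indicator A x\<bar>) \<longlonglongrightarrow> 0"
        using AE_in_carrier
      proof eventually_elim
        case (elim x)
        then have "indicator (A \<inter> \<Omega>) x = (indicator A x :: real)" by (auto simp: indicator_def)
        then show ?case using f(4)[of x]
          by (simp add: tendsto_rabs_zero_iff LIM_zero_iff)
      qed
      show "AE x in M. norm \<bar>f n x - indicator A x\<bar> \<le> 1" for n
      proof (rule AE_I2)
        show "norm \<bar>f n x - indicator A x\<bar> \<le> 1" for x
          using f(2)[of n x] f(3)[of n x] by (auto simp: indicator_def)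
      qed
    qed auto
    then have lim: "(\<lambda>n. \<integral>x. \<bar>f n x - indicator A x\<bar> \<partial>M) \<longlonglongrightarrow> 0" by simp
    show ?case
    proof (intro allI impI)
      fix e :: real assume "e > 0"
      from order_tendstoD(2)[OF lim this] obtain n where "(\<integral>x. \<bar>f n x - indicator A x\<bar> \<partial>M) < e"
        by (auto simp: eventually_sequentially)
      then show "\<exists>\<zeta>\<in>test_functions \<Omega>. (\<integral>x. \<bar>\<zeta> x - indicator A x\<bar> \<partial>M) < e"
        using test_mono[OF f(1)] by blast
    qed
  next
    case empty
    show ?case using test_zero[of \<Omega>] by (auto intro!: bexI[of _ "\<lambda>_. 0"])
  next
    case (compl A)
    have [measurable]: "A \<in> sets borel" using compl by (simp add: borel_def)
    show ?case
    proof (intro allI impI)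
      fix e :: real assume "e > 0"
      then obtain \<zeta> where z: "\<zeta> \<in> test_functions \<Omega>" "(\<integral>x. \<bar>\<zeta> x - indicator A x\<bar> \<partial>M) < e / 2"
        using compl by (metis half_gt_zero)
      (* the constant 1 is approximated as well, since M is concentrated on the carrier *)
      obtain f :: "nat \<Rightarrow> 'a \<Rightarrow> real" where f: "\<And>n. f n \<in> test_functions \<Omega>"
        "\<And>n x. 0 \<le> f n x" "\<And>n x. f n x \<le> 1" "\<And>x. (\<lambda>n. f n x) \<longlonglongrightarrow> indicator \<Omega> x"
        using open_bump_sequence[OF \<Omega>(1)] by metis
      note [measurable] = test_measurable[OF f(1)] test_measurable[OF z(1)]
      have "(\<lambda>n. \<integral>x. \<bar>f n x - 1\<bar> \<partial>M) \<longlonglongrightarrow> (\<integral>x. 0 \<partial>M)"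
      proof (rule integral_dominated_convergence[where w = "\<lambda>_. 1"])
        show "AE x in M. (\<lambda>n. \<bar>f n x - 1\<bar>) \<longlonglongrightarrow> 0"
          using AE_in_carrier
        proof eventually_elim
          case (elim x)
          then show ?case using f(4)[of x]
            by (simp add: tendsto_rabs_zero_iff LIM_zero_iff)
        qed
        show "AE x in M. norm \<bar>f n x - 1\<bar> \<le> 1" for n
        proof (rule AE_I2)
          show "norm \<bar>f n x - 1\<bar> \<le> 1" for x
            using f(2)[of n x] f(3)[of n x] by auto
        qed
      qed auto
      then have "(\<lambda>n. \<integral>x. \<bar>f n x - 1\<bar> \<partial>M) \<longlonglongrightarrow> 0" by simp
      from order_tendstoD(2)[OF this, of "e/2"] \<open>e > 0\<close> obtain n where n: "(\<integral>x. \<bar>f n x - 1\<bar> \<partial>M) < e/2"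
        by (auto simp: eventually_sequentially)
      have i: "integrable M (\<lambda>x. \<bar>f n x - 1\<bar>)" "integrable M (\<lambda>x. \<bar>\<zeta> x - indicator A x\<bar>)"
        using test_integrable[OF f(1) M] test_integrable[OF z(1) M] ind[of A] by auto
      have "(\<integral>x. \<bar>(f n x - \<zeta> x) - indicator (UNIV - A) x\<bar> \<partial>M)
         \<le> (\<integral>x. \<bar>f n x - 1\<bar> + \<bar>\<zeta> x - indicator A x\<bar> \<partial>M)"
        using i(1) i(2)
      proof (intro integral_mono)
        show "integrable M (\<lambda>x. \<bar>(f n x - \<zeta> x) - indicator (UNIV - A) x\<bar>)"
          using test_integrable[OF test_diff[OF f(1) z(1)] M] ind[of "UNIV - A"] by auto
      qed (auto simp: indicator_def)
      also have "\<dots> < e" using i n z(2) by simp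
      finally show "\<exists>\<zeta>\<in>test_functions \<Omega>. (\<integral>x. \<bar>\<zeta> x - indicator (UNIV - A) x\<bar> \<partial>M) < e"
        by (intro bexI[OF _ test_diff[OF f(1) z(1)]])
    qed
  next
    case (union A)
    have A [measurable]: "A i \<in> sets borel" for i using union by (auto simp: borel_def)
    show ?case
    proof (intro allI impI)
      fix e :: real assume "e > 0"
      have "(\<lambda>n. measure M (\<Union>i<n. A i)) \<longlonglongrightarrow> measure M (\<Union>n. \<Union>i<n. A i)"
      proof (rule finite_Lim_measure_incseq)
        show "range (\<lambda>n. \<Union>i<n. A i) \<subseteq> sets M" unfolding M(2) by auto
        show "incseq (\<lambda>n. \<Union>i<n. A i)" by (intro incseq_SucI UN_mono) auto
      qed
      moreover have "(\<Union>n. \<Union>i<n. A i) = (\<Union>i. A i)" by blast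
      ultimately have "(\<lambda>n. measure M (\<Union>i<n. A i)) \<longlonglongrightarrow> measure M (\<Union>i. A i)" by simp
      from order_tendstoD(1)[OF this, of "measure M (\<Union>i. A i) - e / 2"] \<open>e > 0\<close>
      obtain n where n: "measure M (\<Union>i. A i) - e / 2 < measure M (\<Union>i<n. A i)"
        by (auto simp: eventually_sequentially)
      have "\<exists>\<zeta>. \<forall>i. \<zeta> i \<in> test_functions \<Omega> \<and> (\<integral>x. \<bar>\<zeta> i x - indicator (A i) x\<bar> \<partial>M) < e / (2 * (real n + 1))"
      proof (intro choice allI)
        fix i
        have "e / (2 * (real n + 1)) > 0" using \<open>e > 0\<close> by simp
        from union(3)[rule_format, OF this, of i]
        show "\<exists>\<zeta>. \<zeta> \<in> test_functions \<Omega> \<and> (\<integral>x. \<bar>\<zeta> x - indicator (A i) x\<bar> \<partial>M) < e / (2 * (real n + 1))"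
          by (simp add: Bex_def)
      qed
      then obtain \<zeta> where z: "\<And>i. \<zeta> i \<in> test_functions \<Omega>"
          "\<And>i. (\<integral>x. \<bar>\<zeta> i x - indicator (A i) x\<bar> \<partial>M) < e / (2 * (real n + 1))"
        by blast
      let ?U = "\<Union>i. A i" and ?Un = "\<Union>i<n. A i"
      have i: "integrable M (\<lambda>x. \<bar>\<zeta> i x - indicator (A i) x\<bar>)" for i
        using test_integrable[OF z(1) M] ind[OF A] by auto
      have i2: "integrable M (\<lambda>x. \<bar>(\<Sum>i<n. \<zeta> i x) - indicator ?U x\<bar>)"
        using test_integrable[OF test_sum[of "{..<n}", OF z(1)] M] ind[of ?U] by auto
      have pt: "\<bar>(\<Sum>i<n. \<zeta> i x) - indicator ?U x\<bar>
          \<le> (\<Sum>i<n. \<bar>\<zeta> i x - indicator (A i) x\<bar>) + indicator (?U - ?Un) x" for x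
      proof -
        have "indicator ?Un x = (\<Sum>i<n. indicator (A i) x :: real)"
          using union(1) by (intro indicator_UN_disjoint) (auto simp: disjoint_family_on_def)
        moreover have "indicator ?U x = (indicator ?Un x + indicator (?U - ?Un) x :: real)"
          by (auto simp: indicator_def)
        ultimately have "(\<Sum>i<n. \<zeta> i x) - indicator ?U x =
           (\<Sum>i<n. \<zeta> i x - indicator (A i) x) - indicator (?U - ?Un) x"
          by (simp only: sum_subtractf)
        then show ?thesis
          using sum_abs[of "\<lambda>i. \<zeta> i x - indicator (A i) x" "{..<n}"]
            abs_triangle_ineq4[of "\<Sum>i<n. \<zeta> i x - indicator (A i) x" "indicator (?U - ?Un) x"]
            abs_of_nonneg[OF indicator_pos_le[of "?U - ?Un" x, where 'a = real]]
          by linarith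
      qed
      have "(\<integral>x. \<bar>(\<Sum>i<n. \<zeta> i x) - indicator ?U x\<bar> \<partial>M)
          \<le> (\<integral>x. (\<Sum>i<n. \<bar>\<zeta> i x - indicator (A i) x\<bar>) + indicator (?U - ?Un) x \<partial>M)"
        using i i2 ind pt by (intro integral_mono) auto
      also have "\<dots> = (\<Sum>i<n. \<integral>x. \<bar>\<zeta> i x - indicator (A i) x\<bar> \<partial>M) + measure M (?U - ?Un)"
        using i ind[of "?U - ?Un"] by (subst Bochner_Integration.integral_add) (auto simp: sp)
      also have "measure M (?U - ?Un) = measure M ?U - measure M ?Un"
        using M(2) by (intro finite_measure_Diff) auto
      also have "(\<Sum>i<n. \<integral>x. \<bar>\<zeta> i x - indicator (A i) x\<bar> \<partial>M) \<le> (\<Sum>i<n. e / (2 * (real n + 1)))"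
        using z(2) by (intro sum_mono less_imp_le)
      also have "\<dots> \<le> e / 2" using \<open>e > 0\<close> by (simp add: field_simps)
      finally have "(\<integral>x. \<bar>(\<Sum>i<n. \<zeta> i x) - indicator ?U x\<bar> \<partial>M) < e"
        using n by linarith
      then show "\<exists>\<zeta>\<in>test_functions \<Omega>. (\<integral>x. \<bar>\<zeta> x - indicator ?U x\<bar> \<partial>M) < e"
        by (intro bexI[OF _ test_sum[of "{..<n}", OF z(1)]])
    qed
  qed
  then show ?thesis using assms(2) by blast
qed

lemma test_functions_dense:
  fixes u :: "'a \<Rightarrow> real"
  assumes "integrable M u" "e > 0"
  shows "\<exists>\<zeta>\<in>test_functions \<Omega>. (\<integral>x. \<bar>\<zeta> x - u x\<bar> \<partial>M) < e"
proof -
  interpret finite_measure M by (rule M(1))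
  note T = test_integrable[OF _ M]
  have "\<forall>e>0. \<exists>\<zeta>\<in>test_functions \<Omega>. (\<integral>x. \<bar>\<zeta> x - u x\<bar> \<partial>M) < e"
    using assms(1)
  proof (induction u rule: integrable_induct)
    case (base A c)
    show ?case
    proof (intro allI impI)
      fix e :: real assume "e > 0"
      then have "e / (\<bar>c\<bar> + 1) > 0" by simp
      from test_functions_dense_indicator[OF _ this, of A] base M(2)
      obtain \<zeta> where z: "\<zeta> \<in> test_functions \<Omega>" "(\<integral>x. \<bar>\<zeta> x - indicator A x\<bar> \<partial>M) < e / (\<bar>c\<bar> + 1)" by auto
      have "(\<integral>x. \<bar>c * \<zeta> x - indicator A x *\<^sub>R c\<bar> \<partial>M) = (\<integral>x. \<bar>c\<bar> * \<bar>\<zeta> x - indicator A x\<bar> \<partial>M)"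
        by (intro Bochner_Integration.integral_cong) (auto simp: abs_mult[symmetric] algebra_simps)
      also have "\<dots> = \<bar>c\<bar> * (\<integral>x. \<bar>\<zeta> x - indicator A x\<bar> \<partial>M)" by simp
      also have "\<dots> \<le> \<bar>c\<bar> * (e / (\<bar>c\<bar> + 1))" using z(2) by (intro mult_left_mono) auto
      also have "\<dots> < e" using \<open>e > 0\<close> by (simp add: field_simps)
      finally show "\<exists>\<zeta>\<in>test_functions \<Omega>. (\<integral>x. \<bar>\<zeta> x - indicator A x *\<^sub>R c\<bar> \<partial>M) < e"
        by (intro bexI[OF _ test_cmult[OF z(1), of c]])
    qed
  next
    case (add f g)
    show ?case
    proof (intro allI impI)
      fix e :: real assume "e > 0"
      obtain \<zeta> where z: "\<zeta> \<in> test_functions \<Omega>" "(\<integral>x. \<bar>\<zeta> x - f x\<bar> \<partial>M) < e / 2"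
        using add.IH(1) \<open>e > 0\<close> half_gt_zero by blast
      obtain \<xi> where x: "\<xi> \<in> test_functions \<Omega>" "(\<integral>x. \<bar>\<xi> x - g x\<bar> \<partial>M) < e / 2"
        using add.IH(2) \<open>e > 0\<close> half_gt_zero by blast
      have "(\<integral>x. \<bar>(\<zeta> x + \<xi> x) - (f x + g x)\<bar> \<partial>M) \<le> (\<integral>x. \<bar>\<zeta> x - f x\<bar> + \<bar>\<xi> x - g x\<bar> \<partial>M)"
        using add.hyps T[OF z(1)] T[OF x(1)] by (intro integral_mono) auto
      also have "\<dots> < e" using z x add.hyps T[OF z(1)] T[OF x(1)] by simp
      finally show "\<exists>\<zeta>\<in>test_functions \<Omega>. (\<integral>x. \<bar>\<zeta> x - (f x + g x)\<bar> \<partial>M) < e"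
        by (intro bexI[OF _ test_add[OF z(1) x(1)]])
    qed
  next
    case (lim f s)
    have "(\<lambda>n. \<integral>x. \<bar>s n x - f x\<bar> \<partial>M) \<longlonglongrightarrow> (\<integral>x. 0 \<partial>M)"
    proof (rule integral_dominated_convergence[where w = "\<lambda>x. 3 * norm (f x)"])
      show "AE x in M. (\<lambda>n. \<bar>s n x - f x\<bar>) \<longlonglongrightarrow> 0"
        using lim.hyps(2) by (intro AE_I2) (simp add: tendsto_rabs_zero_iff LIM_zero_iff)
      show "AE x in M. norm \<bar>s n x - f x\<bar> \<le> 3 * norm (f x)" for n
      proof (rule AE_I2)
        fix x assume "x \<in> space M"
        from lim.hyps(3)[OF this, of n] show "norm \<bar>s n x - f x\<bar> \<le> 3 * norm (f x)" by auto
      qed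
    qed (use lim.hyps in auto)
    then have l: "(\<lambda>n. \<integral>x. \<bar>s n x - f x\<bar> \<partial>M) \<longlonglongrightarrow> 0" by simp
    show ?case
    proof (intro allI impI)
      fix e :: real assume "e > 0"
      from order_tendstoD(2)[OF l, of "e/2"] \<open>e > 0\<close> obtain n where n: "(\<integral>x. \<bar>s n x - f x\<bar> \<partial>M) < e/2"
        by (auto simp: eventually_sequentially)
      obtain \<zeta> where z: "\<zeta> \<in> test_functions \<Omega>" "(\<integral>x. \<bar>\<zeta> x - s n x\<bar> \<partial>M) < e / 2"
        using lim.IH \<open>e > 0\<close> half_gt_zero by blast
      have "(\<integral>x. \<bar>\<zeta> x - f x\<bar> \<partial>M) \<le> (\<integral>x. \<bar>\<zeta> x - s n x\<bar> + \<bar>s n x - f x\<bar> \<partial>M)"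
        using lim.hyps T[OF z(1)] by (intro integral_mono) auto
      also have "\<dots> < e" using z n lim.hyps T[OF z(1)] by simp
      finally show "\<exists>\<zeta>\<in>test_functions \<Omega>. (\<integral>x. \<bar>\<zeta> x - f x\<bar> \<partial>M) < e"
        using z(1) by blast
    qed
  qed
  then show ?thesis using assms(2) by blast
qed

end

text \<open>A signed measure on \<open>\<Omega>\<close> is given by measures on the trace sigma-algebra of \<open>\<Omega>\<close>. Pushing these
forward along the inclusion makes them Borel measures on the whole space, to which the density result applies.\<close>

lemma extend_measure:
  fixes P :: "'a::euclidean_space measure"
  assumes P: "finite_measure P" "sets P = sets (restrict_space borel \<Omega>)" and "open \<Omega>"
  defines "P' \<equiv> distr P borel (\<lambda>x. x)"
  shows "finite_measure P'" "sets P' = sets borel" "emeasure P' (- \<Omega>) = 0"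
    "\<And>A. A \<in> sets borel \<Longrightarrow> measure P' A = measure P (A \<inter> \<Omega>)"
    "\<And>f :: 'a \<Rightarrow> real. f \<in> borel_measurable borel \<Longrightarrow> (\<integral>x. f x \<partial>P') = (\<integral>x. f x \<partial>P)"
proof -
  have id: "(\<lambda>x. x) \<in> measurable P borel"
    by (subst measurable_cong_sets[OF P(2) refl], rule measurable_restrict_space1) simp
  have sp: "space P = \<Omega>"
    using sets_eq_imp_space_eq[OF P(2)] by (simp add: space_restrict_space)
  interpret finite_measure P by fact
  show "finite_measure P'" unfolding P'_def by (rule finite_measure_distr[OF id])
  show "sets P' = sets borel" by (simp add: P'_def)
  show "emeasure P' (- \<Omega>) = 0"
    unfolding P'_def using \<open>open \<Omega>\<close> by (subst emeasure_distr[OF id]) (auto simp: sp)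
  show "measure P' A = measure P (A \<inter> \<Omega>)" if "A \<in> sets borel" for A
    unfolding P'_def using measure_distr[OF id, of A] that by (simp add: sp)
  show "(\<integral>x. f x \<partial>P') = (\<integral>x. f x \<partial>P)" if "f \<in> borel_measurable borel" for f :: "'a \<Rightarrow> real"
    unfolding P'_def using id that by (rule integral_distr)
qed

text \<open>One test function approximates the indicator of \<open>E\<close> in \<open>L\<^sup>1\<close> of all four measures involved, so the values on
test functions determine the value on \<open>E\<close>.\<close>

lemma dist_is_measure_unique:
  assumes "open \<Omega>" and 1: "dist_is_measure \<Omega> T \<mu>" and 2: "dist_is_measure \<Omega> T \<nu>"
  shows "\<mu> = \<nu>"
proof
  fix E
  from 1 obtain P1 N1 where m1: "finite_measure P1" "sets P1 = sets (restrict_space borel \<Omega>)"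
     "finite_measure N1" "sets N1 = sets (restrict_space borel \<Omega>)"
     "\<And>E. \<mu> E = measure P1 E - measure N1 E"
     "\<And>\<zeta>. \<zeta>\<in>test_functions \<Omega> \<Longrightarrow> T \<zeta> = (\<integral>x. \<zeta> x \<partial>P1) - (\<integral>x. \<zeta> x \<partial>N1)"
    unfolding dist_is_measure_def by blast
  from 2 obtain P2 N2 where m2: "finite_measure P2" "sets P2 = sets (restrict_space borel \<Omega>)"
     "finite_measure N2" "sets N2 = sets (restrict_space borel \<Omega>)"
     "\<And>E. \<nu> E = measure P2 E - measure N2 E"
     "\<And>\<zeta>. \<zeta>\<in>test_functions \<Omega> \<Longrightarrow> T \<zeta> = (\<integral>x. \<zeta> x \<partial>P2) - (\<integral>x. \<zeta> x \<partial>N2)"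
    unfolding dist_is_measure_def by blast
  show "\<mu> E = \<nu> E"
  proof (cases "E \<in> sets (restrict_space borel \<Omega>)")
    case False
    then show ?thesis using m1 m2 by (simp add: measure_notin_sets)
  next
    case True
    then have E: "E \<in> sets borel" "E \<subseteq> \<Omega>"
      using \<open>open \<Omega>\<close> by (auto simp: sets_restrict_space_iff)
    define Q where "Q i = (if i = 0 then distr P1 borel (\<lambda>x. x) else if i = 1 then distr N1 borel (\<lambda>x. x)
        else if i = 2 then distr P2 borel (\<lambda>x. x) else distr N2 borel (\<lambda>x. x))" for i :: nat
    note e = extend_measure[OF _ _ \<open>open \<Omega>\<close>]
    note ex = e[OF m1(1,2)] e[OF m1(3,4)] e[OF m2(1,2)] e[OF m2(3,4)]
    have Q: "finite_measure (Q i)" "sets (Q i) = sets borel" "emeasure (Q i) (-\<Omega>) = 0" for i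
      using ex by (auto simp: Q_def)
    obtain M where M: "finite_measure M" "sets M = sets borel"
      "\<And>A. A \<in> sets borel \<Longrightarrow> emeasure M A = (\<Sum>i\<le>3. emeasure (Q i) A)" "\<And>i. i \<le> 3 \<Longrightarrow> Q i \<le> M"
      using finite_sum_of_measures[of "{..3}" Q] Q by (metis atMost_iff finite_atMost)
    have M0: "emeasure M (- \<Omega>) = 0" using \<open>open \<Omega>\<close> Q by (simp add: M(3))
    have meas: "measure (Q 0) E = measure P1 E" "measure (Q 1) E = measure N1 E"
         "measure (Q 2) E = measure P2 E" "measure (Q 3) E = measure N2 E"
      using ex E by (simp_all add: Q_def Int_absorb2)
    have "\<bar>\<mu> E - \<nu> E\<bar> \<le> e" if "e > 0" for e
    proof -
      have "e / 4 > 0" using that by simp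
      from test_functions_dense_indicator[OF M(1,2) \<open>open \<Omega>\<close> M0 E(1) this]
      obtain \<zeta> where z: "\<zeta> \<in> test_functions \<Omega>" "(\<integral>x. \<bar>\<zeta> x - indicator E x\<bar> \<partial>M) < e / 4" by blast
      have intM: "integrable M (\<lambda>x. \<bar>\<zeta> x - indicator E x\<bar>)"
        using test_integrable[OF z(1) M(1,2)] E(1) M(2) finite_measure.emeasure_finite[OF M(1)]
        by (auto intro!: integrable_abs Bochner_Integration.integrable_diff integrable_real_indicator simp: less_top[symmetric])
      have ap: "\<bar>(\<integral>x. \<zeta> x \<partial>Q i) - measure (Q i) E\<bar> < e / 4" if "i \<le> 3" for i
      proof -
        have i1: "integrable (Q i) \<zeta>" using test_integrable[OF z(1) Q(1,2)] .
        have i2: "integrable (Q i) (indicator E :: 'a \<Rightarrow> real)" using E(1) Q finite_measure.emeasure_finite[OF Q(1)]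
          by (auto intro!: integrable_real_indicator simp: less_top[symmetric])
        have "(\<integral>x. \<zeta> x \<partial>Q i) - measure (Q i) E = (\<integral>x. \<zeta> x - indicator E x \<partial>Q i)"
          using i1 i2 E(1) Q(2)[of i] sets_eq_imp_space_eq[OF Q(2)[of i]] by simp
        then have "\<bar>(\<integral>x. \<zeta> x \<partial>Q i) - measure (Q i) E\<bar> \<le> (\<integral>x. \<bar>\<zeta> x - indicator E x\<bar> \<partial>Q i)"
          by (simp add: integral_abs_bound)
        also have "\<dots> \<le> (\<integral>x. \<bar>\<zeta> x - indicator E x\<bar> \<partial>M)"
          by (rule integral_mono_le_measure(2)[OF _ M(4)[OF that] intM]) (simp_all add: Q(2) M(2))
        finally show ?thesis using z(2) by simp
      qed
      have "(\<integral>x. \<zeta> x \<partial>Q 0) - (\<integral>x. \<zeta> x \<partial>Q 1) = (\<integral>x. \<zeta> x \<partial>Q 2) - (\<integral>x. \<zeta> x \<partial>Q 3)"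
        using m1(6)[OF z(1)] m2(6)[OF z(1)] ex test_measurable[OF z(1)] by (simp add: Q_def)
      then show ?thesis
        using ap[of 0] ap[of 1] ap[of 2] ap[of 3] meas m1(5)[of E] m2(5)[of E] by linarith
    qed
    then have "\<bar>\<mu> E - \<nu> E\<bar> \<le> 0" by (rule field_le_epsilon) simp
    then show ?thesis by simp
  qed
qed

lemma dist_measure_eqI:
  assumes "open \<Omega>" "dist_is_measure \<Omega> T \<mu>"
  shows "dist_measure \<Omega> T = \<mu>"
proof -
  have "\<nu> = \<mu>" if "dist_is_measure \<Omega> T \<nu>" for \<nu>
    using dist_is_measure_unique[OF assms(1) that assms(2)] .
  with assms(2) show ?thesis
    unfolding dist_measure_def by (metis theI)
qed

section \<open>Functionals dominated by a measure\<close>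

context
  fixes M :: "'a::euclidean_space measure" and \<Omega> :: "'a set"
    and T :: "('a \<Rightarrow> real) \<Rightarrow> real" and C :: real
  assumes M: "finite_measure M" "sets M = sets borel" and \<Omega>: "open \<Omega>" "emeasure M (- \<Omega>) = 0"
    and T_add: "\<And>\<zeta> \<xi>. \<zeta> \<in> test_functions \<Omega> \<Longrightarrow> \<xi> \<in> test_functions \<Omega> \<Longrightarrow> T (\<lambda>x. \<zeta> x + \<xi> x) = T \<zeta> + T \<xi>"
    and T_scale: "\<And>\<zeta> c. \<zeta> \<in> test_functions \<Omega> \<Longrightarrow> T (\<lambda>x. c * \<zeta> x) = c * T \<zeta>"
    and T_bound: "\<And>\<zeta>. \<zeta> \<in> test_functions \<Omega> \<Longrightarrow> \<bar>T \<zeta>\<bar> \<le> C * (\<integral>x. \<bar>\<zeta> x\<bar> \<partial>M)"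
    and C: "C \<ge> 0"
begin

text \<open>By \<open>T_bound\<close> and linearity, \<open>T\<close> is Lipschitz with constant \<open>C\<close> for the \<open>L\<^sup>1\<close> distance. This is the McShane formula
for extending a Lipschitz function from a subset of a metric space; since test functions are dense, the extension is the only one,
which is what makes it linear again.\<close>

private definition ext :: "('a \<Rightarrow> real) \<Rightarrow> real" where
  "ext u = (SUP \<zeta>\<in>test_functions \<Omega>. T \<zeta> - C * (\<integral>x. \<bar>\<zeta> x - u x\<bar> \<partial>M))"

private lemmas test_int = test_integrable[OF _ M]

private lemma T_diff:
  assumes "\<zeta> \<in> test_functions \<Omega>" "\<xi> \<in> test_functions \<Omega>"
  shows "\<bar>T \<zeta> - T \<xi>\<bar> \<le> C * (\<integral>x. \<bar>\<zeta> x - \<xi> x\<bar> \<partial>M)"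
  using T_bound[OF test_diff[OF assms]] T_add[OF assms(1) test_cmult[OF assms(2), of "-1"]]
    T_scale[OF assms(2), of "-1"] by simp

private lemma L1_triangle:
  fixes u v w :: "'a \<Rightarrow> real"
  assumes "integrable M u" "integrable M v" "integrable M w"
  shows "(\<integral>x. \<bar>u x - w x\<bar> \<partial>M) \<le> (\<integral>x. \<bar>u x - v x\<bar> \<partial>M) + (\<integral>x. \<bar>v x - w x\<bar> \<partial>M)"
proof -
  have "(\<integral>x. \<bar>u x - w x\<bar> \<partial>M) \<le> (\<integral>x. \<bar>u x - v x\<bar> + \<bar>v x - w x\<bar> \<partial>M)"
    using assms by (intro integral_mono) auto
  then show ?thesis using assms by simp
qed

private lemma ext_approx:
  assumes u: "integrable M u" and \<xi>: "\<xi> \<in> test_functions \<Omega>"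
  shows "\<bar>T \<xi> - ext u\<bar> \<le> C * (\<integral>x. \<bar>\<xi> x - u x\<bar> \<partial>M)"
proof -
  have up: "T \<zeta> - C * (\<integral>x. \<bar>\<zeta> x - u x\<bar> \<partial>M) \<le> T \<xi> + C * (\<integral>x. \<bar>\<xi> x - u x\<bar> \<partial>M)"
    if z: "\<zeta> \<in> test_functions \<Omega>" for \<zeta>
  proof -
    have "T \<zeta> - T \<xi> \<le> C * (\<integral>x. \<bar>\<zeta> x - \<xi> x\<bar> \<partial>M)"
      using T_diff[OF z \<xi>] by linarith
    also have "\<dots> \<le> C * ((\<integral>x. \<bar>\<zeta> x - u x\<bar> \<partial>M) + (\<integral>x. \<bar>u x - \<xi> x\<bar> \<partial>M))"
      using L1_triangle[OF test_int[OF z] u test_int[OF \<xi>]] C by (rule mult_left_mono)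
    finally show ?thesis by (simp add: algebra_simps abs_minus_commute)
  qed
  have "ext u \<le> T \<xi> + C * (\<integral>x. \<bar>\<xi> x - u x\<bar> \<partial>M)"
    unfolding ext_def using up \<xi> by (intro cSUP_least) auto
  moreover have "T \<xi> - C * (\<integral>x. \<bar>\<xi> x - u x\<bar> \<partial>M) \<le> ext u"
    unfolding ext_def using up \<xi> by (intro cSUP_upper bdd_aboveI2) auto
  ultimately show ?thesis by linarith
qed

private lemma ext_unique:
  assumes u: "integrable M u"
    and y: "\<And>\<xi>. \<xi> \<in> test_functions \<Omega> \<Longrightarrow> \<bar>T \<xi> - y\<bar> \<le> C * (\<integral>x. \<bar>\<xi> x - u x\<bar> \<partial>M)"
  shows "ext u = y"
proof -
  have "\<bar>ext u - y\<bar> \<le> 0 + e" if "e > 0" for e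
  proof -
    have "e / (2 * (C + 1)) > 0" using that C by simp
    from test_functions_dense[OF M \<Omega> u this] obtain \<xi> where
      x: "\<xi> \<in> test_functions \<Omega>" "(\<integral>x. \<bar>\<xi> x - u x\<bar> \<partial>M) < e / (2 * (C + 1))" by blast
    have "\<bar>ext u - y\<bar> \<le> 2 * (C * (\<integral>x. \<bar>\<xi> x - u x\<bar> \<partial>M))"
      using ext_approx[OF u x(1)] y[OF x(1)] by linarith
    also have "\<dots> \<le> 2 * (C * (e / (2 * (C + 1))))"
      using x(2) C by (intro mult_left_mono) auto
    also have "\<dots> \<le> e" using that C by (simp add: field_simps)
    finally show ?thesis by simp
  qed
  then have "\<bar>ext u - y\<bar> \<le> 0" by (rule field_le_epsilon)
  then show ?thesis by simp
qed

private lemma ext_test: "\<zeta> \<in> test_functions \<Omega> \<Longrightarrow> ext \<zeta> = T \<zeta>"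
  using ext_approx[of \<zeta> \<zeta>] test_int by simp

private lemma ext_bound: "integrable M u \<Longrightarrow> \<bar>ext u\<bar> \<le> C * (\<integral>x. \<bar>u x\<bar> \<partial>M)"
  using ext_approx[OF _ test_zero, of u] T_scale[OF test_zero, of 0] by simp

private lemma ext_add:
  assumes u: "integrable M u" and w: "integrable M w"
  shows "ext (\<lambda>x. u x + w x) = ext u + ext w"
proof -
  have "\<bar>ext (\<lambda>x. u x + w x) - (ext u + ext w)\<bar> \<le> 0 + e" if "e > 0" for e
  proof -
    have "e / (4 * (C + 1)) > 0" using that C by simp
    note d = test_functions_dense[OF M \<Omega> _ this]
    obtain \<xi> where x: "\<xi> \<in> test_functions \<Omega>" "(\<integral>x. \<bar>\<xi> x - u x\<bar> \<partial>M) < e / (4 * (C + 1))"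
      using d[OF u] by blast
    obtain \<zeta> where z: "\<zeta> \<in> test_functions \<Omega>" "(\<integral>x. \<bar>\<zeta> x - w x\<bar> \<partial>M) < e / (4 * (C + 1))"
      using d[OF w] by blast
    have "(\<integral>x. \<bar>(\<xi> x + \<zeta> x) - (u x + w x)\<bar> \<partial>M) \<le> (\<integral>x. \<bar>\<xi> x - u x\<bar> + \<bar>\<zeta> x - w x\<bar> \<partial>M)"
      using u w test_int[OF x(1)] test_int[OF z(1)] by (intro integral_mono) auto
    also have "\<dots> = (\<integral>x. \<bar>\<xi> x - u x\<bar> \<partial>M) + (\<integral>x. \<bar>\<zeta> x - w x\<bar> \<partial>M)"
      using u w test_int[OF x(1)] test_int[OF z(1)] by simp
    finally have *: "C * (\<integral>x. \<bar>(\<xi> x + \<zeta> x) - (u x + w x)\<bar> \<partial>M)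
       \<le> C * ((\<integral>x. \<bar>\<xi> x - u x\<bar> \<partial>M) + (\<integral>x. \<bar>\<zeta> x - w x\<bar> \<partial>M))"
      using C by (rule mult_left_mono)
    have "\<bar>ext (\<lambda>x. u x + w x) - (ext u + ext w)\<bar>
        \<le> 2 * (C * ((\<integral>x. \<bar>\<xi> x - u x\<bar> \<partial>M) + (\<integral>x. \<bar>\<zeta> x - w x\<bar> \<partial>M)))"
      using ext_approx[OF u x(1)] ext_approx[OF w z(1)] *
        ext_approx[OF Bochner_Integration.integrable_add[OF u w] test_add[OF x(1) z(1)]] T_add[OF x(1) z(1)]
      by (simp add: distrib_left)
    also have "\<dots> \<le> 2 * (C * (e / (4 * (C + 1)) + e / (4 * (C + 1))))"
      using x(2) z(2) C by (intro mult_left_mono add_mono) auto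
    also have "\<dots> = C * (e / (C + 1))" using C by (simp add: field_simps add_nonneg_eq_0_iff)
    also have "\<dots> \<le> e" using that C by (simp add: field_simps)
    finally show ?thesis by simp
  qed
  then have "\<bar>ext (\<lambda>x. u x + w x) - (ext u + ext w)\<bar> \<le> 0" by (rule field_le_epsilon)
  then show ?thesis by simp
qed

private lemma ext_scale:
  assumes u: "integrable M u"
  shows "ext (\<lambda>x. c * u x) = c * ext u"
proof (cases "c = 0")
  case True
  then show ?thesis using ext_bound[of "\<lambda>x. 0"] by simp
next
  case False
  show ?thesis
  proof (rule ext_unique)
    fix \<xi> assume x: "\<xi> \<in> test_functions \<Omega>"
    have "\<bar>T (\<lambda>x. (1 / c) * \<xi> x) - ext u\<bar> \<le> C * (\<integral>x. \<bar>(1 / c) * \<xi> x - u x\<bar> \<partial>M)"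
      by (rule ext_approx[OF u test_cmult[OF x]])
    then have "\<bar>c\<bar> * \<bar>(1 / c) * T \<xi> - ext u\<bar> \<le> \<bar>c\<bar> * (C * (\<integral>x. \<bar>(1 / c) * \<xi> x - u x\<bar> \<partial>M))"
      unfolding T_scale[OF x] by (rule mult_left_mono) simp
    moreover have "\<bar>c\<bar> * \<bar>(1 / c) * a - b\<bar> = \<bar>a - c * b\<bar>" for a b
      using False by (simp add: abs_mult[symmetric] algebra_simps)
    ultimately show "\<bar>T \<xi> - c * ext u\<bar> \<le> C * (\<integral>x. \<bar>\<xi> x - c * u x\<bar> \<partial>M)"
      by (simp add: mult.left_commute[of "\<bar>c\<bar>" C] Bochner_Integration.integral_mult_right_zero[symmetric]
           del: Bochner_Integration.integral_mult_right_zero)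
  qed (use u in auto)
qed

private lemma indicator_int:
  "A \<in> sets borel \<Longrightarrow> integrable M (indicator A :: 'a \<Rightarrow> real)"
  using finite_measure.emeasure_finite[OF M(1)] M(2)
  by (intro integrable_real_indicator) (auto simp: less_top[symmetric])

private lemma space_UNIV: "space M = UNIV"
  using sets_eq_imp_space_eq[OF M(2)] by simp

private lemma ext_indicator_sums:
  fixes A :: "nat \<Rightarrow> 'a set"
  assumes A: "range A \<subseteq> sets borel" "disjoint_family A"
  shows "(\<lambda>n. ext (indicator (A n))) sums ext (indicator (\<Union>n. A n))"
proof -
  interpret finite_measure M by (rule M(1))
  have m [measurable]: "A n \<in> sets borel" for n using A by auto
  note [measurable_cong] = M(2)
  let ?s = "\<lambda>n x. \<Sum>i<n. indicator (A i) x :: real"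
  have ints: "integrable M (?s n)" for n
    by (intro Bochner_Integration.integrable_sum indicator_int m)
  have fin: "ext (?s n) = (\<Sum>i<n. ext (indicator (A i)))" for n
  proof (induction n)
    case 0
    then show ?case using ext_bound[of "\<lambda>x. 0"] by simp
  next
    case (Suc n)
    then show ?case using ext_add[OF ints[of n] indicator_int[OF m[of n]]] by simp
  qed
  have iU: "integrable M (indicator (\<Union>n. A n) :: 'a \<Rightarrow> real)" by (intro indicator_int) auto
  have lim: "(\<lambda>n. \<integral>x. \<bar>indicator (\<Union>n. A n) x + (-1) * ?s n x\<bar> \<partial>M) \<longlonglongrightarrow> (\<integral>x. 0 \<partial>M)"
  proof (rule integral_dominated_convergence[where w = "\<lambda>_. 1"])
    have s: "?s n x = indicator (\<Union>i<n. A i) x" for n x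
      using A(2) by (intro indicator_UN_disjoint[symmetric]) (auto simp: disjoint_family_on_def)
    show "AE x in M. (\<lambda>n. \<bar>indicator (\<Union>n. A n) x + (-1) * ?s n x\<bar>) \<longlonglongrightarrow> 0"
    proof (rule AE_I2)
      fix x
      show "(\<lambda>n. \<bar>indicator (\<Union>n. A n) x + (-1) * ?s n x\<bar>) \<longlonglongrightarrow> 0"
      proof (cases "x \<in> (\<Union>n. A n)")
        case True
        then obtain k where k: "x \<in> A k" by auto
        have "eventually (\<lambda>n. \<bar>indicator (\<Union>n. A n) x + (-1) * ?s n x\<bar> = 0) sequentially"
          unfolding s using k by (intro eventually_sequentiallyI[of "Suc k"]) (auto simp: indicator_def)
        then show ?thesis by (rule tendsto_eventually)
      next
        case False
        then show ?thesis unfolding s by (auto simp: indicator_def)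
      qed
    qed
    show "AE x in M. norm \<bar>indicator (\<Union>n. A n) x + (-1) * ?s n x\<bar> \<le> 1" for n
      unfolding s by (intro AE_I2) (auto simp: indicator_def)
  qed auto
  have "(\<lambda>n. ext (indicator (\<Union>n. A n)) - ext (?s n)) \<longlonglongrightarrow> 0"
  proof (rule Lim_null_comparison)
    show "(\<lambda>n. C * (\<integral>x. \<bar>indicator (\<Union>n. A n) x + (-1) * ?s n x\<bar> \<partial>M)) \<longlonglongrightarrow> 0"
      using tendsto_mult_left[OF lim, of C] by simp
    have "norm (ext (indicator (\<Union>n. A n)) - ext (?s n))
        \<le> C * (\<integral>x. \<bar>indicator (\<Union>n. A n) x + (-1) * ?s n x\<bar> \<partial>M)" for n
    proof -
      have "ext (\<lambda>x. indicator (\<Union>n. A n) x + (-1) * ?s n x) = ext (indicator (\<Union>n. A n)) + (-1) * ext (?s n)"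
        using ext_add[OF iU, of "\<lambda>x. (-1) * ?s n x"] ext_scale[OF ints, of "-1" n] ints[of n]
        by (simp del: mult_minus1)
      then show ?thesis
        using ext_bound[of "\<lambda>x. indicator (\<Union>n. A n) x + (-1) * ?s n x"] ints[of n] iU by simp
    qed
    then show "\<forall>\<^sub>F n in sequentially. norm (ext (indicator (\<Union>n. A n)) - ext (?s n))
        \<le> C * (\<integral>x. \<bar>indicator (\<Union>n. A n) x + (-1) * ?s n x\<bar> \<partial>M)" by simp
  qed
  from tendsto_diff[OF tendsto_const[of "ext (indicator (\<Union>n. A n))"] this]
  show ?thesis by (simp add: sums_def fin)
qed

private lemma ext_bound_indicator:
  "A \<in> sets borel \<Longrightarrow> \<bar>ext (indicator A)\<bar> \<le> C * measure M A"
  using ext_bound[OF indicator_int, of A] M(2) by (simp add: space_UNIV)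

text \<open>The set function \<open>A \<mapsto> ext (indicator A) + C * measure M A\<close> is nonnegative by the bound on \<open>T\<close>, so it is a measure with a
Radon-Nikodym density \<open>h\<close> with respect to \<open>M\<close>, and \<open>h - C\<close> is the density sought.\<close>

lemma functional_density:
  obtains g where "g \<in> borel_measurable borel" "\<And>x. \<bar>g x\<bar> \<le> C"
    "\<And>\<zeta>. \<zeta> \<in> test_functions \<Omega> \<Longrightarrow> T \<zeta> = (\<integral>x. \<zeta> x * g x \<partial>M)"
proof -
  interpret finite_measure M by (rule M(1))
  note [measurable_cong] = M(2)
  define \<nu> where "\<nu> A = ext (indicator A) + C * measure M A" for A
  have nu0: "0 \<le> \<nu> A" and nu2: "\<nu> A \<le> 2 * C * measure M A" if "A \<in> sets borel" for A
    using ext_bound_indicator[OF that] by (auto simp: \<nu>_def)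
  define N where "N = measure_of UNIV (sets borel) (\<lambda>A. ennreal (\<nu> A))"
  have sN: "sets N = sets borel"
    unfolding N_def using sets.sigma_sets_eq[of "borel :: 'a measure"] by (simp add: sets_measure_of)
  have eN: "emeasure N A = ennreal (\<nu> A)" if "A \<in> sets borel" for A
    unfolding N_def
  proof (rule emeasure_measure_of_sigma)
    show "sigma_algebra UNIV (sets borel :: 'a set set)" by (metis sets.sigma_algebra_axioms space_borel)
    show "positive (sets borel) (\<lambda>A. ennreal (\<nu> A))"
      using nu2[of "{}"] by (auto simp: positive_def intro!: ennreal_neg)
    show "countably_additive (sets borel) (\<lambda>A. ennreal (\<nu> A))"
    proof (rule countably_additiveI)
      fix A :: "nat \<Rightarrow> 'a set"
      assume A: "range A \<subseteq> sets borel" "disjoint_family A"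
      have "(\<lambda>n. C * measure M (A n)) sums (C * measure M (\<Union>n. A n))"
        using A M(2) by (intro sums_mult finite_measure_UNION) auto
      from sums_add[OF ext_indicator_sums[OF A] this] have "(\<lambda>n. \<nu> (A n)) sums \<nu> (\<Union>n. A n)"
        by (simp add: \<nu>_def)
      then show "(\<Sum>n. ennreal (\<nu> (A n))) = ennreal (\<nu> (\<Union>n. A n))"
        using A nu0 by (intro suminf_ennreal_eq) auto
    qed
  qed (use that in auto)
  have ac: "absolutely_continuous M N"
    unfolding absolutely_continuous_def
  proof
    fix A assume "A \<in> null_sets M"
    then have "A \<in> sets borel" "measure M A = 0" using M(2) by (auto simp: null_sets_def measure_def)
    then show "A \<in> null_sets N" using nu2[of A] nu0[of A] sN by (auto simp: null_sets_def eN)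
  qed
  obtain f where f: "f \<in> borel_measurable M" "density M f = N"
    using Radon_Nikodym[OF ac] sN M(2) by auto
  note [measurable] = f(1)
  have fin: "(\<integral>\<^sup>+x. f x \<partial>M) < \<infinity>"
  proof -
    have "ennreal (\<nu> UNIV) = (\<integral>\<^sup>+x. f x \<partial>M)"
      using emeasure_density[OF f(1), of UNIV] f(2) M(2) by (simp add: eN)
    then show ?thesis by (metis ennreal_less_top infinity_ennreal_def)
  qed
  define h where "h x = enn2real (f x)" for x
  have h [measurable]: "h \<in> borel_measurable M" unfolding h_def by measurable
  have fh: "AE x in M. f x = ennreal (h x)"
    using nn_integral_PInf_AE[OF f(1)] fin by (auto simp: h_def less_top[symmetric])
  have h0: "h x \<ge> 0" for x by (simp add: h_def)
  have hint: "integrable M h"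
  proof (rule integrableI_nonneg)
    have "(\<integral>\<^sup>+x. ennreal (h x) \<partial>M) = (\<integral>\<^sup>+x. f x \<partial>M)"
      using fh by (intro nn_integral_cong_AE) auto
    then show "(\<integral>\<^sup>+x. ennreal (h x) \<partial>M) < \<infinity>" using fin by simp
  qed (use h0 in auto)
  have hA: "(\<integral>x. indicator A x * h x \<partial>M) = \<nu> A" if [measurable]: "A \<in> sets borel" for A
  proof -
    have "ennreal (\<integral>x. indicator A x * h x \<partial>M) = (\<integral>\<^sup>+x. ennreal (indicator A x * h x) \<partial>M)"
      using hint h0 integrable_real_mult_indicator[of A M h] M(2)
      by (intro nn_integral_eq_integral[symmetric]) (auto simp: mult.commute)
    also have "\<dots> = (\<integral>\<^sup>+x. f x * indicator A x \<partial>M)"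
      using fh by (intro nn_integral_cong_AE) (auto simp: indicator_def)
    also have "\<dots> = ennreal (\<nu> A)"
      using emeasure_density[OF f(1), of A] that M(2) by (simp add: f(2) eN)
    finally show ?thesis
      using nu0[OF that] h0 by (subst (asm) ennreal_inj) (auto intro!: integral_nonneg_AE)
  qed
  define g where "g x = min (h x) (2 * C) - C" for x
  have gm [measurable]: "g \<in> borel_measurable borel"
    using h measurable_cong_sets[OF M(2) refl] unfolding g_def by auto
  have gb: "\<bar>g x\<bar> \<le> C" for x using h0[of x] C by (auto simp: g_def min_def)
  (* The density h is at most 2C only almost everywhere; truncating it makes the bound hold everywhere. *)
  have AEg: "AE x in M. g x = h x - C"
  proof -
    let ?A = "{x. h x > 2 * C}"
    have hb [measurable]: "h \<in> borel_measurable borel"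
      using h by (simp add: measurable_cong_sets[OF M(2) refl])
    have "{x\<in>space borel. h x > 2 * C} \<in> sets borel" by measurable
    then have [measurable]: "?A \<in> sets borel" by simp
    have i: "integrable M (\<lambda>x. indicator ?A x * (h x - 2 * C))"
      using integrable_real_mult_indicator[of ?A M "\<lambda>x. h x - 2 * C"] hint M(2) by (simp add: mult.commute)
    have "(\<integral>x. indicator ?A x * (h x - 2 * C) \<partial>M) = (\<integral>x. indicator ?A x * h x - 2 * C * indicator ?A x \<partial>M)"
      by (simp add: algebra_simps)
    also have "\<dots> = (\<integral>x. indicator ?A x * h x \<partial>M) - 2 * C * measure M ?A"
      using integrable_real_mult_indicator[of ?A M h] hint M(2) indicator_int[of ?A]
      by (subst Bochner_Integration.integral_diff) (auto simp: mult.commute space_UNIV)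
    also have "\<dots> \<le> 0" using hA[of ?A] nu2[of ?A] by simp
    finally have "(\<integral>x. indicator ?A x * (h x - 2 * C) \<partial>M) = 0"
      by (intro antisym integral_nonneg_AE) (auto simp: indicator_def)
    then have "AE x in M. indicator ?A x * (h x - 2 * C) = 0"
      using integral_nonneg_eq_0_iff_AE[OF i] by (auto simp: indicator_def)
    then show ?thesis by eventually_elim (auto simp: g_def indicator_def split: if_splits)
  qed
  have gA: "(\<integral>x. indicator A x * g x \<partial>M) = ext (indicator A)" if [measurable]: "A \<in> sets borel" for A
  proof -
    have "(\<integral>x. indicator A x * g x \<partial>M) = (\<integral>x. indicator A x * h x - C * indicator A x \<partial>M)"
    proof (rule integral_cong_AE)
      show "AE x in M. indicator A x * g x = indicator A x * h x - C * indicator A x"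
        using AEg by eventually_elim (simp add: right_diff_distrib)
    qed auto
    also have "\<dots> = \<nu> A - C * measure M A"
      using integrable_real_mult_indicator[of A M h] hint M(2) indicator_int[of A] hA[OF that]
      by (simp add: mult.commute space_UNIV)
    finally show ?thesis by (simp add: \<nu>_def)
  qed
  have gi: "integrable M (\<lambda>x. u x * g x)" if "integrable M u" for u :: "'a \<Rightarrow> real"
  proof (rule Bochner_Integration.integrable_bound[of M "\<lambda>x. C * u x"])
    show "AE x in M. norm (u x * g x) \<le> norm (C * u x)"
      using gb C by (intro AE_I2) (auto simp: abs_mult mult.commute[of C] intro!: mult_left_mono)
  qed (use that in auto)
  have "ext u = (\<integral>x. u x * g x \<partial>M)" if "integrable M u" for u
    using that
  proof (induction u rule: integrable_induct)
    case (base A c)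
    then have "A \<in> sets borel" using M(2) by simp
    have "ext (\<lambda>x. c * indicator A x) = c * (\<integral>x. indicator A x * g x \<partial>M)"
      using ext_scale[OF indicator_int] gA \<open>A \<in> sets borel\<close> by simp
    also have "\<dots> = (\<integral>x. c * indicator A x * g x \<partial>M)" by (simp add: mult.assoc)
    finally show ?case by (simp add: mult.commute)
  next
    case (add u w)
    then show ?case using gi[OF add.hyps(1)] gi[OF add.hyps(2)] by (simp add: ext_add distrib_right)
  next
    case (lim u s)
    have d: "(\<lambda>n. \<integral>x. \<bar>s n x - u x\<bar> \<partial>M) \<longlonglongrightarrow> (\<integral>x. 0 \<partial>M)"
    proof (rule integral_dominated_convergence[where w = "\<lambda>x. 3 * norm (u x)"])
      show "AE x in M. (\<lambda>n. \<bar>s n x - u x\<bar>) \<longlonglongrightarrow> 0"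
        using lim.hyps(2) by (intro AE_I2) (simp add: tendsto_rabs_zero_iff LIM_zero_iff)
      show "AE x in M. norm \<bar>s n x - u x\<bar> \<le> 3 * norm (u x)" for n
      proof (rule AE_I2)
        fix x assume "x \<in> space M"
        from lim.hyps(3)[OF this, of n] show "norm \<bar>s n x - u x\<bar> \<le> 3 * norm (u x)" by auto
      qed
    qed (use lim.hyps in auto)
    have "(\<lambda>n. ext (s n) - ext u) \<longlonglongrightarrow> 0"
    proof (rule Lim_null_comparison)
      show "(\<lambda>n. C * (\<integral>x. \<bar>s n x - u x\<bar> \<partial>M)) \<longlonglongrightarrow> 0"
        using tendsto_mult_left[OF d, of C] by simp
      have "norm (ext (s n) - ext u) \<le> C * (\<integral>x. \<bar>s n x - u x\<bar> \<partial>M)" for n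
        using ext_bound[of "\<lambda>x. s n x + (-1) * u x"] ext_add[of "s n" "\<lambda>x. (-1) * u x"]
          ext_scale[of u "-1"] lim.hyps by simp
      then show "\<forall>\<^sub>F n in sequentially. norm (ext (s n) - ext u) \<le> C * (\<integral>x. \<bar>s n x - u x\<bar> \<partial>M)" by simp
    qed
    then have "(\<lambda>n. ext (s n)) \<longlonglongrightarrow> ext u" by (simp add: LIM_zero_iff)
    moreover have "(\<lambda>n. ext (s n)) \<longlonglongrightarrow> (\<integral>x. u x * g x \<partial>M)"
      unfolding lim.IH
    proof (rule integral_dominated_convergence[where w = "\<lambda>x. 2 * C * norm (u x)"])
      show "AE x in M. (\<lambda>n. s n x * g x) \<longlonglongrightarrow> u x * g x"
        using lim.hyps(2) by (intro AE_I2 tendsto_mult_right) simp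
      show "AE x in M. norm (s n x * g x) \<le> 2 * C * norm (u x)" for n
      proof (rule AE_I2)
        fix x assume "x \<in> space M"
        have "norm (s n x) * \<bar>g x\<bar> \<le> 2 * norm (u x) * C"
          using lim.hyps(3)[OF \<open>x \<in> space M\<close>, of n] gb[of x] C by (intro mult_mono) auto
        then show "norm (s n x * g x) \<le> 2 * C * norm (u x)" by (simp add: abs_mult algebra_simps)
      qed
    qed (use lim.hyps in auto)
    ultimately show ?case by (rule LIMSEQ_unique)
  qed
  then have "T \<zeta> = (\<integral>x. \<zeta> x * g x \<partial>M)" if "\<zeta> \<in> test_functions \<Omega>" for \<zeta>
    using ext_test[OF that] test_int[OF that] by simp
  with gm gb show ?thesis by (rule that)
qed

end

context
  fixes M :: "'a::euclidean_space measure" and \<Omega> :: "'a set"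
    and T :: "('a \<Rightarrow> real) \<Rightarrow> real" and g :: "'a \<Rightarrow> real" and C :: real
  assumes M: "finite_measure M" "sets M = sets borel" and \<Omega>: "open \<Omega>"
    and g: "g \<in> borel_measurable borel" "\<And>x. \<bar>g x\<bar> \<le> C"
    and T: "\<And>\<zeta>. \<zeta> \<in> test_functions \<Omega> \<Longrightarrow> T \<zeta> = (\<integral>x. \<zeta> x * g x \<partial>M)"
begin

text \<open>The signed measure \<open>g M\<close> is the difference of the finite measures \<open>(g + C) M\<close> and \<open>C M\<close>.\<close>

lemma dist_measure_density:
  "dist_measure \<Omega> T E = (if E \<in> sets borel \<and> E \<subseteq> \<Omega> then \<integral>x. indicator E x * g x \<partial>M else 0)"
proof -
  interpret finite_measure M by (rule M(1))
  note [measurable_cong] = M(2)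
  note [measurable] = g(1)
  have [measurable]: "\<Omega> \<in> sets borel" using \<Omega> by simp
  have C: "C \<ge> 0" using g(2)[of undefined] by linarith
  have sp: "space M = UNIV" using sets_eq_imp_space_eq[OF M(2)] by simp
  define D where "D k = density M (\<lambda>x. ennreal (k x))" for k :: "'a \<Rightarrow> real"
  define R where "R k = restrict_space (D k) \<Omega>" for k
  have bint: "integrable M (\<lambda>x. u x * k x)" if "integrable M u" "k \<in> borel_measurable borel" "\<And>x. \<bar>k x\<bar> \<le> 2 * C" for u k
  proof (rule Bochner_Integration.integrable_bound[of M "\<lambda>x. 2 * C * u x"])
    show "AE x in M. norm (u x * k x) \<le> norm (2 * C * u x)"
      using that(3) C by (intro AE_I2) (auto simp: abs_mult mult.commute[of _ "\<bar>u _\<bar>"] intro!: mult_left_mono)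
    have [measurable]: "u \<in> borel_measurable M" "k \<in> borel_measurable M"
      using that(1,2) by (auto simp: measurable_cong_sets[OF M(2) refl])
    show "(\<lambda>x. u x * k x) \<in> borel_measurable M" by measurable
  qed (use that(1) in auto)
  have 1: "finite_measure (R k)" "sets (R k) = sets (restrict_space borel \<Omega>)"
    "measure (R k) E = (if E \<in> sets borel \<and> E \<subseteq> \<Omega> then \<integral>x. indicator E x * k x \<partial>M else 0)"
    "\<And>\<zeta>. \<zeta> \<in> test_functions \<Omega> \<Longrightarrow> (\<integral>x. \<zeta> x \<partial>R k) = (\<integral>x. \<zeta> x * k x \<partial>M)"
    if k[measurable]: "k \<in> borel_measurable borel" and k0: "\<And>x. 0 \<le> k x" and kC: "\<And>x. k x \<le> 2 * C" for k E
  proof -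
    have kb: "\<And>x. \<bar>k x\<bar> \<le> 2 * C" using k0 kC by (simp add: abs_of_nonneg)
    have km: "k \<in> borel_measurable M" by measurable
    have ik: "integrable M k"
      by (rule integrable_const_bound[where B = "2 * C"]) (use kb in auto)
    have sD: "sets (D k) = sets borel" "space (D k) = UNIV" by (auto simp: D_def M(2) sp)
    have eD: "emeasure (D k) A = ennreal (\<integral>x. indicator A x * k x \<partial>M)" if "A \<in> sets borel" for A
    proof -
      have "emeasure (D k) A = (\<integral>\<^sup>+x. ennreal (indicator A x * k x) \<partial>M)"
        unfolding D_def using that M(2) by (subst emeasure_density) (auto intro!: nn_integral_cong simp: indicator_def)
      also have "\<dots> = ennreal (\<integral>x. indicator A x * k x \<partial>M)"
        using that k0 integrable_real_mult_indicator[of A M k] ik M(2)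
        by (intro nn_integral_eq_integral) (auto simp: mult.commute)
      finally show ?thesis .
    qed
    have "finite_measure (D k)"
      using eD[of UNIV] sD by (intro finite_measureI) auto
    then show "finite_measure (R k)" unfolding R_def by (rule finite_measure_restrict_space) (simp add: sD)
    show s: "sets (R k) = sets (restrict_space borel \<Omega>)"
      unfolding R_def by (rule sets_restrict_space_cong) (simp add: sD)
    show "measure (R k) E = (if E \<in> sets borel \<and> E \<subseteq> \<Omega> then \<integral>x. indicator E x * k x \<partial>M else 0)"
    proof (cases "E \<in> sets borel \<and> E \<subseteq> \<Omega>")
      case True
      then have "emeasure (R k) E = emeasure (D k) E"
        unfolding R_def by (intro emeasure_restrict_space) (auto simp: sD)
      then show ?thesis using True k0 by (simp add: measure_def eD integral_nonneg_AE)
    next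
      case False
      then have "E \<notin> sets (R k)" unfolding s by (auto simp: sets_restrict_space_iff)
      then show ?thesis using False by (auto simp: measure_notin_sets)
    qed
    show "(\<integral>x. \<zeta> x \<partial>R k) = (\<integral>x. \<zeta> x * k x \<partial>M)" if z: "\<zeta> \<in> test_functions \<Omega>" for \<zeta>
    proof -
      have "(\<integral>x. \<zeta> x \<partial>R k) = (\<integral>x. indicator \<Omega> x *\<^sub>R \<zeta> x \<partial>D k)"
        unfolding R_def by (intro integral_restrict_space) (simp add: sD)
      also have "\<dots> = (\<integral>x. \<zeta> x \<partial>D k)"
        using test_zero_outside[OF z] by (intro Bochner_Integration.integral_cong) (auto simp: indicator_def)
      also have "\<dots> = (\<integral>x. k x *\<^sub>R \<zeta> x \<partial>M)"
        unfolding D_def using test_measurable[OF z] k0 km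
        by (intro integral_density) (auto simp: measurable_cong_sets[OF M(2) refl])
      finally show ?thesis by (simp add: mult.commute)
    qed
  qed
  define \<mu> where "\<mu> E = (if E \<in> sets borel \<and> E \<subseteq> \<Omega> then \<integral>x. indicator E x * g x \<partial>M else 0)" for E
  define k where "k x = g x + C" for x
  have k: "k \<in> borel_measurable borel" "\<And>x. 0 \<le> k x" "\<And>x. k x \<le> 2 * C"
  proof -
    show "k \<in> borel_measurable borel" unfolding k_def by simp
    fix x show "0 \<le> k x" "k x \<le> 2 * C" using g(2)[of x] by (auto simp: k_def abs_le_iff)
  qed
  have c: "(\<lambda>_::'a. C) \<in> borel_measurable borel" "\<And>x::'a. 0 \<le> (\<lambda>_. C) x" "\<And>x::'a. (\<lambda>_. C) x \<le> 2 * C"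
    using C by auto
  have "dist_is_measure \<Omega> T \<mu>"
    unfolding dist_is_measure_def
  proof (rule exI[of _ "R k"], rule exI[of _ "R (\<lambda>_. C)"], intro conjI allI ballI)
    have sub: "(\<integral>x. u x * k x \<partial>M) - (\<integral>x. u x * C \<partial>M) = (\<integral>x. u x * g x \<partial>M)" if "integrable M u" for u
    proof -
      have "integrable M (\<lambda>x. u x * g x)" proof (intro bint that g(1))
        show "\<bar>g x\<bar> \<le> 2 * C" for x using g(2)[of x] C by linarith
      qed
      then show ?thesis using that by (simp add: k_def distrib_left)
    qed
    show "\<mu> E = measure (R k) E - measure (R (\<lambda>_. C)) E" for E
    proof (cases "E \<in> sets borel \<and> E \<subseteq> \<Omega>")
      case True
      have "integrable M (indicator E :: 'a \<Rightarrow> real)"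
        using True M(2) emeasure_finite by (intro integrable_real_indicator) (auto simp: less_top[symmetric])
      from sub[OF this] show ?thesis using True by (simp add: 1(3)[OF k] 1(3)[OF c] \<mu>_def)
    next
      case False
      then show ?thesis unfolding \<mu>_def 1(3)[OF k] 1(3)[OF c] by (simp only: if_not_P) simp
    qed
    show "T \<zeta> = (\<integral>x. \<zeta> x \<partial>R k) - (\<integral>x. \<zeta> x \<partial>R (\<lambda>_. C))" if "\<zeta> \<in> test_functions \<Omega>" for \<zeta>
      using T[OF that] sub[OF test_integrable[OF that M]] by (simp add: 1(4)[OF k that] 1(4)[OF c that])
  qed (use 1[OF k] 1[OF c] in auto)
  from dist_measure_eqI[OF \<Omega> this] show ?thesis by (simp add: \<mu>_def)
qed

text \<open>The upper bound holds for every partition; for the lower bound, split \<open>E\<close> by the sign of \<open>g\<close>.\<close>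

lemma total_variation_density:
  assumes E: "E \<in> sets borel" "E \<subseteq> \<Omega>"
  shows "total_variation (dist_measure \<Omega> T) E = (\<integral>\<^sup>+x. ennreal (indicator E x * \<bar>g x\<bar>) \<partial>M)"
proof (rule antisym)
  interpret finite_measure M by (rule M(1))
  note [measurable_cong] = M(2)
  note [measurable] = g(1) E(1)
  have sp: "space M = UNIV" using sets_eq_imp_space_eq[OF M(2)] by simp
  let ?\<mu> = "dist_measure \<Omega> T"
  have ig: "integrable M g" by (rule integrable_const_bound[where B = C]) (use g in auto)
  have iA: "integrable M (\<lambda>x. indicator A x * g x)" if "A \<in> sets borel" for A
    using integrable_real_mult_indicator[of A M g] ig that M(2) by (simp add: mult.commute)
  show "total_variation ?\<mu> E \<le> (\<integral>\<^sup>+x. ennreal (indicator E x * \<bar>g x\<bar>) \<partial>M)"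
    unfolding total_variation_def
  proof (rule SUP_least, clarify)
    fix A :: "nat \<Rightarrow> 'a set"
    assume A: "range A \<subseteq> sets borel" "disjoint_family A" "E = (\<Union>n. A n)"
    have [measurable]: "A n \<in> sets borel" for n using A by auto
    have "ennreal \<bar>?\<mu> (A n)\<bar> \<le> (\<integral>\<^sup>+x. ennreal (indicator (A n) x * \<bar>g x\<bar>) \<partial>M)" for n
    proof -
      have "\<bar>?\<mu> (A n)\<bar> \<le> (\<integral>x. \<bar>indicator (A n) x * g x\<bar> \<partial>M)"
        unfolding dist_measure_density using integral_abs_bound by (auto intro: integral_nonneg_AE)
      then have "ennreal \<bar>?\<mu> (A n)\<bar> \<le> ennreal (\<integral>x. \<bar>indicator (A n) x * g x\<bar> \<partial>M)" by (rule ennreal_leI)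
      also have "\<dots> = (\<integral>\<^sup>+x. ennreal \<bar>indicator (A n) x * g x\<bar> \<partial>M)"
        using iA[of "A n"] by (intro nn_integral_eq_integral[symmetric]) auto
      finally show ?thesis by (simp add: abs_mult)
    qed
    then have "(\<Sum>n. ennreal \<bar>?\<mu> (A n)\<bar>) \<le> (\<Sum>n. \<integral>\<^sup>+x. ennreal (indicator (A n) x * \<bar>g x\<bar>) \<partial>M)"
      by (intro suminf_le) auto
    also have "\<dots> = (\<integral>\<^sup>+x. (\<Sum>n. ennreal (indicator (A n) x * \<bar>g x\<bar>)) \<partial>M)"
      by (intro nn_integral_suminf[symmetric]) auto
    also have "\<dots> = (\<integral>\<^sup>+x. ennreal (indicator (\<Union>n. A n) x * \<bar>g x\<bar>) \<partial>M)"
    proof (intro nn_integral_cong)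
      fix x
      have "(\<Sum>n. ennreal (indicator (A n) x * \<bar>g x\<bar>)) = (\<Sum>n. indicator (A n) x * ennreal \<bar>g x\<bar>)"
        by (intro suminf_cong) (auto simp: indicator_def)
      also have "\<dots> = indicator (\<Union>n. A n) x * ennreal \<bar>g x\<bar>"
        using A(2) by (simp add: suminf_indicator)
      finally show "(\<Sum>n. ennreal (indicator (A n) x * \<bar>g x\<bar>)) = ennreal (indicator (\<Union>n. A n) x * \<bar>g x\<bar>)"
        by (auto simp: indicator_def)
    qed
    finally show "(\<Sum>n. ennreal \<bar>?\<mu> (A n)\<bar>) \<le> (\<integral>\<^sup>+x. ennreal (indicator (\<Union>n. A n) x * \<bar>g x\<bar>) \<partial>M)" .
  qed
  show "(\<integral>\<^sup>+x. ennreal (indicator E x * \<bar>g x\<bar>) \<partial>M) \<le> total_variation ?\<mu> E"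
  proof -
    define P N where "P = {x\<in>E. g x \<ge> 0}" and "N = {x\<in>E. g x < 0}"
    have [measurable]: "P \<in> sets borel" "N \<in> sets borel" unfolding P_def N_def by measurable
    have sub: "P \<subseteq> \<Omega>" "N \<subseteq> \<Omega>" using E by (auto simp: P_def N_def)
    define A where "A n = (if n = 0 then P else if n = 1 then N else {})" for n :: nat
    have "(\<integral>\<^sup>+x. ennreal (indicator E x * \<bar>g x\<bar>) \<partial>M)
        = (\<integral>\<^sup>+x. ennreal (indicator P x * g x) + ennreal (- (indicator N x * g x)) \<partial>M)"
      by (intro nn_integral_cong) (auto simp: P_def N_def indicator_def)
    also have "\<dots> = (\<integral>\<^sup>+x. ennreal (indicator P x * g x) \<partial>M) + (\<integral>\<^sup>+x. ennreal (- (indicator N x * g x)) \<partial>M)"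
      by (intro nn_integral_add) auto
    also have "(\<integral>\<^sup>+x. ennreal (indicator P x * g x) \<partial>M) = ennreal (\<integral>x. indicator P x * g x \<partial>M)"
      using iA[of P] by (intro nn_integral_eq_integral) (auto simp: P_def indicator_def)
    also have "(\<integral>\<^sup>+x. ennreal (- (indicator N x * g x)) \<partial>M) = ennreal (\<integral>x. - (indicator N x * g x) \<partial>M)"
      using iA[of N] by (intro nn_integral_eq_integral) (auto simp: N_def indicator_def)
    also have "ennreal (\<integral>x. indicator P x * g x \<partial>M) + ennreal (\<integral>x. - (indicator N x * g x) \<partial>M)
       \<le> ennreal \<bar>?\<mu> (A 0)\<bar> + ennreal \<bar>?\<mu> (A 1)\<bar>"
      using sub by (intro add_mono ennreal_leI) (auto simp: A_def dist_measure_density)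
    also have "\<dots> = (\<Sum>n<2. ennreal \<bar>?\<mu> (A n)\<bar>)" by (simp add: numeral_2_eq_2)
    also have "\<dots> \<le> (\<Sum>n. ennreal \<bar>?\<mu> (A n)\<bar>)" by (intro sum_le_suminf) auto
    also have "\<dots> \<le> total_variation ?\<mu> E"
      unfolding total_variation_def
    proof (rule SUP_upper, clarify, intro conjI)
      show "range A \<subseteq> sets borel" by (auto simp: A_def)
      show "disjoint_family A" by (auto simp: A_def disjoint_family_on_def P_def N_def)
      have "(\<Union>n. A n) = P \<union> N" by (auto simp: A_def split: if_splits)
      then show "(\<Union>n. A n) = E" by (auto simp: P_def N_def)
    qed
    finally show ?thesis .
  qed
qed

lemma total_variation_le:
  assumes E: "E \<in> sets borel" "E \<subseteq> \<Omega>"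
  shows "total_variation (dist_measure \<Omega> T) E \<le> ennreal C * emeasure M E"
proof -
  have "(\<integral>\<^sup>+x. ennreal (indicator E x * \<bar>g x\<bar>) \<partial>M) \<le> (\<integral>\<^sup>+x. ennreal C * indicator E x \<partial>M)"
    using g(2) by (intro nn_integral_mono) (auto simp: indicator_def intro: ennreal_leI)
  also have "\<dots> = ennreal C * emeasure M E"
    using E M(2) by (intro nn_integral_cmult_indicator) auto
  finally show ?thesis by (simp add: total_variation_density[OF E])
qed

lemma total_variation_disjoint_Un:
  assumes "A \<in> sets borel" "A \<subseteq> \<Omega>" "B \<in> sets borel" "B \<subseteq> \<Omega>" "A \<inter> B = {}"
  shows "total_variation (dist_measure \<Omega> T) (A \<union> B) =
     total_variation (dist_measure \<Omega> T) A + total_variation (dist_measure \<Omega> T) B"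
proof -
  note [measurable_cong] = M(2)
  note [measurable] = g(1) assms(1,3)
  have "(\<integral>\<^sup>+x. ennreal (indicator (A \<union> B) x * \<bar>g x\<bar>) \<partial>M)
     = (\<integral>\<^sup>+x. ennreal (indicator A x * \<bar>g x\<bar>) + ennreal (indicator B x * \<bar>g x\<bar>) \<partial>M)"
    using assms(5) by (intro nn_integral_cong) (auto simp: indicator_def)
  also have "\<dots> = (\<integral>\<^sup>+x. ennreal (indicator A x * \<bar>g x\<bar>) \<partial>M) + (\<integral>\<^sup>+x. ennreal (indicator B x * \<bar>g x\<bar>) \<partial>M)"
    by (intro nn_integral_add) auto
  finally show ?thesis using assms by (simp add: total_variation_density)
qed

lemma abs_functional_le_total_variation:
  assumes \<zeta>: "\<zeta> \<in> test_functions \<Omega>" "\<And>x. \<bar>\<zeta> x\<bar> \<le> 1" "\<And>x. x \<notin> E \<Longrightarrow> \<zeta> x = 0"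
    and E: "E \<in> sets borel" "E \<subseteq> \<Omega>"
  shows "ennreal \<bar>T \<zeta>\<bar> \<le> total_variation (dist_measure \<Omega> T) E"
proof -
  interpret finite_measure M by (rule M(1))
  note [measurable_cong] = M(2)
  note [measurable] = g(1) E(1) test_measurable[OF \<zeta>(1)]
  have i: "integrable M (\<lambda>x. \<zeta> x * g x)"
  proof (rule integrable_const_bound[where B = C])
    have "\<bar>\<zeta> x\<bar> * \<bar>g x\<bar> \<le> 1 * C" for x using \<zeta>(2) g(2) by (intro mult_mono) auto
    then show "AE x in M. norm (\<zeta> x * g x) \<le> C" by (simp add: abs_mult)
  qed simp
  have "ennreal \<bar>T \<zeta>\<bar> \<le> ennreal (\<integral>x. \<bar>\<zeta> x * g x\<bar> \<partial>M)"
    unfolding T[OF \<zeta>(1)] by (intro ennreal_leI integral_abs_bound)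
  also have "\<dots> = (\<integral>\<^sup>+x. ennreal \<bar>\<zeta> x * g x\<bar> \<partial>M)"
    using i by (intro nn_integral_eq_integral[symmetric]) auto
  also have "\<dots> \<le> (\<integral>\<^sup>+x. ennreal (indicator E x * \<bar>g x\<bar>) \<partial>M)"
  proof (intro nn_integral_mono ennreal_leI)
    fix x
    have "\<bar>\<zeta> x\<bar> \<le> indicator E x" using \<zeta>(2,3) by (auto simp: indicator_def)
    then have "\<bar>\<zeta> x\<bar> * \<bar>g x\<bar> \<le> indicator E x * \<bar>g x\<bar>" by (rule mult_right_mono) simp
    then show "\<bar>\<zeta> x * g x\<bar> \<le> indicator E x * \<bar>g x\<bar>" by (simp add: abs_mult)
  qed
  finally show ?thesis by (simp add: total_variation_density[OF E])
qed

end

section \<open>Increments of functions whose derivative is a measure\<close>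

lemma lborel_integral_translate:
  fixes f :: "'a::euclidean_space \<Rightarrow> real"
  assumes [measurable]: "f \<in> borel_measurable borel"
  shows "(\<integral>x. f (c + x) \<partial>lborel) = (\<integral>x. f x \<partial>lborel)"
proof -
  have "(\<integral>x. f x \<partial>lborel) = (\<integral>x. f x \<partial>distr lborel borel ((+) c))"
    by (simp add: lborel_distr_plus)
  also have "\<dots> = (\<integral>x. f (c + x) \<partial>lborel)" by (rule integral_distr) auto
  finally show ?thesis by simp
qed

lemma integrable_lborel_bounded_support:
  fixes f :: "'a::euclidean_space \<Rightarrow> real"
  assumes "f \<in> borel_measurable borel" "compact K" "\<And>x. x \<notin> K \<Longrightarrow> f x = 0" "\<And>x. \<bar>f x\<bar> \<le> B"
  shows "integrable lborel f"
  by (rule integrableI_bounded_set[where A = K and B = B])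
     (use assms emeasure_compact_finite in \<open>auto simp: compact_imp_closed\<close>)

lemma finite_time_measure:
  fixes h :: real
  assumes h: "h \<ge> 0"
  shows "finite_measure (density lborel (\<lambda>t. ennreal (indicator {0..h} t)))"
proof (rule finite_measureI)
  have "emeasure (density lborel (\<lambda>t. ennreal (indicator {0..h} t))) UNIV = ennreal h"
    using h by (simp add: emeasure_density ennreal_indicator)
  then show "emeasure (density lborel (\<lambda>t. ennreal (indicator {0..h} t))) (space (density lborel (\<lambda>t. ennreal (indicator {0..h} t)))) \<noteq> \<infinity>"
    by simp
qed

text \<open>The measure swept out when \<open>M\<close> is translated along \<open>- v\<close> during the times \<open>[0, h]\<close>. It bounds
the increment \<open>w (x + h v) - w x\<close> of a function whose derivative in direction \<open>v\<close> is bounded by \<open>M\<close>.\<close>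

definition drift :: "'a::euclidean_space measure \<Rightarrow> 'a \<Rightarrow> real \<Rightarrow> 'a measure" where
  "drift M v h = distr (density lborel (\<lambda>t::real. ennreal (indicator {0..h} t)) \<Otimes>\<^sub>M M) borel (\<lambda>p. snd p - fst p *\<^sub>R v)"

context
  fixes M :: "'a::euclidean_space measure" and v :: 'a and h :: real
  assumes M: "finite_measure M" "sets M = sets borel" and h: "h \<ge> 0"
begin

private abbreviation "L \<equiv> (density lborel (\<lambda>t::real. ennreal (indicator {0..h} t)))"

private lemma drift_map: "(\<lambda>p. snd p - fst p *\<^sub>R v) \<in> borel_measurable (L \<Otimes>\<^sub>M M)"
proof -
  have "(\<lambda>p. snd p - fst p *\<^sub>R v) \<in> borel_measurable (borel \<Otimes>\<^sub>M borel)" by measurable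
  moreover have "sets (L \<Otimes>\<^sub>M M) = sets (borel \<Otimes>\<^sub>M borel)"
    using M(2) by (intro sets_pair_measure_cong) auto
  ultimately show ?thesis by (subst measurable_cong_sets[OF _ refl])
qed

lemma finite_drift: "finite_measure (drift M v h)" "sets (drift M v h) = sets borel"
proof -
  interpret L: finite_measure L by (rule finite_time_measure[OF h])
  interpret M: finite_measure M by (rule M)
  interpret pair_sigma_finite L M ..
  have "emeasure (L \<Otimes>\<^sub>M M) (space L \<times> space M) = emeasure L (space L) * emeasure M (space M)"
    by (rule M.emeasure_pair_measure_Times) auto
  then have "finite_measure (L \<Otimes>\<^sub>M M)"
    using L.emeasure_finite M.emeasure_finite
    by (intro finite_measureI) (auto simp: space_pair_measure ennreal_mult_eq_top_iff)
  then show "finite_measure (drift M v h)"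
    unfolding drift_def by (rule finite_measure.finite_measure_distr[OF _ drift_map])
qed (simp add: drift_def)

lemma integral_drift:
  fixes f :: "'a \<Rightarrow> real"
  assumes f: "f \<in> borel_measurable borel" "\<And>x. \<bar>f x\<bar> \<le> B"
  shows "(\<integral>x. f x \<partial>drift M v h) = (\<integral>t. (\<integral>x. f (x - t *\<^sub>R v) \<partial>M) * indicator {0..h} t \<partial>lborel)"
    and "(\<lambda>t. \<integral>x. f (x - t *\<^sub>R v) \<partial>M) \<in> borel_measurable borel"
proof -
  interpret L: finite_measure L by (rule finite_time_measure[OF h])
  interpret M: finite_measure M by (rule M)
  interpret P: pair_sigma_finite L M ..
  interpret D: finite_measure "drift M v h" by (rule finite_drift)
  have m: "(\<lambda>p. f (snd p - fst p *\<^sub>R v)) \<in> borel_measurable (L \<Otimes>\<^sub>M M)"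
    using measurable_compose[OF drift_map f(1)] .
  have "(\<lambda>t. \<integral>x. f (x - t *\<^sub>R v) \<partial>M) \<in> borel_measurable L"
    using M.borel_measurable_lebesgue_integral[of "\<lambda>t x. f (x - t *\<^sub>R v)" L] m by (simp add: case_prod_beta')
  then show m2: "(\<lambda>t. \<integral>x. f (x - t *\<^sub>R v) \<partial>M) \<in> borel_measurable borel" by simp
  have "integrable (drift M v h) f"
    by (rule D.integrable_const_bound[where B = B]) (use f in \<open>auto simp: measurable_cong_sets[OF finite_drift(2) refl]\<close>)
  then have i: "integrable (L \<Otimes>\<^sub>M M) (\<lambda>p. f (snd p - fst p *\<^sub>R v))"
    using integrable_distr[OF drift_map, of f] by (simp add: drift_def)
  have "(\<integral>x. f x \<partial>drift M v h) = (\<integral>p. f (snd p - fst p *\<^sub>R v) \<partial>(L \<Otimes>\<^sub>M M))"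
    unfolding drift_def by (rule integral_distr[OF drift_map f(1)])
  also have "\<dots> = (\<integral>t. (\<integral>x. f (x - t *\<^sub>R v) \<partial>M) \<partial>L)"
    using P.integral_fst'[OF i] by simp
  also have "\<dots> = (\<integral>t. indicator {0..h} t *\<^sub>R (\<integral>x. f (x - t *\<^sub>R v) \<partial>M) \<partial>lborel)"
    by (rule integral_density) (use m2 in auto)
  finally show "(\<integral>x. f x \<partial>drift M v h) = (\<integral>t. (\<integral>x. f (x - t *\<^sub>R v) \<partial>M) * indicator {0..h} t \<partial>lborel)"
    by (simp add: mult.commute)
qed

end

context
  fixes M :: "'a::euclidean_space measure" and \<Omega> U :: "'a set" and w :: "'a \<Rightarrow> real" and v :: 'a and h :: real
  assumes M: "finite_measure M" "sets M = sets borel"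
    and w: "w \<in> borel_measurable borel" "\<And>x. \<bar>w x\<bar> \<le> 1"
    and deriv: "\<And>\<zeta>. \<zeta> \<in> test_functions \<Omega> \<Longrightarrow>
          \<bar>\<integral>x. w x * frechet_derivative \<zeta> (at x) v \<partial>lborel\<bar> \<le> (\<integral>x. \<bar>\<zeta> x\<bar> \<partial>M)"
    and h: "h \<ge> 0" and U: "\<And>x t. x \<in> U \<Longrightarrow> 0 \<le> t \<Longrightarrow> t \<le> h \<Longrightarrow> x + t *\<^sub>R v \<in> \<Omega>"
begin

private abbreviation (input) "L2 \<equiv> density lborel (\<lambda>t::real. ennreal (indicator {0..h} t))"

text \<open>Moving the increment onto the test function by a translation, and writing the increment of \<open>\<zeta>\<close> as the integral
of its derivative along the segment, reduces the claim to the bound on the derivative of \<open>w\<close> tested with the translates of \<open>\<zeta>\<close>. For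
\<open>\<zeta>\<close> supported in \<open>U\<close>, all these translates are test functions on \<open>\<Omega>\<close>.\<close>

lemma difference_functional_le_drift:
  assumes \<zeta>: "\<zeta> \<in> test_functions U"
  shows "\<bar>\<integral>x. \<zeta> x * (w (x + h *\<^sub>R v) - w x) \<partial>lborel\<bar> \<le> (\<integral>x. \<bar>\<zeta> x\<bar> \<partial>drift M v h)"
proof -
  interpret L: finite_measure L2 by (rule finite_time_measure[OF h])
  interpret P: pair_sigma_finite L2 lborel ..
  note [measurable] = w(1) test_measurable[OF \<zeta>] test_derivative_measurable[OF \<zeta>]
  obtain K where K: "compact K" "K \<subseteq> U" "\<And>x. x \<notin> K \<Longrightarrow> \<zeta> x = 0" "\<And>x v. x \<notin> K \<Longrightarrow> frechet_derivative \<zeta> (at x) v = 0"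
    using test_support[OF \<zeta>] by metis
  obtain B where B: "B \<ge> 0" "\<And>x. \<bar>\<zeta> x\<bar> \<le> B" using test_bounded[OF \<zeta>] by metis
  obtain B' where B': "B' \<ge> 0" "\<And>x. \<bar>frechet_derivative \<zeta> (at x) v\<bar> \<le> B'" using test_derivative_bounded[OF \<zeta>] by metis
  (* a compact set that contains the supports of all translates *)
  define K' where "K' = (\<lambda>(t, x). x + t *\<^sub>R v) ` ({0..h} \<times> K)"
  have K': "compact K'" unfolding K'_def case_prod_beta'
    by (intro compact_continuous_image continuous_intros compact_Times K(1)) auto
  have K'I: "x \<in> K'" if "x - t *\<^sub>R v \<in> K" "0 \<le> t" "t \<le> h" for x t
    unfolding K'_def using that by (intro image_eqI[of _ _ "(t, x - t *\<^sub>R v)"]) auto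
  have zK': "\<zeta> (x - t *\<^sub>R v) = 0" "frechet_derivative \<zeta> (at (x - t *\<^sub>R v)) v = 0"
    if "x \<notin> K'" "0 \<le> t" "t \<le> h" for x t
    using K'I[of x t] K(3,4) that by auto
  have bd: "\<bar>w x * \<zeta> y\<bar> \<le> B" for x y
    using mult_mono[OF w(2)[of x] B(2)[of y]] by (simp add: abs_mult)
  have bd': "\<bar>w x * frechet_derivative \<zeta> (at y) v\<bar> \<le> B'" for x y
    using mult_mono[OF w(2)[of x] B'(2)[of y]] by (simp add: abs_mult)
  have i1: "integrable lborel (\<lambda>x. w x * \<zeta> (x - t *\<^sub>R v))" if "0 \<le> t" "t \<le> h" for t
    by (rule integrable_lborel_bounded_support[OF _ K' _ bd]) (use zK'(1)[OF _ that] in auto)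
  have i2: "integrable lborel (\<lambda>x. w (h *\<^sub>R v + x) * \<zeta> x)"
    by (rule integrable_lborel_bounded_support[OF _ K(1) _ bd]) (use K(3) in auto)
  have "(\<integral>x. \<zeta> x * (w (x + h *\<^sub>R v) - w x) \<partial>lborel) = (\<integral>x. w (h *\<^sub>R v + x) * \<zeta> x - w x * \<zeta> (x - 0 *\<^sub>R v) \<partial>lborel)"
    by (intro Bochner_Integration.integral_cong) (auto simp: algebra_simps)
  also have "\<dots> = (\<integral>x. w (h *\<^sub>R v + x) * \<zeta> x \<partial>lborel) - (\<integral>x. w x * \<zeta> (x - 0 *\<^sub>R v) \<partial>lborel)"
    using i1[of 0] i2 h by (intro Bochner_Integration.integral_diff) auto
  also have "(\<integral>x. w (h *\<^sub>R v + x) * \<zeta> x \<partial>lborel) = (\<integral>x. w x * \<zeta> (x - h *\<^sub>R v) \<partial>lborel)"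
    using lborel_integral_translate[of "\<lambda>x. w x * \<zeta> (x - h *\<^sub>R v)" "h *\<^sub>R v"] by simp
  also have "(\<integral>x. w x * \<zeta> (x - h *\<^sub>R v) \<partial>lborel) - (\<integral>x. w x * \<zeta> (x - 0 *\<^sub>R v) \<partial>lborel)
     = (\<integral>x. w x * (\<zeta> (x - h *\<^sub>R v) - \<zeta> (x - 0 *\<^sub>R v)) \<partial>lborel)"
    using i1[of 0] i1[of h] h by (subst Bochner_Integration.integral_diff[symmetric]) (auto simp: right_diff_distrib)
  also have "\<dots> = (\<integral>x. (\<integral>t. - (w x * frechet_derivative \<zeta> (at (x - t *\<^sub>R v)) v) \<partial>L2) \<partial>lborel)"
  proof (rule Bochner_Integration.integral_cong[OF refl])
    fix x
    have "(\<integral>t. frechet_derivative \<zeta> (at (x + t *\<^sub>R (- v))) (- v) * indicator {0..h} t \<partial>lborel)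
       = \<zeta> (x + h *\<^sub>R (- v)) - \<zeta> (x + 0 *\<^sub>R (- v))"
    proof (rule integral_FTC_Icc_real[OF h])
      show "((\<lambda>t. \<zeta> (x + t *\<^sub>R - v)) has_real_derivative frechet_derivative \<zeta> (at (x + t *\<^sub>R - v)) (- v)) (at t)" for t
        by (rule test_line_derivative[OF \<zeta>])
      have "continuous_on UNIV (\<lambda>t::real. frechet_derivative \<zeta> (at (x + t *\<^sub>R - v)) (- v))"
        by (rule continuous_on_compose2[OF test_derivative_continuous[OF \<zeta>]]) (auto intro!: continuous_intros)
      then show "isCont (\<lambda>t. frechet_derivative \<zeta> (at (x + t *\<^sub>R - v)) (- v)) t" for t
        by (simp add: continuous_on_eq_continuous_at)
    qed
    moreover have "frechet_derivative \<zeta> (at y) (- v) = - frechet_derivative \<zeta> (at y) v" for y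
      using linear_neg[OF test_derivative_linear[OF \<zeta>]] .
    ultimately have "(\<integral>t. - (frechet_derivative \<zeta> (at (x - t *\<^sub>R v)) v * indicator {0..h} t) \<partial>lborel) = \<zeta> (x - h *\<^sub>R v) - \<zeta> (x - 0 *\<^sub>R v)"
      by simp
    moreover have "(\<integral>t. - (w x * frechet_derivative \<zeta> (at (x - t *\<^sub>R v)) v) \<partial>L2) =
       w x * (\<integral>t. - (frechet_derivative \<zeta> (at (x - t *\<^sub>R v)) v * indicator {0..h} t) \<partial>lborel)"
      by (subst integral_density) (auto simp: mult_ac)
    ultimately show "w x * (\<zeta> (x - h *\<^sub>R v) - \<zeta> (x - 0 *\<^sub>R v)) = (\<integral>t. - (w x * frechet_derivative \<zeta> (at (x - t *\<^sub>R v)) v) \<partial>L2)"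
      by simp
  qed
  also have "\<dots> = (\<integral>t. (\<integral>x. - (w x * frechet_derivative \<zeta> (at (x - t *\<^sub>R v)) v) \<partial>lborel) \<partial>L2)"
  proof (rule P.Fubini_integral, rule integrableI_bounded_set[where A = "UNIV \<times> K'" and B = B'])
    show "UNIV \<times> K' \<in> sets (L2 \<Otimes>\<^sub>M lborel)" using K' by (intro pair_measureI) (auto simp: compact_imp_closed)
    have "(\<lambda>(t, x). - (w x * frechet_derivative \<zeta> (at (x - t *\<^sub>R v)) v)) \<in> borel_measurable (borel \<Otimes>\<^sub>M borel)"
      by measurable
    then show "(\<lambda>(t, x). - (w x * frechet_derivative \<zeta> (at (x - t *\<^sub>R v)) v)) \<in> borel_measurable (L2 \<Otimes>\<^sub>M lborel)"
      by (simp add: measurable_cong_sets[OF sets_pair_measure_cong[of L2 borel lborel borel] refl])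
    have "emeasure (L2 \<Otimes>\<^sub>M lborel) (UNIV \<times> K') = emeasure L2 UNIV * emeasure lborel K'"
      using K' by (intro lborel.emeasure_pair_measure_Times) (auto simp: compact_imp_closed)
    then show "emeasure (L2 \<Otimes>\<^sub>M lborel) (UNIV \<times> K') < \<infinity>"
      by (metis L.emeasure_finite emeasure_compact_finite[OF K'] ennreal_mult_less_top infinity_ennreal_def less_top)
    show "AE p in L2 \<Otimes>\<^sub>M lborel. p \<in> UNIV \<times> K' \<longrightarrow> norm (case p of (t, x) \<Rightarrow> - (w x * frechet_derivative \<zeta> (at (x - t *\<^sub>R v)) v)) \<le> B'"
      using bd' by (auto simp: case_prod_beta')
    show "AE p in L2 \<Otimes>\<^sub>M lborel. p \<notin> UNIV \<times> K' \<longrightarrow> (case p of (t, x) \<Rightarrow> - (w x * frechet_derivative \<zeta> (at (x - t *\<^sub>R v)) v)) = 0"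
    proof -
      have "AE t in L2. 0 \<le> t \<and> t \<le> h" by (subst AE_density) (auto simp: indicator_def)
      then have "AE p in L2 \<Otimes>\<^sub>M lborel. 0 \<le> fst p \<and> fst p \<le> h"
      proof (intro P.AE_pair_measure)
        have [measurable_cong]: "sets L2 = sets borel" by simp
        show "{p \<in> space (L2 \<Otimes>\<^sub>M lborel). 0 \<le> fst p \<and> fst p \<le> h} \<in> sets (L2 \<Otimes>\<^sub>M lborel)"
          by measurable
      qed auto
      then show ?thesis
      proof eventually_elim
        case (elim p)
        then show ?case using zK'(2)[of "snd p" "fst p"] by (cases p) auto
      qed
    qed
  qed
  also have "\<dots> = (\<integral>t. (\<integral>x. - (w x * frechet_derivative \<zeta> (at (x - t *\<^sub>R v)) v) \<partial>lborel) * indicator {0..h} t \<partial>lborel)"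
  proof (subst integral_density)
    have "(\<lambda>t. \<integral>x. - (w x * frechet_derivative \<zeta> (at (x - t *\<^sub>R v)) v) \<partial>lborel) \<in> borel_measurable borel"
      by measurable
    then show "(\<lambda>t. \<integral>x. - (w x * frechet_derivative \<zeta> (at (x - t *\<^sub>R v)) v) \<partial>lborel) \<in> borel_measurable lborel" by simp
  qed (auto simp: mult.commute)
  finally have eq: "(\<integral>x. \<zeta> x * (w (x + h *\<^sub>R v) - w x) \<partial>lborel) = \<dots>" .
  have "\<bar>\<dots>\<bar> \<le> (\<integral>t. \<bar>(\<integral>x. - (w x * frechet_derivative \<zeta> (at (x - t *\<^sub>R v)) v) \<partial>lborel) * indicator {0..h} t\<bar> \<partial>lborel)"
    by (rule integral_abs_bound)
  also have "\<dots> \<le> (\<integral>t. (\<integral>x. \<bar>\<zeta> (x - t *\<^sub>R v)\<bar> \<partial>M) * indicator {0..h} t \<partial>lborel)"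
  proof (rule integral_mono')
    have sp: "space M = UNIV" using sets_eq_imp_space_eq[OF M(2)] by simp
    have b: "(\<integral>x. \<bar>\<zeta> (x - t *\<^sub>R v)\<bar> \<partial>M) \<le> B * measure M UNIV" for t
    proof -
      interpret M: finite_measure M by (rule M)
      have "(\<lambda>x. \<bar>\<zeta> (x - t *\<^sub>R v)\<bar>) \<in> borel_measurable M"
        by (simp add: measurable_cong_sets[OF M(2) refl])
      then have "integrable M (\<lambda>x. \<bar>\<zeta> (x - t *\<^sub>R v)\<bar>)"
        by (intro M.integrable_const_bound[where B = B]) (use B in auto)
      then have "(\<integral>x. \<bar>\<zeta> (x - t *\<^sub>R v)\<bar> \<partial>M) \<le> (\<integral>x. B \<partial>M)"
        using B by (intro integral_mono) auto
      then show ?thesis by (simp add: sp mult.commute)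
    qed
    show "integrable lborel (\<lambda>t. (\<integral>x. \<bar>\<zeta> (x - t *\<^sub>R v)\<bar> \<partial>M) * indicator {0..h} t)"
    proof (rule integrable_lborel_bounded_support[where K = "{0..h}"])
      have "(\<lambda>t. \<integral>x. \<bar>\<zeta> (x - t *\<^sub>R v)\<bar> \<partial>M) \<in> borel_measurable borel"
        by (rule integral_drift(2)[OF M h, of "\<lambda>x. \<bar>\<zeta> x\<bar>" B]) (use B in auto)
      then show "(\<lambda>t. (\<integral>x. \<bar>\<zeta> (x - t *\<^sub>R v)\<bar> \<partial>M) * indicator {0..h} t) \<in> borel_measurable borel"
        by simp
      show "\<bar>(\<integral>x. \<bar>\<zeta> (x - t *\<^sub>R v)\<bar> \<partial>M) * indicator {0..h} t\<bar> \<le> B * measure M UNIV" for t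
        using b[of t] B(1) by (auto simp: indicator_def)
    qed (auto simp: compact_Icc)
    fix t
    show "0 \<le> (\<integral>x. \<bar>\<zeta> (x - t *\<^sub>R v)\<bar> \<partial>M) * indicator {0..h} t" by simp
    show "\<bar>(\<integral>x. - (w x * frechet_derivative \<zeta> (at (x - t *\<^sub>R v)) v) \<partial>lborel) * indicator {0..h} t\<bar>
        \<le> (\<integral>x. \<bar>\<zeta> (x - t *\<^sub>R v)\<bar> \<partial>M) * indicator {0..h} t"
    proof (cases "t \<in> {0..h}")
      case True
      then have T: "(\<lambda>x. \<zeta> (x - t *\<^sub>R v)) \<in> test_functions \<Omega>"
        by (intro test_translate[OF \<zeta>] U) auto
      have "frechet_derivative (\<lambda>x. \<zeta> (x - t *\<^sub>R v)) (at x) v = frechet_derivative \<zeta> (at (x - t *\<^sub>R v)) v" for x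
        using test_has_derivative[OF \<zeta>] by (subst frechet_derivative_translate) (auto intro: differentiableI)
      then show ?thesis using deriv[OF T] True by simp
    qed simp
  qed
  also have "\<dots> = (\<integral>x. \<bar>\<zeta> x\<bar> \<partial>drift M v h)"
    by (rule integral_drift(1)[OF M h, symmetric, of "\<lambda>x. \<bar>\<zeta> x\<bar>" B]) (use B in auto)
  finally show ?thesis unfolding eq .
qed

end

text \<open>A bound for signed test functions says that \<open>\<bar>d\<bar> dx\<close> is at most \<open>Q\<close> on \<open>U\<close> as a measure: approximate indicators by test functions, then
split a set by the sign of \<open>d\<close>. This gives access to the absolute value of \<open>d\<close>, which the test functions do not see directly.\<close>

lemma functional_domination_imp_measure_le:
  fixes Q :: "'a::euclidean_space measure" and d :: "'a \<Rightarrow> real"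
  assumes Q: "finite_measure Q" "sets Q = sets borel" and d: "d \<in> borel_measurable borel" "\<And>x. \<bar>d x\<bar> \<le> B"
    and U: "open U" "bounded U"
    and dom: "\<And>\<zeta>. \<zeta> \<in> test_functions U \<Longrightarrow> \<bar>\<integral>x. \<zeta> x * d x \<partial>lborel\<bar> \<le> (\<integral>x. \<bar>\<zeta> x\<bar> \<partial>Q)"
    and f: "f \<in> borel_measurable borel" "\<And>x. x \<notin> U \<Longrightarrow> f x = 0"
  shows "(\<integral>\<^sup>+x. f x * ennreal \<bar>d x\<bar> \<partial>lborel) \<le> (\<integral>\<^sup>+x. f x \<partial>Q)"
proof -
  have [measurable]: "U \<in> sets borel" using U by simp
  note [measurable] = d(1)
  note Qm = measurable_cong_sets[OF Q(2) refl]
  interpret Q: finite_measure Q by (rule Q)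
  have B: "B \<ge> 0" using d(2)[of undefined] by linarith
  have Ufin: "emeasure lborel U < \<infinity>" using U emeasure_bounded_finite by blast
  define D where "D = density lborel (\<lambda>x. ennreal (indicator U x * \<bar>d x\<bar>))"
  (* Q may charge the complement of U, where the test functions vanish *)
  define Q' where "Q' = density Q (\<lambda>x. ennreal (indicator U x))"
  have eD: "emeasure D A = (\<integral>\<^sup>+x. ennreal (indicator (A \<inter> U) x * \<bar>d x\<bar>) \<partial>lborel)" if "A \<in> sets borel" for A
    unfolding D_def using that by (subst emeasure_density) (auto intro!: nn_integral_cong simp: indicator_def)
  have eQ': "emeasure Q' A = emeasure Q (A \<inter> U)" if A: "A \<in> sets borel" for A
  proof -
    have "emeasure Q' A = (\<integral>\<^sup>+x. ennreal (indicator U x) * indicator A x \<partial>Q)"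
      unfolding Q'_def using A Q(2) by (subst emeasure_density) (auto simp: Qm)
    also have "\<dots> = (\<integral>\<^sup>+x. indicator (A \<inter> U) x \<partial>Q)"
      by (intro nn_integral_cong) (auto simp: indicator_def)
    finally show ?thesis using A Q(2) by simp
  qed
  have sD: "sets D = sets borel" "sets Q' = sets borel" by (auto simp: D_def Q'_def Q(2))
  have fD: "finite_measure D"
  proof (rule finite_measureI)
    have "emeasure D (space D) \<le> (\<integral>\<^sup>+x. ennreal B * indicator U x \<partial>lborel)"
      using eD[of UNIV] d(2) sets_eq_imp_space_eq[OF sD(1)]
      by (auto intro!: nn_integral_mono ennreal_leI simp: indicator_def)
    also have "\<dots> < \<infinity>" using Ufin by (simp add: nn_integral_cmult_indicator ennreal_mult_less_top)
    finally show "emeasure D (space D) \<noteq> \<infinity>" by simp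
  qed
  have fQ': "finite_measure Q'"
    using eQ'[of UNIV] Q.emeasure_finite sets_eq_imp_space_eq[OF sD(2)] by (intro finite_measureI) auto
  have key: "\<bar>\<integral>x. indicator A x * d x \<partial>lborel\<bar> \<le> measure Q A" if A: "A \<in> sets borel" "A \<subseteq> U" for A
  proof -
    have [measurable]: "A \<in> sets borel" by fact
    define I where "I i = (if i = 0 then D else Q')" for i :: nat
    have I: "finite_measure (I i)" "sets (I i) = sets borel" for i using fD fQ' sD by (auto simp: I_def)
    obtain S where S: "finite_measure S" "sets S = sets borel"
      "\<And>A. A \<in> sets borel \<Longrightarrow> emeasure S A = (\<Sum>i\<in>{0,1}. emeasure (I i) A)" "\<And>i. i \<in> {0,1} \<Longrightarrow> I i \<le> S"
      using finite_sum_of_measures[of "{0,1}" I] I by (metis finite.emptyI finite.insertI)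
    have "D \<le> S" "Q' \<le> S" using S(4)[of 0] S(4)[of 1] by (auto simp: I_def)
    have S0: "emeasure S (- U) = 0" by (subst S(3)) (auto simp: I_def eD eQ')
    have "\<bar>\<integral>x. indicator A x * d x \<partial>lborel\<bar> \<le> measure Q A + e" if "e > 0" for e
    proof -
      have "e / 2 > 0" using that by simp
      from test_functions_dense_indicator[OF S(1,2) U(1) S0 A(1) this] obtain \<zeta> where
        z: "\<zeta> \<in> test_functions U" "(\<integral>x. \<bar>\<zeta> x - indicator A x\<bar> \<partial>S) < e / 2" by blast
      note [measurable] = test_measurable[OF z(1)]
      obtain B' where B': "B' \<ge> 0" "\<And>x. \<bar>\<zeta> x\<bar> \<le> B'" using test_bounded[OF z(1)] by metis
      have iS: "integrable S (\<lambda>x. \<bar>\<zeta> x - indicator A x\<bar>)"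
        using test_integrable[OF z(1) S(1,2)] A(1) S(2) finite_measure.emeasure_finite[OF S(1)]
        by (auto intro!: integrable_abs Bochner_Integration.integrable_diff integrable_real_indicator simp: less_top[symmetric])
      have bsupp: "integrable lborel (\<lambda>x. f x * d x)" if "f \<in> borel_measurable borel" "\<And>x. x \<notin> U \<Longrightarrow> f x = 0" "\<And>x. \<bar>f x\<bar> \<le> b" for f :: "'a \<Rightarrow> real" and b
      proof (rule integrableI_bounded_set[where A = U and B = "b * B"])
        have "\<bar>f x\<bar> * \<bar>d x\<bar> \<le> b * B" for x using that(3)[of x] d(2)[of x] by (intro mult_mono) auto
        then show "AE x in lborel. x \<in> U \<longrightarrow> norm (f x * d x) \<le> b * B" by (simp add: abs_mult)
      qed (use that Ufin in auto)
      have i1: "integrable lborel (\<lambda>x. indicator A x * d x)" by (rule bsupp[where b = 1]) (use A in \<open>auto simp: indicator_def\<close>)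
      have i2: "integrable lborel (\<lambda>x. \<zeta> x * d x)" by (rule bsupp[where b = B']) (use B' test_zero_outside[OF z(1)] in auto)
      have "\<bar>(\<integral>x. \<zeta> x * d x \<partial>lborel) - (\<integral>x. indicator A x * d x \<partial>lborel)\<bar> = \<bar>\<integral>x. \<zeta> x * d x - indicator A x * d x \<partial>lborel\<bar>"
        using i1 i2 by simp
      also have "\<dots> \<le> (\<integral>x. \<bar>\<zeta> x * d x - indicator A x * d x\<bar> \<partial>lborel)" by (rule integral_abs_bound)
      also have "\<dots> = (\<integral>x. (indicator U x * \<bar>d x\<bar>) *\<^sub>R \<bar>\<zeta> x - indicator A x\<bar> \<partial>lborel)"
        using A(2) test_zero_outside[OF z(1)]
        by (intro Bochner_Integration.integral_cong) (auto simp: indicator_def abs_mult[symmetric] algebra_simps)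
      also have "\<dots> = (\<integral>x. \<bar>\<zeta> x - indicator A x\<bar> \<partial>D)"
        unfolding D_def by (subst integral_density) auto
      also have "\<dots> \<le> (\<integral>x. \<bar>\<zeta> x - indicator A x\<bar> \<partial>S)"
        by (rule integral_mono_le_measure(2)[OF _ \<open>D \<le> S\<close> iS]) (simp_all add: sD S(2))
      finally have 1: "\<bar>\<integral>x. indicator A x * d x \<partial>lborel\<bar> \<le> \<bar>\<integral>x. \<zeta> x * d x \<partial>lborel\<bar> + e / 2"
        using z(2) by linarith
      have "(\<integral>x. \<bar>\<zeta> x\<bar> \<partial>Q) = (\<integral>x. indicator U x *\<^sub>R \<bar>\<zeta> x\<bar> \<partial>Q)"
        using test_zero_outside[OF z(1)] by (intro Bochner_Integration.integral_cong) (auto simp: indicator_def)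
      also have "\<dots> = (\<integral>x. \<bar>\<zeta> x\<bar> \<partial>Q')"
        unfolding Q'_def by (subst integral_density) (auto simp: Qm)
      also have "\<dots> \<le> (\<integral>x. \<bar>\<zeta> x - indicator A x\<bar> + indicator A x \<partial>Q')"
      proof (rule integral_mono)
        have iA: "integrable Q' (indicator A :: 'a \<Rightarrow> real)"
          using A(1) sD finite_measure.emeasure_finite[OF fQ'] by (intro integrable_real_indicator) (auto simp: less_top[symmetric])
        show "integrable Q' (\<lambda>x. \<bar>\<zeta> x\<bar>)" using test_integrable[OF z(1) fQ' sD(2)] by simp
        show "integrable Q' (\<lambda>x. \<bar>\<zeta> x - indicator A x\<bar> + indicator A x)"
          using test_integrable[OF z(1) fQ' sD(2)] iA by auto
      qed (auto simp: indicator_def)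
      also have "\<dots> = (\<integral>x. \<bar>\<zeta> x - indicator A x\<bar> \<partial>Q') + measure Q' A"
        using test_integrable[OF z(1) fQ' sD(2)] A(1) sD finite_measure.emeasure_finite[OF fQ'] sets_eq_imp_space_eq[OF sD(2)]
        by (subst Bochner_Integration.integral_add)
           (auto intro!: integrable_abs Bochner_Integration.integrable_diff integrable_real_indicator simp: less_top[symmetric])
      also have "measure Q' A = measure Q A" using A by (simp add: measure_def eQ' Int_absorb2)
      also have "(\<integral>x. \<bar>\<zeta> x - indicator A x\<bar> \<partial>Q') \<le> (\<integral>x. \<bar>\<zeta> x - indicator A x\<bar> \<partial>S)"
        by (rule integral_mono_le_measure(2)[OF _ \<open>Q' \<le> S\<close> iS]) (simp_all add: sD S(2))
      finally have "(\<integral>x. \<bar>\<zeta> x\<bar> \<partial>Q) \<le> e / 2 + measure Q A" using z(2) by linarith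
      then show ?thesis using 1 dom[OF z(1)] by linarith
    qed
    then show ?thesis by (rule field_le_epsilon)
  qed
  have "D \<le> Q'"
  proof (subst le_measure)
    show "sets D = sets Q'" by (simp add: sD)
    show "\<forall>A\<in>sets D. emeasure D A \<le> emeasure Q' A"
    proof
      fix A assume "A \<in> sets D"
      then have [measurable]: "A \<in> sets borel" by (simp add: sD)
      define P N where "P = {x\<in>A \<inter> U. d x \<ge> 0}" and "N = {x\<in>A \<inter> U. d x < 0}"
      have PN [measurable]: "P \<in> sets borel" "N \<in> sets borel" unfolding P_def N_def by measurable
      have sub: "P \<subseteq> U" "N \<subseteq> U" "P \<inter> N = {}" "P \<union> N = A \<inter> U" by (auto simp: P_def N_def)
      have i: "integrable lborel (\<lambda>x. indicator Z x * d x)" if "Z \<in> sets borel" "Z \<subseteq> U" for Z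
        by (rule integrableI_bounded_set[where A = U and B = B])
           (use that d Ufin B in \<open>auto simp: indicator_def\<close>)
      have "emeasure D A = (\<integral>\<^sup>+x. ennreal (indicator P x * d x) + ennreal (- (indicator N x * d x)) \<partial>lborel)"
        unfolding eD[OF \<open>A \<in> sets borel\<close>] by (intro nn_integral_cong) (auto simp: P_def N_def indicator_def)
      also have "\<dots> = (\<integral>\<^sup>+x. ennreal (indicator P x * d x) \<partial>lborel) + (\<integral>\<^sup>+x. ennreal (- (indicator N x * d x)) \<partial>lborel)"
        by (intro nn_integral_add) auto
      also have "(\<integral>\<^sup>+x. ennreal (indicator P x * d x) \<partial>lborel) = ennreal (\<integral>x. indicator P x * d x \<partial>lborel)"
        using i[of P] sub by (intro nn_integral_eq_integral) (auto simp: P_def indicator_def)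
      also have "(\<integral>\<^sup>+x. ennreal (- (indicator N x * d x)) \<partial>lborel) = ennreal (\<integral>x. - (indicator N x * d x) \<partial>lborel)"
        using i[of N] sub by (intro nn_integral_eq_integral) (auto simp: N_def indicator_def)
      also have "ennreal (\<integral>x. indicator P x * d x \<partial>lborel) + ennreal (\<integral>x. - (indicator N x * d x) \<partial>lborel)
         \<le> ennreal (measure Q P) + ennreal (measure Q N)"
        using key[of P] key[of N] sub PN by (intro add_mono ennreal_leI) auto
      also have "\<dots> = emeasure Q (P \<union> N)"
        using sub PN Q(2) by (subst plus_emeasure[symmetric]) (auto simp: Q.emeasure_eq_measure)
      also have "\<dots> = emeasure Q' A" by (simp add: sub eQ')
      finally show "emeasure D A \<le> emeasure Q' A" .
    qed
  qed
  have "(\<integral>\<^sup>+x. f x * ennreal \<bar>d x\<bar> \<partial>lborel) = (\<integral>\<^sup>+x. ennreal (indicator U x * \<bar>d x\<bar>) * f x \<partial>lborel)"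
    using f(2) by (intro nn_integral_cong) (auto simp: indicator_def mult.commute)
  also have "\<dots> = (\<integral>\<^sup>+x. f x \<partial>D)" unfolding D_def using f(1) by (subst nn_integral_density) auto
  also have "\<dots> \<le> (\<integral>\<^sup>+x. f x \<partial>Q')" by (rule nn_integral_mono_measure[OF _ \<open>D \<le> Q'\<close>]) (simp add: sD)
  also have "\<dots> = (\<integral>\<^sup>+x. ennreal (indicator U x) * f x \<partial>Q)"
    unfolding Q'_def using f(1) by (subst nn_integral_density) (auto simp: Qm)
  also have "\<dots> = (\<integral>\<^sup>+x. f x \<partial>Q)" using f(2) by (intro nn_integral_cong) (auto simp: indicator_def)
  finally show ?thesis .
qed

section \<open>A chain rule bound for Lipschitz functions\<close>

lemma compact_in_open_margin:
  fixes K :: "'a::euclidean_space set"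
  assumes "compact K" "open \<Omega>" "K \<subseteq> \<Omega>"
  obtains d where "d > 0" "\<And>x y. x \<in> K \<Longrightarrow> dist x y < d \<Longrightarrow> y \<in> \<Omega>"
proof -
  have "K \<inter> (- \<Omega>) = {}" using assms(3) by auto
  from separate_compact_closed[OF assms(1) closed_Compl[OF assms(2)] this]
  obtain d where d: "d > 0" "\<forall>x\<in>K. \<forall>y\<in>- \<Omega>. d \<le> dist x y" by blast
  show ?thesis
  proof (rule that[OF d(1)])
    show "y \<in> \<Omega>" if "x \<in> K" "dist x y < d" for x y
      using d(2) that by (meson ComplI not_le)
  qed
qed

text \<open>The Lipschitz bound compares increments of \<open>G\<close> with increments of the components of \<open>u\<close>, and absolute increments of \<open>u\<close> are bounded by
\<open>drift M v h\<close>. Dividing by \<open>h\<close> and letting \<open>h\<close> tend to \<open>0\<close> turns the increments of \<open>G\<close> into its distributional derivative, while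
\<open>drift M v h / h\<close> tends to \<open>M\<close>.\<close>

lemma lipschitz_chain_rule_bound:
  fixes u :: "'a::euclidean_space \<Rightarrow> 'b::euclidean_space" and G :: "'a \<Rightarrow> real"
  assumes M: "finite_measure M" "sets M = sets borel" and \<Omega>: "open \<Omega>"
    and u: "u \<in> borel_measurable borel" "\<And>x. norm (u x) \<le> 1"
    and deriv: "\<And>b \<zeta>. b \<in> Basis \<Longrightarrow> \<zeta> \<in> test_functions \<Omega> \<Longrightarrow>
          \<bar>\<integral>x. (u x \<bullet> b) * frechet_derivative \<zeta> (at x) v \<partial>lborel\<bar> \<le> (\<integral>x. \<bar>\<zeta> x\<bar> \<partial>M)"
    and v: "norm v \<le> 1"
    and G: "G \<in> borel_measurable borel" "\<And>x. \<bar>G x\<bar> \<le> C" "\<And>x y. \<bar>G x - G y\<bar> \<le> L * norm (u x - u y)" "L \<ge> 0"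
    and \<zeta>: "\<zeta> \<in> test_functions \<Omega>"
  shows "\<bar>\<integral>x. G x * frechet_derivative \<zeta> (at x) v \<partial>lborel\<bar> \<le> L * DIM('b) * (\<integral>x. \<bar>\<zeta> x\<bar> \<partial>M)"
proof -
  interpret M: finite_measure M by (rule M)
  have sp: "space M = UNIV" using sets_eq_imp_space_eq[OF M(2)] by simp
  note Mm = measurable_cong_sets[OF M(2) refl]
  note [measurable] = u(1) G(1) test_measurable[OF \<zeta>] test_derivative_measurable[OF \<zeta>]
  have C: "C \<ge> 0" using G(2)[of undefined] by linarith
  obtain K where K: "compact K" "K \<subseteq> \<Omega>" "\<And>x. x \<notin> K \<Longrightarrow> \<zeta> x = 0" "\<And>x v. x \<notin> K \<Longrightarrow> frechet_derivative \<zeta> (at x) v = 0"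
    using test_support[OF \<zeta>] by metis
  obtain B where B: "B \<ge> 0" "\<And>x. \<bar>\<zeta> x\<bar> \<le> B" using test_bounded[OF \<zeta>] by metis
  obtain B' where B': "B' \<ge> 0" "\<And>x. \<bar>frechet_derivative \<zeta> (at x) v\<bar> \<le> B'" using test_derivative_bounded[OF \<zeta>] by metis
  note Lip = test_lipschitz_line[OF \<zeta> B'(2)]
  obtain d where d: "d > 0" "\<And>x y. x \<in> K \<Longrightarrow> dist x y < d \<Longrightarrow> y \<in> \<Omega>"
    using compact_in_open_margin[OF K(1) \<Omega> K(2)] by metis
  (* a neighbourhood of the support that stays in the open set when it is shifted by at most d/2 *)
  define U where "U = (\<Union>x\<in>K. ball x (d / 2))"
  have U: "open U" "bounded U" "K \<subseteq> U"
  proof -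
    show "open U" by (auto simp: U_def)
    obtain r where "K \<subseteq> ball 0 r" using compact_imp_bounded[OF K(1)] bounded_subset_ballD by blast
    have "U \<subseteq> ball 0 (r + d / 2)"
    proof
      fix y assume "y \<in> U"
      then obtain x where x: "x \<in> K" "dist x y < d / 2" by (auto simp: U_def)
      with \<open>K \<subseteq> ball 0 r\<close> have "norm x < r" by auto
      with x(2) norm_triangle_sub[of y x] show "y \<in> ball 0 (r + d / 2)"
        by (simp add: dist_norm norm_minus_commute)
    qed
    then show "bounded U" by (rule bounded_subset[OF bounded_ball])
    show "K \<subseteq> U" using d(1) by (force simp: U_def)
  qed
  have UI: "x + t *\<^sub>R v \<in> \<Omega>" if "x \<in> U" "0 \<le> t" "t \<le> d / 2" for x t
  proof -
    from that(1) obtain k where k: "k \<in> K" "dist k x < d / 2" by (auto simp: U_def)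
    have "norm (t *\<^sub>R v) \<le> d / 2" using mult_mono[OF that(3) v] that(2) d(1) by simp
    then have "dist k (x + t *\<^sub>R v) < d"
      using k(2) norm_triangle_ineq4[of "k - x" "t *\<^sub>R v"] by (simp add: dist_norm algebra_simps)
    then show ?thesis using d(2) k(1) by blast
  qed
  have \<zeta>U: "\<zeta> \<in> test_functions U"
    by (rule test_functionsI[OF test_functionsD(1)[OF \<zeta>] K(1) U(3) K(3)])
  let ?m = "measure M UNIV" and ?I = "\<integral>x. \<bar>\<zeta> x\<bar> \<partial>M"
  have quotient: "\<bar>\<integral>x. G x * (\<zeta> (x - h *\<^sub>R v) - \<zeta> x) \<partial>lborel\<bar> \<le> L * DIM('b) * (h * (?I + B' * h * ?m))"
    if h: "0 < h" "h \<le> d / 2" for h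
  proof -
    have UI': "\<And>x t. x \<in> U \<Longrightarrow> 0 \<le> t \<Longrightarrow> t \<le> h \<Longrightarrow> x + t *\<^sub>R v \<in> \<Omega>" using UI h by auto
    have ub: "\<bar>u x \<bullet> b\<bar> \<le> 1" if "b \<in> Basis" for x b
      using u(2)[of x] Basis_le_norm[OF that, of "u x"] by linarith
    have drift: "(\<integral>x. \<bar>\<zeta> x\<bar> \<partial>drift M v h) \<le> h * (?I + B' * h * ?m)"
    proof -
      have mz: "(\<lambda>x. \<bar>\<zeta> (x - t *\<^sub>R v)\<bar>) \<in> borel_measurable M" for t by (simp add: Mm)
      have 1: "(\<integral>x. \<bar>\<zeta> (x - t *\<^sub>R v)\<bar> \<partial>M) \<le> ?I + B' * h * ?m" if "0 \<le> t" "t \<le> h" for t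
      proof -
        have "(\<integral>x. \<bar>\<zeta> (x - t *\<^sub>R v)\<bar> \<partial>M) \<le> (\<integral>x. \<bar>\<zeta> x\<bar> + B' * h \<partial>M)"
        proof (rule integral_mono)
          show "integrable M (\<lambda>x. \<bar>\<zeta> (x - t *\<^sub>R v)\<bar>)"
            by (rule M.integrable_const_bound[where B = B]) (use B mz in auto)
          show "integrable M (\<lambda>x. \<bar>\<zeta> x\<bar> + B' * h)" using test_integrable[OF \<zeta> M] by simp
          fix x
          have "\<bar>\<zeta> (x - t *\<^sub>R v) - \<zeta> x\<bar> \<le> B' * t" using Lip[of x "- t"] that by simp
          also have "\<dots> \<le> B' * h" using that B' by (intro mult_left_mono) auto
          finally show "\<bar>\<zeta> (x - t *\<^sub>R v)\<bar> \<le> \<bar>\<zeta> x\<bar> + B' * h" by linarith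
        qed
        then show ?thesis using test_integrable[OF \<zeta> M] by (simp add: sp mult_ac)
      qed
      have "(\<integral>x. \<bar>\<zeta> x\<bar> \<partial>drift M v h) = (\<integral>t. (\<integral>x. \<bar>\<zeta> (x - t *\<^sub>R v)\<bar> \<partial>M) * indicator {0..h} t \<partial>lborel)"
        by (rule integral_drift(1)[OF M less_imp_le[OF h(1)], where f = "\<lambda>x. \<bar>\<zeta> x\<bar>" and B = B]) (use B h in auto)
      also have "\<dots> \<le> (\<integral>t. (?I + B' * h * ?m) * indicator {0..h} t \<partial>lborel)"
      proof (rule integral_mono')
        show "integrable lborel (\<lambda>t. (?I + B' * h * ?m) * indicator {0..h} t)"
          using h by (intro integrable_mult_right integrable_real_indicator) auto
      qed (use 1 B' h in \<open>auto simp: indicator_def\<close>)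
      also have "\<dots> = h * (?I + B' * h * ?m)" using h by simp
      finally show ?thesis .
    qed
    have diff: "(\<integral>x. \<bar>\<zeta> x\<bar> * \<bar>u (x + h *\<^sub>R v) \<bullet> b - u x \<bullet> b\<bar> \<partial>lborel) \<le> h * (?I + B' * h * ?m)"
      and idiff: "integrable lborel (\<lambda>x. \<bar>\<zeta> x\<bar> * \<bar>u (x + h *\<^sub>R v) \<bullet> b - u x \<bullet> b\<bar>)"
      if b: "b \<in> Basis" for b
    proof -
      have bm: "(\<lambda>x. u x \<bullet> b) \<in> borel_measurable borel" by measurable
      have fdr: "finite_measure (drift M v h)" "sets (drift M v h) = sets borel"
        using finite_drift[OF M] h by auto
      have d2: "\<bar>u (x + h *\<^sub>R v) \<bullet> b - u x \<bullet> b\<bar> \<le> 2" for x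
        using ub[OF b, of x] ub[OF b, of "x + h *\<^sub>R v"] by linarith
      show i: "integrable lborel (\<lambda>x. \<bar>\<zeta> x\<bar> * \<bar>u (x + h *\<^sub>R v) \<bullet> b - u x \<bullet> b\<bar>)"
      proof (rule integrable_lborel_bounded_support[OF _ K(1)])
        show "\<bar>\<bar>\<zeta> x\<bar> * \<bar>u (x + h *\<^sub>R v) \<bullet> b - u x \<bullet> b\<bar>\<bar> \<le> B * 2" for x
          using mult_mono[OF B(2) d2] B(1) by (simp add: abs_mult)
      qed (use K(3) in auto)
      have dom: "\<bar>\<integral>x. \<xi> x * (u (x + h *\<^sub>R v) \<bullet> b - u x \<bullet> b) \<partial>lborel\<bar> \<le> (\<integral>x. \<bar>\<xi> x\<bar> \<partial>drift M v h)"
        if "\<xi> \<in> test_functions U" for \<xi>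
        by (rule difference_functional_le_drift[OF M bm ub[OF b] deriv[OF b] less_imp_le[OF h(1)] UI' that])
      have "ennreal (\<integral>x. \<bar>\<zeta> x\<bar> * \<bar>u (x + h *\<^sub>R v) \<bullet> b - u x \<bullet> b\<bar> \<partial>lborel)
         = (\<integral>\<^sup>+x. ennreal \<bar>\<zeta> x\<bar> * ennreal \<bar>u (x + h *\<^sub>R v) \<bullet> b - u x \<bullet> b\<bar> \<partial>lborel)"
        using i by (subst nn_integral_eq_integral[symmetric]) (auto simp: ennreal_mult)
      also have "\<dots> \<le> (\<integral>\<^sup>+x. ennreal \<bar>\<zeta> x\<bar> \<partial>drift M v h)"
        by (rule functional_domination_imp_measure_le[OF fdr _ d2 U(1,2) dom])
           (use test_zero_outside[OF \<zeta>U] in auto)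
      also have "\<dots> = ennreal (\<integral>x. \<bar>\<zeta> x\<bar> \<partial>drift M v h)"
        using test_integrable[OF \<zeta> fdr] by (intro nn_integral_eq_integral) auto
      finally show "(\<integral>x. \<bar>\<zeta> x\<bar> * \<bar>u (x + h *\<^sub>R v) \<bullet> b - u x \<bullet> b\<bar> \<partial>lborel) \<le> h * (?I + B' * h * ?m)"
        using drift by (simp add: ennreal_le_iff integral_nonneg_AE)
    qed
    have bd: "\<bar>G x * \<zeta> y\<bar> \<le> C * B" for x y
      using mult_mono[OF G(2)[of x] B(2)[of y]] C by (simp add: abs_mult)
    have i1: "integrable lborel (\<lambda>x. G (h *\<^sub>R v + x) * \<zeta> x)" "integrable lborel (\<lambda>x. G x * \<zeta> x)"
      by (rule integrable_lborel_bounded_support[OF _ K(1) _ bd]; use K(3) in auto)+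
    have i2: "integrable lborel (\<lambda>x. G x * \<zeta> (x - h *\<^sub>R v))"
    proof (rule integrable_lborel_bounded_support[OF _ _ _ bd])
      show "compact ((+) (h *\<^sub>R v) ` K)" using K(1) by (rule compact_translation)
      show "G x * \<zeta> (x - h *\<^sub>R v) = 0" if "x \<notin> (+) (h *\<^sub>R v) ` K" for x
      proof -
        have "x - h *\<^sub>R v \<notin> K" using that by (metis add.commute diff_add_cancel imageI)
        then show ?thesis using K(3) by simp
      qed
    qed measurable
    have "(\<integral>x. G x * (\<zeta> (x - h *\<^sub>R v) - \<zeta> x) \<partial>lborel) = (\<integral>x. G x * \<zeta> (x - h *\<^sub>R v) \<partial>lborel) - (\<integral>x. G x * \<zeta> x \<partial>lborel)"
      using i1 i2 by (simp add: right_diff_distrib)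
    also have "(\<integral>x. G x * \<zeta> (x - h *\<^sub>R v) \<partial>lborel) = (\<integral>x. G (h *\<^sub>R v + x) * \<zeta> x \<partial>lborel)"
      using lborel_integral_translate[of "\<lambda>x. G x * \<zeta> (x - h *\<^sub>R v)" "h *\<^sub>R v"] by simp
    also have "\<dots> - (\<integral>x. G x * \<zeta> x \<partial>lborel) = (\<integral>x. (G (x + h *\<^sub>R v) - G x) * \<zeta> x \<partial>lborel)"
      using i1 by (subst Bochner_Integration.integral_diff[symmetric]) (auto simp: left_diff_distrib add.commute)
    finally have "\<bar>\<integral>x. G x * (\<zeta> (x - h *\<^sub>R v) - \<zeta> x) \<partial>lborel\<bar> \<le> (\<integral>x. \<bar>(G (x + h *\<^sub>R v) - G x) * \<zeta> x\<bar> \<partial>lborel)"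
      using integral_abs_bound[of lborel "\<lambda>x. (G (x + h *\<^sub>R v) - G x) * \<zeta> x"] by simp
    also have "\<dots> \<le> (\<integral>x. L * (\<Sum>b\<in>Basis. \<bar>\<zeta> x\<bar> * \<bar>u (x + h *\<^sub>R v) \<bullet> b - u x \<bullet> b\<bar>) \<partial>lborel)"
    proof (rule integral_mono')
      show "integrable lborel (\<lambda>x. L * (\<Sum>b\<in>Basis. \<bar>\<zeta> x\<bar> * \<bar>u (x + h *\<^sub>R v) \<bullet> b - u x \<bullet> b\<bar>))"
        using idiff by (intro integrable_mult_right Bochner_Integration.integrable_sum)
      fix x
      have "\<bar>G (x + h *\<^sub>R v) - G x\<bar> \<le> L * (\<Sum>b\<in>Basis. \<bar>(u (x + h *\<^sub>R v) - u x) \<bullet> b\<bar>)"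
        using G(3)[of "x + h *\<^sub>R v" x] mult_left_mono[OF norm_le_l1[of "u (x + h *\<^sub>R v) - u x"] G(4)] by linarith
      then have "\<bar>\<zeta> x\<bar> * \<bar>G (x + h *\<^sub>R v) - G x\<bar> \<le> \<bar>\<zeta> x\<bar> * (L * (\<Sum>b\<in>Basis. \<bar>(u (x + h *\<^sub>R v) - u x) \<bullet> b\<bar>))"
        by (rule mult_left_mono) simp
      then show "\<bar>(G (x + h *\<^sub>R v) - G x) * \<zeta> x\<bar> \<le> L * (\<Sum>b\<in>Basis. \<bar>\<zeta> x\<bar> * \<bar>u (x + h *\<^sub>R v) \<bullet> b - u x \<bullet> b\<bar>)"
        by (simp add: abs_mult inner_diff_left sum_distrib_left mult_ac)
    qed (use G(4) in \<open>auto intro!: mult_nonneg_nonneg sum_nonneg\<close>)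
    also have "\<dots> = L * (\<Sum>b\<in>Basis. \<integral>x. \<bar>\<zeta> x\<bar> * \<bar>u (x + h *\<^sub>R v) \<bullet> b - u x \<bullet> b\<bar> \<partial>lborel)"
      using idiff by (subst Bochner_Integration.integral_mult_right_zero, subst Bochner_Integration.integral_sum) auto
    also have "\<dots> \<le> L * (\<Sum>b\<in>(Basis::'b set). h * (?I + B' * h * ?m))"
      using diff G(4) by (intro mult_left_mono sum_mono)
    also have "\<dots> = L * DIM('b) * (h * (?I + B' * h * ?m))" by (simp add: mult.assoc)
    finally show ?thesis .
  qed
  define h where "h n = d / 2 / real (Suc n)" for n
  have h: "0 < h n" "h n \<le> d / 2" for n
    using d(1) by (auto simp: h_def field_simps)
  have h0: "h \<longlonglongrightarrow> 0"
    using LIMSEQ_Suc[OF lim_const_over_n[of "d / 2"]] by (simp add: h_def[abs_def])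
  (* a compact set outside which all the difference quotients vanish *)
  define K'' where "K'' = (\<lambda>(x, y). x + y) ` (K \<times> cball 0 d)"
  have K'': "compact K''" unfolding K''_def case_prod_beta'
    by (intro compact_continuous_image continuous_intros compact_Times K(1) compact_cball)
  have K''I: "x \<in> K''" if "x - t *\<^sub>R v \<in> K" "0 \<le> t" "t \<le> d / 2" for x t
  proof -
    have "norm (t *\<^sub>R v) \<le> d" using mult_mono[OF that(3) v] that(2) d(1) by simp
    then show ?thesis unfolding K''_def using that(1) by (intro image_eqI[of _ _ "(x - t *\<^sub>R v, t *\<^sub>R v)"]) auto
  qed
  have lim: "(\<lambda>n. \<integral>x. G x * ((\<zeta> (x - h n *\<^sub>R v) - \<zeta> x) / h n) \<partial>lborel)
      \<longlonglongrightarrow> (\<integral>x. G x * (- frechet_derivative \<zeta> (at x) v) \<partial>lborel)"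
  proof (rule integral_dominated_convergence[where w = "\<lambda>x. C * B' * indicator K'' x"])
    show "integrable lborel (\<lambda>x. C * B' * indicator K'' x)"
      using K'' emeasure_compact_finite[OF K''] by (auto intro!: integrable_real_indicator simp: compact_imp_closed)
    show "AE x in lborel. (\<lambda>n. G x * ((\<zeta> (x - h n *\<^sub>R v) - \<zeta> x) / h n)) \<longlonglongrightarrow> G x * (- frechet_derivative \<zeta> (at x) v)"
    proof (rule AE_I2, rule tendsto_mult_left)
      fix x
      have "((\<lambda>t. \<zeta> (x + t *\<^sub>R (- v))) has_real_derivative frechet_derivative \<zeta> (at (x + 0 *\<^sub>R (- v))) (- v)) (at 0)"
        by (rule test_line_derivative[OF \<zeta>])
      then have D: "((\<lambda>t. (\<zeta> (x - t *\<^sub>R v) - \<zeta> x) / t) \<longlongrightarrow> - frechet_derivative \<zeta> (at x) v) (at 0)"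
        by (simp add: DERIV_def linear_neg[OF test_derivative_linear[OF \<zeta>]])
      have "filterlim h (at 0) sequentially"
        unfolding filterlim_at using h0 h(1) by (auto simp: less_imp_neq[symmetric])
      from filterlim_compose[OF D this]
      show "(\<lambda>n. (\<zeta> (x - h n *\<^sub>R v) - \<zeta> x) / h n) \<longlonglongrightarrow> - frechet_derivative \<zeta> (at x) v" .
    qed
    show "AE x in lborel. norm (G x * ((\<zeta> (x - h n *\<^sub>R v) - \<zeta> x) / h n)) \<le> C * B' * indicator K'' x" for n
    proof (rule AE_I2)
      fix x
      show "norm (G x * ((\<zeta> (x - h n *\<^sub>R v) - \<zeta> x) / h n)) \<le> C * B' * indicator K'' x"
      proof (cases "x \<in> K''")
        case True
        have "\<bar>\<zeta> (x - h n *\<^sub>R v) - \<zeta> x\<bar> / h n \<le> B'"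
          using Lip[of x "- h n"] h(1)[of n] by (simp add: divide_le_eq)
        then have "\<bar>G x\<bar> * (\<bar>\<zeta> (x - h n *\<^sub>R v) - \<zeta> x\<bar> / h n) \<le> C * B'"
          using G(2) C h(1)[of n] by (intro mult_mono) auto
        then show ?thesis using True h(1)[of n] by (simp add: abs_mult)
      next
        case False
        then have "\<zeta> (x - h n *\<^sub>R v) = 0" "\<zeta> x = 0"
          using K''I[of x "h n"] K''I[of x 0] K(3) h[of n] d(1) by auto
        then show ?thesis using False by simp
      qed
    qed
  qed auto
  have lim2: "(\<lambda>n. \<bar>\<integral>x. G x * ((\<zeta> (x - h n *\<^sub>R v) - \<zeta> x) / h n) \<partial>lborel\<bar>)
      \<longlonglongrightarrow> \<bar>\<integral>x. G x * frechet_derivative \<zeta> (at x) v \<partial>lborel\<bar>"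
    using tendsto_rabs[OF lim] by simp
  have bound: "\<bar>\<integral>x. G x * ((\<zeta> (x - h n *\<^sub>R v) - \<zeta> x) / h n) \<partial>lborel\<bar> \<le> L * DIM('b) * (?I + B' * h n * ?m)" for n
  proof -
    have "\<bar>\<integral>x. G x * ((\<zeta> (x - h n *\<^sub>R v) - \<zeta> x) / h n) \<partial>lborel\<bar> = \<bar>\<integral>x. G x * (\<zeta> (x - h n *\<^sub>R v) - \<zeta> x) \<partial>lborel\<bar> / h n"
      using h(1)[of n] by simp
    also have "\<dots> \<le> (L * DIM('b) * (h n * (?I + B' * h n * ?m))) / h n"
      using quotient[OF h(1) h(2)] h(1)[of n] by (intro divide_right_mono) auto
    also have "\<dots> = L * DIM('b) * (?I + B' * h n * ?m)" using h(1)[of n] by simp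
    finally show ?thesis .
  qed
  have "(\<lambda>n. L * DIM('b) * (?I + B' * h n * ?m)) \<longlonglongrightarrow> L * DIM('b) * (?I + B' * 0 * ?m)"
    by (intro tendsto_intros h0)
  from LIMSEQ_le[OF lim2 this] bound show ?thesis by auto
qed

section \<open>The steep entropies\<close>

lemma interval_integral_from_0:
  fixes G g :: "real \<Rightarrow> 'a::euclidean_space"
  assumes "\<And>x. (G has_vector_derivative g x) (at x)" "continuous_on UNIV g"
  shows "(LBINT s=0..ereal t. g s) = G t - G 0"
  using interval_integral_FTC_finite[of 0 t g G] assms
  by (auto intro: continuous_on_subset has_vector_derivative_at_within simp: zero_ereal_def)

lemma sin_cos_add_periods:
  "sin (x + of_int k * (2 * pi)) = sin x" "cos (x + of_int k * (2 * pi)) = cos x"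
  using sin.plus_of_int[of x k] cos.plus_of_int[of x k] by simp_all

text \<open>This is \<open>P (- cos (2 * (t - \<theta>)))\<close> for the cubic \<open>P x = x - (1 - x)\<^sup>2 * (1 + x) / 4\<close>, expanded into harmonics
(\<open>steep_entropy_polynomial\<close>). The cubic fixes \<open>1\<close> and \<open>-1\<close>, and the correction is chosen so that the jump of \<open>\<Phi>\<close> increases
while the values stay in \<open>[-1, 1]\<close>.\<close>

definition steep_entropy :: "real \<Rightarrow> real \<Rightarrow> real" where
  "steep_entropy \<theta> t = - 1/8 - 17/16 * cos (2 * (t - \<theta>)) + 1/8 * cos (4 * (t - \<theta>)) + 1/16 * cos (6 * (t - \<theta>))"

lemma steep_entropy_polynomial:
  fixes \<theta> t :: real
  defines "x \<equiv> - cos (2 * (t - \<theta>))"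
  shows "steep_entropy \<theta> t = x - (1 - x)\<^sup>2 * (1 + x) / 4"
proof -
  let ?u = "2 * (t - \<theta>)"
  have "cos (4 * (t - \<theta>)) = 2 * (cos ?u)\<^sup>2 - 1"
    using cos_double_cos[of ?u] by (simp add: algebra_simps)
  moreover have "cos (6 * (t - \<theta>)) = 4 * (cos ?u)^3 - 3 * cos ?u"
    using cos_treble_cos[of ?u] by (simp add: algebra_simps)
  ultimately show ?thesis
    unfolding steep_entropy_def x_def by (simp add: field_simps power2_eq_square power3_eq_cube)
qed

lemma abs_steep_entropy_le_1: "\<bar>steep_entropy \<theta> t\<bar> \<le> 1"
proof -
  define x where "x = - cos (2 * (t - \<theta>))"
  have x: "-1 \<le> x" "x \<le> 1" by (auto simp: x_def)
  have "0 \<le> (1 - x)\<^sup>2 * (1 + x)" using x by simp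
  moreover have "x - (1 - x)\<^sup>2 * (1 + x) / 4 + 1 = (1 + x) * ((3 - x) * (1 + x)) / 4"
    by (simp add: field_simps power2_eq_square)
  moreover have "0 \<le> (1 + x) * ((3 - x) * (1 + x)) / 4" using x by simp
  ultimately show ?thesis
    using x unfolding steep_entropy_polynomial x_def[symmetric] by linarith
qed

lemma steep_entropy_C0_per: "steep_entropy \<theta> \<in> C0_per"
proof -
  have "cos (2 * (t + 2 * pi - \<theta>)) = cos (2 * (t - \<theta>))" "cos (4 * (t + 2 * pi - \<theta>)) = cos (4 * (t - \<theta>))"
    "cos (6 * (t + 2 * pi - \<theta>)) = cos (6 * (t - \<theta>))" for t
  proof -
    have "2 * (t + 2 * pi - \<theta>) = 2 * (t - \<theta>) + of_int 2 * (2 * pi)"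
         "4 * (t + 2 * pi - \<theta>) = 4 * (t - \<theta>) + of_int 4 * (2 * pi)"
         "6 * (t + 2 * pi - \<theta>) = 6 * (t - \<theta>) + of_int 6 * (2 * pi)" by (simp_all add: algebra_simps)
    then show "cos (2 * (t + 2 * pi - \<theta>)) = cos (2 * (t - \<theta>))" "cos (4 * (t + 2 * pi - \<theta>)) = cos (4 * (t - \<theta>))"
      "cos (6 * (t + 2 * pi - \<theta>)) = cos (6 * (t - \<theta>))"
      by (simp_all only: sin_cos_add_periods)
  qed
  then show ?thesis
    by (auto simp: C0_per_def steep_entropy_def intro!: continuous_intros)
qed

text \<open>The harmonics \<open>2\<close>, \<open>4\<close>, \<open>6\<close> are orthogonal to \<open>1\<close>, \<open>cos\<close> and \<open>sin\<close>, so only the mean \<open>-1/8\<close> is removed.\<close>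

lemma steep_entropy_tilde: "f_tilde (steep_entropy \<theta>) t = steep_entropy \<theta> t + 1/8"
proof -
  have cont: "continuous_on UNIV (steep_entropy \<theta>)"
    unfolding steep_entropy_def[abs_def] by (intro continuous_intros)
  have per: "sin (of_int k * (2 * pi) + c) = sin c" "cos (of_int k * (2 * pi) + c) = cos c" for k c
    using sin_cos_add_periods[of c k] by (simp_all add: add.commute)
  have mean: "(LBINT s=0..2*pi. steep_entropy \<theta> s) = - 1/8 * (2 * pi)"
  proof -
    define G where "G s = - 1/8 * s - 17/32 * sin (2 * (s - \<theta>)) + 1/32 * sin (4 * (s - \<theta>)) + 1/96 * sin (6 * (s - \<theta>))" for s
    have "(LBINT s=0..ereal (2*pi). steep_entropy \<theta> s) = G (2 * pi) - G 0"
    proof (rule interval_integral_from_0[OF _ cont])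
      show "(G has_vector_derivative steep_entropy \<theta> s) (at s)" for s
        unfolding has_real_derivative_iff_has_vector_derivative[symmetric] G_def[abs_def] steep_entropy_def
        by (auto intro!: derivative_eq_intros)
    qed
    also have "\<dots> = - 1/8 * (2 * pi)"
    proof -
      have "2 * (2 * pi - \<theta>) = of_int 2 * (2 * pi) + 2 * (0 - \<theta>)" "4 * (2 * pi - \<theta>) = of_int 4 * (2 * pi) + 4 * (0 - \<theta>)"
        "6 * (2 * pi - \<theta>) = of_int 6 * (2 * pi) + 6 * (0 - \<theta>)" by (simp_all add: algebra_simps)
      then show ?thesis unfolding G_def by (simp only: per)
    qed
    finally show ?thesis by simp
  qed
  (* A n and B n are primitives of cos (2n(s - \<theta>)) cos s and cos (2n(s - \<theta>)) sin s *)
  define A where "A n s = (sin ((2 * n + 1) * s - 2 * n * \<theta>) / (2 * n + 1) + sin ((2 * n - 1) * s - 2 * n * \<theta>) / (2 * n - 1)) / 2" for n s :: real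
  define B where "B n s = (- cos ((2 * n + 1) * s - 2 * n * \<theta>) / (2 * n + 1) + cos ((2 * n - 1) * s - 2 * n * \<theta>) / (2 * n - 1)) / 2" for n s :: real
  have DA: "(A n has_real_derivative cos (2 * n * (s - \<theta>)) * cos s) (at s)" if "n \<ge> 1" for n s
  proof -
    have "(A n has_real_derivative (cos ((2 * n + 1) * s - 2 * n * \<theta>) + cos ((2 * n - 1) * s - 2 * n * \<theta>)) / 2) (at s)"
      unfolding A_def[abs_def] using that by (auto intro!: derivative_eq_intros)
    also have "(cos ((2 * n + 1) * s - 2 * n * \<theta>) + cos ((2 * n - 1) * s - 2 * n * \<theta>)) / 2 = cos (2 * n * (s - \<theta>)) * cos s"
      unfolding cos_times_cos by (simp add: algebra_simps)
    finally show ?thesis .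
  qed
  have DB: "(B n has_real_derivative cos (2 * n * (s - \<theta>)) * sin s) (at s)" if "n \<ge> 1" for n s
  proof -
    have "(B n has_real_derivative (sin ((2 * n + 1) * s - 2 * n * \<theta>) - sin ((2 * n - 1) * s - 2 * n * \<theta>)) / 2) (at s)"
      unfolding B_def[abs_def] using that by (auto intro!: derivative_eq_intros)
    also have "(sin ((2 * n + 1) * s - 2 * n * \<theta>) - sin ((2 * n - 1) * s - 2 * n * \<theta>)) / 2 = cos (2 * n * (s - \<theta>)) * sin s"
      unfolding cos_times_sin by (simp add: algebra_simps)
    finally show ?thesis .
  qed
  have AB: "A (of_int n) (2 * pi) = A (of_int n) 0" "B (of_int n) (2 * pi) = B (of_int n) 0" for n
  proof -
    have "(2 * of_int n + 1) * (2 * pi) - 2 * of_int n * \<theta> = of_int (2 * n + 1) * (2 * pi) + ((2 * of_int n + 1) * 0 - 2 * of_int n * \<theta>)"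
      "(2 * of_int n - 1) * (2 * pi) - 2 * of_int n * \<theta> = of_int (2 * n - 1) * (2 * pi) + ((2 * of_int n - 1) * 0 - 2 * of_int n * \<theta>)"
      by (simp_all add: algebra_simps)
    then show "A (of_int n) (2 * pi) = A (of_int n) 0" "B (of_int n) (2 * pi) = B (of_int n) 0"
      unfolding A_def B_def by (simp_all only: per)
  qed
  have fc: "(LBINT s=0..2*pi. steep_entropy \<theta> s * cos s) = 0"
  proof -
    define G where "G s = - 1/8 * sin s - 17/16 * A 1 s + 1/8 * A 2 s + 1/16 * A 3 s" for s
    have "(LBINT s=0..ereal (2*pi). steep_entropy \<theta> s * cos s) = G (2 * pi) - G 0"
    proof (rule interval_integral_from_0)
      show "(G has_vector_derivative steep_entropy \<theta> s * cos s) (at s)" for s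
        unfolding has_real_derivative_iff_has_vector_derivative[symmetric] G_def[abs_def] steep_entropy_def
        by (rule derivative_eq_intros DA refl | simp add: algebra_simps)+
    qed (intro continuous_intros cont)
    also have "\<dots> = 0" using AB(1)[of 1] AB(1)[of 2] AB(1)[of 3] by (simp add: G_def)
    finally show ?thesis by simp
  qed
  have fs: "(LBINT s=0..2*pi. steep_entropy \<theta> s * sin s) = 0"
  proof -
    define G where "G s = 1/8 * cos s - 17/16 * B 1 s + 1/8 * B 2 s + 1/16 * B 3 s" for s
    have "(LBINT s=0..ereal (2*pi). steep_entropy \<theta> s * sin s) = G (2 * pi) - G 0"
    proof (rule interval_integral_from_0)
      show "(G has_vector_derivative steep_entropy \<theta> s * sin s) (at s)" for s
        unfolding has_real_derivative_iff_has_vector_derivative[symmetric] G_def[abs_def] steep_entropy_def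
        by (rule derivative_eq_intros DB refl | simp add: algebra_simps)+
    qed (intro continuous_intros cont)
    also have "\<dots> = 0" using AB(2)[of 1] AB(2)[of 2] AB(2)[of 3] by (simp add: G_def)
    finally show ?thesis by simp
  qed
  show ?thesis unfolding f_tilde_def mean fc fs by simp
qed

text \<open>The constant of integration that makes \<open>psi (steep_entropy \<theta>)\<close> vanish at \<open>0\<close>. It contributes to \<open>\<Phi>\<close> a multiple of the identity,
which is invisible for tangential jumps.\<close>

definition steep_constant :: "real \<Rightarrow> real" where
  "steep_constant \<theta> = - 17/32 * sin (2 * \<theta>) + 1/32 * sin (4 * \<theta>) + 1/96 * sin (6 * \<theta>)"

lemma steep_entropy_psi:
  "psi (steep_entropy \<theta>) t = - 17/32 * sin (2 * (t - \<theta>)) + 1/32 * sin (4 * (t - \<theta>)) + 1/96 * sin (6 * (t - \<theta>))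
      + steep_constant \<theta>"
proof -
  define G where "G s = - 17/32 * sin (2 * (s - \<theta>)) + 1/32 * sin (4 * (s - \<theta>)) + 1/96 * sin (6 * (s - \<theta>))" for s
  have "(LBINT s=0..ereal t. f_tilde (steep_entropy \<theta>) s) = G t - G 0"
  proof (rule interval_integral_from_0)
    show "(G has_vector_derivative f_tilde (steep_entropy \<theta>) s) (at s)" for s
      unfolding has_real_derivative_iff_has_vector_derivative[symmetric] G_def[abs_def] steep_entropy_tilde steep_entropy_def
      by (auto intro!: derivative_eq_intros)
    show "continuous_on UNIV (f_tilde (steep_entropy \<theta>))"
      unfolding steep_entropy_tilde[abs_def] steep_entropy_def by (intro continuous_intros)
  qed
  then show ?thesis by (simp add: psi_def G_def steep_constant_def)
qed

text \<open>The map \<open>\<Phi>\<close> of \<open>steep_entropy \<theta>\<close> in the rotated coordinate \<open>E = exp (\<i> (t - \<theta>))\<close> on the unit circle.\<close>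

definition steep_map :: "real \<Rightarrow> complex \<Rightarrow> complex" where
  "steep_map k E = - 2 * of_real k * E + \<i> * (17/32 * (E^3 / 3 + cnj E) + 1/32 * (E^5 / 5 + cnj E ^ 3 / 3)
      - 1/96 * (E^7 / 7 + cnj E ^ 5 / 5))"

text \<open>In exponentials, \<open>psi (steep_entropy \<theta>) t * \<i> * exp (\<i> t)\<close> is a finite sum of odd powers of \<open>E\<close>, which is integrated term by
term. The shifts by \<open>\<pi>/2\<close> multiply odd powers of \<open>E\<close> by \<open>\<plusminus>\<i>\<close>.\<close>

lemma Phi_steep_entropy_exp:
  "Phi (steep_entropy \<theta>) (exp (\<i> * of_real t)) =
     exp (\<i> * of_real \<theta>) * steep_map (steep_constant \<theta>) (exp (\<i> * of_real (t - \<theta>)))"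
proof -
  let ?k = "steep_constant \<theta>"
  define w where "w = exp (\<i> * complex_of_real \<theta>)"
  define e where "e m s = exp (\<i> * complex_of_real (m * (s - \<theta>)))" for m s
  (* a primitive of psi times \<i> exp (\<i> s) *)
  define H where "H s = of_real ?k * w * e 1 s
     + w * (- 17/64 * (e 3 s / (3 * \<i>) + e (- 1) s / \<i>)
     + 1/64 * (e 5 s / (5 * \<i>) + e (- 3) s / (3 * \<i>))
     + 1/192 * (e 7 s / (7 * \<i>) + e (- 5) s / (5 * \<i>)))" for s
  have De: "(e m has_vector_derivative \<i> * of_real m * e m s) (at s)" for m s
  proof -
    have "((\<lambda>z. exp (\<i> * (of_real m * (z - of_real \<theta>)))) has_field_derivative
        \<i> * of_real m * exp (\<i> * (of_real m * (of_real s - of_real \<theta>)))) (at (of_real s))"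
      by (auto intro!: derivative_eq_intros)
    from has_vector_derivative_real_field[OF this] show ?thesis
      by (simp add: e_def[abs_def])
  qed
  have e_mult: "e a s * e b s = e (a + b) s" for a b s
    by (simp add: e_def exp_add[symmetric] algebra_simps)
  have sin_e: "complex_of_real (sin (m * (s - \<theta>))) = (e m s - e (- m) s) / (2 * \<i>)" for m s
    by (simp add: e_def sin_exp_eq flip: sin_of_real)
  have exp_e: "exp (\<i> * complex_of_real s) = w * e 1 s" for s
    by (simp add: w_def e_def exp_add[symmetric] algebra_simps)
  have psi: "of_real (psi (steep_entropy \<theta>) s) * (\<i> * exp (\<i> * of_real s)) =
     of_real ?k * w * (\<i> * e 1 s) + w * (- 17/64 * (e 3 s - e (- 1) s) + 1/64 * (e 5 s - e (- 3) s) + 1/192 * (e 7 s - e (- 5) s))" for s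
  proof -
    have "of_real (psi (steep_entropy \<theta>) s) * (\<i> * exp (\<i> * of_real s)) =
       of_real ?k * w * (\<i> * e 1 s) + w * (- 17/64 * (e 2 s * e 1 s - e (- 2) s * e 1 s)
          + 1/64 * (e 4 s * e 1 s - e (- 4) s * e 1 s) + 1/192 * (e 6 s * e 1 s - e (- 6) s * e 1 s))"
      unfolding steep_entropy_psi of_real_add of_real_mult sin_e exp_e by (simp add: field_simps)
    then show ?thesis by (simp add: e_mult)
  qed
  have phi: "phi (steep_entropy \<theta>) t = H t - H 0" for t
  proof -
    have "(LBINT s=0..ereal t. of_real (psi (steep_entropy \<theta>) s) * (\<i> * exp (\<i> * of_real s))) = H t - H 0"
    proof (rule interval_integral_from_0)
      show "(H has_vector_derivative of_real (psi (steep_entropy \<theta>) s) * (\<i> * exp (\<i> * of_real s))) (at s)" for s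
        unfolding psi H_def[abs_def] divide_inverse
        by (rule has_vector_derivative_eq_rhs,
            (rule has_vector_derivative_diff has_vector_derivative_add has_vector_derivative_mult_left
              has_vector_derivative_mult_right De)+)
           (simp add: field_simps)
      show "continuous_on UNIV (\<lambda>s. of_real (psi (steep_entropy \<theta>) s) * (\<i> * exp (\<i> * complex_of_real s)))"
        unfolding steep_entropy_psi[abs_def] by (intro continuous_intros)
    qed
    then show ?thesis by (simp add: phi_def)
  qed
  have e_powers: "e 3 s = e 1 s ^ 3" "e 5 s = e 1 s ^ 5" "e 7 s = e 1 s ^ 7"
    "e (- 3) s = e (- 1) s ^ 3" "e (- 5) s = e (- 1) s ^ 5" for s
    unfolding e_def exp_of_nat_mult[symmetric] by (simp_all add: algebra_simps)
  have shift: "e 1 (t + pi / 2) = \<i> * e 1 t" "e 1 (t - pi / 2) = - \<i> * e 1 t"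
    "e (- 1) (t + pi / 2) = - \<i> * e (- 1) t" "e (- 1) (t - pi / 2) = \<i> * e (- 1) t"
  proof -
    have p: "exp (\<i> * complex_of_real (pi / 2)) = \<i>" using cis_pi_half by (simp add: cis_conv_exp)
    have m: "exp (- (\<i> * complex_of_real (pi / 2))) = - \<i>" unfolding exp_minus p by simp
    have "\<i> * complex_of_real (1 * (t + pi / 2 - \<theta>)) = \<i> * complex_of_real (pi / 2) + \<i> * complex_of_real (1 * (t - \<theta>))"
      "\<i> * complex_of_real (1 * (t - pi / 2 - \<theta>)) = - (\<i> * complex_of_real (pi / 2)) + \<i> * complex_of_real (1 * (t - \<theta>))"
      "\<i> * complex_of_real (- 1 * (t + pi / 2 - \<theta>)) = - (\<i> * complex_of_real (pi / 2)) + \<i> * complex_of_real (- 1 * (t - \<theta>))"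
      "\<i> * complex_of_real (- 1 * (t - pi / 2 - \<theta>)) = \<i> * complex_of_real (pi / 2) + \<i> * complex_of_real (- 1 * (t - \<theta>))"
      by (simp_all add: algebra_simps)
    then show "e 1 (t + pi / 2) = \<i> * e 1 t" "e 1 (t - pi / 2) = - \<i> * e 1 t"
      "e (- 1) (t + pi / 2) = - \<i> * e (- 1) t" "e (- 1) (t - pi / 2) = \<i> * e (- 1) t"
      unfolding e_def by (simp_all only: exp_add p m)
  qed
  have cnj: "cnj (e 1 t) = e (- 1) t" unfolding e_def exp_cnj by (simp add: algebra_simps)
  have "Phi (steep_entropy \<theta>) (exp (\<i> * of_real t)) = - \<i> * H (t - pi / 2) + \<i> * H (t + pi / 2)"
    unfolding Phi_exp[OF steep_entropy_C0_per] phi by (simp add: algebra_simps)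
  also have "\<dots> = w * steep_map ?k (e 1 t)"
    unfolding H_def e_powers shift steep_map_def cnj by (simp add: eval_nat_numeral field_simps)
  finally show ?thesis by (simp add: w_def e_def)
qed

lemma Phi_steep_entropy:
  assumes "norm \<nu> = 1" "norm z = 1"
  shows "Phi (steep_entropy (Arg \<nu>)) z = \<nu> * steep_map (steep_constant (Arg \<nu>)) (z * cnj \<nu>)"
proof -
  have e: "exp (\<i> * of_real (Arg z)) = z" "exp (\<i> * of_real (Arg \<nu>)) = \<nu>"
    using assms Arg_eq[of z] Arg_eq[of \<nu>] by (cases "z = 0"; cases "\<nu> = 0"; simp)+
  have "exp (\<i> * of_real (Arg z - Arg \<nu>)) = z * cnj \<nu>"
  proof -
    have "exp (\<i> * of_real (Arg z - Arg \<nu>)) = exp (\<i> * of_real (Arg z)) * exp (cnj (\<i> * of_real (Arg \<nu>)))"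
      by (simp add: exp_add[symmetric] algebra_simps)
    then show ?thesis by (simp only: exp_cnj[symmetric] e)
  qed
  then show ?thesis using Phi_steep_entropy_exp[of "Arg \<nu>" "Arg z"] by (simp add: e)
qed

lemma abs_steep_constant: "\<bar>steep_constant \<theta>\<bar> \<le> 55/96"
  unfolding steep_constant_def
  using abs_sin_le_one[of "2 * \<theta>"] abs_sin_le_one[of "4 * \<theta>"] abs_sin_le_one[of "6 * \<theta>"]
  unfolding abs_le_iff by linarith

lemma steep_map_lipschitz:
  assumes "\<bar>k\<bar> \<le> 55/96" "norm a = 1" "norm b = 1"
  shows "norm (steep_map k a - steep_map k b) \<le> 3 * norm (a - b)"
proof -
  have p: "norm (a ^ m - b ^ m) \<le> m * norm (a - b)" "norm (cnj a ^ m - cnj b ^ m) \<le> m * norm (a - b)" for m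
    using norm_power_diff[of a b m] assms
    by (auto simp flip: complex_cnj_power complex_cnj_diff)
  have c1: "norm (cnj a - cnj b) = norm (a - b)" using complex_mod_cnj[of "a - b"] by simp
  let ?d = "norm (a - b)"
  have k: "norm (- 2 * of_real k * (a - b)) \<le> 55/48 * ?d"
    using mult_right_mono[OF assms(1), of ?d] by (simp add: norm_mult)
  have t: "norm ((\<i> * of_real c) * x) \<le> c * (m * ?d)" if "0 \<le> c" "norm x \<le> m * ?d" for c m :: real and x
    using mult_left_mono[OF that(2,1)] that(1) by (simp add: norm_mult)
  have t1: "norm ((\<i> * of_real (17/96)) * (a^3 - b^3)) \<le> 17/96 * (3 * ?d)" by (rule t) (use p(1)[of 3] in simp_all)
  have t2: "norm ((\<i> * of_real (17/32)) * (cnj a - cnj b)) \<le> 17/32 * (1 * ?d)" by (rule t) (use c1 in simp_all)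
  have t3: "norm ((\<i> * of_real (1/160)) * (a^5 - b^5)) \<le> 1/160 * (5 * ?d)" by (rule t) (use p(1)[of 5] in simp_all)
  have t4: "norm ((\<i> * of_real (1/96)) * (cnj a ^ 3 - cnj b ^ 3)) \<le> 1/96 * (3 * ?d)" by (rule t) (use p(2)[of 3] in simp_all)
  have t5: "norm ((\<i> * of_real (1/672)) * (b^7 - a^7)) \<le> 1/672 * (7 * ?d)"
    by (rule t) (use p(1)[of 7] in \<open>simp_all add: norm_minus_commute\<close>)
  have t6: "norm ((\<i> * of_real (1/480)) * (cnj b ^ 5 - cnj a ^ 5)) \<le> 1/480 * (5 * ?d)"
    by (rule t) (use p(2)[of 5] in \<open>simp_all add: norm_minus_commute\<close>)
  have eq: "steep_map k a - steep_map k b = - 2 * of_real k * (a - b)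
    + (\<i> * of_real (17/96)) * (a^3 - b^3) + (\<i> * of_real (17/32)) * (cnj a - cnj b)
    + (\<i> * of_real (1/160)) * (a^5 - b^5) + (\<i> * of_real (1/96)) * (cnj a ^ 3 - cnj b ^ 3)
    + (\<i> * of_real (1/672)) * (b^7 - a^7) + (\<i> * of_real (1/480)) * (cnj b ^ 5 - cnj a ^ 5)"
    by (simp add: steep_map_def field_simps)
  have "norm (steep_map k a - steep_map k b) \<le> 55/48 * ?d + 17/96 * (3 * ?d) + 17/32 * (1 * ?d) + 1/160 * (5 * ?d) + 1/96 * (3 * ?d)
      + 1/672 * (7 * ?d) + 1/480 * (5 * ?d)"
    unfolding eq by (rule norm_triangle_mono[OF norm_triangle_mono[OF norm_triangle_mono[OF norm_triangle_mono[OF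
          norm_triangle_mono[OF norm_triangle_mono[OF k t1] t2] t3] t4] t5] t6])
  also have "\<dots> = 55/24 * ?d" by (simp add: algebra_simps)
  also have "\<dots> \<le> 3 * ?d" by (rule mult_right_mono) auto
  finally show ?thesis .
qed

lemma Phi_steep_entropy_lipschitz:
  assumes "norm \<nu> = 1" "norm a = 1" "norm b = 1"
  shows "norm (Phi (steep_entropy (Arg \<nu>)) a - Phi (steep_entropy (Arg \<nu>)) b) \<le> 3 * norm (a - b)"
proof -
  have "norm (Phi (steep_entropy (Arg \<nu>)) a - Phi (steep_entropy (Arg \<nu>)) b)
     = norm (steep_map (steep_constant (Arg \<nu>)) (a * cnj \<nu>) - steep_map (steep_constant (Arg \<nu>)) (b * cnj \<nu>))"
    using assms by (simp add: Phi_steep_entropy right_diff_distrib[symmetric] norm_mult)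
  also have "\<dots> \<le> 3 * norm (a * cnj \<nu> - b * cnj \<nu>)"
    using assms by (intro steep_map_lipschitz abs_steep_constant) (auto simp: norm_mult)
  also have "norm (a * cnj \<nu> - b * cnj \<nu>) = norm (a - b)"
    using assms by (simp add: left_diff_distrib[symmetric] norm_mult)
  finally show ?thesis .
qed

lemma Im_powers_unit:
  assumes "c\<^sup>2 = 1 - s\<^sup>2"
  shows "Im (Complex c s ^ 3) = 3 * s - 4 * s^3"
    "Im (Complex c s ^ 5) = 5 * s - 20 * s^3 + 16 * s^5"
    "Im (Complex c s ^ 7) = 7 * s - 56 * s^3 + 112 * s^5 - 64 * s^7"
proof -
  define C where "C = c\<^sup>2"
  have C: "C = 1 - s\<^sup>2" using assms by (simp add: C_def)
  have 3: "Complex c s ^ 3 = Complex (c * (C - 3 * s\<^sup>2)) (s * (3 * C - s\<^sup>2))"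
    by (simp add: C_def complex_eq_iff power3_eq_cube power2_eq_square algebra_simps)
  have 2: "Complex c s ^ 2 = Complex (C - s\<^sup>2) (2 * c * s)"
    by (simp add: C_def complex_eq_iff power2_eq_square algebra_simps)
  have 5: "Complex c s ^ 5 = Complex (c * ((C - 3 * s\<^sup>2) * (C - s\<^sup>2) - 2 * s * (s * (3 * C - s\<^sup>2)))) (2 * s * (C * (C - 3 * s\<^sup>2)) + (s * (3 * C - s\<^sup>2)) * (C - s\<^sup>2))"
  proof -
    have "Complex c s ^ 5 = Complex c s ^ 3 * Complex c s ^ 2" by (simp flip: power_add)
    then show ?thesis unfolding 2 3 by (simp add: complex_eq_iff C_def power2_eq_square algebra_simps)
  qed
  have 7: "Im (Complex c s ^ 7) = 2 * s * (C * ((C - 3 * s\<^sup>2) * (C - s\<^sup>2) - 2 * s * (s * (3 * C - s\<^sup>2)))) + (2 * s * (C * (C - 3 * s\<^sup>2)) + (s * (3 * C - s\<^sup>2)) * (C - s\<^sup>2)) * (C - s\<^sup>2)"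
  proof -
    have "Complex c s ^ 7 = Complex c s ^ 5 * Complex c s ^ 2" by (simp flip: power_add)
    then show ?thesis unfolding 2 5 by (simp add: C_def power2_eq_square algebra_simps)
  qed
  show "Im (Complex c s ^ 3) = 3 * s - 4 * s^3"
    unfolding 3 C by (simp add: power2_eq_square power3_eq_cube algebra_simps)
  show "Im (Complex c s ^ 5) = 5 * s - 20 * s^3 + 16 * s^5"
    unfolding 5 C by (simp add: eval_nat_numeral algebra_simps)
  show "Im (Complex c s ^ 7) = 7 * s - 56 * s^3 + 112 * s^5 - 64 * s^7"
    unfolding 7 C by (simp add: eval_nat_numeral algebra_simps)
qed

text \<open>If \<open>a - b\<close> is orthogonal to \<open>\<nu>\<close>, then \<open>a\<close> and \<open>b\<close> are mirror images, i.e. \<open>E\<close> and \<open>cnj E\<close> in the rotated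
coordinate. With \<open>s = Im E\<close> one has \<open>\<bar>a - b\<bar> = 2 \<bar>s\<bar>\<close>, and the normal jump is \<open>s\<^sup>3 (3/2 + s\<^sup>2/15 - 4 s\<^sup>4/21)\<close>. The
bracket is smallest at \<open>\<bar>s\<bar> = 1\<close>, where it equals \<open>289/210\<close>. The entropy \<open>- cos (2 * (t - \<theta>))\<close> has the normal jump
\<open>4/3 s\<^sup>3\<close>, which corresponds to the density \<open>\<bar>a - b\<bar>\<^sup>3/6\<close>.\<close>

lemma steep_entropy_jump:
  assumes \<nu>: "norm \<nu> = 1" and ab: "norm a = 1" "norm b = 1" "(a - b) \<bullet> \<nu> = 0" "a \<noteq> b"
  shows "289/280 * (1/6 * norm (a - b) ^ 3) \<le> \<bar>(Phi (steep_entropy (Arg \<nu>)) a - Phi (steep_entropy (Arg \<nu>)) b) \<bullet> \<nu>\<bar>"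
proof -
  let ?k = "steep_constant (Arg \<nu>)"
  define E F where "E = a * cnj \<nu>" and "F = b * cnj \<nu>"
  have nn: "cnj \<nu> * \<nu> = 1" using \<nu> by (simp add: complex_norm_square[symmetric] mult.commute[of "cnj \<nu>"])
  have inner: "x \<bullet> \<nu> = Re (x * cnj \<nu>)" for x by (simp add: inner_complex_def)
  have EF: "norm E = 1" "norm F = 1" using ab \<nu> by (auto simp: E_def F_def norm_mult)
  have "Re E = Re F" using ab(3) by (simp add: inner E_def F_def left_diff_distrib)
  moreover have "E \<noteq> F" using ab(4) \<nu> by (auto simp: E_def F_def)
  moreover have "(Re E)\<^sup>2 + (Im E)\<^sup>2 = 1" "(Re F)\<^sup>2 + (Im F)\<^sup>2 = 1"
    using EF by (simp_all add: cmod_def)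
  ultimately have "(Im E)\<^sup>2 = (Im F)\<^sup>2" "Im E \<noteq> Im F" "Re E = Re F" and E2: "(Re E)\<^sup>2 = 1 - (Im E)\<^sup>2"
    by (auto simp: complex_eq_iff)
  then have F: "F = cnj E" by (auto simp: complex_eq_iff power2_eq_iff)
  define c s where "c = Re E" and "s = Im E"
  have Ecs: "E = Complex c s" by (simp add: c_def s_def)
  have s1: "s\<^sup>2 \<le> 1" using E2 by (simp add: s_def) (metis diff_ge_0_iff_ge zero_le_power2)
  have norm_ab: "norm (a - b) = 2 * \<bar>s\<bar>"
  proof -
    have "norm (a - b) = norm ((a - b) * cnj \<nu>)" using \<nu> by (simp add: norm_mult)
    also have "(a - b) * cnj \<nu> = E - cnj E" using F by (simp add: E_def F_def left_diff_distrib)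
    also have "norm \<dots> = 2 * \<bar>s\<bar>" by (simp add: complex_diff_cnj s_def norm_mult)
    finally show ?thesis .
  qed
  have im: "Re (\<i> * (17/32 * (E^3 / 3 + cnj E) + 1/32 * (E^5 / 5 + cnj E ^ 3 / 3) - 1/96 * (E^7 / 7 + cnj E ^ 5 / 5)))
    = - (17/32 * (Im (E^3) / 3 - Im E) + 1/32 * (Im (E^5) / 5 - Im (E^3) / 3) - 1/96 * (Im (E^7) / 7 - Im (E^5) / 5))"
    by (simp flip: complex_cnj_power)
  have im': "Re (\<i> * (17/32 * (cnj E^3 / 3 + E) + 1/32 * (cnj E^5 / 5 + E ^ 3 / 3) - 1/96 * (cnj E^7 / 7 + E ^ 5 / 5)))
    = 17/32 * (Im (E^3) / 3 - Im E) + 1/32 * (Im (E^5) / 5 - Im (E^3) / 3) - 1/96 * (Im (E^7) / 7 - Im (E^5) / 5)"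
    by (simp flip: complex_cnj_power) (simp add: field_simps)
  have "(Phi (steep_entropy (Arg \<nu>)) a - Phi (steep_entropy (Arg \<nu>)) b) \<bullet> \<nu>
      = Re (steep_map ?k E - steep_map ?k (cnj E))"
  proof -
    have "(Phi (steep_entropy (Arg \<nu>)) a - Phi (steep_entropy (Arg \<nu>)) b) * cnj \<nu>
       = (cnj \<nu> * \<nu>) * (steep_map ?k E - steep_map ?k F)"
      using \<nu> ab by (simp add: Phi_steep_entropy E_def F_def algebra_simps)
    then show ?thesis by (simp add: inner nn F)
  qed
  also have "\<dots> = - 2 * (17/32 * (Im (E^3) / 3 - Im E) + 1/32 * (Im (E^5) / 5 - Im (E^3) / 3) - 1/96 * (Im (E^7) / 7 - Im (E^5) / 5))"
  proof -
    have r1: "Re (steep_map ?k E) = - 2 * ?k * Re E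
        - (17/32 * (Im (E^3) / 3 - Im E) + 1/32 * (Im (E^5) / 5 - Im (E^3) / 3) - 1/96 * (Im (E^7) / 7 - Im (E^5) / 5))"
      unfolding steep_map_def plus_complex.sel im by simp
    have r2: "Re (steep_map ?k (cnj E)) = - 2 * ?k * Re E
        + (17/32 * (Im (E^3) / 3 - Im E) + 1/32 * (Im (E^5) / 5 - Im (E^3) / 3) - 1/96 * (Im (E^7) / 7 - Im (E^5) / 5))"
      unfolding steep_map_def complex_cnj_cnj plus_complex.sel im' by simp
    have "p - q = - 2 * x" if "p = r - x" "q = r + x" for p q r x :: real using that by simp
    from this[OF r1 r2] show ?thesis by simp
  qed
  also have "\<dots> = s^3 * (3/2 + s\<^sup>2 / 15 - 4/21 * (s\<^sup>2)\<^sup>2)"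
  proof -
    have cs: "c\<^sup>2 = 1 - s\<^sup>2" using E2 by (simp add: c_def s_def)
    show ?thesis unfolding Ecs Im_powers_unit[OF cs] by (simp add: eval_nat_numeral field_simps)
  qed
  finally have eq: "(Phi (steep_entropy (Arg \<nu>)) a - Phi (steep_entropy (Arg \<nu>)) b) \<bullet> \<nu> = s^3 * (3/2 + s\<^sup>2 / 15 - 4/21 * (s\<^sup>2)\<^sup>2)" .
  have "289/210 \<le> 3/2 + x / 15 - 4/21 * x\<^sup>2" if "0 \<le> x" "x \<le> 1" for x :: real
  proof -
    have "3/2 + x / 15 - 4/21 * x\<^sup>2 - 289/210 = (1 - x) * (26/210 + 4/21 * x)"
      by (simp add: field_simps power2_eq_square)
    moreover have "0 \<le> (1 - x) * (26/210 + 4/21 * x)" using that by simp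
    ultimately show ?thesis by linarith
  qed
  from this[of "s\<^sup>2"] s1 have ge: "289/210 \<le> 3/2 + s\<^sup>2 / 15 - 4/21 * (s\<^sup>2)\<^sup>2" by simp
  have "289/280 * (1/6 * norm (a - b) ^ 3) = \<bar>s\<bar>^3 * (289/210)"
    unfolding norm_ab by (simp add: power_mult_distrib)
  also have "\<dots> \<le> \<bar>s\<bar>^3 * (3/2 + s\<^sup>2 / 15 - 4/21 * (s\<^sup>2)\<^sup>2)" using ge by (intro mult_left_mono) auto
  also have "\<dots> = \<bar>s^3 * (3/2 + s\<^sup>2 / 15 - 4/21 * (s\<^sup>2)\<^sup>2)\<bar>" using ge by (simp add: abs_mult power_abs)
  finally show ?thesis unfolding eq .
qed

section \<open>Least upper bounds of measures and Hausdorff measure\<close>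

lemma measure_lub_upper:
  assumes "\<alpha> \<in> I" "E \<in> sets borel"
  shows "\<mu> \<alpha> E \<le> measure_lub I \<mu> E"
proof -
  have "(\<Sum>\<^sub>\<infinity>\<beta>\<in>{\<alpha>}. \<mu> \<beta> ((\<lambda>_. E) \<beta>)) \<le> measure_lub I \<mu> E"
    unfolding measure_lub_def
    by (rule SUP_upper2[of "({\<alpha>}, \<lambda>_. E)"]) (use assms in \<open>auto simp: disjoint_family_on_def\<close>)
  then show ?thesis by simp
qed

lemma measure_lub_mono_index:
  assumes "I \<subseteq> J" shows "measure_lub I \<mu> E \<le> measure_lub J \<mu> E"
  unfolding measure_lub_def by (rule SUP_subset_mono[OF _ order_refl]) (use assms in blast)

lemma measure_lub_le:
  assumes M: "sets M = sets borel" and E: "E \<in> sets borel" "E \<subseteq> \<Omega>"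
    and le: "\<And>\<alpha> X. \<alpha> \<in> I \<Longrightarrow> X \<in> sets borel \<Longrightarrow> X \<subseteq> \<Omega> \<Longrightarrow> \<mu> \<alpha> X \<le> c * emeasure M X"
  shows "measure_lub I \<mu> E \<le> c * emeasure M E"
  unfolding measure_lub_def
proof (rule SUP_least, clarify)
  fix S A
  assume S: "S \<subseteq> I" "countable S" and A: "\<forall>\<alpha>\<in>S. A \<alpha> \<in> sets borel" "disjoint_family_on A S" "E = (\<Union>\<alpha>\<in>S. A \<alpha>)"
  have "(\<Sum>\<alpha>\<in>F. \<mu> \<alpha> (A \<alpha>)) \<le> c * emeasure M (\<Union>\<alpha>\<in>S. A \<alpha>)" if F: "finite F" "F \<subseteq> S" for F
  proof -
    have "(\<Sum>\<alpha>\<in>F. \<mu> \<alpha> (A \<alpha>)) \<le> (\<Sum>\<alpha>\<in>F. c * emeasure M (A \<alpha>))"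
    proof (intro sum_mono le)
      fix \<alpha> assume "\<alpha> \<in> F"
      then have "\<alpha> \<in> S" using F by auto
      then show "\<alpha> \<in> I" "A \<alpha> \<in> sets borel" "A \<alpha> \<subseteq> \<Omega>" using S A E by auto
    qed
    also have "\<dots> = c * emeasure M (\<Union>\<alpha>\<in>F. A \<alpha>)"
      using F A M by (subst sum_emeasure[symmetric])
        (auto simp: sum_distrib_left intro: disjoint_family_on_mono)
    also have "\<dots> \<le> c * emeasure M (\<Union>\<alpha>\<in>S. A \<alpha>)"
      using F A M E by (intro mult_left_mono emeasure_mono) auto
    finally show ?thesis .
  qed
  then show "(\<Sum>\<^sub>\<infinity>\<alpha>\<in>S. \<mu> \<alpha> (A \<alpha>)) \<le> c * emeasure M (\<Union>\<alpha>\<in>S. A \<alpha>)"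
    by (subst nonneg_infsum_complete) (auto intro!: SUP_least)
qed

context
  fixes I :: "'i set" and \<mu> :: "'i \<Rightarrow> 'a::euclidean_space set \<Rightarrow> ennreal" and \<Omega> :: "'a set"
  assumes I: "I \<noteq> {}"
    and empty: "\<And>\<alpha>. \<alpha> \<in> I \<Longrightarrow> \<mu> \<alpha> {} = 0"
    and additive: "\<And>\<alpha> X Y. \<alpha> \<in> I \<Longrightarrow> X \<in> sets borel \<Longrightarrow> X \<subseteq> \<Omega> \<Longrightarrow> Y \<in> sets borel \<Longrightarrow> Y \<subseteq> \<Omega> \<Longrightarrow> X \<inter> Y = {} \<Longrightarrow>
        \<mu> \<alpha> (X \<union> Y) = \<mu> \<alpha> X + \<mu> \<alpha> Y"
begin

text \<open>Competitors for two disjoint sets are merged into one: an index used by both is assigned the union of its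
two pieces. Here additivity of the members enters.\<close>

lemma measure_lub_superadditive:
  assumes X: "X \<in> sets borel" "X \<subseteq> \<Omega>" and Y: "Y \<in> sets borel" "Y \<subseteq> \<Omega>" and disj: "X \<inter> Y = {}"
  shows "measure_lub I \<mu> X + measure_lub I \<mu> Y \<le> measure_lub I \<mu> (X \<union> Y)"
proof -
  define \<P> where "\<P> E = {(S, A). S \<subseteq> I \<and> countable S \<and> (\<forall>\<alpha>\<in>S. A \<alpha> \<in> sets borel) \<and>
     disjoint_family_on A S \<and> (\<Union>\<alpha>\<in>S. A \<alpha>) = E}" for E :: "'a set"
  define \<Sigma> where "\<Sigma> p = (case p of (S, A) \<Rightarrow> \<Sum>\<^sub>\<infinity>\<alpha>\<in>S. \<mu> \<alpha> (A \<alpha>))" for p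
  have lub: "measure_lub I \<mu> E = (SUP p\<in>\<P> E. \<Sigma> p)" for E
    unfolding measure_lub_def \<P>_def \<Sigma>_def by simp
  have ne: "\<P> E \<noteq> {}" if "E \<in> sets borel" for E
  proof -
    obtain \<alpha> where "\<alpha> \<in> I" using I by auto
    then have "({\<alpha>}, \<lambda>_. E) \<in> \<P> E" using that by (auto simp: \<P>_def disjoint_family_on_def)
    then show ?thesis by auto
  qed
  have pair: "\<Sigma> p + \<Sigma> q \<le> (SUP p\<in>\<P> (X \<union> Y). \<Sigma> p)" if p: "p \<in> \<P> X" and q: "q \<in> \<P> Y" for p q
  proof -
    obtain S A where pS: "p = (S, A)" by (cases p)
    obtain S' A' where qS: "q = (S', A')" by (cases q)
    have S: "S \<subseteq> I" "countable S" "\<And>\<alpha>. \<alpha> \<in> S \<Longrightarrow> A \<alpha> \<in> sets borel" "disjoint_family_on A S" "(\<Union>\<alpha>\<in>S. A \<alpha>) = X"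
      using p by (auto simp: pS \<P>_def)
    have S': "S' \<subseteq> I" "countable S'" "\<And>\<alpha>. \<alpha> \<in> S' \<Longrightarrow> A' \<alpha> \<in> sets borel" "disjoint_family_on A' S'" "(\<Union>\<alpha>\<in>S'. A' \<alpha>) = Y"
      using q by (auto simp: qS \<P>_def)
    define B where "B \<alpha> = (if \<alpha> \<in> S then A \<alpha> else {})" for \<alpha>
    define B' where "B' \<alpha> = (if \<alpha> \<in> S' then A' \<alpha> else {})" for \<alpha>
    have B: "B \<alpha> \<in> sets borel" "B \<alpha> \<subseteq> X" "B' \<alpha> \<in> sets borel" "B' \<alpha> \<subseteq> Y" for \<alpha>
      using S S' by (auto simp: B_def B'_def)
    have "\<Sigma> p = (\<Sum>\<^sub>\<infinity>\<alpha>\<in>S \<union> S'. \<mu> \<alpha> (B \<alpha>))"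
      unfolding pS \<Sigma>_def prod.case
      by (rule infsum_cong_neutral) (use S S' empty in \<open>auto simp: B_def\<close>)
    moreover have "\<Sigma> q = (\<Sum>\<^sub>\<infinity>\<alpha>\<in>S \<union> S'. \<mu> \<alpha> (B' \<alpha>))"
      unfolding qS \<Sigma>_def prod.case
      by (rule infsum_cong_neutral) (use S S' empty in \<open>auto simp: B'_def\<close>)
    ultimately have "\<Sigma> p + \<Sigma> q = (\<Sum>\<^sub>\<infinity>\<alpha>\<in>S \<union> S'. \<mu> \<alpha> (B \<alpha>) + \<mu> \<alpha> (B' \<alpha>))"
      using infsum_add[OF nonneg_summable_on_complete[where A = "S \<union> S'" and f = "\<lambda>\<alpha>. \<mu> \<alpha> (B \<alpha>)"]
        nonneg_summable_on_complete[where A = "S \<union> S'" and f = "\<lambda>\<alpha>. \<mu> \<alpha> (B' \<alpha>)"]] by simp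
    also have "\<dots> = (\<Sum>\<^sub>\<infinity>\<alpha>\<in>S \<union> S'. \<mu> \<alpha> (B \<alpha> \<union> B' \<alpha>))"
    proof (rule infsum_cong)
      fix \<alpha> assume "\<alpha> \<in> S \<union> S'"
      then have "\<alpha> \<in> I" using S S' by auto
      moreover have "B \<alpha> \<subseteq> \<Omega>" "B' \<alpha> \<subseteq> \<Omega>" "B \<alpha> \<inter> B' \<alpha> = {}"
        using B(2,4)[of \<alpha>] X Y disj by auto
      ultimately show "\<mu> \<alpha> (B \<alpha>) + \<mu> \<alpha> (B' \<alpha>) = \<mu> \<alpha> (B \<alpha> \<union> B' \<alpha>)"
        using B by (intro additive[symmetric])
    qed
    also have "\<dots> = \<Sigma> (S \<union> S', \<lambda>\<alpha>. B \<alpha> \<union> B' \<alpha>)" by (simp add: \<Sigma>_def)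
    also have "\<dots> \<le> (SUP p\<in>\<P> (X \<union> Y). \<Sigma> p)"
    proof (rule SUP_upper)
      have "disjoint_family_on (\<lambda>\<alpha>. B \<alpha> \<union> B' \<alpha>) (S \<union> S')"
        unfolding disjoint_family_on_def
      proof (intro ballI impI)
        fix \<alpha> \<beta> :: 'i assume "\<alpha> \<noteq> \<beta>"
        then have "B \<alpha> \<inter> B \<beta> = {}" "B' \<alpha> \<inter> B' \<beta> = {}"
          using S(4) S'(4) by (simp_all add: B_def B'_def disjoint_family_on_def)
        then show "(B \<alpha> \<union> B' \<alpha>) \<inter> (B \<beta> \<union> B' \<beta>) = {}"
          using B(2,4)[of \<alpha>] B(2,4)[of \<beta>] disj by blast
      qed
      moreover have "(\<Union>\<alpha>\<in>S \<union> S'. B \<alpha> \<union> B' \<alpha>) = X \<union> Y"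
        using S(5) S'(5) B(2,4) by (fastforce simp: B_def B'_def)
      ultimately show "(S \<union> S', \<lambda>\<alpha>. B \<alpha> \<union> B' \<alpha>) \<in> \<P> (X \<union> Y)"
        using S S' B by (auto simp: \<P>_def)
    qed
    finally show ?thesis .
  qed
  have "(SUP p\<in>\<P> X. \<Sigma> p) + (SUP q\<in>\<P> Y. \<Sigma> q) = (SUP q\<in>\<P> Y. SUP p\<in>\<P> X. \<Sigma> p + \<Sigma> q)"
    by (simp add: ennreal_SUP_add_right[OF ne[OF Y(1)]] ennreal_SUP_add_left[OF ne[OF X(1)]])
  also have "\<dots> \<le> (SUP p\<in>\<P> (X \<union> Y). \<Sigma> p)"
    using pair by (intro SUP_least) auto
  finally show ?thesis unfolding lub .
qed

lemma measure_lub_mono: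
  assumes "X \<subseteq> Y" "X \<in> sets borel" "Y \<in> sets borel" "Y \<subseteq> \<Omega>"
  shows "measure_lub I \<mu> X \<le> measure_lub I \<mu> Y"
proof -
  have "measure_lub I \<mu> X \<le> measure_lub I \<mu> X + measure_lub I \<mu> (Y - X)"
    by (rule add_increasing2) simp_all
  also have "\<dots> \<le> measure_lub I \<mu> (X \<union> (Y - X))"
    using assms by (intro measure_lub_superadditive) auto
  also have "X \<union> (Y - X) = Y" using assms by auto
  finally show ?thesis .
qed

lemma measure_lub_sum_le:
  assumes "finite F" "\<And>i. i \<in> F \<Longrightarrow> D i \<in> sets borel" "\<And>i. i \<in> F \<Longrightarrow> D i \<subseteq> E"
    and "disjoint_family_on D F" and E: "E \<in> sets borel" "E \<subseteq> \<Omega>"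
  shows "(\<Sum>i\<in>F. measure_lub I \<mu> (D i)) \<le> measure_lub I \<mu> E"
proof -
  have "(\<Sum>i\<in>F. measure_lub I \<mu> (D i)) \<le> measure_lub I \<mu> (\<Union>i\<in>F. D i)"
    using assms(1-4)
  proof (induction F rule: finite_induct)
    case empty
    then show ?case by simp
  next
    case (insert i F)
    have "(\<Sum>j\<in>insert i F. measure_lub I \<mu> (D j)) \<le> measure_lub I \<mu> (D i) + measure_lub I \<mu> (\<Union>j\<in>F. D j)"
    proof -
      have "disjoint_family_on D F"
        by (rule disjoint_family_on_mono[OF _ insert.prems(3)]) auto
      then have "(\<Sum>j\<in>F. measure_lub I \<mu> (D j)) \<le> measure_lub I \<mu> (\<Union>j\<in>F. D j)"
        using insert.prems by (intro insert.IH) auto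
      then show ?thesis using insert.hyps by (simp add: add_left_mono)
    qed
    also have "\<dots> \<le> measure_lub I \<mu> (D i \<union> (\<Union>j\<in>F. D j))"
    proof (rule measure_lub_superadditive)
      show "D i \<inter> (\<Union>j\<in>F. D j) = {}"
      proof -
        have "D i \<inter> D j = {}" if "j \<in> F" for j
          using disjoint_family_onD[OF insert.prems(3), of i j] insert.hyps(2) that by auto
        then show ?thesis by blast
      qed
      show "(\<Union>j\<in>F. D j) \<subseteq> \<Omega>" "D i \<subseteq> \<Omega>" using insert.prems(2) E(2) by (auto; blast)+
      show "(\<Union>j\<in>F. D j) \<in> sets borel" "D i \<in> sets borel" using insert by auto
    qed
    finally show ?case by simp
  qed
  also have "\<dots> \<le> measure_lub I \<mu> E"
    using assms by (intro measure_lub_mono) auto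
  finally show ?thesis .
qed

end

text \<open>Covers by a countable family over any index set serve as well as sequences, and it suffices to bound the finite partial sums of the diameters.\<close>

lemma hausdorff1_outer_le_covers:
  fixes E :: "'a::euclidean_space set"
  assumes "\<And>\<delta>. \<delta> > 0 \<Longrightarrow> \<exists>(K :: 'i set) C. countable K \<and> E \<subseteq> (\<Union>i\<in>K. C i) \<and> (\<forall>i\<in>K. bounded (C i) \<and> diameter (C i) \<le> \<delta>) \<and>
     (\<forall>F. finite F \<longrightarrow> F \<subseteq> K \<longrightarrow> (\<Sum>i\<in>F. ennreal (diameter (C i))) \<le> R)"
  shows "hausdorff1_outer E \<le> R"
  unfolding hausdorff1_outer_def
proof (rule SUP_least)
  fix \<delta> :: real assume "\<delta> \<in> {0<..}"
  then have "\<delta> > 0" by simp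
  define Q where "Q K C \<longleftrightarrow> countable K \<and> E \<subseteq> (\<Union>i\<in>K. C i) \<and>
     (\<forall>i\<in>K. bounded (C i) \<and> diameter (C i) \<le> \<delta>) \<and>
     (\<forall>F. finite F \<longrightarrow> F \<subseteq> K \<longrightarrow> (\<Sum>i\<in>F. ennreal (diameter (C i))) \<le> R)" for K :: "'i set" and C
  have "\<exists>K C. Q K C" unfolding Q_def by (rule assms[OF \<open>\<delta> > 0\<close>])
  then obtain K C where "Q K C" by blast
  note KC = this[unfolded Q_def]
  have K: "countable K" "E \<subseteq> (\<Union>i\<in>K. C i)" "\<And>i. i \<in> K \<Longrightarrow> bounded (C i) \<and> diameter (C i) \<le> \<delta>"
    using KC by blast+
  have K4: "(\<Sum>i\<in>F. ennreal (diameter (C i))) \<le> R" if "finite F" "F \<subseteq> K" for F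
    by (rule KC[THEN conjunct2, THEN conjunct2, THEN conjunct2, rule_format, OF that])
  define D where "D n = (if n \<in> to_nat_on K ` K then C (from_nat_into K n) else {})" for n
  have inj: "inj_on (to_nat_on K) K" using K(1) by (rule inj_on_to_nat_on)
  have D: "D (to_nat_on K i) = C i" if "i \<in> K" for i
    using that K(1) by (simp add: D_def)
  have "(INF C\<in>{C. E \<subseteq> (\<Union>n. C n) \<and> (\<forall>n. bounded (C n) \<and> diameter (C n) \<le> \<delta>)}. \<Sum>n. ennreal (diameter (C n)))
     \<le> (\<Sum>n. ennreal (diameter (D n)))"
  proof (rule INF_lower, clarify, intro conjI)
    show "E \<subseteq> (\<Union>n. D n)"
    proof
      fix x assume "x \<in> E"
      then obtain i where "i \<in> K" "x \<in> C i" using K(2) by auto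
      then show "x \<in> (\<Union>n. D n)" by (intro UN_I[of "to_nat_on K i"]) (simp_all add: D)
    qed
    show "\<forall>n. bounded (D n) \<and> diameter (D n) \<le> \<delta>"
      using K(1,3) \<open>\<delta> > 0\<close> by (auto simp: D_def)
  qed
  also have "\<dots> \<le> R"
    unfolding suminf_eq_SUP
  proof (rule SUP_least)
    fix n
    let ?F = "{i \<in> K. to_nat_on K i < n}"
    have injF: "inj_on (to_nat_on K) ?F" by (rule inj_on_subset[OF inj]) auto
    have fin: "finite ?F"
      by (rule inj_on_finite[OF injF, of "{..<n}"]) auto
    have "(\<Sum>m<n. ennreal (diameter (D m))) = (\<Sum>m\<in>to_nat_on K ` ?F. ennreal (diameter (D m)))"
    proof (rule sum.mono_neutral_right)
      show "\<forall>m\<in>{..<n} - to_nat_on K ` ?F. ennreal (diameter (D m)) = 0"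
      proof
        fix m assume "m \<in> {..<n} - to_nat_on K ` ?F"
        then have "m \<notin> to_nat_on K ` K" by blast
        then show "ennreal (diameter (D m)) = 0" by (simp add: D_def)
      qed
    qed auto
    also have "\<dots> = (\<Sum>i\<in>?F. ennreal (diameter (D (to_nat_on K i))))"
      by (rule sum.reindex_cong[OF injF]) auto
    also have "\<dots> = (\<Sum>i\<in>?F. ennreal (diameter (C i)))" by (intro sum.cong) (auto simp: D)
    also have "\<dots> \<le> R" using fin by (intro K4) auto
    finally show "(\<Sum>m<n. ennreal (diameter (D m))) \<le> R" .
  qed
  finally show "(INF C\<in>{C. E \<subseteq> (\<Union>n. C n) \<and> (\<forall>n. bounded (C n) \<and> diameter (C n) \<le> \<delta>)}. \<Sum>n. ennreal (diameter (C n))) \<le> R" .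
qed

lemma finite_sums_small_tail:
  fixes f :: "'i \<Rightarrow> real"
  assumes nonneg: "\<And>i. i \<in> K \<Longrightarrow> 0 \<le> f i" and bound: "\<And>F. finite F \<Longrightarrow> F \<subseteq> K \<Longrightarrow> sum f F \<le> R" and "\<epsilon> > 0"
  obtains F0 where "finite F0" "F0 \<subseteq> K" "\<And>G. finite G \<Longrightarrow> G \<subseteq> K - F0 \<Longrightarrow> sum f G \<le> \<epsilon>"
proof -
  define S where "S = (SUP F\<in>{F. finite F \<and> F \<subseteq> K}. sum f F)"
  have bdd: "bdd_above (sum f ` {F. finite F \<and> F \<subseteq> K})" using bound by (intro bdd_aboveI2) auto
  have "S - \<epsilon> < S" using \<open>\<epsilon> > 0\<close> by simp
  then obtain F0 where F0: "finite F0" "F0 \<subseteq> K" "S - \<epsilon> < sum f F0"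
    using less_cSUP_iff[OF _ bdd, of "S - \<epsilon>"] unfolding S_def by auto
  show ?thesis
  proof (rule that[OF F0(1,2)])
    fix G assume G: "finite G" "G \<subseteq> K - F0"
    have "sum f (F0 \<union> G) \<le> S" unfolding S_def using F0 G by (intro cSUP_upper bdd) auto
    moreover have "sum f (F0 \<union> G) = sum f F0 + sum f G" using F0 G by (intro sum.union_disjoint) auto
    ultimately show "sum f G \<le> \<epsilon>" using F0(3) by linarith
  qed
qed

text \<open>Cover \<open>A\<close> by small balls \<open>cball x r\<close> on which some member of the family has mass at least \<open>2rc\<close>, inside an open set
\<open>V\<close> that exceeds \<open>A\<close> by little \<open>M\<close>-measure. For disjoint balls, the sum of the diameters times \<open>c\<close> is at most the least upper bound on
\<open>A\<close> plus a small error from \<open>V - A\<close>. By Vitali's lemma, finitely many of the selected balls, together with the remaining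
ones enlarged five times, cover \<open>A\<close>; the remaining ones contribute arbitrarily little.\<close>

lemma hausdorff1_outer_le_measure_lub:
  fixes M :: "'a::euclidean_space measure" and \<mu> :: "'i \<Rightarrow> 'a set \<Rightarrow> ennreal" and c :: real
  assumes M: "finite_measure M" "sets M = sets borel" and \<Omega>: "open \<Omega>" and I: "I \<noteq> {}"
    and empty: "\<And>\<alpha>. \<alpha> \<in> I \<Longrightarrow> \<mu> \<alpha> {} = 0"
    and additive: "\<And>\<alpha> X Y. \<alpha> \<in> I \<Longrightarrow> X \<in> sets borel \<Longrightarrow> X \<subseteq> \<Omega> \<Longrightarrow> Y \<in> sets borel \<Longrightarrow> Y \<subseteq> \<Omega> \<Longrightarrow> X \<inter> Y = {} \<Longrightarrow>
        \<mu> \<alpha> (X \<union> Y) = \<mu> \<alpha> X + \<mu> \<alpha> Y"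
    and dominated: "\<And>\<alpha> X. \<alpha> \<in> I \<Longrightarrow> X \<in> sets borel \<Longrightarrow> X \<subseteq> \<Omega> \<Longrightarrow> \<mu> \<alpha> X \<le> ennreal C * emeasure M X"
    and C: "C \<ge> 0" and A: "A \<in> sets borel" "A \<subseteq> \<Omega>" and c: "c > 0"
    and density: "\<And>x. x \<in> A \<Longrightarrow> \<exists>\<alpha>\<in>I. eventually (\<lambda>r. ennreal (c * (2 * r)) \<le> \<mu> \<alpha> (cball x r)) (at_right 0)"
  shows "ennreal c * hausdorff1_outer A \<le> measure_lub I \<mu> A"
proof -
  interpret finite_measure M by (rule M)
  have sp: "space M = UNIV" using sets_eq_imp_space_eq[OF M(2)] by simp
  let ?\<Lambda> = "measure_lub I \<mu>"
  have "?\<Lambda> A \<le> ennreal C * emeasure M A" by (rule measure_lub_le[OF M(2) A dominated])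
  also have "\<dots> < \<infinity>" using emeasure_eq_measure[of A] by (simp add: ennreal_mult_less_top)
  finally obtain l where l: "?\<Lambda> A = ennreal l" "l \<ge> 0" by (cases "?\<Lambda> A") auto
  have main: "hausdorff1_outer A \<le> ennreal ((l + C * \<epsilon>) / c + 5 * \<epsilon>)" if e: "\<epsilon> > 0" for \<epsilon>
  proof -
    obtain V where V: "open V" "A \<subseteq> V" "V \<subseteq> \<Omega>" "measure M (V - A) < \<epsilon>"
    proof -
      have "emeasure M A < ennreal (measure M A + \<epsilon>)"
        using e by (simp add: emeasure_eq_measure ennreal_less_iff)
      moreover have "emeasure M A = (INF U\<in>{U. A \<subseteq> U \<and> open U}. emeasure M U)"
        using M(2) A(1) emeasure_finite[of "space M"] by (intro outer_regular) auto
      ultimately obtain U where U: "A \<subseteq> U" "open U" "emeasure M U < ennreal (measure M A + \<epsilon>)"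
        by (auto simp: INF_less_iff)
      then have "measure M U < measure M A + \<epsilon>" using e by (simp add: emeasure_eq_measure ennreal_less_iff del: ennreal_plus)
      moreover have "measure M (U \<inter> \<Omega>) \<le> measure M U" using U \<Omega> M(2) by (intro finite_measure_mono) auto
      moreover have "measure M (U \<inter> \<Omega> - A) = measure M (U \<inter> \<Omega>) - measure M A"
        using U A \<Omega> M(2) by (intro finite_measure_Diff) auto
      ultimately show ?thesis using U \<Omega> A by (intro that[of "U \<inter> \<Omega>"]) auto
    qed
    show ?thesis
    proof (rule hausdorff1_outer_le_covers[where 'i = "'a \<times> real"])
      fix \<delta> :: real assume "\<delta> > 0"
      (* centres and radii of the admissible balls; radii are at most \<delta>/10 since the balls get enlarged five times *)
      define K where "K = {p. fst p \<in> A \<and> 0 < snd p \<and> snd p \<le> \<delta> / 10 \<and> cball (fst p) (snd p) \<subseteq> V \<and>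
          (\<exists>\<alpha>\<in>I. ennreal (c * (2 * snd p)) \<le> \<mu> \<alpha> (cball (fst p) (snd p)))}"
      have fine: "\<exists>r. (x, r) \<in> K \<and> r < d" if x: "x \<in> A" and d: "d > 0" for x d
      proof -
        from density[OF x] obtain \<alpha> where \<alpha>: "\<alpha> \<in> I"
          "eventually (\<lambda>r. ennreal (c * (2 * r)) \<le> \<mu> \<alpha> (cball x r)) (at_right 0)" by blast
        obtain \<rho> where \<rho>: "\<rho> > 0" "cball x \<rho> \<subseteq> V" using V x open_contains_cball by blast
        have "eventually (\<lambda>r. 0 < r \<and> r < min (min d \<rho>) (\<delta> / 10)) (at_right (0::real))"
          using eventually_at_right_real[of 0 "min (min d \<rho>) (\<delta> / 10)"] d \<rho>(1) \<open>\<delta> > 0\<close> by simp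
        from eventually_happens[OF eventually_conj[OF \<alpha>(2) this]]
        obtain r where "0 < r" "r < d" "r < \<rho>" "r < \<delta> / 10" "ennreal (c * (2 * r)) \<le> \<mu> \<alpha> (cball x r)" by auto
        moreover have "cball x r \<subseteq> V" using \<rho>(2) \<open>r < \<rho>\<close> by (auto simp: subset_eq)
        ultimately show ?thesis using x \<alpha>(1) by (auto simp: K_def)
      qed
      obtain Cc where Cc: "countable Cc" "Cc \<subseteq> K"
        "pairwise (\<lambda>i j. disjnt (cball (fst i) (snd i)) (cball (fst j) (snd j))) Cc"
        "\<And>i. i \<in> K \<Longrightarrow> \<exists>j. j \<in> Cc \<and> \<not> disjnt (cball (fst i) (snd i)) (cball (fst j) (snd j)) \<and>
             cball (fst i) (snd i) \<subseteq> ball (fst j) (5 * snd j)"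
        by (rule Vitali_covering_lemma_cballs_balls[of K snd "\<delta> / 10" fst]) (auto simp: K_def)
      let ?B = "\<lambda>i :: 'a \<times> real. cball (fst i) (snd i)"
      have r0: "0 < snd i" "snd i \<le> \<delta> / 10" if "i \<in> Cc" for i using that Cc(2) by (auto simp: K_def)
      have sums: "(\<Sum>i\<in>F. 2 * snd i) \<le> (l + C * \<epsilon>) / c" if F: "finite F" "F \<subseteq> Cc" for F
      proof -
        have disj: "disjoint_family_on ?B F"
          using pairwise_subset[OF Cc(3) F(2)] unfolding disjoint_family_on_def pairwise_def disjnt_def by blast
        then have disj': "disjoint_family_on (\<lambda>i. ?B i \<inter> A) F" "disjoint_family_on (\<lambda>i. ?B i - A) F"
          unfolding disjoint_family_on_def by blast+
        have single: "ennreal (c * (2 * snd i)) \<le> ?\<Lambda> (?B i \<inter> A) + ennreal (C * measure M (?B i - A))" if "i \<in> F" for i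
        proof -
          have "i \<in> K" using that F Cc by auto
          then obtain \<alpha> where \<alpha>: "\<alpha> \<in> I" "ennreal (c * (2 * snd i)) \<le> \<mu> \<alpha> (?B i)" and sub: "?B i \<subseteq> \<Omega>"
            using V(3) by (auto simp: K_def)
          have "\<mu> \<alpha> (?B i) = \<mu> \<alpha> ((?B i \<inter> A) \<union> (?B i - A))" by (simp add: Int_Diff_Un)
          also have "\<dots> = \<mu> \<alpha> (?B i \<inter> A) + \<mu> \<alpha> (?B i - A)"
            using sub A \<alpha> by (intro additive) auto
          also have "\<dots> \<le> ?\<Lambda> (?B i \<inter> A) + ennreal C * emeasure M (?B i - A)"
            using sub A \<alpha> by (intro add_mono measure_lub_upper dominated) auto
          finally show ?thesis using \<alpha>(2) C by (simp add: emeasure_eq_measure ennreal_mult)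
        qed
        have "ennreal (\<Sum>i\<in>F. c * (2 * snd i)) = (\<Sum>i\<in>F. ennreal (c * (2 * snd i)))"
          using r0 F c by (subst sum_ennreal) (auto simp: less_imp_le subset_eq)
        also have "\<dots> \<le> (\<Sum>i\<in>F. ?\<Lambda> (?B i \<inter> A) + ennreal (C * measure M (?B i - A)))"
          by (intro sum_mono single)
        also have "\<dots> = (\<Sum>i\<in>F. ?\<Lambda> (?B i \<inter> A)) + ennreal (\<Sum>i\<in>F. C * measure M (?B i - A))"
          using C by (simp add: sum.distrib sum_ennreal)
        also have "\<dots> \<le> ?\<Lambda> A + ennreal (C * \<epsilon>)"
        proof (intro add_mono ennreal_leI)
          show "(\<Sum>i\<in>F. ?\<Lambda> (?B i \<inter> A)) \<le> ?\<Lambda> A"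
            by (rule measure_lub_sum_le[OF I empty additive F(1)])
               (use A disj'(1) in auto)
          have "(\<Sum>i\<in>F. measure M (?B i - A)) = measure M (\<Union>i\<in>F. ?B i - A)"
            using F(1) disj'(2) A M(2) by (intro finite_measure_finite_Union[symmetric]) auto
          also have "\<dots> \<le> measure M (V - A)"
          proof (rule finite_measure_mono)
            have "?B i \<subseteq> V" if "i \<in> F" for i using that F Cc(2) by (auto simp: K_def)
            then show "(\<Union>i\<in>F. ?B i - A) \<subseteq> V - A" by blast
          qed (use V A M(2) in auto)
          finally show "(\<Sum>i\<in>F. C * measure M (?B i - A)) \<le> C * \<epsilon>"
            using C V(4) by (simp add: sum_distrib_left[symmetric] mult_left_mono)
        qed
        also have "\<dots> = ennreal (l + C * \<epsilon>)" using l C e by (simp add: ennreal_plus)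
        finally have "(\<Sum>i\<in>F. c * (2 * snd i)) \<le> l + C * \<epsilon>"
          using l C e by (subst (asm) ennreal_le_iff) auto
        then show ?thesis using c by (simp add: sum_distrib_left[symmetric] field_simps)
      qed
      have r00: "0 \<le> 2 * snd i" if "i \<in> Cc" for i using r0[OF that] by simp
      obtain F0 where F0: "finite F0" "F0 \<subseteq> Cc" "\<And>G. finite G \<Longrightarrow> G \<subseteq> Cc - F0 \<Longrightarrow> (\<Sum>i\<in>G. 2 * snd i) \<le> \<epsilon>"
        using finite_sums_small_tail[of Cc "\<lambda>i. 2 * snd i", OF r00 sums e] by blast
      (* only the balls outside the finite part F0 have to be enlarged *)
      define D where "D i = (if i \<in> F0 then ?B i else cball (fst i) (5 * snd i))" for i
      have diam: "diameter (D i) = (if i \<in> F0 then 2 * snd i else 10 * snd i)" if "i \<in> Cc" for i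
        using r0[OF that] by (simp add: D_def)
      show "\<exists>(K :: ('a \<times> real) set) C'. countable K \<and> A \<subseteq> (\<Union>i\<in>K. C' i) \<and> (\<forall>i\<in>K. bounded (C' i) \<and> diameter (C' i) \<le> \<delta>) \<and>
         (\<forall>F. finite F \<longrightarrow> F \<subseteq> K \<longrightarrow> (\<Sum>i\<in>F. ennreal (diameter (C' i))) \<le> ennreal ((l + C * \<epsilon>) / c + 5 * \<epsilon>))"
      proof (intro exI[of _ Cc] exI[of _ D] conjI ballI allI impI)
        show "countable Cc" by fact
        show "A \<subseteq> (\<Union>i\<in>Cc. D i)"
        proof
          fix x assume x: "x \<in> A"
          show "x \<in> (\<Union>i\<in>Cc. D i)"
          proof (cases "x \<in> (\<Union>i\<in>F0. ?B i)")
            case True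
            then show ?thesis using F0(2) by (auto simp: D_def)
          next
            case False
            have "closed (\<Union>i\<in>F0. ?B i)" using F0(1) by auto
            then have "open (- (\<Union>i\<in>F0. ?B i))" by (rule open_Compl)
            then obtain d where d: "d > 0" "ball x d \<subseteq> - (\<Union>i\<in>F0. ?B i)"
              using False by (meson ComplI open_contains_ball)
            obtain r where r: "(x, r) \<in> K" "r < d" using fine[OF x d(1)] by blast
            from Cc(4)[OF r(1)] obtain j where j: "j \<in> Cc" "\<not> disjnt (cball x r) (?B j)" "cball x r \<subseteq> ball (fst j) (5 * snd j)"
              by auto
            have "j \<notin> F0"
            proof
              assume "j \<in> F0"
              moreover obtain y where "y \<in> cball x r" "y \<in> ?B j" using j(2) by (auto simp: disjnt_def)
              moreover have "y \<in> ball x d" using \<open>y \<in> cball x r\<close> r(2) by auto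
              ultimately show False using d(2) by blast
            qed
            moreover have "x \<in> cball x r" using r(1) by (auto simp: K_def)
            then have "x \<in> cball (fst j) (5 * snd j)" using j(3) ball_subset_cball by blast
            ultimately show ?thesis using j(1) by (auto simp: D_def)
          qed
        qed
        fix i assume i: "i \<in> Cc"
        show "bounded (D i)" by (simp add: D_def)
        show "diameter (D i) \<le> \<delta>" using r0[OF i] \<open>\<delta> > 0\<close> by (simp add: diam[OF i])
      next
        fix F assume F: "finite F" "F \<subseteq> Cc"
        have "(\<Sum>i\<in>F. diameter (D i)) = (\<Sum>i\<in>F \<inter> F0. diameter (D i)) + (\<Sum>i\<in>F - F0. diameter (D i))"
          using F(1) by (rule sum.Int_Diff)
        also have "(\<Sum>i\<in>F \<inter> F0. diameter (D i)) = (\<Sum>i\<in>F \<inter> F0. 2 * snd i)"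
          using F diam by (intro sum.cong) auto
        also have "(\<Sum>i\<in>F - F0. diameter (D i)) = 5 * (\<Sum>i\<in>F - F0. 2 * snd i)"
          using F diam unfolding sum_distrib_left by (intro sum.cong) auto
        also have "(\<Sum>i\<in>F \<inter> F0. 2 * snd i) + 5 * (\<Sum>i\<in>F - F0. 2 * snd i) \<le> (l + C * \<epsilon>) / c + 5 * \<epsilon>"
          using F by (intro add_mono mult_left_mono sums F0(3)) auto
        finally have "(\<Sum>i\<in>F. diameter (D i)) \<le> (l + C * \<epsilon>) / c + 5 * \<epsilon>" .
        then show "(\<Sum>i\<in>F. ennreal (diameter (D i))) \<le> ennreal ((l + C * \<epsilon>) / c + 5 * \<epsilon>)"
          by (subst sum_ennreal) (auto intro: ennreal_leI diameter_ge_0 simp: D_def)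
      qed
    qed
  qed
  have le: "ennreal c * hausdorff1_outer A \<le> ennreal l + ennreal e" if "e > 0" for e
  proof -
    define \<epsilon> where "\<epsilon> = e / (C + 5 * c)"
    have d: "C + 5 * c > 0" using C c by simp
    then have \<epsilon>: "\<epsilon> > 0" "\<epsilon> * (C + 5 * c) = e" using that by (auto simp: \<epsilon>_def)
    have "ennreal c * hausdorff1_outer A \<le> ennreal c * ennreal ((l + C * \<epsilon>) / c + 5 * \<epsilon>)"
      using main[OF \<epsilon>(1)] by (rule mult_left_mono) simp
    also have "\<dots> = ennreal (c * ((l + C * \<epsilon>) / c + 5 * \<epsilon>))"
      using c l C \<epsilon> by (intro ennreal_mult[symmetric]) auto
    also have "c * ((l + C * \<epsilon>) / c + 5 * \<epsilon>) = l + \<epsilon> * (C + 5 * c)" using c by (simp add: field_simps)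
    also have "\<dots> = l + e" by (simp add: \<epsilon>(2))
    finally show ?thesis using l that by (simp add: ennreal_plus)
  qed
  show ?thesis unfolding l(1)
    by (rule ennreal_le_epsilon) (use le in auto)
qed

text \<open>The nonnegative integral is a supremum over simple functions, also when the integrand is not measurable, so it suffices to
add up the bound over the finitely many level sets of a simple function below \<open>t\<close>.\<close>

lemma nn_integral_hausdorff1_le_measure_lub:
  fixes \<mu> :: "'i \<Rightarrow> 'a::euclidean_space set \<Rightarrow> ennreal" and t :: "'a \<Rightarrow> real"
  assumes I: "I \<noteq> {}" and empty: "\<And>\<alpha>. \<alpha> \<in> I \<Longrightarrow> \<mu> \<alpha> {} = 0"
    and additive: "\<And>\<alpha> X Y. \<alpha> \<in> I \<Longrightarrow> X \<in> sets borel \<Longrightarrow> X \<subseteq> \<Omega> \<Longrightarrow> Y \<in> sets borel \<Longrightarrow> Y \<subseteq> \<Omega> \<Longrightarrow> X \<inter> Y = {} \<Longrightarrow>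
        \<mu> \<alpha> (X \<union> Y) = \<mu> \<alpha> X + \<mu> \<alpha> Y"
    and le: "\<And>A c. A \<in> sets borel \<Longrightarrow> A \<subseteq> \<Omega> \<Longrightarrow> c > 0 \<Longrightarrow> (\<And>x. x \<in> A \<Longrightarrow> x \<in> J \<and> c \<le> t x) \<Longrightarrow>
        \<kappa> * (ennreal c * hausdorff1_outer A) \<le> measure_lub I \<mu> A"
    and E: "E \<in> sets borel" "E \<subseteq> \<Omega>"
  shows "\<kappa> * (\<integral>\<^sup>+x\<in>E \<inter> J. ennreal (t x) \<partial>hausdorff1) \<le> measure_lub I \<mu> E"
  unfolding nn_integral_def SUP_mult_left_ennreal
proof (rule SUP_least, clarify)
  let ?H = "hausdorff1 :: 'a measure"
  have sH: "sets ?H = sets borel" "space ?H = UNIV"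
    unfolding hausdorff1_def using sets.sigma_sets_eq[of "borel :: 'a measure"] by (auto simp: sets_measure_of)
  have eH: "emeasure ?H A \<le> hausdorff1_outer A" for A
    unfolding hausdorff1_def by (simp add: emeasure_measure_of_conv)
  fix g assume g: "simple_function ?H g" "g \<le> (\<lambda>x. ennreal (t x) * indicator (E \<inter> J) x)"
  define Y where "Y = range g - {0}"
  have fin: "finite (range g)" using g(1) by (auto simp: simple_function_def sH)
  have AY: "g -` {y} \<in> sets borel" for y
    using simple_functionD(2)[OF g(1), of "{y}"] by (simp add: sH)
  have sub: "x \<in> E \<and> x \<in> J \<and> y \<le> ennreal (t x)" if "y \<noteq> 0" "g x = y" for x y
    using le_funD[OF g(2), of x] that by (cases "x \<in> E \<inter> J") auto
  have term_le: "\<kappa> * (y * emeasure ?H (g -` {y})) \<le> measure_lub I \<mu> (g -` {y})" if y: "y \<in> Y" for y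
  proof -
    obtain x where x: "g x = y" "y \<noteq> 0" using y by (auto simp: Y_def)
    have "y < top" using sub[OF x(2,1)] by (metis ennreal_less_top le_less_trans)
    then obtain c where c: "y = ennreal c" "c > 0"
      using x(2) by (cases y) (auto simp: less_le)
    have "\<kappa> * (y * emeasure ?H (g -` {y})) \<le> \<kappa> * (ennreal c * hausdorff1_outer (g -` {y}))"
      unfolding c(1) by (intro mult_left_mono eH) auto
    also have "\<dots> \<le> measure_lub I \<mu> (g -` {y})"
    proof (rule le[OF AY _ c(2)])
      show "g -` {y} \<subseteq> \<Omega>" using sub[OF x(2)] E(2) by blast
      fix z assume "z \<in> g -` {y}"
      then have "z \<in> J \<and> y \<le> ennreal (t z)" using sub[OF x(2)] by blast
      then show "z \<in> J \<and> c \<le> t z" using c by (auto simp: ennreal_le_iff2)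
    qed
    finally show ?thesis .
  qed
  have "\<kappa> * integral\<^sup>S ?H g = \<kappa> * (\<Sum>y\<in>Y. y * emeasure ?H (g -` {y}))"
    unfolding simple_integral_def sH Y_def using fin
    by (subst sum.mono_neutral_right[of "range g" "range g - {0}"]) auto
  also have "\<dots> = (\<Sum>y\<in>Y. \<kappa> * (y * emeasure ?H (g -` {y})))" by (rule sum_distrib_left)
  also have "\<dots> \<le> (\<Sum>y\<in>Y. measure_lub I \<mu> (g -` {y}))" by (intro sum_mono term_le)
  also have "\<dots> \<le> measure_lub I \<mu> E"
  proof (rule measure_lub_sum_le[OF I empty additive])
    show "finite Y" using fin by (simp add: Y_def)
    show "g -` {y} \<subseteq> E" if "y \<in> Y" for y using sub that by (auto simp: Y_def)
  qed (use AY E in \<open>auto simp: disjoint_family_on_def\<close>)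
  finally show "\<kappa> * integral\<^sup>S ?H g \<le> measure_lub I \<mu> E" .
qed

section \<open>Lebesgue measure on the complex plane in rotated frames\<close>

lemma measurable_Complex_pair [measurable]:
  "(\<lambda>p. Complex (fst p) (snd p)) \<in> borel_measurable (borel \<Otimes>\<^sub>M borel)"
  unfolding Complex_eq by measurable

text \<open>This makes Fubini's theorem available for integrals over the complex plane.\<close>

lemma lborel_complex_eq_distr: "distr (lborel \<Otimes>\<^sub>M lborel) borel (\<lambda>p. Complex (fst p) (snd p)) = lborel"
proof (rule lborel_eqI[symmetric])
  have m: "(\<lambda>p. Complex (fst p) (snd p)) \<in> borel_measurable (lborel \<Otimes>\<^sub>M lborel)"
    using measurable_Complex_pair by (simp cong: measurable_cong_sets)
  fix l u :: complex assume lu: "\<And>b. b \<in> Basis \<Longrightarrow> l \<bullet> b \<le> u \<bullet> b"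
  have le: "Re l \<le> Re u" "Im l \<le> Im u" using lu[of 1] lu[of \<i>] by (auto simp: Basis_complex_def inner_complex_def)
  have "(\<lambda>p. Complex (fst p) (snd p)) -` box l u \<inter> space (lborel \<Otimes>\<^sub>M lborel) = {Re l<..<Re u} \<times> {Im l<..<Im u}"
    by (auto simp: in_box_complex_iff space_pair_measure)
  then have "emeasure (distr (lborel \<Otimes>\<^sub>M lborel) borel (\<lambda>p. Complex (fst p) (snd p))) (box l u)
     = emeasure (lborel \<Otimes>\<^sub>M lborel) ({Re l<..<Re u} \<times> {Im l<..<Im u})"
    by (subst emeasure_distr[OF m]) auto
  also have "\<dots> = emeasure lborel {Re l<..<Re u} * emeasure lborel {Im l<..<Im u}"
    by (rule lborel.emeasure_pair_measure_Times) auto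
  also have "\<dots> = ennreal ((Re u - Re l) * (Im u - Im l))"
    using le by (simp add: ennreal_mult)
  also have "(Re u - Re l) * (Im u - Im l) = (\<Prod>b\<in>Basis. (u - l) \<bullet> b)"
    by (simp add: Basis_complex_def inner_complex_def)
  finally show "emeasure (distr (lborel \<Otimes>\<^sub>M lborel) borel (\<lambda>p. Complex (fst p) (snd p))) (box l u) = (\<Prod>b\<in>Basis. (u - l) \<bullet> b)" .
qed simp

lemma nn_integral_complex_iterated:
  fixes f :: "complex \<Rightarrow> ennreal"
  assumes [measurable]: "f \<in> borel_measurable borel"
  shows "(\<integral>\<^sup>+z. f z \<partial>lborel) = (\<integral>\<^sup>+t. \<integral>\<^sup>+s. f (Complex s t) \<partial>lborel \<partial>lborel)"
    and "(\<integral>\<^sup>+z. f z \<partial>lborel) = (\<integral>\<^sup>+s. \<integral>\<^sup>+t. f (Complex s t) \<partial>lborel \<partial>lborel)"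
proof -
  have m: "(\<lambda>p. Complex (fst p) (snd p)) \<in> borel_measurable (lborel \<Otimes>\<^sub>M lborel)"
    using measurable_Complex_pair by (simp cong: measurable_cong_sets)
  have fm: "(\<lambda>p. f (Complex (fst p) (snd p))) \<in> borel_measurable (lborel \<Otimes>\<^sub>M lborel)"
    using measurable_compose[OF m assms] .
  have "(\<integral>\<^sup>+z. f z \<partial>lborel) = (\<integral>\<^sup>+p. f (Complex (fst p) (snd p)) \<partial>(lborel \<Otimes>\<^sub>M lborel))"
    using nn_integral_distr[OF m, of f] by (simp add: lborel_complex_eq_distr)
  then show "(\<integral>\<^sup>+z. f z \<partial>lborel) = (\<integral>\<^sup>+t. \<integral>\<^sup>+s. f (Complex s t) \<partial>lborel \<partial>lborel)"
    and "(\<integral>\<^sup>+z. f z \<partial>lborel) = (\<integral>\<^sup>+s. \<integral>\<^sup>+t. f (Complex s t) \<partial>lborel \<partial>lborel)"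
    using lborel_pair.nn_integral_snd[OF fm] lborel.nn_integral_fst[OF fm] by simp_all
qed

text \<open>A rotation that is not a quarter turn is a composition of two shears and scalings, each of which acts on a single
variable, so the one-dimensional substitution rule applies twice.\<close>

lemma nn_integral_complex_rotated:
  fixes f :: "complex \<Rightarrow> ennreal"
  assumes f [measurable]: "f \<in> borel_measurable borel" and \<nu>: "norm \<nu> = 1"
  shows "(\<integral>\<^sup>+z. f (\<nu> * z) \<partial>lborel) = (\<integral>\<^sup>+z. f z \<partial>lborel)"
proof -
  define a b where "a = Re \<nu>" and "b = Im \<nu>"
  have ab: "a * a + b * b = 1" using \<nu> by (simp add: a_def b_def cmod_def power2_eq_square)
  have mult: "\<nu> * Complex s t = Complex (a * s - b * t) (b * s + a * t)" for s t
    by (simp add: a_def b_def complex_eq_iff)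
  have m1 [measurable]: "(\<lambda>x. f (Complex (g x) (h x))) \<in> borel_measurable borel"
    if [measurable]: "g \<in> borel_measurable borel" "h \<in> borel_measurable borel" for g h :: "real \<Rightarrow> real"
    unfolding Complex_eq by measurable
  have "(\<integral>\<^sup>+z. f (\<nu> * z) \<partial>lborel) = (\<integral>\<^sup>+t. \<integral>\<^sup>+s. f (Complex (a * s - b * t) (b * s + a * t)) \<partial>lborel \<partial>lborel)"
    by (subst nn_integral_complex_iterated(1)) (auto simp: mult)
  also have "\<dots> = (\<integral>\<^sup>+z. f z \<partial>lborel)"
  proof (cases "a = 0")
    case False
    (* substitute x = a s - b t for s, and then y = (b x + t)/a for t *)
    have i1: "(\<integral>\<^sup>+x. f (Complex x ((b * x + t) / a)) \<partial>lborel) = ennreal \<bar>a\<bar> * (\<integral>\<^sup>+s. f (Complex (a * s - b * t) (b * s + a * t)) \<partial>lborel)" for t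
    proof -
      have "(b * (- (b * t) + a * s) + t) / a = b * s + a * t" for s
      proof -
        have "b * (- (b * t) + a * s) + t = a * (b * s) + t * (1 - b * b)" by (simp add: algebra_simps)
        also have "\<dots> = a * (b * s + a * t)" using ab by (simp add: algebra_simps flip: ab)
        finally show ?thesis using False by simp
      qed
      then show ?thesis
        using nn_integral_real_affine[of "\<lambda>x. f (Complex x ((b * x + t) / a))" a "- (b * t)"] False by (simp add: m1)
    qed
    have i2: "(\<integral>\<^sup>+t. f (Complex x ((b * x + t) / a)) \<partial>lborel) = ennreal \<bar>a\<bar> * (\<integral>\<^sup>+y. f (Complex x y) \<partial>lborel)" for x
    proof -
      have "(\<integral>\<^sup>+t. f (Complex x ((b * x + t) / a)) \<partial>lborel) = ennreal \<bar>a\<bar> * (\<integral>\<^sup>+y. f (Complex x ((b * x + (- (b * x) + a * y)) / a)) \<partial>lborel)"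
        using nn_integral_real_affine[of "\<lambda>t. f (Complex x ((b * x + t) / a))" a "- (b * x)"] False by (simp add: m1)
      then show ?thesis using False by simp
    qed
    have m2: "(\<lambda>p. f (Complex (fst p) ((b * fst p + snd p) / a))) \<in> borel_measurable (lborel \<Otimes>\<^sub>M lborel)"
      by (simp add: Complex_eq)
    have m4: "(\<lambda>p. f (Complex (a * snd p - b * fst p) (b * snd p + a * fst p))) \<in> borel_measurable (lborel \<Otimes>\<^sub>M lborel)"
      by (simp add: Complex_eq)
    have "ennreal \<bar>a\<bar> * (\<integral>\<^sup>+t. \<integral>\<^sup>+s. f (Complex (a * s - b * t) (b * s + a * t)) \<partial>lborel \<partial>lborel)
       = (\<integral>\<^sup>+t. \<integral>\<^sup>+x. f (Complex x ((b * x + t) / a)) \<partial>lborel \<partial>lborel)"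
      unfolding i1 using lborel.borel_measurable_nn_integral_fst[OF m4] by (intro nn_integral_cmult[symmetric]) simp
    also have "(\<integral>\<^sup>+t. \<integral>\<^sup>+x. f (Complex x ((b * x + t) / a)) \<partial>lborel \<partial>lborel)
        = (\<integral>\<^sup>+x. \<integral>\<^sup>+t. f (Complex x ((b * x + t) / a)) \<partial>lborel \<partial>lborel)"
      using lborel_pair.Fubini[OF m2] by simp
    also have "\<dots> = ennreal \<bar>a\<bar> * (\<integral>\<^sup>+x. \<integral>\<^sup>+y. f (Complex x y) \<partial>lborel \<partial>lborel)"
      unfolding i2
    proof (rule nn_integral_cmult)
      have "(\<lambda>p. f (Complex (fst p) (snd p))) \<in> borel_measurable (lborel \<Otimes>\<^sub>M lborel)"
        by (simp add: Complex_eq)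
      from lborel.borel_measurable_nn_integral_fst[OF this]
      show "(\<lambda>x. \<integral>\<^sup>+y. f (Complex x y) \<partial>lborel) \<in> borel_measurable lborel" by simp
    qed
    also have "(\<integral>\<^sup>+x. \<integral>\<^sup>+y. f (Complex x y) \<partial>lborel \<partial>lborel) = (\<integral>\<^sup>+z. f z \<partial>lborel)"
      by (rule nn_integral_complex_iterated(2)[symmetric, OF f])
    finally show ?thesis using False by (simp add: ennreal_mult_cancel_left)
  next
    case True
    then have b: "b * b = 1" "b \<noteq> 0" using ab by auto
    then have b1: "\<bar>b\<bar> = 1" by (metis abs_mult_self_eq abs_ge_zero abs_mult abs_one mult_eq_1_iff real_sqrt_abs2 real_sqrt_one)
    have i1: "(\<integral>\<^sup>+s. f (Complex x (b * s)) \<partial>lborel) = (\<integral>\<^sup>+y. f (Complex x y) \<partial>lborel)" for x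
      using nn_integral_real_affine[of "\<lambda>y. f (Complex x y)" b 0] b b1 by (simp add: m1)
    have m3: "(\<lambda>x. \<integral>\<^sup>+y. f (Complex x y) \<partial>lborel) \<in> borel_measurable lborel"
    proof -
      have "(\<lambda>p. f (Complex (fst p) (snd p))) \<in> borel_measurable (lborel \<Otimes>\<^sub>M lborel)"
        by (simp add: Complex_eq)
      from lborel.borel_measurable_nn_integral_fst[OF this] show ?thesis by simp
    qed
    have "(\<integral>\<^sup>+t. \<integral>\<^sup>+s. f (Complex (a * s - b * t) (b * s + a * t)) \<partial>lborel \<partial>lborel)
       = (\<integral>\<^sup>+t. \<integral>\<^sup>+y. f (Complex (0 + (- b) * t) y) \<partial>lborel \<partial>lborel)"
      by (simp add: True i1)
    also have "\<dots> = (\<integral>\<^sup>+x. \<integral>\<^sup>+y. f (Complex x y) \<partial>lborel \<partial>lborel)"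
      using nn_integral_real_affine[of "\<lambda>x. \<integral>\<^sup>+y. f (Complex x y) \<partial>lborel" "- b" 0] b b1 m3 by simp
    also have "\<dots> = (\<integral>\<^sup>+z. f z \<partial>lborel)"
      by (rule nn_integral_complex_iterated(2)[symmetric, OF f])
    finally show ?thesis .
  qed
  finally show ?thesis .
qed

lemma lborel_complex_frame:
  assumes \<nu>: "norm \<nu> = 1"
  shows "distr (lborel \<Otimes>\<^sub>M lborel) borel (\<lambda>p. x + \<nu> * Complex (fst p) (snd p)) = lborel"
proof -
  have rot: "distr lborel borel ((*) \<nu>) = lborel"
  proof (rule measure_eqI)
    fix A assume "A \<in> sets (distr lborel borel ((*) \<nu>))"
    then have A [measurable]: "A \<in> sets borel" by simp
    have "emeasure (distr lborel borel ((*) \<nu>)) A = (\<integral>\<^sup>+z. indicator A z \<partial>distr lborel borel ((*) \<nu>))"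
      using A by simp
    also have "\<dots> = (\<integral>\<^sup>+z. indicator A (\<nu> * z) \<partial>lborel)"
      by (rule nn_integral_distr) auto
    also have "\<dots> = (\<integral>\<^sup>+z. indicator A z \<partial>lborel)"
      by (rule nn_integral_complex_rotated[OF _ \<nu>]) simp
    finally show "emeasure (distr lborel borel ((*) \<nu>)) A = emeasure lborel A" using A by simp
  qed simp
  have m: "(\<lambda>p. Complex (fst p) (snd p)) \<in> borel_measurable (lborel \<Otimes>\<^sub>M lborel)"
    using measurable_Complex_pair by (simp cong: measurable_cong_sets)
  (* translation after rotation *)
  have "lborel = distr (distr (distr (lborel \<Otimes>\<^sub>M lborel) borel (\<lambda>p. Complex (fst p) (snd p))) borel ((*) \<nu>)) borel ((+) x)"
    by (simp add: lborel_complex_eq_distr lborel_distr_plus rot)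
  also have "\<dots> = distr (lborel \<Otimes>\<^sub>M lborel) borel (\<lambda>p. x + \<nu> * Complex (fst p) (snd p))"
    using m by (simp add: distr_distr comp_def)
  finally show ?thesis ..
qed

lemma inner_frame:
  assumes "norm \<nu> = 1"
  shows "(x + \<nu> * Complex s t - x) \<bullet> \<nu> = s" "(x + \<nu> * Complex s t - x) \<bullet> (\<i> * \<nu>) = t"
    "(norm z)\<^sup>2 = (z \<bullet> \<nu>)\<^sup>2 + (z \<bullet> (\<i> * \<nu>))\<^sup>2"
proof -
  have n: "Re \<nu> * Re \<nu> + Im \<nu> * Im \<nu> = 1" using assms by (simp add: cmod_def power2_eq_square)
  have "s * (Re \<nu> * Re \<nu> + Im \<nu> * Im \<nu>) = s" "t * (Re \<nu> * Re \<nu> + Im \<nu> * Im \<nu>) = t" by (simp_all add: n)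
  then show "(x + \<nu> * Complex s t - x) \<bullet> \<nu> = s" "(x + \<nu> * Complex s t - x) \<bullet> (\<i> * \<nu>) = t"
    by (simp_all add: inner_complex_def algebra_simps)
  have "(z \<bullet> \<nu>)\<^sup>2 + (z \<bullet> (\<i> * \<nu>))\<^sup>2 = ((Re z)\<^sup>2 + (Im z)\<^sup>2) * (Re \<nu> * Re \<nu> + Im \<nu> * Im \<nu>)"
    by (simp add: inner_complex_def power2_eq_square algebra_simps)
  then show "(norm z)\<^sup>2 = (z \<bullet> \<nu>)\<^sup>2 + (z \<bullet> (\<i> * \<nu>))\<^sup>2" by (simp add: n cmod_power2)
qed

text \<open>Fubini's theorem in the orthonormal frame \<open>\<nu>\<close>, \<open>\<i> \<nu>\<close> with origin \<open>x\<close>.\<close>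

lemma integral_frame_product:
  fixes f g :: "real \<Rightarrow> real"
  assumes \<nu>: "norm \<nu> = 1" and f: "integrable lborel f" and g: "integrable lborel g"
  shows "integrable lborel (\<lambda>y. f ((y - x) \<bullet> \<nu>) * g ((y - x) \<bullet> (\<i> * \<nu>)))"
    and "(\<integral>y. f ((y - x) \<bullet> \<nu>) * g ((y - x) \<bullet> (\<i> * \<nu>)) \<partial>lborel) = (\<integral>s. f s \<partial>lborel) * (\<integral>t. g t \<partial>lborel)"
proof -
  have [measurable]: "f \<in> borel_measurable borel" "g \<in> borel_measurable borel"
    using f g by (auto dest: borel_measurable_integrable)
  let ?T = "\<lambda>p. x + \<nu> * Complex (fst p) (snd p)"
  have T: "?T \<in> borel_measurable (lborel \<Otimes>\<^sub>M lborel)"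
    unfolding Complex_eq by (simp cong: measurable_cong_sets)
  let ?h = "\<lambda>y. f ((y - x) \<bullet> \<nu>) * g ((y - x) \<bullet> (\<i> * \<nu>))"
  have h: "?h \<in> borel_measurable borel" by measurable
  have hT: "?h (?T p) = f (fst p) * g (snd p)" for p using inner_frame(1,2)[OF \<nu>] by simp
  have i: "integrable (lborel \<Otimes>\<^sub>M lborel) (\<lambda>p. f (fst p) * g (snd p))"
  proof (rule lborel_pair.Fubini_integrable)
    show "(\<lambda>p. f (fst p) * g (snd p)) \<in> borel_measurable (lborel \<Otimes>\<^sub>M lborel)" by simp
    show "integrable lborel (\<lambda>x. \<integral>y. norm (f (fst (x, y)) * g (snd (x, y))) \<partial>lborel)"
      using f by (simp add: abs_mult)
    show "AE x in lborel. integrable lborel (\<lambda>y. f (fst (x, y)) * g (snd (x, y)))"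
      using g by simp
  qed
  then show "integrable lborel ?h"
    using integrable_distr_eq[OF T h] unfolding lborel_complex_frame[OF \<nu>] hT by simp
  have "(\<integral>y. ?h y \<partial>lborel) = (\<integral>p. f (fst p) * g (snd p) \<partial>(lborel \<Otimes>\<^sub>M lborel))"
    using integral_distr[OF T h] unfolding lborel_complex_frame[OF \<nu>] hT by simp
  also have "\<dots> = (\<integral>s. (\<integral>t. f s * g t \<partial>lborel) \<partial>lborel)"
    using lborel_pair.integral_fst'[OF i] by simp
  finally show "(\<integral>y. ?h y \<partial>lborel) = (\<integral>s. f s \<partial>lborel) * (\<integral>t. g t \<partial>lborel)" by simp
qed

section \<open>Blow-up along a jump\<close>

definition bump1 :: "nat \<Rightarrow> real \<Rightarrow> real \<Rightarrow> real" where
  "bump1 n c s = flat (n * (s + c)) * flat (n * (c - s))"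

definition bump1_deriv :: "nat \<Rightarrow> real \<Rightarrow> real \<Rightarrow> real" where
  "bump1_deriv n c s = n * flat_poly (flat_step 1) (n * (s + c)) * flat (n * (c - s))
     - n * flat (n * (s + c)) * flat_poly (flat_step 1) (n * (c - s))"

lemma DERIV_bump1: "(bump1 n c has_real_derivative bump1_deriv n c s) (at s)"
proof -
  have "((\<lambda>s. flat (n * (s + c))) has_real_derivative flat_poly (flat_step 1) (n * (s + c)) * n) (at s)"
    by (rule DERIV_chain2[OF DERIV_flat_poly]) (auto intro!: derivative_eq_intros)
  moreover have "((\<lambda>s. flat (n * (c - s))) has_real_derivative flat_poly (flat_step 1) (n * (c - s)) * (- n)) (at s)"
    by (rule DERIV_chain2[OF DERIV_flat_poly]) (auto intro!: derivative_eq_intros)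
  ultimately show ?thesis
    unfolding bump1_def[abs_def] bump1_deriv_def by (auto intro!: derivative_eq_intros)
qed

lemma continuous_flat_poly: "continuous_on UNIV (flat_poly p)"
  by (meson DERIV_flat_poly DERIV_isCont continuous_at_imp_continuous_on)

lemma continuous_bump1: "continuous_on A (bump1 n c)" "continuous_on A (bump1_deriv n c)"
  unfolding bump1_def[abs_def] bump1_deriv_def[abs_def]
  by (intro continuous_intros continuous_on_compose2[OF continuous_flat_poly]; simp)+

lemma flat_poly_nonpos: "x \<le> 0 \<Longrightarrow> flat_poly p x = 0"
  by (simp add: flat_poly_def)

lemma bump1_outside: "c \<le> \<bar>s\<bar> \<Longrightarrow> bump1 n c s = 0" "c \<le> \<bar>s\<bar> \<Longrightarrow> bump1_deriv n c s = 0"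
proof -
  assume "c \<le> \<bar>s\<bar>"
  then have "n * (s + c) \<le> 0 \<or> n * (c - s) \<le> 0"
    by (cases "s \<ge> 0") (auto simp: mult_le_0_iff)
  then show "bump1 n c s = 0" "bump1_deriv n c s = 0"
    by (auto simp: bump1_def bump1_deriv_def flat_poly_nonpos)
qed

lemma bump1_bounds: "0 \<le> bump1 n c s" "bump1 n c s \<le> 1"
  unfolding bump1_def by (auto intro!: mult_nonneg_nonneg mult_le_one simp: flat_bounds)

lemma bump1_deriv_bounded: obtains B where "B \<ge> 0" "\<And>s. \<bar>bump1_deriv n c s\<bar> \<le> B"
proof (rule continuous_compact_support_bounded[OF continuous_bump1(2)])
  show "compact {-\<bar>c\<bar>..\<bar>c\<bar>}" by simp
  show "bump1_deriv n c s = 0" if "s \<notin> {-\<bar>c\<bar>..\<bar>c\<bar>}" for s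
    using that by (intro bump1_outside(2)) auto
qed (use that in blast)

lemma bump1_tendsto: "\<bar>s\<bar> < c \<Longrightarrow> (\<lambda>n. bump1 n c s) \<longlonglongrightarrow> 1"
  unfolding bump1_def using tendsto_mult[OF flat_scaled_tendsto_1[of "s + c"] flat_scaled_tendsto_1[of "c - s"]]
  by (simp add: abs_less_iff)

lemma integral_bump1_tendsto:
  assumes "c > 0" shows "(\<lambda>n. \<integral>s. bump1 n c s \<partial>lborel) \<longlonglongrightarrow> 2 * c"
proof -
  have m: "bump1 n c \<in> borel_measurable borel" for n by (rule borel_measurable_continuous_onI[OF continuous_bump1(1)])
  have "(\<lambda>n. \<integral>s. bump1 n c s \<partial>lborel) \<longlonglongrightarrow> (\<integral>s. indicator {-c<..<c} s \<partial>lborel)"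
  proof (rule integral_dominated_convergence[where w = "indicator {-c<..<c}"])
    show "AE s in lborel. (\<lambda>n. bump1 n c s) \<longlonglongrightarrow> indicator {-c<..<c} s"
    proof (rule AE_I2)
      fix s show "(\<lambda>n. bump1 n c s) \<longlonglongrightarrow> indicator {-c<..<c} s"
        using bump1_tendsto[of s c] bump1_outside(1)[of c s] by (cases "\<bar>s\<bar> < c") (auto simp: indicator_def)
    qed
    show "AE s in lborel. norm (bump1 n c s) \<le> indicator {-c<..<c} s" for n
      using bump1_bounds[of n c] bump1_outside(1)[of c] by (intro AE_I2) (auto simp: indicator_def not_less abs_le_iff)
    show "integrable lborel (indicator {-c<..<c} :: real \<Rightarrow> real)"
      using assms by (intro integrable_real_indicator) auto
  qed (use m in auto)
  then show ?thesis using assms by simp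
qed

text \<open>As \<open>n\<close> grows, the product tends to \<open>2 * 199/200 = 1.99\<close>.\<close>

lemma bump1_mass:
  obtains n where "99/50 < bump1 n (1/20) 0 * (\<integral>t. bump1 n (199/200) t \<partial>lborel)"
proof -
  have "(\<lambda>n. bump1 n (1/20) 0 * (\<integral>t. bump1 n (199/200) t \<partial>lborel)) \<longlonglongrightarrow> 1 * (2 * (199/200))"
    by (intro tendsto_mult bump1_tendsto integral_bump1_tendsto) auto
  then have "eventually (\<lambda>n. 99/50 < bump1 n (1/20) 0 * (\<integral>t. bump1 n (199/200) t \<partial>lborel)) sequentially"
    by (rule order_tendstoD) simp
  then show ?thesis using that by (auto simp: eventually_sequentially)
qed

text \<open>Short in the normal direction \<open>\<nu>\<close> and long in the tangential direction: the support lies in \<open>ball x r\<close> because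
\<open>(1/20)\<^sup>2 + (199/200)\<^sup>2 < 1\<close>, and its tangential length is almost the diameter \<open>2 r\<close>.\<close>

definition frame_bump :: "nat \<Rightarrow> complex \<Rightarrow> complex \<Rightarrow> real \<Rightarrow> complex \<Rightarrow> real" where
  "frame_bump n x \<nu> r y = bump1 n (1/20) (((y - x) \<bullet> \<nu>) / r) * bump1 n (199/200) (((y - x) \<bullet> (\<i> * \<nu>)) / r)"

lemma frame_bump_bounds: "0 \<le> frame_bump n x \<nu> r y" "frame_bump n x \<nu> r y \<le> 1"
  unfolding frame_bump_def by (auto intro!: mult_nonneg_nonneg mult_le_one simp: bump1_bounds)

context
  fixes \<nu> x :: complex and r :: real and n :: nat
  assumes \<nu>: "norm \<nu> = 1" and r: "r > 0"
begin

lemma frame_box_subset_ball: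
  assumes "\<bar>((y - x) \<bullet> \<nu>) / r\<bar> < 1/20" "\<bar>((y - x) \<bullet> (\<i> * \<nu>)) / r\<bar> < 199/200"
  shows "y \<in> ball x r"
proof -
  let ?S = "((y - x) \<bullet> \<nu>) / r" and ?T = "((y - x) \<bullet> (\<i> * \<nu>)) / r"
  have "(norm (y - x))\<^sup>2 = r\<^sup>2 * (?S\<^sup>2 + ?T\<^sup>2)"
    using r by (simp add: inner_frame(3)[OF \<nu>, of "y - x"] power_divide distrib_left)
  also have "\<dots> < r\<^sup>2 * 1"
  proof (rule mult_strict_left_mono)
    have "?S\<^sup>2 \<le> (1/20)\<^sup>2" "?T\<^sup>2 \<le> (199/200)\<^sup>2"
      using assms by (auto intro!: abs_le_square_iff[THEN iffD1] simp del: abs_divide)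
    then have "?S\<^sup>2 + ?T\<^sup>2 \<le> (1/20)\<^sup>2 + (199/200)\<^sup>2" by (rule add_mono)
    also have "\<dots> < 1" by (simp add: power2_eq_square)
    finally show "?S\<^sup>2 + ?T\<^sup>2 < 1" .
  qed (use r in simp)
  finally have "norm (y - x) < r" using r by (simp add: power_less_imp_less_base)
  then show ?thesis by (simp add: dist_norm norm_minus_commute)
qed

lemma frame_bump_outside: "y \<notin> ball x r \<Longrightarrow> frame_bump n x \<nu> r y = 0"
  using frame_box_subset_ball[of y] bump1_outside(1)[of "1/20" "((y - x) \<bullet> \<nu>) / r" n]
    bump1_outside(1)[of "199/200" "((y - x) \<bullet> (\<i> * \<nu>)) / r" n]
  by (auto simp: frame_bump_def not_less[symmetric])

lemma frame_bump_test: "cball x r \<subseteq> \<Omega> \<Longrightarrow> frame_bump n x \<nu> r \<in> test_functions \<Omega>"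
proof (rule test_functionsI[of _ "cball x r"])
  fix k
  have e: "flat (n * (((y - x) \<bullet> w) / r + c)) = flat_poly 1 (((n / r) *\<^sub>R w) \<bullet> y + (n * c - n * (x \<bullet> w) / r))"
    "flat (n * (c - ((y - x) \<bullet> w) / r)) = flat_poly 1 (((- n / r) *\<^sub>R w) \<bullet> y + (n * c + n * (x \<bullet> w) / r))" for y w :: complex and c :: real
  proof -
    have d: "(y - x) \<bullet> w = w \<bullet> y - x \<bullet> w" by (simp only: inner_diff_left inner_commute[of y w])
    show "flat (n * (((y - x) \<bullet> w) / r + c)) = flat_poly 1 (((n / r) *\<^sub>R w) \<bullet> y + (n * c - n * (x \<bullet> w) / r))"
      "flat (n * (c - ((y - x) \<bullet> w) / r)) = flat_poly 1 (((- n / r) *\<^sub>R w) \<bullet> y + (n * c + n * (x \<bullet> w) / r))"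
      unfolding d using r by (auto intro!: arg_cong[where f = flat] simp: field_simps)
  qed
  have "C_k k (\<lambda>y. bump1 n c (((y - x) \<bullet> w) / r))" for c and w :: complex
  proof -
    have 1: "(\<lambda>y. flat (n * (((y - x) \<bullet> w) / r + c))) = (\<lambda>y. flat_poly 1 (((n / r) *\<^sub>R w) \<bullet> y + (n * c - n * (x \<bullet> w) / r)))"
      by (rule ext) (rule e(1))
    have 2: "(\<lambda>y. flat (n * (c - ((y - x) \<bullet> w) / r))) = (\<lambda>y. flat_poly 1 (((- n / r) *\<^sub>R w) \<bullet> y + (n * c + n * (x \<bullet> w) / r)))"
      by (rule ext) (rule e(2))
    have "C_k k (\<lambda>y. flat (n * (((y - x) \<bullet> w) / r + c)))" "C_k k (\<lambda>y. flat (n * (c - ((y - x) \<bullet> w) / r)))"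
      unfolding 1 2 by (rule C_k_flat_affine)+
    then show ?thesis unfolding bump1_def by (rule C_k_mult)
  qed
  then show "C_k k (frame_bump n x \<nu> r)"
    unfolding frame_bump_def[abs_def] by (intro C_k_mult)
  show "frame_bump n x \<nu> r y = 0" if "y \<notin> cball x r" for y
    using that by (intro frame_bump_outside) auto
qed auto

lemma frame_bump_derivative:
  "frechet_derivative (frame_bump n x \<nu> r) (at y) w =
     (bump1_deriv n (1/20) (((y - x) \<bullet> \<nu>) / r) / r) * bump1 n (199/200) (((y - x) \<bullet> (\<i> * \<nu>)) / r) * (w \<bullet> \<nu>)
     + bump1 n (1/20) (((y - x) \<bullet> \<nu>) / r) * (bump1_deriv n (199/200) (((y - x) \<bullet> (\<i> * \<nu>)) / r) / r) * (w \<bullet> (\<i> * \<nu>))"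
proof -
  have D: "((\<lambda>y. bump1 n c (((y - x) \<bullet> u) / r)) has_derivative
      (\<lambda>w. (bump1_deriv n c (((y - x) \<bullet> u) / r) / r) * (w \<bullet> u))) (at y)" for c and u :: complex
  proof -
    have "((\<lambda>y. ((y - x) \<bullet> u) / r) has_derivative (\<lambda>w. (w \<bullet> u) / r)) (at y)"
      using r by (auto intro!: derivative_eq_intros)
    from diff_chain_at[OF this DERIV_bump1[THEN has_field_derivative_imp_has_derivative]]
    show ?thesis by (simp add: o_def)
  qed
  have "(frame_bump n x \<nu> r has_derivative (\<lambda>w. bump1 n (1/20) (((y - x) \<bullet> \<nu>) / r) * ((bump1_deriv n (199/200) (((y - x) \<bullet> (\<i> * \<nu>)) / r) / r) * (w \<bullet> (\<i> * \<nu>)))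
      + (bump1_deriv n (1/20) (((y - x) \<bullet> \<nu>) / r) / r) * (w \<bullet> \<nu>) * bump1 n (199/200) (((y - x) \<bullet> (\<i> * \<nu>)) / r))) (at y)"
    unfolding frame_bump_def[abs_def] by (rule has_derivative_mult[OF D D])
  then show ?thesis by (simp add: frechet_derivative_eqI algebra_simps)
qed

lemma bump1_scaled_integrals:
  assumes c: "c > 0"
  shows "integrable lborel (\<lambda>s. bump1 n c (s / r))" "(\<integral>s. bump1 n c (s / r) \<partial>lborel) = r * (\<integral>s. bump1 n c s \<partial>lborel)"
    "integrable lborel (\<lambda>s. bump1_deriv n c (s / r) / r)" "(\<integral>s. bump1_deriv n c (s / r) / r \<partial>lborel) = 0"
    "(\<integral>s. indicator {0<..} s * (bump1_deriv n c (s / r) / r) \<partial>lborel) = - bump1 n c 0"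
    "(\<integral>s. indicator {..0} s * (bump1_deriv n c (s / r) / r) \<partial>lborel) = bump1 n c 0"
proof -
  have m [measurable]: "bump1 n c \<in> borel_measurable borel" "bump1_deriv n c \<in> borel_measurable borel"
    by (rule borel_measurable_continuous_onI[OF continuous_bump1(1)], rule borel_measurable_continuous_onI[OF continuous_bump1(2)])
  have out: "bump1 n c (s / r) = 0" "bump1_deriv n c (s / r) = 0" if "r * c \<le> \<bar>s\<bar>" for s
    using bump1_outside[of c "s / r" n] that r by (simp_all add: abs_divide pos_le_divide_eq mult.commute)
  show "integrable lborel (\<lambda>s. bump1 n c (s / r))"
    by (rule integrable_lborel_bounded_support[where K = "{-(r * c)..r * c}" and B = 1])
       (use out(1) bump1_bounds in \<open>auto simp: abs_le_iff not_le\<close>)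
  show "(\<integral>s. bump1 n c (s / r) \<partial>lborel) = r * (\<integral>s. bump1 n c s \<partial>lborel)"
    using lborel_integral_real_affine[of r "\<lambda>s. bump1 n c (s / r)" 0] r by simp
  obtain B where B: "B \<ge> 0" "\<And>s. \<bar>bump1_deriv n c s\<bar> \<le> B" using bump1_deriv_bounded by metis
  show "integrable lborel (\<lambda>s. bump1_deriv n c (s / r) / r)"
  proof (rule integrable_lborel_bounded_support[where K = "{-(r * c)..r * c}" and B = "B / r"])
    show "bump1_deriv n c (s / r) / r = 0" if "s \<notin> {-(r * c)..r * c}" for s
      using out(2)[of s] that by (auto simp: not_le)
    show "\<bar>bump1_deriv n c (s / r) / r\<bar> \<le> B / r" for s
      using B(2)[of "s / r"] r by (simp add: abs_divide divide_right_mono)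
  qed auto
  have FTC: "(\<integral>s. (bump1_deriv n c (s / r) / r) * indicator {a..b} s \<partial>lborel) = bump1 n c (b / r) - bump1 n c (a / r)"
    if "a \<le> b" for a b
  proof (rule integral_FTC_Icc_real[OF that])
    show "((\<lambda>s. bump1 n c (s / r)) has_real_derivative bump1_deriv n c (s / r) / r) (at s)" for s
    proof -
      have "((\<lambda>s. s / r) has_real_derivative 1 / r) (at s)" using r by (auto intro!: derivative_eq_intros)
      from DERIV_chain2[OF DERIV_bump1 this] show ?thesis by simp
    qed
    have "continuous_on UNIV (\<lambda>s. bump1_deriv n c (s / r) / r)"
      using r by (intro continuous_intros continuous_on_compose2[OF continuous_bump1(2)[of UNIV]]) auto
    then show "isCont (\<lambda>s. bump1_deriv n c (s / r) / r) s" for s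
      by (simp add: continuous_on_eq_continuous_at)
  qed
  have rc: "0 \<le> r * c" using r c by simp
  have e: "bump1 n c (r * c / r) = 0" "bump1 n c (- (r * c) / r) = 0"
    using r c by (auto intro!: bump1_outside)
  show "(\<integral>s. bump1_deriv n c (s / r) / r \<partial>lborel) = 0"
  proof -
    have "(\<integral>s. bump1_deriv n c (s / r) / r \<partial>lborel) = (\<integral>s. (bump1_deriv n c (s / r) / r) * indicator {-(r * c)..r * c} s \<partial>lborel)"
    proof (rule Bochner_Integration.integral_cong[OF refl])
      fix s show "bump1_deriv n c (s / r) / r = (bump1_deriv n c (s / r) / r) * indicator {-(r * c)..r * c} s"
        using out(2)[of s] by (cases "r * c \<le> \<bar>s\<bar>") (auto simp: indicator_def not_le abs_less_iff)
    qed
    also have "\<dots> = bump1 n c (r * c / r) - bump1 n c (- (r * c) / r)" by (rule FTC) (use rc in simp)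
    also have "\<dots> = 0" by (simp only: e diff_self)
    finally show ?thesis .
  qed
  show "(\<integral>s. indicator {0<..} s * (bump1_deriv n c (s / r) / r) \<partial>lborel) = - bump1 n c 0"
  proof -
    have "(\<integral>s. indicator {0<..} s * (bump1_deriv n c (s / r) / r) \<partial>lborel) = (\<integral>s. (bump1_deriv n c (s / r) / r) * indicator {0..r * c} s \<partial>lborel)"
    proof (rule integral_cong_AE)
      show "AE s in lborel. indicator {0<..} s * (bump1_deriv n c (s / r) / r) = (bump1_deriv n c (s / r) / r) * indicator {0..r * c} s"
        using AE_lborel_singleton[of "0::real"]
      proof eventually_elim
        case (elim s)
        then show ?case using out(2)[of s] by (cases "r * c \<le> \<bar>s\<bar>") (auto simp: indicator_def not_le abs_less_iff)
      qed
    qed auto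
    also have "\<dots> = bump1 n c (r * c / r) - bump1 n c (0 / r)" by (rule FTC[OF rc])
    also have "\<dots> = - bump1 n c 0" by (simp only: e div_0 diff_0)
    finally show ?thesis .
  qed
  show "(\<integral>s. indicator {..0} s * (bump1_deriv n c (s / r) / r) \<partial>lborel) = bump1 n c 0"
  proof -
    have "(\<integral>s. indicator {..0} s * (bump1_deriv n c (s / r) / r) \<partial>lborel) = (\<integral>s. (bump1_deriv n c (s / r) / r) * indicator {-(r * c)..0} s \<partial>lborel)"
    proof (rule Bochner_Integration.integral_cong[OF refl])
      fix s show "indicator {..0} s * (bump1_deriv n c (s / r) / r) = (bump1_deriv n c (s / r) / r) * indicator {-(r * c)..0} s"
        using out(2)[of s] by (cases "r * c \<le> \<bar>s\<bar>") (auto simp: indicator_def not_le abs_less_iff)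
    qed
    also have "\<dots> = bump1 n c (0 / r) - bump1 n c (- (r * c) / r)" by (rule FTC) (use rc in simp)
    also have "\<dots> = bump1 n c 0" by (simp only: e div_0 diff_0_right)
    finally show ?thesis .
  qed
qed

text \<open>For a field that takes the constant values \<open>A\<close> and \<open>B\<close> on the two sides of the line through \<open>x\<close> orthogonal to \<open>\<nu>\<close>, the
divergence lives on that line with density \<open>(A - B) \<bullet> \<nu>\<close>.\<close>

lemma frame_bump_jump_integral:
  fixes A B :: complex
  defines "G \<equiv> \<lambda>y. if (y - x) \<bullet> \<nu> > 0 then A else B"
  shows "integrable lborel (\<lambda>y. frechet_derivative (frame_bump n x \<nu> r) (at y) (G y))"
    and "- (\<integral>y. frechet_derivative (frame_bump n x \<nu> r) (at y) (G y) \<partial>lborel)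
       = r * (bump1 n (1/20) 0 * (\<integral>t. bump1 n (199/200) t \<partial>lborel)) * ((A - B) \<bullet> \<nu>)"
proof -
  let ?\<alpha> = "\<lambda>s. bump1 n (1/20) (s / r)" and ?\<alpha>' = "\<lambda>s. bump1_deriv n (1/20) (s / r) / r"
  let ?\<beta> = "\<lambda>s. bump1 n (199/200) (s / r)" and ?\<beta>' = "\<lambda>s. bump1_deriv n (199/200) (s / r) / r"
  let ?P = "{0<..} :: real set" and ?N = "{..0} :: real set"
  let ?S = "\<lambda>y. (y - x) \<bullet> \<nu>" and ?T = "\<lambda>y. (y - x) \<bullet> (\<i> * \<nu>)"
  have c: "(0::real) < 1/20" "(0::real) < 199/200" by simp_all
  note a = bump1_scaled_integrals[OF c(1)] and b = bump1_scaled_integrals[OF c(2)]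
  (* sum of products of a function of the normal and one of the tangential coordinate *)
  have eq: "frechet_derivative (frame_bump n x \<nu> r) (at y) (G y) =
     (A \<bullet> \<nu>) * ((indicator ?P (?S y) * ?\<alpha>' (?S y)) * ?\<beta> (?T y)) + (A \<bullet> (\<i> * \<nu>)) * ((indicator ?P (?S y) * ?\<alpha> (?S y)) * ?\<beta>' (?T y))
     + (B \<bullet> \<nu>) * ((indicator ?N (?S y) * ?\<alpha>' (?S y)) * ?\<beta> (?T y)) + (B \<bullet> (\<i> * \<nu>)) * ((indicator ?N (?S y) * ?\<alpha> (?S y)) * ?\<beta>' (?T y))" for y
    unfolding frame_bump_derivative G_def by (simp add: indicator_def mult_ac)
  have ind: "integrable lborel (\<lambda>s. indicator X s * f s)" if "integrable lborel f" "X \<in> sets borel" for f :: "real \<Rightarrow> real" and X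
    using integrable_real_mult_indicator[of X lborel f] that by (simp add: mult.commute)
  have i1: "integrable lborel (\<lambda>y. (indicator X (?S y) * ?\<alpha>' (?S y)) * ?\<beta> (?T y))"
      "integrable lborel (\<lambda>y. (indicator X (?S y) * ?\<alpha> (?S y)) * ?\<beta>' (?T y))" if "X \<in> sets borel" for X
    by (rule integral_frame_product(1)[OF \<nu> ind[OF a(3) that] b(1)], rule integral_frame_product(1)[OF \<nu> ind[OF a(1) that] b(3)])
  have v1: "(\<integral>y. (indicator X (?S y) * ?\<alpha>' (?S y)) * ?\<beta> (?T y) \<partial>lborel) = (\<integral>s. indicator X s * ?\<alpha>' s \<partial>lborel) * (\<integral>t. ?\<beta> t \<partial>lborel)"
      "(\<integral>y. (indicator X (?S y) * ?\<alpha> (?S y)) * ?\<beta>' (?T y) \<partial>lborel) = 0" if "X \<in> sets borel" for X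
  proof -
    show "(\<integral>y. (indicator X (?S y) * ?\<alpha>' (?S y)) * ?\<beta> (?T y) \<partial>lborel) = (\<integral>s. indicator X s * ?\<alpha>' s \<partial>lborel) * (\<integral>t. ?\<beta> t \<partial>lborel)"
      by (rule integral_frame_product(2)[OF \<nu> ind[OF a(3) that] b(1)])
    have "(\<integral>y. (indicator X (?S y) * ?\<alpha> (?S y)) * ?\<beta>' (?T y) \<partial>lborel) = (\<integral>s. indicator X s * ?\<alpha> s \<partial>lborel) * (\<integral>t. ?\<beta>' t \<partial>lborel)"
      by (rule integral_frame_product(2)[OF \<nu> ind[OF a(1) that] b(3)])
    then show "(\<integral>y. (indicator X (?S y) * ?\<alpha> (?S y)) * ?\<beta>' (?T y) \<partial>lborel) = 0" by (simp only: b(4) mult_zero_right)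
  qed
  show "integrable lborel (\<lambda>y. frechet_derivative (frame_bump n x \<nu> r) (at y) (G y))"
    unfolding eq by (intro Bochner_Integration.integrable_add integrable_mult_right i1) auto
  have "(\<integral>y. frechet_derivative (frame_bump n x \<nu> r) (at y) (G y) \<partial>lborel)
     = (A \<bullet> \<nu>) * (- bump1 n (1/20) 0 * (r * (\<integral>t. bump1 n (199/200) t \<partial>lborel))) + (B \<bullet> \<nu>) * (bump1 n (1/20) 0 * (r * (\<integral>t. bump1 n (199/200) t \<partial>lborel)))"
  proof -
    have "(\<integral>y. p1 * u1 y + p2 * u2 y + p3 * u3 y + p4 * u4 y \<partial>lborel)
        = p1 * (\<integral>y. u1 y \<partial>lborel) + p2 * (\<integral>y. u2 y \<partial>lborel) + p3 * (\<integral>y. u3 y \<partial>lborel) + p4 * (\<integral>y. u4 y \<partial>lborel)"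
      if "integrable lborel u1" "integrable lborel u2" "integrable lborel u3" "integrable lborel u4"
      for p1 p2 p3 p4 and u1 u2 u3 u4 :: "complex \<Rightarrow> real"
      using that by simp
    note lin = this[OF i1(1)[of ?P] i1(2)[of ?P] i1(1)[of ?N] i1(2)[of ?N]]
    have PN: "?P \<in> sets borel" "?N \<in> sets borel" by simp_all
    show ?thesis
      unfolding eq lin[OF PN(1) PN(1) PN(2) PN(2)] v1[OF PN(1)] v1[OF PN(2)] a(5,6) b(2) by (simp only: mult_zero_right add_0_right)
  qed
  then show "- (\<integral>y. frechet_derivative (frame_bump n x \<nu> r) (at y) (G y) \<partial>lborel)
       = r * (bump1 n (1/20) 0 * (\<integral>t. bump1 n (199/200) t \<partial>lborel)) * ((A - B) \<bullet> \<nu>)"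
    by (simp add: inner_diff_left algebra_simps)
qed

end

lemma AE_not_in_hyperplane:
  assumes "\<nu> \<noteq> (0::complex)" shows "AE y in lborel. (y - x) \<bullet> \<nu> \<noteq> 0"
proof (rule AE_I')
  have "negligible {y. \<nu> \<bullet> y = x \<bullet> \<nu>}" using assms by (intro negligible_hyperplane) auto
  moreover have "{y. \<nu> \<bullet> y = x \<bullet> \<nu>} \<in> sets borel"
    by (intro borel_closed closed_hyperplane)
  ultimately show "{y. \<nu> \<bullet> y = x \<bullet> \<nu>} \<in> null_sets lborel"
    by (simp add: negligible_iff_null_sets null_sets_completion_iff)
  show "{y \<in> space lborel. \<not> (y - x) \<bullet> \<nu> \<noteq> 0} \<subseteq> {y. \<nu> \<bullet> y = x \<bullet> \<nu>}"
    by (auto simp: inner_diff_left inner_commute[of \<nu>])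
qed

lemma borel_half_ball [measurable]: "half_ball x r \<nu> \<in> sets borel"
  unfolding half_ball_def by measurable

text \<open>The gradient of the bump is of order \<open>1/r\<close>, so replacing \<open>F\<close> by its two one-sided limits costs \<open>o(r\<^sup>2)/r\<close>, which vanishes
after division by \<open>r\<close>.\<close>

lemma frame_bump_blow_up:
  fixes F :: "complex \<Rightarrow> complex"
  assumes F: "F \<in> borel_measurable borel" "\<And>y. norm (F y) \<le> C" and \<nu>: "norm \<nu> = 1"
    and A: "((\<lambda>r. (\<integral>y. indicator (half_ball x r \<nu>) y * norm (F y - A) \<partial>lborel) / r\<^sup>2) \<longlongrightarrow> 0) (at_right 0)"
    and B: "((\<lambda>r. (\<integral>y. indicator (half_ball x r (- \<nu>)) y * norm (F y - B) \<partial>lborel) / r\<^sup>2) \<longlongrightarrow> 0) (at_right 0)"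
  shows "((\<lambda>r. - (\<integral>y. frechet_derivative (frame_bump n x \<nu> r) (at y) (F y) \<partial>lborel) / r) \<longlongrightarrow>
     (bump1 n (1/20) 0 * (\<integral>t. bump1 n (199/200) t \<partial>lborel)) * ((A - B) \<bullet> \<nu>)) (at_right 0)"
proof -
  let ?c = "bump1 n (1/20) 0 * (\<integral>t. bump1 n (199/200) t \<partial>lborel)"
  note [measurable] = F(1)
  obtain K1 where K1: "K1 \<ge> 0" "\<And>s. \<bar>bump1_deriv n (1/20) s\<bar> \<le> K1" using bump1_deriv_bounded by metis
  obtain K2 where K2: "K2 \<ge> 0" "\<And>s. \<bar>bump1_deriv n (199/200) s\<bar> \<le> K2" using bump1_deriv_bounded by metis
  define e1 where "e1 r = (\<integral>y. indicator (half_ball x r \<nu>) y * norm (F y - A) \<partial>lborel)" for r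
  define e2 where "e2 r = (\<integral>y. indicator (half_ball x r (- \<nu>)) y * norm (F y - B) \<partial>lborel)" for r
  define G where "G y = (if (y - x) \<bullet> \<nu> > 0 then A else B)" for y
  have [measurable]: "G \<in> borel_measurable borel" unfolding G_def by measurable
  have bound: "\<bar>- (\<integral>y. frechet_derivative (frame_bump n x \<nu> r) (at y) (F y) \<partial>lborel) / r - ?c * ((A - B) \<bullet> \<nu>)\<bar>
      \<le> (K1 + K2) * (e1 r / r\<^sup>2 + e2 r / r\<^sup>2)" if r: "r > 0" for r
  proof -
    let ?D = "\<lambda>y. frechet_derivative (frame_bump n x \<nu> r) (at y)"
    have T: "frame_bump n x \<nu> r \<in> test_functions UNIV" using frame_bump_test[OF \<nu> r] by simp
    have iu: "\<bar>w \<bullet> (\<i> * \<nu>)\<bar> \<le> norm w" "\<bar>w \<bullet> \<nu>\<bar> \<le> norm w" for w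
      using Cauchy_Schwarz_ineq2[of w "\<i> * \<nu>"] Cauchy_Schwarz_ineq2[of w \<nu>] \<nu> by (auto simp: norm_mult)
    have Db: "\<bar>?D y w\<bar> \<le> (K1 + K2) / r * norm w" for y w
    proof -
      have "\<bar>?D y w\<bar> \<le> \<bar>(bump1_deriv n (1/20) (((y - x) \<bullet> \<nu>) / r) / r) * bump1 n (199/200) (((y - x) \<bullet> (\<i> * \<nu>)) / r) * (w \<bullet> \<nu>)\<bar>
         + \<bar>bump1 n (1/20) (((y - x) \<bullet> \<nu>) / r) * (bump1_deriv n (199/200) (((y - x) \<bullet> (\<i> * \<nu>)) / r) / r) * (w \<bullet> (\<i> * \<nu>))\<bar>"
        unfolding frame_bump_derivative[OF \<nu> r] by (rule abs_triangle_ineq)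
      also have "\<dots> \<le> (K1 / r * 1 * norm w) + (1 * (K2 / r) * norm w)"
        unfolding abs_mult using r K1 K2 bump1_bounds iu
        by (intro add_mono mult_mono) (auto simp: abs_divide divide_right_mono abs_of_nonneg)
      finally show ?thesis by (simp add: add_divide_distrib distrib_right)
    qed
    have D0: "?D y w = 0" if "y \<notin> ball x r" for y w
    proof -
      have "\<not> (\<bar>((y - x) \<bullet> \<nu>) / r\<bar> < 1/20 \<and> \<bar>((y - x) \<bullet> (\<i> * \<nu>)) / r\<bar> < 199/200)"
        using frame_box_subset_ball[OF \<nu> r, of y x] that by blast
      then have "1/20 \<le> \<bar>((y - x) \<bullet> \<nu>) / r\<bar> \<or> 199/200 \<le> \<bar>((y - x) \<bullet> (\<i> * \<nu>)) / r\<bar>"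
        by (simp only: de_Morgan_conj not_less)
      then show ?thesis
        unfolding frame_bump_derivative[OF \<nu> r] using bump1_outside by auto
    qed
    have Dm: "(\<lambda>y. ?D y (H y)) \<in> borel_measurable borel" if [measurable]: "H \<in> borel_measurable borel" for H
    proof -
      have [measurable]: "bump1 n c \<in> borel_measurable borel" "bump1_deriv n c \<in> borel_measurable borel" for c
        by (rule borel_measurable_continuous_onI[OF continuous_bump1(1)], rule borel_measurable_continuous_onI[OF continuous_bump1(2)])
      show ?thesis unfolding frame_bump_derivative[OF \<nu> r] by measurable
    qed
    have iF: "integrable lborel (\<lambda>y. ?D y (F y))"
    proof (rule integrable_lborel_bounded_support[where K = "cball x r" and B = "(K1 + K2) / r * C"])
      show "\<bar>?D y (F y)\<bar> \<le> (K1 + K2) / r * C" for y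
        using Db[of y "F y"] mult_left_mono[OF F(2)[of y], of "(K1 + K2) / r"] K1(1) K2(1) r by fastforce
      show "?D y (F y) = 0" if "y \<notin> cball x r" for y using that by (intro D0) auto
    qed (use Dm in auto)
    have iG: "integrable lborel (\<lambda>y. ?D y (G y))"
      unfolding G_def by (rule frame_bump_jump_integral(1)[OF \<nu> r])
    have iH: "integrable lborel (\<lambda>y. indicator (half_ball x r u) y * norm (F y - E))" for u E
    proof (rule integrable_lborel_bounded_support[where K = "cball x r" and B = "C + norm E"])
      show "\<bar>indicator (half_ball x r u) y * norm (F y - E)\<bar> \<le> C + norm E" for y
        using norm_triangle_ineq4[of "F y" E] F(2)[of y] order_trans[OF norm_ge_zero F(2)[of y]] norm_ge_zero[of E]
        by (auto simp: indicator_def simp del: norm_ge_zero)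
      show "indicator (half_ball x r u) y * norm (F y - E) = 0" if "y \<notin> cball x r" for y
      proof -
        have "y \<notin> half_ball x r u" using that by (auto simp: half_ball_def)
        then show ?thesis by simp
      qed
    qed auto
    have eq: "- (\<integral>y. ?D y (F y) \<partial>lborel) - r * ?c * ((A - B) \<bullet> \<nu>) = - (\<integral>y. ?D y (F y) - ?D y (G y) \<partial>lborel)"
      using frame_bump_jump_integral(2)[OF \<nu> r, of n x A B] iF iG by (simp add: G_def)
    have "\<bar>- (\<integral>y. ?D y (F y) \<partial>lborel) - r * ?c * ((A - B) \<bullet> \<nu>)\<bar> \<le> (\<integral>y. \<bar>?D y (F y) - ?D y (G y)\<bar> \<partial>lborel)"
      unfolding eq abs_minus_cancel by (rule integral_abs_bound)
    also have "\<dots> \<le> (\<integral>y. (K1 + K2) / r * (indicator (half_ball x r \<nu>) y * norm (F y - A) + indicator (half_ball x r (- \<nu>)) y * norm (F y - B)) \<partial>lborel)"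
    proof (rule integral_mono_AE)
      show "AE y in lborel. \<bar>?D y (F y) - ?D y (G y)\<bar> \<le> (K1 + K2) / r * (indicator (half_ball x r \<nu>) y * norm (F y - A) + indicator (half_ball x r (- \<nu>)) y * norm (F y - B))"
      proof -
        have "AE y in lborel. (y - x) \<bullet> \<nu> \<noteq> 0" by (rule AE_not_in_hyperplane) (use \<nu> in auto)
        then show ?thesis
        proof eventually_elim
          fix y assume y: "(y - x) \<bullet> \<nu> \<noteq> 0"
          have lin: "?D y (F y) - ?D y (G y) = ?D y (F y - G y)"
            by (rule linear_diff[OF test_derivative_linear[OF T], symmetric])
          show "\<bar>?D y (F y) - ?D y (G y)\<bar> \<le> (K1 + K2) / r * (indicator (half_ball x r \<nu>) y * norm (F y - A) + indicator (half_ball x r (- \<nu>)) y * norm (F y - B))"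
          proof (cases "y \<in> ball x r")
            case True
            then have "norm (F y - G y) = indicator (half_ball x r \<nu>) y * norm (F y - A) + indicator (half_ball x r (- \<nu>)) y * norm (F y - B)"
            proof (cases "(y - x) \<bullet> \<nu> > 0")
              case pos: True
              then have "y \<in> half_ball x r \<nu>" "y \<notin> half_ball x r (- \<nu>)" using True by (simp_all add: half_ball_def)
              then show ?thesis using pos by (simp add: G_def)
            next
              case neg: False
              then have "y \<notin> half_ball x r \<nu>" "y \<in> half_ball x r (- \<nu>)" using True y by (simp_all add: half_ball_def)
              then show ?thesis using neg by (simp add: G_def)
            qed
            with Db[of y "F y - G y"] show ?thesis unfolding lin by (simp only:)
          next
            case False
            have "0 \<le> (K1 + K2) / r * (indicator (half_ball x r \<nu>) y * norm (F y - A) + indicator (half_ball x r (- \<nu>)) y * norm (F y - B))"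
              using K1(1) K2(1) r by (intro mult_nonneg_nonneg add_nonneg_nonneg divide_nonneg_nonneg) auto
            then show ?thesis unfolding lin D0[OF False] by simp
          qed
        qed
      qed
      show "integrable lborel (\<lambda>y. \<bar>?D y (F y) - ?D y (G y)\<bar>)"
        by (intro integrable_abs Bochner_Integration.integrable_diff iF iG)
      show "integrable lborel (\<lambda>y. (K1 + K2) / r * (indicator (half_ball x r \<nu>) y * norm (F y - A) + indicator (half_ball x r (- \<nu>)) y * norm (F y - B)))"
        by (intro integrable_mult_right Bochner_Integration.integrable_add iH)
    qed
    also have "\<dots> = (K1 + K2) / r * (e1 r + e2 r)"
      using iH by (simp add: e1_def e2_def)
    finally have "\<bar>- (\<integral>y. ?D y (F y) \<partial>lborel) - r * ?c * ((A - B) \<bullet> \<nu>)\<bar> / r \<le> ((K1 + K2) / r * (e1 r + e2 r)) / r"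
      using r by (intro divide_right_mono) auto
    moreover have "\<bar>- (\<integral>y. ?D y (F y) \<partial>lborel) - r * ?c * ((A - B) \<bullet> \<nu>)\<bar> / r
       = \<bar>- (\<integral>y. ?D y (F y) \<partial>lborel) / r - ?c * ((A - B) \<bullet> \<nu>)\<bar>"
    proof -
      have "\<bar>u - r * v * w\<bar> / r = \<bar>u / r - v * w\<bar>" for u v w
      proof -
        have "u - r * v * w = r * (u / r - v * w)" using r by (simp add: field_simps)
        then show ?thesis using r by (simp add: abs_mult)
      qed
      then show ?thesis by blast
    qed
    moreover have "((K1 + K2) / r * (e1 r + e2 r)) / r = (K1 + K2) * (e1 r / r\<^sup>2 + e2 r / r\<^sup>2)"
      using r by (simp add: power2_eq_square field_simps)
    ultimately show ?thesis by simp
  qed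
  have "((\<lambda>r. (K1 + K2) * (e1 r / r\<^sup>2 + e2 r / r\<^sup>2)) \<longlongrightarrow> (K1 + K2) * (0 + 0)) (at_right 0)"
    using A B unfolding e1_def e2_def by (intro tendsto_intros)
  then have lim: "((\<lambda>r. (K1 + K2) * (e1 r / r\<^sup>2 + e2 r / r\<^sup>2)) \<longlongrightarrow> 0) (at_right 0)" by simp
  have "((\<lambda>r. - (\<integral>y. frechet_derivative (frame_bump n x \<nu> r) (at y) (F y) \<partial>lborel) / r - ?c * ((A - B) \<bullet> \<nu>)) \<longlongrightarrow> 0) (at_right 0)"
  proof (rule Lim_null_comparison[OF _ lim])
    show "\<forall>\<^sub>F r in at_right 0. norm (- (\<integral>y. frechet_derivative (frame_bump n x \<nu> r) (at y) (F y) \<partial>lborel) / r - ?c * ((A - B) \<bullet> \<nu>))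
        \<le> (K1 + K2) * (e1 r / r\<^sup>2 + e2 r / r\<^sup>2)"
      using eventually_at_right_less[of 0] by eventually_elim (use bound in simp)
  qed
  then show ?thesis by (simp add: LIM_zero_iff)
qed

section \<open>Divergences of Lipschitz functions of a unit field\<close>

text \<open>The integrals in \<open>dist_div\<close> and \<open>dist_deriv\<close> are over \<open>lebesgue\<close> restricted to \<open>\<Omega>\<close>. Test functions vanish outside
\<open>\<Omega>\<close>, so with a Borel representative they become \<open>lborel\<close> integrals over the plane.\<close>

lemma lebesgue_set_integral_eq_lborel:
  fixes f g :: "'a::euclidean_space \<Rightarrow> 'b::euclidean_space"
  assumes ae: "AE x in lebesgue. x \<in> S \<longrightarrow> f x = g x"
    and g: "g \<in> borel_measurable borel" "\<And>x. x \<notin> S \<Longrightarrow> g x = 0"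
  shows "(LINT x:S|lebesgue. f x) = (\<integral>x. g x \<partial>lborel)"
proof -
  have ae': "AE x in lebesgue. indicator S x *\<^sub>R f x = g x"
    using ae by eventually_elim (auto simp: indicator_def g(2))
  have gm: "g \<in> borel_measurable lebesgue" by (rule measurable_completion) (use g(1) in simp)
  have fm: "(\<lambda>x. indicator S x *\<^sub>R f x) \<in> borel_measurable lebesgue"
    by (rule borel_measurable_AE[OF gm]) (use ae' in eventually_elim, simp)
  have "(LINT x:S|lebesgue. f x) = (\<integral>x. g x \<partial>lebesgue)"
    unfolding set_lebesgue_integral_def by (rule integral_cong_AE[OF fm gm ae'])
  also have "\<dots> = (\<integral>x. g x \<partial>lborel)" using g(1) by (intro integral_completion) simp
  finally show ?thesis .
qed

lemma unit_borel_representative: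
  fixes m :: "complex \<Rightarrow> complex"
  assumes "open \<Omega>" "set_integrable lebesgue \<Omega> m" and unit: "AE x\<in>\<Omega> in lebesgue. norm (m x) = 1"
  obtains u where "u \<in> borel_measurable borel" "\<And>x. norm (u x) = 1" "AE x in lebesgue. x \<in> \<Omega> \<longrightarrow> m x = u x"
proof -
  define f where "f x = indicator \<Omega> x *\<^sub>R m x" for x
  have f: "f \<in> borel_measurable (completion lborel)"
    using assms(2) unfolding set_integrable_def f_def by (rule borel_measurable_integrable)
  have "(\<lambda>x. Re (f x)) \<in> borel_measurable (completion lborel)" "(\<lambda>x. Im (f x)) \<in> borel_measurable (completion lborel)"
    using f by measurable
  from this[THEN completion_ex_borel_measurable_real] obtain g1 g2 where
    [measurable]: "g1 \<in> borel_measurable lborel" "g2 \<in> borel_measurable lborel"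
    and ae: "AE x in lborel. Re (f x) = g1 x" "AE x in lborel. Im (f x) = g2 x" by auto
  (* the value 1 is arbitrary; it is taken on a null set and outside the domain *)
  define u where "u x = (let w = of_real (g1 x) + \<i> * of_real (g2 x) in if norm w = 1 then w else 1)" for x
  have "u \<in> borel_measurable borel"
    unfolding u_def Let_def by measurable
  moreover have "norm (u x) = 1" for x by (simp add: u_def Let_def)
  moreover have "AE x in lebesgue. x \<in> \<Omega> \<longrightarrow> m x = u x"
    using ae[THEN AE_completion] unit
  proof eventually_elim
    fix x assume x: "Re (f x) = g1 x" "Im (f x) = g2 x" "x \<in> \<Omega> \<longrightarrow> norm (m x) = 1"
    show "x \<in> \<Omega> \<longrightarrow> m x = u x"
    proof
      assume "x \<in> \<Omega>"
      with x have "of_real (g1 x) + \<i> * of_real (g2 x) = m x" by (simp add: f_def complex_eq_iff)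
      then show "m x = u x" using x \<open>x \<in> \<Omega>\<close> by (simp add: u_def Let_def)
    qed
  qed
  ultimately show ?thesis using that by blast
qed

text \<open>The half ball contains the ball of radius \<open>r/2\<close> around \<open>x + (r/2) \<nu>\<close>.\<close>

lemma measure_half_ball:
  fixes x :: complex
  assumes "r > 0" "norm \<nu> = 1"
  shows "r\<^sup>2 / 4 * measure lborel (ball (0::complex) 1) \<le> measure lborel (half_ball x r \<nu>)"
    "measure lborel (half_ball x r \<nu>) \<le> r\<^sup>2 * measure lborel (ball (0::complex) 1)"
    "emeasure lborel (half_ball x r \<nu>) < \<infinity>"
proof -
  have sub: "ball (x + (r/2) *\<^sub>R \<nu>) (r/2) \<subseteq> half_ball x r \<nu>"
  proof
    fix y assume "y \<in> ball (x + (r/2) *\<^sub>R \<nu>) (r/2)"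
    then have d: "norm (y - x - (r/2) *\<^sub>R \<nu>) < r/2" by (simp add: dist_norm norm_minus_commute algebra_simps)
    have "norm (y - x) \<le> norm (y - x - (r/2) *\<^sub>R \<nu>) + norm ((r/2) *\<^sub>R \<nu>)"
      using norm_triangle_ineq[of "y - x - (r/2) *\<^sub>R \<nu>" "(r/2) *\<^sub>R \<nu>"] by simp
    then have "norm (y - x) < r" using d assms by simp
    moreover have "\<bar>(y - x - (r/2) *\<^sub>R \<nu>) \<bullet> \<nu>\<bar> \<le> norm (y - x - (r/2) *\<^sub>R \<nu>) * norm \<nu>" by (rule Cauchy_Schwarz_ineq2)
    moreover have "(y - x - (r/2) *\<^sub>R \<nu>) \<bullet> \<nu> = (y - x) \<bullet> \<nu> - r/2"
      using assms(2) by (simp add: inner_diff_left dot_square_norm)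
    ultimately show "y \<in> half_ball x r \<nu>" using d assms(2)
      by (simp add: half_ball_def dist_norm norm_minus_commute)
  qed
  have fin: "emeasure lborel (ball x r) < \<infinity>" for x :: complex and r by (rule emeasure_bounded_finite) simp
  have sub2: "half_ball x r \<nu> \<subseteq> ball x r" by (auto simp: half_ball_def)
  show f: "emeasure lborel (half_ball x r \<nu>) < \<infinity>"
    using emeasure_mono[OF sub2, of lborel] fin[of x r] by (simp add: order_le_less_trans)
  have "measure lborel (ball (x + (r/2) *\<^sub>R \<nu>) (r/2)) \<le> measure lborel (half_ball x r \<nu>)"
    using sub f by (intro measure_mono_fmeasurable) (auto simp: fmeasurable_def)
  then show "r\<^sup>2 / 4 * measure lborel (ball (0::complex) 1) \<le> measure lborel (half_ball x r \<nu>)"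
    using assms(1) content_ball_conv_unit_ball[of "r/2" "x + (r/2) *\<^sub>R \<nu>"] by (simp add: power_divide)
  have "measure lborel (half_ball x r \<nu>) \<le> measure lborel (ball x r)"
    using sub2 fin by (intro measure_mono_fmeasurable) (auto simp: fmeasurable_def)
  then show "measure lborel (half_ball x r \<nu>) \<le> r\<^sup>2 * measure lborel (ball (0::complex) 1)"
    using assms(1) content_ball_conv_unit_ball[of "r" "x"] by simp
qed

lemma integrable_half_ball:
  fixes u :: "complex \<Rightarrow> complex"
  assumes [measurable]: "u \<in> borel_measurable borel" and u: "\<And>x. norm (u x) \<le> C"
  shows "integrable lborel (\<lambda>y. indicator (half_ball x r \<nu>) y * norm (u y - a))"
proof (rule integrable_lborel_bounded_support[where K = "cball x r" and B = "C + norm a"])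
  have C: "C \<ge> 0" using order_trans[OF norm_ge_zero u] .
  show "\<bar>indicator (half_ball x r \<nu>) y * norm (u y - a)\<bar> \<le> C + norm a" for y
    using norm_triangle_ineq4[of "u y" a] u[of y] C by (auto simp: indicator_def)
  show "indicator (half_ball x r \<nu>) y * norm (u y - a) = 0" if "y \<notin> cball x r" for y
    using that by (auto simp: half_ball_def indicator_def)
qed (use assms in measurable)

text \<open>A half ball has area comparable to \<open>r\<^sup>2\<close>, which gives the first claim. The second holds because \<open>\<bar>1 - \<bar>a\<bar>\<bar> \<le> \<bar>u - a\<bar>\<close>, so the
mean value of \<open>\<bar>u - a\<bar>\<close> can only vanish in the limit if \<open>\<bar>a\<bar> = 1\<close>.\<close>

lemma one_sided_limit:
  fixes u m :: "complex \<Rightarrow> complex"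
  assumes u: "u \<in> borel_measurable borel" "\<And>x. norm (u x) = 1"
    and mu: "AE x in lebesgue. x \<in> \<Omega> \<longrightarrow> m x = u x" and x: "open \<Omega>" "x \<in> \<Omega>" and \<nu>: "norm \<nu> = 1"
    and lim: "((\<lambda>r. (LINT y:half_ball x r \<nu>|lebesgue. norm (m y - a)) / measure lebesgue (half_ball x r \<nu>)) \<longlongrightarrow> 0) (at_right 0)"
  shows "((\<lambda>r. (\<integral>y. indicator (half_ball x r \<nu>) y * norm (u y - a) \<partial>lborel) / r\<^sup>2) \<longlongrightarrow> 0) (at_right 0)"
    and "norm a = 1"
proof -
  note [measurable] = u(1)
  define V where "V = measure lborel (ball (0::complex) 1)"
  have V: "V > 0" unfolding V_def by (rule content_ball_pos) simp
  define J where "J r = (\<integral>y. indicator (half_ball x r \<nu>) y * norm (u y - a) \<partial>lborel)" for r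
  define avg where "avg r = (LINT y:half_ball x r \<nu>|lebesgue. norm (m y - a)) / measure lebesgue (half_ball x r \<nu>)" for r
  obtain d where d: "d > 0" "ball x d \<subseteq> \<Omega>" using x openE by blast
  have J0: "J r \<ge> 0" for r unfolding J_def by simp
  have J_avg: "J r / r\<^sup>2 \<le> V * avg r" if r: "0 < r" "r < d" for r
  proof -
    have sub: "half_ball x r \<nu> \<subseteq> \<Omega>" using d r by (auto simp: half_ball_def)
    have eq: "(LINT y:half_ball x r \<nu>|lebesgue. norm (m y - a)) = J r"
      unfolding J_def
    proof (rule lebesgue_set_integral_eq_lborel)
      show "AE y in lebesgue. y \<in> half_ball x r \<nu> \<longrightarrow> norm (m y - a) = indicator (half_ball x r \<nu>) y * norm (u y - a)"
        using mu by eventually_elim (use sub in auto)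
    qed auto
    have pos: "0 < measure lborel (half_ball x r \<nu>)"
    proof -
      have "0 < r\<^sup>2 / 4 * V" using r V by simp
      then show ?thesis using measure_half_ball(1)[OF r(1) \<nu>, of x] by (simp add: V_def)
    qed
    have "J r / r\<^sup>2 \<le> J r / (measure lborel (half_ball x r \<nu>) / V)"
      using measure_half_ball(2)[OF r(1) \<nu>, of x] pos V J0[of r]
      by (intro divide_left_mono mult_pos_pos divide_pos_pos) (use r in \<open>auto simp: V_def pos_divide_le_eq\<close>)
    also have "\<dots> = V * avg r" unfolding avg_def eq by simp
    finally show ?thesis .
  qed
  have ev: "eventually (\<lambda>r. 0 < r \<and> r < d) (at_right 0)"
    using d(1) by (auto simp: eventually_at_right_field)
  have "((\<lambda>r. V * avg r) \<longlongrightarrow> V * 0) (at_right 0)"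
    using lim unfolding avg_def by (rule tendsto_mult_left)
  then have lV: "((\<lambda>r. V * avg r) \<longlongrightarrow> 0) (at_right 0)" by simp
  have lJ: "((\<lambda>r. J r / r\<^sup>2) \<longlongrightarrow> 0) (at_right 0)"
  proof (rule Lim_null_comparison[OF _ lV])
    show "\<forall>\<^sub>F r in at_right 0. norm (J r / r\<^sup>2) \<le> V * avg r"
      using ev by eventually_elim (use J_avg J0 in simp)
  qed
  then show "((\<lambda>r. (\<integral>y. indicator (half_ball x r \<nu>) y * norm (u y - a) \<partial>lborel) / r\<^sup>2) \<longlongrightarrow> 0) (at_right 0)"
    unfolding J_def .
  have low: "\<bar>1 - norm a\<bar> * V / 4 \<le> J r / r\<^sup>2" if r: "r > 0" for r
  proof -
    have "\<bar>1 - norm a\<bar> * (r\<^sup>2 / 4 * V) \<le> \<bar>1 - norm a\<bar> * measure lborel (half_ball x r \<nu>)"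
      using measure_half_ball(1)[OF r \<nu>, of x] by (intro mult_left_mono) (auto simp: V_def)
    also have "\<dots> = (\<integral>y. indicator (half_ball x r \<nu>) y * \<bar>1 - norm a\<bar> \<partial>lborel)"
      using measure_half_ball(3)[OF r \<nu>, of x] by simp
    also have "\<dots> \<le> J r" unfolding J_def
    proof (rule integral_mono)
      show "integrable lborel (\<lambda>y. indicator (half_ball x r \<nu>) y * \<bar>1 - norm a\<bar>)"
        using measure_half_ball(3)[OF r \<nu>, of x] by (intro integrable_mult_left) auto
      show "integrable lborel (\<lambda>y. indicator (half_ball x r \<nu>) y * norm (u y - a))"
        using u by (intro integrable_half_ball[where C = 1]) auto
      show "indicator (half_ball x r \<nu>) y * \<bar>1 - norm a\<bar> \<le> indicator (half_ball x r \<nu>) y * norm (u y - a)" for y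
        using norm_triangle_ineq3[of "u y" a] u(2)[of y] by (auto simp: indicator_def)
    qed
    finally show ?thesis using r by (simp add: field_simps)
  qed
  have "\<bar>1 - norm a\<bar> * V / 4 \<le> 0"
  proof (rule tendsto_lowerbound[OF lJ])
    show "\<forall>\<^sub>F r in at_right 0. \<bar>1 - norm a\<bar> * V / 4 \<le> J r / r\<^sup>2"
      using ev by eventually_elim (use low in simp)
  qed simp
  then show "norm a = 1" using V by (simp add: mult_le_0_iff)
qed


lemma test_derivative_components:
  assumes "\<zeta> \<in> test_functions \<Omega>"
  shows "frechet_derivative \<zeta> (at x) w = (\<Sum>b\<in>Basis. (w \<bullet> b) * frechet_derivative \<zeta> (at x) b)"
proof -
  have "frechet_derivative \<zeta> (at x) (\<Sum>b\<in>Basis. (w \<bullet> b) *\<^sub>R b) = (\<Sum>b\<in>Basis. (w \<bullet> b) *\<^sub>R frechet_derivative \<zeta> (at x) b)"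
    using test_derivative_linear[OF assms, of x] by (simp add: linear_sum linear_cmul)
  then show ?thesis by (simp add: euclidean_representation)
qed

context
  fixes \<Omega> :: "complex set" and m u :: "complex \<Rightarrow> complex" and M :: "complex measure"
  assumes \<Omega>: "open \<Omega>" "emeasure M (- \<Omega>) = 0" and M: "finite_measure M" "sets M = sets borel"
    and u: "u \<in> borel_measurable borel" "\<And>x. norm (u x) = 1"
    and mu: "AE x in lebesgue. x \<in> \<Omega> \<longrightarrow> m x = u x"
    and deriv: "\<And>v b \<zeta>. v \<in> Basis \<Longrightarrow> b \<in> Basis \<Longrightarrow> \<zeta> \<in> test_functions \<Omega> \<Longrightarrow>
        \<bar>\<integral>x. (u x \<bullet> b) * frechet_derivative \<zeta> (at x) v \<partial>lborel\<bar> \<le> (\<integral>x. \<bar>\<zeta> x\<bar> \<partial>M)"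
begin

lemma dist_div_eq_lborel:
  assumes G: "(\<lambda>x. G (u x)) \<in> borel_measurable borel" and \<zeta>: "\<zeta> \<in> test_functions \<Omega>"
  shows "dist_div \<Omega> (\<lambda>x. G (m x)) \<zeta> = - (\<integral>x. frechet_derivative \<zeta> (at x) (G (u x)) \<partial>lborel)"
proof -
  note [measurable] = G test_derivative_measurable[OF \<zeta>]
  obtain K where K: "K \<subseteq> \<Omega>" "\<And>x v. x \<notin> K \<Longrightarrow> frechet_derivative \<zeta> (at x) v = 0"
    using test_support[OF \<zeta>] by metis
  have "(LINT x:\<Omega>|lebesgue. frechet_derivative \<zeta> (at x) (G (m x))) = (\<integral>x. frechet_derivative \<zeta> (at x) (G (u x)) \<partial>lborel)"
  proof (rule lebesgue_set_integral_eq_lborel)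
    show "AE x in lebesgue. x \<in> \<Omega> \<longrightarrow> frechet_derivative \<zeta> (at x) (G (m x)) = frechet_derivative \<zeta> (at x) (G (u x))"
      using mu by eventually_elim simp
    show "(\<lambda>x. frechet_derivative \<zeta> (at x) (G (u x))) \<in> borel_measurable borel"
      unfolding test_derivative_components[OF \<zeta>, of _ "G (u _)"] by measurable
    show "frechet_derivative \<zeta> (at x) (G (u x)) = 0" if "x \<notin> \<Omega>" for x
      using that K by blast
  qed
  then show ?thesis unfolding dist_div_def by simp
qed

context
  fixes G :: "complex \<Rightarrow> complex" and L :: real
  assumes lip: "\<And>a b. norm a = 1 \<Longrightarrow> norm b = 1 \<Longrightarrow> norm (G a - G b) \<le> L * norm (a - b)" and L: "L \<ge> 0"
begin

lemma borel_lipschitz_unit: "(\<lambda>x. G (u x)) \<in> borel_measurable borel"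
proof -
  have "L-lipschitz_on (sphere 0 1) G"
    by (rule lipschitz_onI) (use lip L in \<open>auto simp: dist_norm\<close>)
  then have "G \<in> borel_measurable (restrict_space borel (sphere 0 1))"
    by (intro borel_measurable_continuous_on_restrict lipschitz_on_continuous_on)
  moreover have "u \<in> measurable borel (restrict_space borel (sphere 0 1))"
    by (rule measurable_restrict_space2) (use u in auto)
  ultimately show ?thesis by (rule measurable_compose[rotated])
qed

lemma lipschitz_unit_bounded: "norm (G (u x)) \<le> norm (G 1) + 2 * L"
proof -
  have "norm (u x - 1) \<le> 2" using norm_triangle_ineq4[of "u x" 1] u(2)[of x] by simp
  then have "L * norm (u x - 1) \<le> L * 2" using L by (rule mult_left_mono)
  moreover have "norm (G (u x)) \<le> norm (G 1) + norm (G (u x) - G 1)"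
    using norm_triangle_ineq[of "G 1" "G (u x) - G 1"] by simp
  ultimately show ?thesis using lip[of "u x" 1] u(2)[of x] by simp
qed

lemma component_bounded: "v \<in> Basis \<Longrightarrow> \<bar>G (u x) \<bullet> v\<bar> \<le> norm (G 1) + 2 * L"
  using Basis_le_norm[of v "G (u x)"] lipschitz_unit_bounded[of x] by simp

lemma integrable_component_derivative:
  assumes \<zeta>: "\<zeta> \<in> test_functions \<Omega>" and v: "v \<in> Basis"
  shows "integrable lborel (\<lambda>x. (G (u x) \<bullet> v) * frechet_derivative \<zeta> (at x) v)"
proof -
  note [measurable] = borel_lipschitz_unit test_derivative_measurable[OF \<zeta>]
  obtain K where K: "compact K" "\<And>x v. x \<notin> K \<Longrightarrow> frechet_derivative \<zeta> (at x) v = 0"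
    using test_support[OF \<zeta>] by metis
  obtain B where B: "B \<ge> 0" "\<And>x. \<bar>frechet_derivative \<zeta> (at x) v\<bar> \<le> B"
    using test_derivative_bounded[OF \<zeta>, of v] by metis
  show ?thesis
  proof (rule integrable_lborel_bounded_support[OF _ K(1), where B = "(norm (G 1) + 2 * L) * B"])
    show "\<bar>(G (u x) \<bullet> v) * frechet_derivative \<zeta> (at x) v\<bar> \<le> (norm (G 1) + 2 * L) * B" for x
      unfolding abs_mult using component_bounded[OF v] B L by (intro mult_mono) auto
  qed (use K in auto)
qed

lemma integrable_derivative_along:
  assumes \<zeta>: "\<zeta> \<in> test_functions \<Omega>"
  shows "integrable lborel (\<lambda>x. frechet_derivative \<zeta> (at x) (G (u x)))"
proof -
  have "integrable lborel (\<lambda>x. \<Sum>b\<in>Basis. (G (u x) \<bullet> b) * frechet_derivative \<zeta> (at x) b)"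
    by (rule Bochner_Integration.integrable_sum) (rule integrable_component_derivative[OF \<zeta>])
  then show ?thesis by (simp only: test_derivative_components[OF \<zeta>, of _ "G (u _)", symmetric])
qed

text \<open>The factor \<open>4\<close> counts the two directions of differentiation and the two components of \<open>u\<close>.\<close>

lemma dist_div_lipschitz_bound:
  assumes \<zeta>: "\<zeta> \<in> test_functions \<Omega>"
  shows "\<bar>dist_div \<Omega> (\<lambda>x. G (m x)) \<zeta>\<bar> \<le> 4 * L * (\<integral>x. \<bar>\<zeta> x\<bar> \<partial>M)"
proof -
  have one: "\<bar>\<integral>x. (G (u x) \<bullet> v) * frechet_derivative \<zeta> (at x) v \<partial>lborel\<bar> \<le> L * DIM(complex) * (\<integral>x. \<bar>\<zeta> x\<bar> \<partial>M)"
    if v: "v \<in> Basis" for v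
  proof (rule lipschitz_chain_rule_bound[OF M \<Omega>(1) u(1) _ deriv[OF v]])
    show "norm (u x) \<le> 1" for x using u(2) by simp
    show "norm v \<le> 1" using v by simp
    show "\<bar>G (u x) \<bullet> v\<bar> \<le> norm (G 1) + 2 * L" for x by (rule component_bounded[OF v])
    show "\<bar>G (u x) \<bullet> v - G (u y) \<bullet> v\<bar> \<le> L * norm (u x - u y)" for x y
      using Basis_le_norm[OF v, of "G (u x) - G (u y)"] lip[of "u x" "u y"] u(2) by (simp add: inner_diff_left)
  qed (use borel_lipschitz_unit L \<zeta> in auto)
  have "dist_div \<Omega> (\<lambda>x. G (m x)) \<zeta> = - (\<Sum>v\<in>Basis. \<integral>x. (G (u x) \<bullet> v) * frechet_derivative \<zeta> (at x) v \<partial>lborel)"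
    unfolding dist_div_eq_lborel[OF borel_lipschitz_unit \<zeta>] test_derivative_components[OF \<zeta>, of _ "G (u _)"]
    using integrable_component_derivative[OF \<zeta>] by (subst Bochner_Integration.integral_sum) auto
  then have "\<bar>dist_div \<Omega> (\<lambda>x. G (m x)) \<zeta>\<bar> \<le> (\<Sum>v\<in>(Basis :: complex set). \<bar>\<integral>x. (G (u x) \<bullet> v) * frechet_derivative \<zeta> (at x) v \<partial>lborel\<bar>)"
    by (simp only: abs_minus_cancel sum_abs)
  also have "\<dots> \<le> (\<Sum>v\<in>(Basis :: complex set). L * DIM(complex) * (\<integral>x. \<bar>\<zeta> x\<bar> \<partial>M))"
    by (rule sum_mono) (rule one)
  also have "\<dots> = 4 * L * (\<integral>x. \<bar>\<zeta> x\<bar> \<partial>M)" by simp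
  finally show ?thesis .
qed

lemma dist_div_lipschitz_density:
  obtains g where "g \<in> borel_measurable borel" "\<And>x. \<bar>g x\<bar> \<le> 4 * L"
    "\<And>\<zeta>. \<zeta> \<in> test_functions \<Omega> \<Longrightarrow> dist_div \<Omega> (\<lambda>x. G (m x)) \<zeta> = (\<integral>x. \<zeta> x * g x \<partial>M)"
proof (rule functional_density[OF M \<Omega>, of "dist_div \<Omega> (\<lambda>x. G (m x))" "4 * L"])
  fix \<zeta> assume \<zeta>: "\<zeta> \<in> test_functions \<Omega>"
  show "\<bar>dist_div \<Omega> (\<lambda>x. G (m x)) \<zeta>\<bar> \<le> 4 * L * (\<integral>x. \<bar>\<zeta> x\<bar> \<partial>M)"
    by (rule dist_div_lipschitz_bound[OF \<zeta>])
  show "dist_div \<Omega> (\<lambda>x. G (m x)) (\<lambda>x. c * \<zeta> x) = c * dist_div \<Omega> (\<lambda>x. G (m x)) \<zeta>" for c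
    using dist_div_eq_lborel[OF borel_lipschitz_unit \<zeta>] dist_div_eq_lborel[OF borel_lipschitz_unit test_cmult[OF \<zeta>]]
    by (simp add: frechet_derivative_eqI[OF has_derivative_mult_right[OF test_has_derivative[OF \<zeta>]]])
next
  fix \<zeta> \<xi> assume \<zeta>: "\<zeta> \<in> test_functions \<Omega>" and \<xi>: "\<xi> \<in> test_functions \<Omega>"
  show "dist_div \<Omega> (\<lambda>x. G (m x)) (\<lambda>x. \<zeta> x + \<xi> x) = dist_div \<Omega> (\<lambda>x. G (m x)) \<zeta> + dist_div \<Omega> (\<lambda>x. G (m x)) \<xi>"
    using dist_div_eq_lborel[OF borel_lipschitz_unit \<zeta>] dist_div_eq_lborel[OF borel_lipschitz_unit \<xi>] dist_div_eq_lborel[OF borel_lipschitz_unit test_add[OF \<zeta> \<xi>]]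
      integrable_derivative_along[OF \<zeta>] integrable_derivative_along[OF \<xi>]
    by (simp add: frechet_derivative_eqI[OF has_derivative_add[OF test_has_derivative[OF \<zeta>] test_has_derivative[OF \<xi>]]])
qed (use L that in auto)

abbreviation "divergence_variation \<equiv> total_variation (dist_measure \<Omega> (dist_div \<Omega> (\<lambda>x. G (m x))))"

text \<open>With the density from \<open>dist_div_lipschitz_density\<close>, the total variation of the divergence measure is the integral of \<open>\<bar>g\<bar>\<close> against \<open>M\<close>.\<close>

lemma divergence_variation_le:
  assumes "E \<in> sets borel" "E \<subseteq> \<Omega>"
  shows "divergence_variation E \<le> ennreal (4 * L) * emeasure M E"
proof (rule dist_div_lipschitz_density)
  fix g assume "g \<in> borel_measurable borel" "\<And>x. \<bar>g x\<bar> \<le> 4 * L"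
    "\<And>\<zeta>. \<zeta> \<in> test_functions \<Omega> \<Longrightarrow> dist_div \<Omega> (\<lambda>x. G (m x)) \<zeta> = (\<integral>x. \<zeta> x * g x \<partial>M)"
  from total_variation_le[OF M \<Omega>(1) this assms] show ?thesis .
qed

lemma divergence_variation_empty: "divergence_variation {} = 0"
  using divergence_variation_le[of "{}"] by simp

lemma divergence_variation_Un:
  assumes "A \<in> sets borel" "A \<subseteq> \<Omega>" "B \<in> sets borel" "B \<subseteq> \<Omega>" "A \<inter> B = {}"
  shows "divergence_variation (A \<union> B) = divergence_variation A + divergence_variation B"
proof (rule dist_div_lipschitz_density)
  fix g assume "g \<in> borel_measurable borel" "\<And>x. \<bar>g x\<bar> \<le> 4 * L"
    "\<And>\<zeta>. \<zeta> \<in> test_functions \<Omega> \<Longrightarrow> dist_div \<Omega> (\<lambda>x. G (m x)) \<zeta> = (\<integral>x. \<zeta> x * g x \<partial>M)"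
  from total_variation_disjoint_Un[OF M \<Omega>(1) this assms] show ?thesis .
qed

lemma abs_dist_div_le_divergence_variation:
  assumes "\<zeta> \<in> test_functions \<Omega>" "\<And>x. \<bar>\<zeta> x\<bar> \<le> 1" "\<And>x. x \<notin> E \<Longrightarrow> \<zeta> x = 0" "E \<in> sets borel" "E \<subseteq> \<Omega>"
  shows "ennreal \<bar>dist_div \<Omega> (\<lambda>x. G (m x)) \<zeta>\<bar> \<le> divergence_variation E"
proof (rule dist_div_lipschitz_density)
  fix g assume "g \<in> borel_measurable borel" "\<And>x. \<bar>g x\<bar> \<le> 4 * L"
    "\<And>\<zeta>. \<zeta> \<in> test_functions \<Omega> \<Longrightarrow> dist_div \<Omega> (\<lambda>x. G (m x)) \<zeta> = (\<integral>x. \<zeta> x * g x \<partial>M)"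
  from abs_functional_le_total_variation[OF M \<Omega>(1) this assms] show ?thesis .
qed

end

text \<open>The blow-up is applied twice. For \<open>m\<close> itself, whose divergence vanishes, it shows that the jump \<open>a - b\<close> is
tangential, so that \<open>steep_entropy_jump\<close> applies. For \<open>\<Phi>(m)\<close> it gives the density.\<close>

lemma divergence_density_at_jump:
  assumes div: "\<And>\<zeta>. \<zeta> \<in> test_functions \<Omega> \<Longrightarrow> dist_div \<Omega> m \<zeta> = 0"
    and x: "x \<in> \<Omega>" and jump: "is_jump_triple m x a b \<nu>"
  shows "\<forall>\<^sub>F r in at_right 0. ennreal (101/100 * (1/3 * norm (a - b) ^ 3) * r)
      \<le> total_variation (dist_measure \<Omega> (dist_div \<Omega> (\<lambda>x. Phi (steep_entropy (Arg \<nu>)) (m x)))) (cball x r)"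
proof -
  let ?\<Phi> = "Phi (steep_entropy (Arg \<nu>))"
  have ab: "a \<noteq> b" and \<nu>: "norm \<nu> = 1" "norm (- \<nu>) = 1"
    using jump by (auto simp: is_jump_triple_def)
  have limA: "((\<lambda>r. (LINT y:half_ball x r \<nu>|lebesgue. norm (m y - a)) / measure lebesgue (half_ball x r \<nu>)) \<longlongrightarrow> 0) (at_right 0)"
    and limB: "((\<lambda>r. (LINT y:half_ball x r (- \<nu>)|lebesgue. norm (m y - b)) / measure lebesgue (half_ball x r (- \<nu>))) \<longlongrightarrow> 0) (at_right 0)"
    using jump unfolding is_jump_triple_def by simp_all
  note A = one_sided_limit[OF u mu \<Omega>(1) x \<nu>(1) limA] and B = one_sided_limit[OF u mu \<Omega>(1) x \<nu>(2) limB]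
  have lip: "\<And>a b. norm a = 1 \<Longrightarrow> norm b = 1 \<Longrightarrow> norm (?\<Phi> a - ?\<Phi> b) \<le> 3 * norm (a - b)"
    by (rule Phi_steep_entropy_lipschitz[OF \<nu>(1)])
  note F = borel_lipschitz_unit[of ?\<Phi> 3, OF lip] lipschitz_unit_bounded[of ?\<Phi> 3, OF lip]
  have Fb: "(\<lambda>y. ?\<Phi> (u y)) \<in> borel_measurable borel" by (rule F(1)) auto
  have Fc: "norm (?\<Phi> (u y)) \<le> norm (?\<Phi> 1) + 2 * 3" for y by (rule F(2)) auto
  obtain d where d: "d > 0" "cball x d \<subseteq> \<Omega>" using x \<Omega>(1) open_contains_cball by blast
  have small: "\<forall>\<^sub>F r in at_right 0. 0 < r \<and> r < d"
    using d(1) by (auto simp: eventually_at_right_field)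
  have sub: "cball x r \<subseteq> \<Omega>" if "r < d" for r using d that by auto
  obtain n where n: "99/50 < bump1 n (1/20) 0 * (\<integral>t. bump1 n (199/200) t \<partial>lborel)" by (rule bump1_mass)
  define k where "k = bump1 n (1/20) 0 * (\<integral>t. bump1 n (199/200) t \<partial>lborel)"
  have k: "99/50 < k" using n by (simp add: k_def)
  have orth: "(a - b) \<bullet> \<nu> = 0"
  proof -
    have "((\<lambda>r. - (\<integral>y. frechet_derivative (frame_bump n x \<nu> r) (at y) (u y) \<partial>lborel) / r) \<longlongrightarrow> k * ((a - b) \<bullet> \<nu>)) (at_right 0)"
      unfolding k_def by (rule frame_bump_blow_up[OF u(1) _ \<nu>(1) A(1) B(1), where C = 1]) (simp add: u)
    moreover have "((\<lambda>r. - (\<integral>y. frechet_derivative (frame_bump n x \<nu> r) (at y) (u y) \<partial>lborel) / r) \<longlongrightarrow> 0) (at_right 0)"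
    proof (rule tendsto_eventually, use small in eventually_elim)
      fix r assume r: "0 < r \<and> r < d"
      have t: "frame_bump n x \<nu> r \<in> test_functions \<Omega>"
        using frame_bump_test[OF \<nu>(1) _ sub] r by blast
      have "(\<lambda>x. (\<lambda>z. z) (u x)) \<in> borel_measurable borel" using u(1) by simp
      from dist_div_eq_lborel[OF this t] div[OF t]
      show "- (\<integral>y. frechet_derivative (frame_bump n x \<nu> r) (at y) (u y) \<partial>lborel) / r = 0" by simp
    qed
    ultimately have "k * ((a - b) \<bullet> \<nu>) = 0" by (rule tendsto_unique[rotated]) simp
    then show ?thesis using k by auto
  qed
  (* \<Phi> is Lipschitz, so its one-sided limits are the values at a and b *)
  have side: "((\<lambda>r. (\<integral>y. indicator (half_ball x r w) y * norm (?\<Phi> (u y) - ?\<Phi> c) \<partial>lborel) / r\<^sup>2) \<longlongrightarrow> 0) (at_right 0)"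
    if c: "norm c = 1" and lim: "((\<lambda>r. (\<integral>y. indicator (half_ball x r w) y * norm (u y - c) \<partial>lborel) / r\<^sup>2) \<longlongrightarrow> 0) (at_right 0)" for w c
  proof (rule Lim_null_comparison)
    show "((\<lambda>r. 3 * ((\<integral>y. indicator (half_ball x r w) y * norm (u y - c) \<partial>lborel) / r\<^sup>2)) \<longlongrightarrow> 0) (at_right 0)"
      using tendsto_mult_left[OF lim, of 3] by simp
    have "(\<integral>y. indicator (half_ball x r w) y * norm (?\<Phi> (u y) - ?\<Phi> c) \<partial>lborel)
        \<le> (\<integral>y. 3 * (indicator (half_ball x r w) y * norm (u y - c)) \<partial>lborel)" for r
    proof (rule integral_mono)
      show "integrable lborel (\<lambda>y. indicator (half_ball x r w) y * norm (?\<Phi> (u y) - ?\<Phi> c))"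
        by (rule integrable_half_ball[OF Fb Fc])
      show "integrable lborel (\<lambda>y. 3 * (indicator (half_ball x r w) y * norm (u y - c)))"
        by (intro integrable_mult_right integrable_half_ball[where C = 1]) (use u in auto)
      show "indicator (half_ball x r w) y * norm (?\<Phi> (u y) - ?\<Phi> c) \<le> 3 * (indicator (half_ball x r w) y * norm (u y - c))" for y
        using lip[OF u(2)[of y] c] by (simp add: indicator_def)
    qed
    then have le: "(\<integral>y. indicator (half_ball x r w) y * norm (?\<Phi> (u y) - ?\<Phi> c) \<partial>lborel)
        \<le> 3 * (\<integral>y. indicator (half_ball x r w) y * norm (u y - c) \<partial>lborel)" for r by simp
    have nonneg: "0 \<le> (\<integral>y. indicator (half_ball x r w) y * norm (?\<Phi> (u y) - ?\<Phi> c) \<partial>lborel)" for r by simp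
    show "\<forall>\<^sub>F r in at_right 0. norm ((\<integral>y. indicator (half_ball x r w) y * norm (?\<Phi> (u y) - ?\<Phi> c) \<partial>lborel) / r\<^sup>2)
        \<le> 3 * ((\<integral>y. indicator (half_ball x r w) y * norm (u y - c) \<partial>lborel) / r\<^sup>2)"
    proof (rule always_eventually, rule allI)
      fix r :: real
      show "norm ((\<integral>y. indicator (half_ball x r w) y * norm (?\<Phi> (u y) - ?\<Phi> c) \<partial>lborel) / r\<^sup>2)
        \<le> 3 * ((\<integral>y. indicator (half_ball x r w) y * norm (u y - c) \<partial>lborel) / r\<^sup>2)"
        using divide_right_mono[OF le[of r], of "r\<^sup>2"] nonneg[of r] by simp
    qed
  qed
  define T where "T r = - (\<integral>y. frechet_derivative (frame_bump n x \<nu> r) (at y) (?\<Phi> (u y)) \<partial>lborel)" for r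
  define j where "j = (?\<Phi> a - ?\<Phi> b) \<bullet> \<nu>"
  have "((\<lambda>r. T r / r) \<longlongrightarrow> k * j) (at_right 0)"
    unfolding T_def k_def j_def
    by (rule frame_bump_blow_up[OF Fb Fc \<nu>(1) side[OF A(2,1)] side[OF B(2,1)]])
  then have lim: "((\<lambda>r. \<bar>T r / r\<bar>) \<longlongrightarrow> \<bar>k * j\<bar>) (at_right 0)" by (rule tendsto_rabs)
  define t where "t = norm (a - b) ^ 3"
  have t: "t > 0" using ab by (simp add: t_def)
  have "289/280 * (1/6 * t) \<le> \<bar>j\<bar>"
    unfolding t_def j_def by (rule steep_entropy_jump[OF \<nu>(1) A(2) B(2) orth ab])
  then have "99/50 * (289/280 * (1/6 * t)) \<le> k * \<bar>j\<bar>"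
    using k t by (intro mult_mono) auto
  (* 99/50 * 289/280 / 6 = 0.3406... exceeds 101/300 = 0.3366... *)
  then have "101/100 * (1/3 * t) < \<bar>k * j\<bar>"
    using k t by (simp add: abs_mult)
  from order_tendstoD(1)[OF lim this] small show ?thesis
  proof eventually_elim
    case (elim r)
    have tst: "frame_bump n x \<nu> r \<in> test_functions \<Omega>"
      using frame_bump_test[OF \<nu>(1) _ sub] elim by blast
    have "101/100 * (1/3 * t) * r < \<bar>T r\<bar>"
      using elim by (simp add: abs_divide pos_less_divide_eq)
    then have "ennreal (101/100 * (1/3 * t) * r) \<le> ennreal \<bar>T r\<bar>" by (intro ennreal_leI) simp
    also have "\<dots> = ennreal \<bar>dist_div \<Omega> (\<lambda>x. ?\<Phi> (m x)) (frame_bump n x \<nu> r)\<bar>"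
      using dist_div_eq_lborel[OF Fb tst] by (simp add: T_def)
    also have "\<dots> \<le> total_variation (dist_measure \<Omega> (dist_div \<Omega> (\<lambda>x. ?\<Phi> (m x)))) (cball x r)"
    proof (rule abs_dist_div_le_divergence_variation[OF lip _ tst])
      show "\<bar>frame_bump n x \<nu> r y\<bar> \<le> 1" for y using frame_bump_bounds[of n x \<nu> r y] by simp
      show "frame_bump n x \<nu> r y = 0" if "y \<notin> cball x r" for y
        by (rule frame_bump_outside[OF \<nu>(1)]) (use that elim in auto)
      show "cball x r \<subseteq> \<Omega>" using elim by (intro sub) simp
    qed auto
    finally show ?case unfolding t_def .
  qed
qed

end

section \<open>The strict inequality\<close>

text \<open>The sum of the positive and negative parts of all partial derivatives of all components. It is
doubled, since each single derivative is a difference of two of the summands.\<close>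

lemma BV_dominating_measure:
  fixes m u :: "complex \<Rightarrow> complex"
  assumes \<Omega>: "open \<Omega>" and BV: "BV \<Omega> m" and u: "u \<in> borel_measurable borel"
    and mu: "AE x in lebesgue. x \<in> \<Omega> \<longrightarrow> m x = u x"
  obtains M where "finite_measure M" "sets M = sets borel" "emeasure M (- \<Omega>) = 0"
    "\<And>v b \<zeta>. v \<in> Basis \<Longrightarrow> b \<in> Basis \<Longrightarrow> \<zeta> \<in> test_functions \<Omega> \<Longrightarrow>
        \<bar>\<integral>x. (u x \<bullet> b) * frechet_derivative \<zeta> (at x) v \<partial>lborel\<bar> \<le> (\<integral>x. \<bar>\<zeta> x\<bar> \<partial>M)"
proof -
  have "\<forall>q. \<exists>p. finite_measure (fst p) \<and> sets (fst p) = sets (restrict_space borel \<Omega>) \<and>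
      finite_measure (snd p) \<and> sets (snd p) = sets (restrict_space borel \<Omega>) \<and>
      (\<forall>\<zeta>\<in>test_functions \<Omega>. dist_deriv \<Omega> (\<lambda>x. m x \<bullet> snd q) (fst q) \<zeta> = (\<integral>x. \<zeta> x \<partial>fst p) - (\<integral>x. \<zeta> x \<partial>snd p))"
    (is "\<forall>q. ?ex q")
  proof
    fix q :: "complex \<times> complex"
    obtain \<mu> where "dist_is_measure \<Omega> (dist_deriv \<Omega> (\<lambda>x. m x \<bullet> snd q) (fst q)) \<mu>"
      using BV unfolding BV_def by blast
    then obtain P N where "finite_measure P" "sets P = sets (restrict_space borel \<Omega>)"
       "finite_measure N" "sets N = sets (restrict_space borel \<Omega>)"
       "\<forall>\<zeta>\<in>test_functions \<Omega>. dist_deriv \<Omega> (\<lambda>x. m x \<bullet> snd q) (fst q) \<zeta> = (\<integral>x. \<zeta> x \<partial>P) - (\<integral>x. \<zeta> x \<partial>N)"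
      unfolding dist_is_measure_def by blast
    then show "?ex q" by (intro exI[of _ "(P, N)"]) simp
  qed
  then have "\<exists>p. \<forall>q. finite_measure (fst (p q)) \<and> sets (fst (p q)) = sets (restrict_space borel \<Omega>) \<and>
      finite_measure (snd (p q)) \<and> sets (snd (p q)) = sets (restrict_space borel \<Omega>) \<and>
      (\<forall>\<zeta>\<in>test_functions \<Omega>. dist_deriv \<Omega> (\<lambda>x. m x \<bullet> snd q) (fst q) \<zeta> = (\<integral>x. \<zeta> x \<partial>fst (p q)) - (\<integral>x. \<zeta> x \<partial>snd (p q)))"
    by (rule choice)
  then obtain p where p: "\<And>q. finite_measure (fst (p q))" "\<And>q. sets (fst (p q)) = sets (restrict_space borel \<Omega>)"
      "\<And>q. finite_measure (snd (p q))" "\<And>q. sets (snd (p q)) = sets (restrict_space borel \<Omega>)"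
      "\<And>q \<zeta>. \<zeta>\<in>test_functions \<Omega> \<Longrightarrow> dist_deriv \<Omega> (\<lambda>x. m x \<bullet> snd q) (fst q) \<zeta> = (\<integral>x. \<zeta> x \<partial>fst (p q)) - (\<integral>x. \<zeta> x \<partial>snd (p q))"
    by blast
  define Q where "Q i = distr ((if snd i then fst else snd) (p (fst i))) borel (\<lambda>x. x)" for i :: "(complex \<times> complex) \<times> bool"
  have Q: "finite_measure (Q i)" "sets (Q i) = sets borel" "emeasure (Q i) (- \<Omega>) = 0" for i
    unfolding Q_def by (rule extend_measure; use p \<Omega> in simp)+
  have Qint: "(\<integral>x. f x \<partial>Q (q, True)) = (\<integral>x. f x \<partial>fst (p q))" "(\<integral>x. f x \<partial>Q (q, False)) = (\<integral>x. f x \<partial>snd (p q))"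
    if "f \<in> borel_measurable borel" for f :: "complex \<Rightarrow> real" and q
    unfolding Q_def using extend_measure(5)[OF p(1,2) \<Omega> that, of q] extend_measure(5)[OF p(3,4) \<Omega> that, of q] by simp_all
  have fin: "finite ((Basis \<times> Basis) \<times> UNIV :: ((complex \<times> complex) \<times> bool) set)" by simp
  obtain N where N: "finite_measure N" "sets N = sets borel"
    "\<And>A. A \<in> sets borel \<Longrightarrow> emeasure N A = (\<Sum>i\<in>(Basis \<times> Basis) \<times> UNIV. emeasure (Q i) A)"
    "\<And>i. i \<in> (Basis \<times> Basis) \<times> UNIV \<Longrightarrow> Q i \<le> N"
    using finite_sum_of_measures[OF fin, of Q] Q by blast
  interpret N: finite_measure N by (rule N)
  have c\<Omega>: "- \<Omega> \<in> sets borel" using \<Omega> by simp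
  define M where "M = density N (\<lambda>x. ennreal 2)"
  have sM: "sets M = sets borel" by (simp add: M_def N)
  have eM: "emeasure M A = 2 * emeasure N A" if "A \<in> sets borel" for A
    unfolding M_def using that N(2) by (subst emeasure_density_const) auto
  have "emeasure M (space M) < \<infinity>"
  proof -
    have "emeasure N UNIV < \<infinity>" 
      using less_top[of "emeasure N UNIV"] N.emeasure_finite[of UNIV] unfolding infinity_ennreal_def by blast
    then show ?thesis using eM[of UNIV] sets_eq_imp_space_eq[OF sM] by (simp add: ennreal_mult_less_top)
  qed
  then have fM: "finite_measure M" by (intro finite_measureI) simp
  show ?thesis
  proof (rule that[OF fM sM])
    show "emeasure M (- \<Omega>) = 0" using eM[OF c\<Omega>] N(3)[OF c\<Omega>] Q(3) by simp
    fix v b :: complex and \<zeta> assume v: "v \<in> Basis" and b: "b \<in> Basis" and \<zeta>: "\<zeta> \<in> test_functions \<Omega>"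
    note [measurable] = u test_derivative_measurable[OF \<zeta>] test_measurable[OF \<zeta>]
    obtain K where K: "K \<subseteq> \<Omega>" "\<And>x v. x \<notin> K \<Longrightarrow> frechet_derivative \<zeta> (at x) v = 0"
      using test_support[OF \<zeta>] by metis
    have "(LINT x:\<Omega>|lebesgue. (m x \<bullet> b) * frechet_derivative \<zeta> (at x) v) = (\<integral>x. (u x \<bullet> b) * frechet_derivative \<zeta> (at x) v \<partial>lborel)"
    proof (rule lebesgue_set_integral_eq_lborel)
      show "AE x in lebesgue. x \<in> \<Omega> \<longrightarrow> (m x \<bullet> b) * frechet_derivative \<zeta> (at x) v = (u x \<bullet> b) * frechet_derivative \<zeta> (at x) v"
        using mu by eventually_elim simp
      show "(u x \<bullet> b) * frechet_derivative \<zeta> (at x) v = 0" if "x \<notin> \<Omega>" for x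
        using that K by auto
    qed simp
    then have eq: "(\<integral>x. (u x \<bullet> b) * frechet_derivative \<zeta> (at x) v \<partial>lborel) = (\<integral>x. \<zeta> x \<partial>Q ((v, b), False)) - (\<integral>x. \<zeta> x \<partial>Q ((v, b), True))"
      using p(5)[OF \<zeta>, of "(v, b)"] Qint[of \<zeta>] by (simp add: dist_deriv_def)
    have one: "\<bar>\<integral>x. \<zeta> x \<partial>Q ((v, b), s)\<bar> \<le> (\<integral>x. \<bar>\<zeta> x\<bar> \<partial>N)" for s
    proof -
      have "\<bar>\<integral>x. \<zeta> x \<partial>Q ((v, b), s)\<bar> \<le> (\<integral>x. \<bar>\<zeta> x\<bar> \<partial>Q ((v, b), s))" by (rule integral_abs_bound)
      also have "\<dots> \<le> (\<integral>x. \<bar>\<zeta> x\<bar> \<partial>N)"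
      proof (rule integral_mono_le_measure(2))
        show "Q ((v, b), s) \<le> N" using v b by (intro N(4)) auto
        show "integrable N (\<lambda>x. \<bar>\<zeta> x\<bar>)" by (intro integrable_abs test_integrable[OF \<zeta> N(1,2)])
      qed (simp_all add: Q N)
      finally show ?thesis .
    qed
    have "(\<integral>x. \<bar>\<zeta> x\<bar> \<partial>M) = 2 * (\<integral>x. \<bar>\<zeta> x\<bar> \<partial>N)"
    proof -
      have "(\<lambda>x. \<bar>\<zeta> x\<bar>) \<in> borel_measurable N" unfolding measurable_cong_sets[OF N(2) refl] by measurable
      then show ?thesis unfolding M_def by (subst integral_density) auto
    qed
    then show "\<bar>\<integral>x. (u x \<bullet> b) * frechet_derivative \<zeta> (at x) v \<partial>lborel\<bar> \<le> (\<integral>x. \<bar>\<zeta> x\<bar> \<partial>M)"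
      unfolding eq using one[of True] one[of False] by linarith
  qed
qed

theorem proposition4p1:
  fixes \<Omega> :: "complex set" and m :: "complex \<Rightarrow> complex"
  assumes "bounded \<Omega>" and "lipschitz_domain \<Omega>"
    and "BV \<Omega> m"
    and "AE x\<in>\<Omega> in lebesgue. norm (m x) = 1"
    and "\<forall>\<zeta>\<in>test_functions \<Omega>. dist_div \<Omega> m \<zeta> = 0"
  shows "(\<forall>E\<in>sets borel. E \<subseteq> \<Omega> \<longrightarrow> jump_cost \<Omega> m E \<le> 2 * sigma_norm \<Omega> m E) \<and>
    ((\<exists>E\<in>sets borel. E \<subseteq> \<Omega> \<and> BV_jump_part \<Omega> m E \<noteq> (\<lambda>v. 0)) \<longrightarrow>
      (\<exists>E\<in>sets borel. E \<subseteq> \<Omega> \<and> jump_cost \<Omega> m E \<noteq> 2 * sigma_norm \<Omega> m E))"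
proof -
  have \<Omega>: "open \<Omega>" using assms(2) by (simp add: lipschitz_domain_def)
  have "set_integrable lebesgue \<Omega> m" using assms(3) by (simp add: BV_def)
  from unit_borel_representative[OF \<Omega> this assms(4)]
  obtain u where u: "u \<in> borel_measurable borel" "\<And>x. norm (u x) = 1" and mu: "AE x in lebesgue. x \<in> \<Omega> \<longrightarrow> m x = u x"
    by blast
  obtain M where M: "finite_measure M" "sets M = sets borel" "emeasure M (- \<Omega>) = 0"
    and deriv: "\<And>v b \<zeta>. v \<in> Basis \<Longrightarrow> b \<in> Basis \<Longrightarrow> \<zeta> \<in> test_functions \<Omega> \<Longrightarrow>
        \<bar>\<integral>x. (u x \<bullet> b) * frechet_derivative \<zeta> (at x) v \<partial>lborel\<bar> \<le> (\<integral>x. \<bar>\<zeta> x\<bar> \<partial>M)"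
    using BV_dominating_measure[OF \<Omega> assms(3) u(1) mu] by blast
  interpret M: finite_measure M by (rule M)
  note setting = \<Omega> M(3,1,2) u mu deriv
  define \<mu> where "\<mu> f = total_variation (dist_measure \<Omega> (dist_div \<Omega> (\<lambda>x. Phi f (m x))))" for f
  define I where "I = (\<lambda>\<nu>. steep_entropy (Arg \<nu>)) ` sphere 0 1"
  have I: "I \<noteq> {}" by (auto simp: I_def)
  have I_sub: "I \<subseteq> {f \<in> C0_per. \<forall>t. \<bar>f t\<bar> \<le> 1}"
    by (auto simp: I_def steep_entropy_C0_per abs_steep_entropy_le_1)
  have lip: "norm (Phi f a - Phi f b) \<le> 3 * norm (a - b)" if "f \<in> I" "norm a = 1" "norm b = 1" for f a b
    using that Phi_steep_entropy_lipschitz by (auto simp: I_def)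
  have empty: "\<mu> f {} = 0" if "f \<in> I" for f
    unfolding \<mu>_def by (rule divergence_variation_empty[OF setting lip[OF that]]) auto
  have additive: "\<mu> f (X \<union> Y) = \<mu> f X + \<mu> f Y"
    if "f \<in> I" "X \<in> sets borel" "X \<subseteq> \<Omega>" "Y \<in> sets borel" "Y \<subseteq> \<Omega>" "X \<inter> Y = {}" for f X Y
    unfolding \<mu>_def by (rule divergence_variation_Un[OF setting lip[OF that(1)] _ that(2-6)]) auto
  have dominated: "\<mu> f X \<le> ennreal 12 * emeasure M X" if "f \<in> I" "X \<in> sets borel" "X \<subseteq> \<Omega>" for f X
  proof -
    have "\<mu> f X \<le> ennreal (4 * 3) * emeasure M X"
      unfolding \<mu>_def by (rule divergence_variation_le[OF setting lip[OF that(1)] _ that(2,3)]) auto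
    then show ?thesis by simp
  qed
  define t where "t x = 1/3 * norm (trace_plus m x - trace_minus m x) ^ 3" for x
  have density: "t x > 0 \<and> (\<exists>f\<in>I. \<forall>\<^sub>F r in at_right 0. ennreal (101/100 * t x * r) \<le> \<mu> f (cball x r))"
    if x: "x \<in> jump_set \<Omega> m" for x
  proof -
    (* the traces are given by a choice of some jump triple *)
    have "\<exists>p. case p of (a, b, \<nu>) \<Rightarrow> is_jump_triple m x a b \<nu>" using x by (auto simp: jump_set_def)
    then have "case jump_triple m x of (a, b, \<nu>) \<Rightarrow> is_jump_triple m x a b \<nu>"
      unfolding jump_triple_def by (rule someI_ex)
    then obtain \<nu> where \<nu>: "is_jump_triple m x (trace_plus m x) (trace_minus m x) \<nu>"
      by (auto simp: trace_plus_def trace_minus_def split: prod.splits)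
    have "\<forall>\<^sub>F r in at_right 0. ennreal (101/100 * t x * r) \<le> \<mu> (steep_entropy (Arg \<nu>)) (cball x r)"
      unfolding \<mu>_def t_def
      by (rule divergence_density_at_jump[OF setting _ _ \<nu>]) (use x assms(5) in \<open>auto simp: jump_set_def\<close>)
    moreover have "steep_entropy (Arg \<nu>) \<in> I" using \<nu> by (auto simp: I_def is_jump_triple_def)
    moreover have "t x > 0" using \<nu> by (simp add: t_def is_jump_triple_def)
    ultimately show ?thesis by blast
  qed
  (* The density bound for a ball is 101/100 t r = 101/200 t (2r), hence the factor 101/200. *)
  have H1: "ennreal (101/200) * (ennreal c * hausdorff1_outer A) \<le> measure_lub I \<mu> A"
    if A: "A \<in> sets borel" "A \<subseteq> \<Omega>" and c: "c > 0" and At: "\<And>x. x \<in> A \<Longrightarrow> x \<in> jump_set \<Omega> m \<and> c \<le> t x" for A c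
  proof -
    have "ennreal (101/200 * c) * hausdorff1_outer A \<le> measure_lub I \<mu> A"
    proof (rule hausdorff1_outer_le_measure_lub[OF M(1,2) \<Omega> I empty additive dominated _ A])
      fix x assume x: "x \<in> A"
      with density At obtain f where f: "f \<in> I" "\<forall>\<^sub>F r in at_right 0. ennreal (101/100 * t x * r) \<le> \<mu> f (cball x r)" by blast
      have "\<forall>\<^sub>F r in at_right 0. ennreal (101/200 * c * (2 * r)) \<le> \<mu> f (cball x r)"
        using f(2) eventually_at_right_less[of 0]
      proof eventually_elim
        case (elim r)
        have "c * r \<le> t x * r" using At[OF x] elim by (intro mult_right_mono) auto
        then have "ennreal (101/200 * c * (2 * r)) \<le> ennreal (101/100 * t x * r)" by (intro ennreal_leI) simp
        then show ?case using elim by (blast intro: order_trans)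
      qed
      then show "\<exists>f\<in>I. \<forall>\<^sub>F r in at_right 0. ennreal (101/200 * c * (2 * r)) \<le> \<mu> f (cball x r)" using f(1) by blast
    qed (use c in auto)
    moreover have "ennreal (101/200 * c) = ennreal (101/200) * ennreal c"
      using c by (intro ennreal_mult) auto
    ultimately show ?thesis by (simp only: mult.assoc)
  qed
  have lower: "ennreal (101/200) * jump_cost \<Omega> m E \<le> measure_lub I \<mu> E" if E: "E \<in> sets borel" "E \<subseteq> \<Omega>" for E
    unfolding jump_cost_def t_def[symmetric]
    by (rule nn_integral_hausdorff1_le_measure_lub[OF I empty additive H1 E])
  have lub_sigma: "measure_lub I \<mu> E \<le> sigma_norm \<Omega> m E" for E
    unfolding sigma_norm_def \<mu>_def by (rule measure_lub_mono_index[OF I_sub])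
  have gap: "ennreal (101/100) * jump_cost \<Omega> m E \<le> 2 * sigma_norm \<Omega> m E" if E: "E \<in> sets borel" "E \<subseteq> \<Omega>" for E
  proof -
    have "ennreal (101/100) * jump_cost \<Omega> m E = 2 * (ennreal (101/200) * jump_cost \<Omega> m E)"
      using ennreal_mult[of 2 "101/200"] by (simp add: mult.assoc)
    also have "\<dots> \<le> 2 * sigma_norm \<Omega> m E"
      using order_trans[OF lower[OF E] lub_sigma] by (intro mult_left_mono) auto
    finally show ?thesis .
  qed
  have "jump_cost \<Omega> m E \<le> 2 * sigma_norm \<Omega> m E" if E: "E \<in> sets borel" "E \<subseteq> \<Omega>" for E
  proof -
    have "1 * jump_cost \<Omega> m E \<le> ennreal (101/100) * jump_cost \<Omega> m E" by (intro mult_right_mono) auto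
    also note gap[OF E]
    finally show ?thesis by simp
  qed
  moreover have "\<exists>E\<in>sets borel. E \<subseteq> \<Omega> \<and> jump_cost \<Omega> m E \<noteq> 2 * sigma_norm \<Omega> m E"
    if "\<exists>E\<in>sets borel. E \<subseteq> \<Omega> \<and> BV_jump_part \<Omega> m E \<noteq> (\<lambda>v. 0)"
  proof -
    have "jump_set \<Omega> m \<noteq> {}"
    proof
      assume J: "jump_set \<Omega> m = {}"
      have "dist_measure \<Omega> (dist_deriv \<Omega> (\<lambda>x. m x \<bullet> b) v) {} = 0" for v b
      proof -
        obtain \<nu> where \<nu>: "dist_is_measure \<Omega> (dist_deriv \<Omega> (\<lambda>x. m x \<bullet> b) v) \<nu>"
          using assms(3) unfolding BV_def by blast
        then have "\<nu> {} = 0" by (auto simp: dist_is_measure_def)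
        then show ?thesis using dist_measure_eqI[OF \<Omega> \<nu>] by simp
      qed
      then have "BV_jump_part \<Omega> m E = (\<lambda>v. 0)" for E
        by (simp add: BV_jump_part_def BV_deriv_def J fun_eq_iff)
      then show False using that by blast
    qed
    then obtain x where x: "x \<in> jump_set \<Omega> m" by blast
    then have x\<Omega>: "x \<in> \<Omega>" by (simp add: jump_set_def)
    obtain d where d: "d > 0" "cball x d \<subseteq> \<Omega>" using x\<Omega> \<Omega> open_contains_cball by blast
    from density[OF x] obtain f where tx: "t x > 0" and f: "f \<in> I"
      "\<forall>\<^sub>F r in at_right 0. ennreal (101/100 * t x * r) \<le> \<mu> f (cball x r)" by blast
    have "\<forall>\<^sub>F r in at_right 0. 0 < r \<and> r < d" using d(1) by (auto simp: eventually_at_right_field)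
    with f(2) have "\<forall>\<^sub>F r in at_right 0. (0 < r \<and> r < d) \<and> ennreal (101/100 * t x * r) \<le> \<mu> f (cball x r)"
      by eventually_elim simp
    then obtain r where r: "0 < r" "r < d" "ennreal (101/100 * t x * r) \<le> \<mu> f (cball x r)"
      using eventually_happens'[of "at_right (0::real)"] by force
    define B where "B = cball x r"
    have B: "B \<in> sets borel" "B \<subseteq> \<Omega>" using d r by (auto simp: B_def)
    have "0 < ennreal (101/100 * t x * r)" using tx r by simp
    also have "\<dots> \<le> \<mu> f B" using r by (simp add: B_def)
    also have "\<dots> \<le> measure_lub I \<mu> B" by (rule measure_lub_upper[OF f(1) B(1)])
    finally have lub_pos: "0 < measure_lub I \<mu> B" .
    have lub_fin: "measure_lub I \<mu> B < \<infinity>"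
    proof -
      have MB: "emeasure M B < \<infinity>" 
        using less_top[of "emeasure M B"] M.emeasure_finite[of B] unfolding infinity_ennreal_def by blast
      have "measure_lub I \<mu> B \<le> ennreal 12 * emeasure M B" by (rule measure_lub_le[OF M(2) B dominated])
      also have "\<dots> < \<infinity>" using MB by (simp add: ennreal_mult_less_top)
      finally show ?thesis .
    qed
    have "jump_cost \<Omega> m B \<noteq> 2 * sigma_norm \<Omega> m B"
    proof
      assume eq: "jump_cost \<Omega> m B = 2 * sigma_norm \<Omega> m B"
      have "ennreal (101/200) * jump_cost \<Omega> m B < \<infinity>" using lower[OF B] lub_fin by (rule order_le_less_trans)
      then obtain c where c: "jump_cost \<Omega> m B = ennreal c" "c \<ge> 0"
        by (cases "jump_cost \<Omega> m B") (auto simp: ennreal_mult_top)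
      have "ennreal (101/100 * c) \<le> ennreal c"
        using gap[OF B] ennreal_mult[of "101/100" c] c(2) unfolding eq[symmetric] c(1) by (simp only:)
      then have "c = 0" using c(2) ennreal_le_iff[OF c(2), of "101/100 * c"] by linarith
      then have "sigma_norm \<Omega> m B = 0" using eq c by simp
      then show False using lub_sigma[of B] lub_pos by simp
    qed
    then show ?thesis using B by blast
  qed
  ultimately show ?thesis by blast
qed

end
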